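(* Let $N\ge 1$ be an integer, $0<s<1$, $N>2s$, $0<\mu<N$, and let $$p,q\ge1,\qquad p\le\frac{2N-\mu}{N-2s},\qquad q\le\frac{N+2s-\mu}{N-2s}.$$ Let $u$ be a positive punctured solution of $$(-\Delta)^s u=\mathcal H_{p,\mu}[u]\,u^q\quad\text{in }\mathbb R^N\setminus\{0\},$$ and set $F=\mathcal H_{p,\mu}[u]\,u^q$ (with any value assigned at the origin). Assume that $$\int_{\mathbb R^N}\frac{F(y)}{1+|y|^{N-2s}}\,dy<+\infty,\qquad \limsup_{x\to0}|x|^{N-2s}u(x)<+\infty,\qquad \lim_{x\to0}u(x)=+\infty .$$ Then $u$ is radially symmetric about the origin. More precisely, there exists a positive function $U:(0,+\infty)\to(0,+\infty)$ such that $u(x)=U(|x|)$ for every $x\in\mathbb R^N\setminus\{0\}$, and $U$ is strictly decreasing.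
   Context: Notation. $\mathcal H_{p,\mu}[u](x)=\int_{\mathbb R^N\setminus\{0\}}\frac{u^p(y)}{|x-y|^\mu}\,dy$. $\mathcal L_s(\mathbb R^N)=\{u\in L^1_{\rm loc}(\mathbb R^N):\int_{\mathbb R^N}\frac{|u(x)|}{1+|x|^{N+2s}}\,dx<+\infty\}$. For $u\in\mathcal L_s(\mathbb R^N)$ sufficiently regular near $x$, $(-\Delta)^su(x)=C_{N,s}\,\mathrm{P.V.}\int_{\mathbb R^N}\frac{u(x)-u(y)}{|x-y|^{N+2s}}\,dy$, where $C_{N,s}>0$ is the constant for which $(-\Delta)^s$ has Fourier multiplier $|\xi|^{2s}$ (with $\widehat f(\xi)=\int e^{-ix\cdot\xi}f(x)\,dx$). A positive punctured solution is a function $u\in\mathcal L_s(\mathbb R^N)\cap C^{2s+\beta}_{\rm loc}(\mathbb R^N\setminus\{0\})$ for some $\beta>0$ with $2s+\beta\notin\mathbb N$, such that $u>0$ in $\mathbb R^N\setminus\{0\}$, $\mathcal H_{p,\mu}[u]$ is finite at every point of $\mathbb R^N\setminus\{0\}$, and the equation holds pointwise in $\mathbb R^N\setminus\{0\}$. *)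

theory Defs
  imports "HOL-Analysis.Analysis"
begin

text \<open>
  \<open>\<real>\<^sup>N\<close> is an arbitrary type \<open>'a :: euclidean_space\<close> with \<open>N = DIM('a)\<close>. All integrals are with respect
  to Lebesgue measure. Functions on the punctured space are total functions whose value at \<open>0\<close> is
  irrelevant.
\<close>

section \<open>Derivatives, Hoelder classes, Schwartz functions\<close>

fun iter_pderiv :: "'a::euclidean_space list \<Rightarrow> ('a \<Rightarrow> real) \<Rightarrow> 'a \<Rightarrow> real" where
  "iter_pderiv [] f = f"
| "iter_pderiv (b # bs) f = (\<lambda>x. frechet_derivative (iter_pderiv bs f) (at x) b)"

definition locally_Hoelder_on :: "real \<Rightarrow> 'a::euclidean_space set \<Rightarrow> ('a \<Rightarrow> real) \<Rightarrow> bool" where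
  "locally_Hoelder_on \<alpha> S f \<longleftrightarrow>
     (\<forall>K. compact K \<and> K \<subseteq> S \<longrightarrow>
        (\<exists>M. \<forall>x\<in>K. \<forall>y\<in>K. \<bar>f x - f y\<bar> \<le> M * norm (x - y) powr \<alpha>))"

text \<open>
  \<open>C\<^sup>\<gamma>\<^sub>l\<^sub>o\<^sub>c(S)\<close> for open \<open>S\<close> and \<open>\<gamma> > 0\<close> not an integer, i.e. \<open>C\<^sup>k\<^sup>,\<^sup>\<alpha>\<^sub>l\<^sub>o\<^sub>c(S)\<close> with \<open>k = \<lfloor>\<gamma>\<rfloor>\<close> and
  \<open>\<alpha> = \<gamma> - k \<in> (0,1)\<close>. Continuity of the derivatives of order \<open>k\<close> is part of the Hoelder condition.
\<close>
definition C_loc :: "real \<Rightarrow> 'a::euclidean_space set \<Rightarrow> ('a \<Rightarrow> real) \<Rightarrow> bool" where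
  "C_loc \<gamma> S f \<longleftrightarrow>
     (\<forall>bs. set bs \<subseteq> Basis \<and> length bs < nat \<lfloor>\<gamma>\<rfloor> \<longrightarrow>
        (\<forall>x\<in>S. iter_pderiv bs f differentiable (at x))) \<and>
     (\<forall>bs. set bs \<subseteq> Basis \<and> length bs = nat \<lfloor>\<gamma>\<rfloor> \<longrightarrow>
        locally_Hoelder_on (frac \<gamma>) S (iter_pderiv bs f))"

definition schwartz :: "('a::euclidean_space \<Rightarrow> real) \<Rightarrow> bool" where
  "schwartz f \<longleftrightarrow>
     (\<forall>bs. set bs \<subseteq> Basis \<longrightarrow>
        (\<forall>x. iter_pderiv bs f differentiable (at x)) \<and>
        (\<forall>m::nat. bounded (range (\<lambda>x. norm x ^ m * iter_pderiv bs f x))))"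

definition fourier :: "('a::euclidean_space \<Rightarrow> real) \<Rightarrow> 'a \<Rightarrow> complex" where
  "fourier f \<xi> = (\<integral>x. cis (- (x \<bullet> \<xi>)) * of_real (f x) \<partial>lebesgue)"

section \<open>The fractional Laplacian\<close>

definition L_space :: "real \<Rightarrow> ('a::euclidean_space \<Rightarrow> real) set" where
  "L_space s = {u. (\<forall>K. compact K \<longrightarrow> set_integrable lebesgue K u) \<and>
     integrable lebesgue (\<lambda>x. \<bar>u x\<bar> / (1 + norm x powr (real DIM('a) + 2 * s)))}"

definition pv_integral :: "real \<Rightarrow> ('a::euclidean_space \<Rightarrow> real) \<Rightarrow> 'a \<Rightarrow> real" where
  "pv_integral s u x = Lim (at_right 0) (\<lambda>\<epsilon>.
     LINT y:(- ball x \<epsilon>)|lebesgue. (u x - u y) / norm (x - y) powr (real DIM('a) + 2 * s))"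

text \<open>
  The normalising constant \<open>C\<^sub>N\<^sub>,\<^sub>s\<close>. Real-valued test functions suffice, by linearity. The type
  argument only carries the dimension.
\<close>
definition frac_laplacian_const :: "'a::euclidean_space itself \<Rightarrow> real \<Rightarrow> real" where
  "frac_laplacian_const _ s = (THE C. C > 0 \<and>
     (\<forall>f::'a \<Rightarrow> real. schwartz f \<longrightarrow>
        (\<forall>\<xi>. fourier (\<lambda>x. C * pv_integral s f x) \<xi> = of_real (norm \<xi> powr (2 * s)) * fourier f \<xi>)))"

definition frac_laplacian :: "real \<Rightarrow> ('a::euclidean_space \<Rightarrow> real) \<Rightarrow> 'a \<Rightarrow> real" where
  "frac_laplacian s u x = frac_laplacian_const TYPE('a) s * pv_integral s u x"

section \<open>The Choquard-type equation\<close>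

definition hartree :: "real \<Rightarrow> real \<Rightarrow> ('a::euclidean_space \<Rightarrow> real) \<Rightarrow> 'a \<Rightarrow> real" where
  "hartree p \<mu> u x = (LINT y:(- {0})|lebesgue. u y powr p / norm (x - y) powr \<mu>)"

definition hartree_finite :: "real \<Rightarrow> real \<Rightarrow> ('a::euclidean_space \<Rightarrow> real) \<Rightarrow> 'a \<Rightarrow> bool" where
  "hartree_finite p \<mu> u x \<longleftrightarrow>
     set_integrable lebesgue (- {0}) (\<lambda>y. u y powr p / norm (x - y) powr \<mu>)"

definition positive_punctured_solution ::
    "real \<Rightarrow> real \<Rightarrow> real \<Rightarrow> real \<Rightarrow> ('a::euclidean_space \<Rightarrow> real) \<Rightarrow> bool" where
  "positive_punctured_solution s \<mu> p q u \<longleftrightarrow>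
     u \<in> L_space s \<and>
     (\<exists>\<beta>>0. 2 * s + \<beta> \<notin> \<nat> \<and> C_loc (2 * s + \<beta>) (- {0}) u) \<and>
     (\<forall>x. x \<noteq> 0 \<longrightarrow> u x > 0) \<and>
     (\<forall>x. x \<noteq> 0 \<longrightarrow> hartree_finite p \<mu> u x) \<and>
     (\<forall>x. x \<noteq> 0 \<longrightarrow> frac_laplacian s u x = hartree p \<mu> u x * u x powr q)"

end

theory Submission
  imports Defs
begin

text \<open>
  The proof is the method of moving spheres in integral form. Write \<open>N\<close> for the dimension. A positive
  solution dominates a Riesz potential of its right-hand side, and truncations \<open>v\<close> of \<open>u\<close> from above are bounded
  continuous functions whose fractional Laplacian is nonnegative, so that they are exactly represented by the
  Riesz potential of that fractional Laplacian (\<open>representation\<close>, \<open>v_representation\<close>). This step rests on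
  explicit superharmonic cut-offs of the Riesz kernel, whose fractional Laplacians act as an approximate identity.

  For a sphere of radius \<open>l < norm a\<close> about \<open>a\<close>, splitting a Riesz potential at the sphere shows that \<open>u\<close> and its
  Kelvin transform differ by an integral over the ball against a positive kernel (\<open>kelvin_identity\<close>,
  \<open>compare\<close>). The bounds on \<open>p\<close> and \<open>q\<close> are those for which the transformed nonlinearity is at
  least the nonlinearity of the transform (\<open>hartree_compare\<close>, \<open>fl_ge\<close>). When the set where \<open>u\<close> exceeds its transform
  has small measure, these integral inequalities are contractive and the set is empty (\<open>contraction\<close>).
  Since \<open>u\<close> blows up at the origin, non-strict comparison improves to strict comparison (\<open>strict\<close>), so the spheres
  can grow from radius \<open>0\<close> up to the distance of the centre from the origin (\<open>moving_spheres\<close>). Letting centres go to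
  infinity turns spheres into hyperplanes and gives \<open>u a \<le> u b\<close> whenever \<open>norm b < norm a\<close> (\<open>radial_le\<close>), hence
  radial symmetry. Finally \<open>u\<close> cannot be constant on an annulus: at two points of the
  annulus exchanged by a reflection, the fractional Laplacians and the Hartree potentials would be strictly ordered
  in opposite directions (\<open>radial_strict\<close>).
\<close>

text \<open>An involution is its own inverse on the invariant set, so the change of variables formula needs its derivative only.\<close>

lemma emeasure_involution_cart:
  fixes f :: "real^'n::{finite,wellorder} \<Rightarrow> real^'n::_" and h :: "real^'n::_ \<Rightarrow> real"
  assumes [measurable]: "f \<in> borel_measurable borel" "h \<in> borel_measurable borel"
    and S [measurable]: "S \<in> sets borel"
    and inv: "\<And>x. x \<in> S \<Longrightarrow> f x \<in> S" "\<And>x. x \<in> S \<Longrightarrow> f (f x) = x"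
    and der: "\<And>x. x \<in> S \<Longrightarrow> (f has_derivative f' x) (at x)"
    and det: "\<And>x. x \<in> S \<Longrightarrow> \<bar>det (matrix (f' x))\<bar> = h x"
    and A [measurable]: "A \<in> sets borel"
  shows "emeasure lborel (f -` A \<inter> S) = (\<integral>\<^sup>+x. indicator (A \<inter> S) x * ennreal (h x) \<partial>lborel)"
proof -
  let ?T = "A \<inter> S"
  have img: "f ` ?T = f -` A \<inter> S"
  proof (intro equalityI subsetI)
    fix y assume "y \<in> f ` ?T"
    then obtain x where "x \<in> A" "x \<in> S" "y = f x" by blast
    then show "y \<in> f -` A \<inter> S" using inv by simp
  next
    fix y assume "y \<in> f -` A \<inter> S"
    then have "f y \<in> ?T" "y = f (f y)" using inv by simp_all
    then show "y \<in> f ` ?T" by (rule rev_image_eqI)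
  qed
  have imb: "f ` ?T \<in> sets borel"
    unfolding img by (simp add: measurable_sets_borel[of f borel A, simplified])
  have inj: "inj_on f ?T"
    using inv by (metis IntD2 inj_onI)
  have h0: "h x \<ge> 0" if "x \<in> S" for x
    using det[OF that] by (metis abs_ge_zero)
  have der': "(f has_derivative f' x) (at x within ?T)" if "x \<in> ?T" for x
    using der that by (auto intro: has_derivative_at_withinI)
  have hi: "((\<lambda>x. \<bar>det (matrix (f' x))\<bar>) has_integral m) ?T \<longleftrightarrow> (h has_integral m) ?T" for m
    by (rule has_integral_cong) (simp add: det)
  have key: "f ` ?T \<in> lmeasurable \<and> measure lebesgue (f ` ?T) = m \<longleftrightarrow> (h has_integral m) ?T" for m
    using has_measure_differentiable_image[of ?T f f' m] der' inj hi by (simp add: S A)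
  have eq: "(\<integral>\<^sup>+x. indicator ?T x * ennreal (h x) \<partial>lborel) = (\<integral>\<^sup>+x. ennreal (indicator ?T x * h x) \<partial>lborel)"
    by (intro nn_integral_cong) (auto simp: indicator_def)
  have ind: "((\<lambda>x. indicator ?T x * h x) has_integral m) UNIV \<longleftrightarrow> (h has_integral m) ?T" for m
  proof -
    have "(\<lambda>x. indicator ?T x * h x) = (\<lambda>x. if x \<in> ?T then h x else 0)"
      by (rule ext) (simp add: indicator_def)
    then show ?thesis using has_integral_restrict_UNIV[of ?T h m] by simp
  qed
  show ?thesis
  proof (cases "emeasure lborel (f -` A \<inter> S) < \<infinity>")
    case True
    then have lm: "f ` ?T \<in> lmeasurable"
      using imb by (intro fmeasurableI) (auto simp: img)
    then have "(h has_integral measure lebesgue (f ` ?T)) ?T"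
      using key by blast
    then have "((\<lambda>x. indicator ?T x * h x) has_integral measure lebesgue (f ` ?T)) UNIV"
      by (simp add: ind)
    then have "(\<integral>\<^sup>+x. ennreal (indicator ?T x * h x) \<partial>lborel) = ennreal (measure lebesgue (f ` ?T))"
      using h0 by (intro nn_integral_has_integral_lborel) (auto simp: indicator_def)
    also have "\<dots> = emeasure lborel (f ` ?T)"
      using lm imb True by (subst emeasure_eq_measure2[symmetric]) (auto simp: fmeasurable_def img)
    finally show ?thesis by (simp add: eq img)
  next
    case False
    have "(\<integral>\<^sup>+x. indicator ?T x * ennreal (h x) \<partial>lborel) = \<infinity>"
    proof (rule ccontr)
      assume "\<not> ?thesis"
      then have "(\<integral>\<^sup>+x. ennreal (indicator ?T x * h x) \<partial>lborel) < \<infinity>"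
        by (simp add: eq less_top)
      then obtain m where "m \<ge> 0" "(\<integral>\<^sup>+x. ennreal (indicator ?T x * h x) \<partial>lborel) = ennreal m"
        by (auto simp: less_top_ennreal)
      then have "((\<lambda>x. indicator ?T x * h x) has_integral m) UNIV"
        using h0 by (intro nn_integral_has_integral) (auto simp: indicator_def)
      then have "(h has_integral m) ?T"
        by (simp add: ind)
      then have "f ` ?T \<in> lmeasurable" using key by blast
      then have "emeasure lborel (f ` ?T) < \<infinity>" using imb by (auto simp: fmeasurable_def)
      then show False using False img by simp
    qed
    then show ?thesis using False by (auto simp: not_less top_unique)
  qed
qed

text \<open>A finite index type with as many elements as there are coordinates makes the matrix-based change of variables theorems available on an arbitrary Euclidean space.\<close>

typedef (overloaded) ('a::euclidean_space) coord = "{..<DIM('a)}"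
  by (rule exI[of _ 0]) (simp)

instantiation coord :: (euclidean_space) wellorder
begin
definition less_eq_coord :: "'a coord \<Rightarrow> 'a coord \<Rightarrow> bool" where
  "less_eq_coord i j \<longleftrightarrow> Rep_coord i \<le> Rep_coord j"
definition less_coord :: "'a coord \<Rightarrow> 'a coord \<Rightarrow> bool" where
  "less_coord i j \<longleftrightarrow> Rep_coord i < Rep_coord j"
instance
proof
  fix x y z :: "'a coord" and P :: "'a coord \<Rightarrow> bool"
  show "x < y \<longleftrightarrow> x \<le> y \<and> \<not> y \<le> x" "x \<le> x" "x \<le> y \<Longrightarrow> y \<le> z \<Longrightarrow> x \<le> z"
    "x \<le> y \<Longrightarrow> y \<le> x \<Longrightarrow> x = y" "x \<le> y \<or> y \<le> x"
    by (auto simp: less_eq_coord_def less_coord_def Rep_coord_inject)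
  assume *: "\<And>x. (\<And>y. y < x \<Longrightarrow> P y) \<Longrightarrow> P x"
  show "P x"
  proof (induction "Rep_coord x" arbitrary: x rule: less_induct)
    case less
    show ?case by (rule *) (use less in \<open>auto simp: less_coord_def\<close>)
  qed
qed
end

lemma univ_coord: "(UNIV :: 'a::euclidean_space coord set) = Abs_coord ` {..<DIM('a)}"
  by (metis type_definition.univ type_definition_coord)

instance coord :: (euclidean_space) finite
  by standard (simp add: univ_coord)

lemma ex_basis_coord: "\<exists>e :: 'a::euclidean_space coord \<Rightarrow> 'a. bij_betw e UNIV Basis"
proof -
  have "card (UNIV :: 'a coord set) = DIM('a)"
    unfolding univ_coord by (subst card_image) (auto simp: inj_on_def Abs_coord_inject)
  then show ?thesis by (intro finite_same_card_bij) auto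
qed

definition basis_coord :: "'a::euclidean_space coord \<Rightarrow> 'a" where
  "basis_coord = (SOME e. bij_betw e UNIV Basis)"

lemma bij_basis_coord: "bij_betw (basis_coord :: 'a::euclidean_space coord \<Rightarrow> 'a) UNIV Basis"
  unfolding basis_coord_def using someI_ex[OF ex_basis_coord] by blast

definition from_cart :: "real ^ ('a::euclidean_space coord) \<Rightarrow> 'a" where
  "from_cart v = (\<Sum>i\<in>UNIV. v $ i *\<^sub>R basis_coord i)"

lemma basis_coord_in [simp]: "basis_coord i \<in> Basis"
  using bij_basis_coord by (auto simp: bij_betw_def)

lemma from_cart_inner_basis: "from_cart v \<bullet> basis_coord i = v $ i"
proof -
  have "basis_coord j \<bullet> basis_coord i = (if j = i then 1 else 0)" for j
    using bij_basis_coord by (auto simp: inner_Basis bij_betw_def dest: injD)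
  then have "from_cart v \<bullet> basis_coord i = (\<Sum>j\<in>UNIV. if j = i then v $ j else 0)"
    unfolding from_cart_def inner_sum_left by (intro sum.cong) auto
  then show ?thesis by simp
qed

lemma linear_from_cart: "linear from_cart"
  by (rule linearI) (auto simp: from_cart_def scaleR_add_left sum.distrib scaleR_sum_right)

lemma from_cart_measurable [measurable]: "from_cart \<in> borel_measurable borel"
  by (intro borel_measurable_continuous_onI linear_continuous_on linear_conv_bounded_linear[THEN iffD1] linear_from_cart)

lemma sum_Basis_coord: "(\<Sum>b\<in>Basis. g b) = (\<Sum>i\<in>UNIV. g (basis_coord i))"
  using sum.reindex_bij_betw[OF bij_basis_coord, of g] by simp

lemma norm_from_cart [simp]: "norm (from_cart v) = norm v"
proof -
  have "norm (from_cart v) ^ 2 = norm v ^ 2"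
    unfolding power2_norm_eq_inner
    by (subst euclidean_inner) (simp add: sum_Basis_coord from_cart_inner_basis inner_vec_def)
  then show ?thesis by simp
qed

lemma inner_from_cart: "from_cart v \<bullet> from_cart w = v \<bullet> w"
  by (subst euclidean_inner) (simp add: sum_Basis_coord from_cart_inner_basis inner_vec_def)

lemma surj_from_cart: "\<exists>v. from_cart v = x"
proof
  show "from_cart (\<chi> i. x \<bullet> basis_coord i) = x"
    unfolding from_cart_def using euclidean_representation[of x] by (simp add: sum_Basis_coord)
qed

lemma distr_from_cart: "distr lborel borel from_cart = (lborel :: 'a::euclidean_space measure)"
proof (rule lborel_eqI[symmetric])
  fix l u :: 'a assume le: "\<And>b. b \<in> Basis \<Longrightarrow> l \<bullet> b \<le> u \<bullet> b"
  define l' u' :: "real ^ 'a coord" where "l' = (\<chi> i. l \<bullet> basis_coord i)" and "u' = (\<chi> i. u \<bullet> basis_coord i)"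
  have iff: "(\<forall>b\<in>Basis. P b) \<longleftrightarrow> (\<forall>i. P (basis_coord i))" for P :: "'a \<Rightarrow> bool"
    using bij_basis_coord unfolding bij_betw_def by (metis image_eqI imageE UNIV_I)
  have "from_cart -` box l u = box l' u'"
    by (auto simp: box_def iff from_cart_inner_basis l'_def u'_def Basis_vec_def inner_axis)
  then have "emeasure (distr lborel borel from_cart) (box l u) = emeasure lborel (box l' u')"
    by (simp add: emeasure_distr)
  also have "\<dots> = ennreal (\<Prod>b\<in>Basis. (u' - l') \<bullet> b)"
    using le by (intro emeasure_lborel_box) (auto simp: l'_def u'_def Basis_vec_def inner_axis)
  also have "(\<Prod>b\<in>Basis. (u' - l') \<bullet> b) = (\<Prod>i\<in>UNIV. (u' - l') $ i)"
  proof -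
    have B: "(Basis :: (real ^ 'a coord) set) = range (\<lambda>i. axis i 1)"
      by (auto simp: Basis_vec_def)
    show ?thesis unfolding B
      by (subst prod.reindex) (auto simp: inj_on_def axis_eq_axis inner_axis)
  qed
  also have "\<dots> = (\<Prod>i\<in>UNIV. (u - l) \<bullet> basis_coord i)"
    by (simp add: l'_def u'_def inner_diff_left)
  also have "\<dots> = (\<Prod>b\<in>Basis. (u - l) \<bullet> b)"
    using prod.reindex_bij_betw[OF bij_basis_coord, of "\<lambda>b. (u - l) \<bullet> b"] by simp
  finally show "emeasure (distr lborel borel from_cart) (box l u) = (\<Prod>b\<in>Basis. (u - l) \<bullet> b)" .
qed simp

lemma nn_integral_from_cart:
  assumes [measurable]: "f \<in> borel_measurable borel"
  shows "(\<integral>\<^sup>+x. f x \<partial>(lborel :: 'a::euclidean_space measure)) = (\<integral>\<^sup>+v. f (from_cart v) \<partial>lborel)"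
  by (subst distr_from_cart[symmetric]) (simp add: nn_integral_distr)

section \<open>Reflections and inversions\<close>

definition refl :: "'a::euclidean_space \<Rightarrow> 'a \<Rightarrow> 'a" where
  "refl n x = x - (2 * (x \<bullet> n) / (n \<bullet> n)) *\<^sub>R n"

lemma refl_0 [simp]: "refl 0 x = x" by (simp add: refl_def)

lemma linear_refl: "linear (refl n)"
  by (rule linearI) (auto simp: refl_def algebra_simps add_divide_distrib inner_simps)

lemma inner_refl_normal: "refl n x \<bullet> n = - (x \<bullet> n)"
  by (cases "n = 0") (simp_all add: refl_def inner_diff_left)

lemma refl_invol [simp]: "refl n (refl n x) = x"
proof -
  have "refl n (refl n x) = refl n x - (2 * - (x \<bullet> n) / (n \<bullet> n)) *\<^sub>R n"
    by (subst (1) refl_def) (simp only: inner_refl_normal)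
  then show ?thesis by (simp add: refl_def)
qed

lemma inner_refl [simp]: "refl n x \<bullet> refl n y = x \<bullet> y"
proof (cases "n = 0")
  case False
  have "refl n x \<bullet> refl n y = refl n x \<bullet> y - (2 * (y \<bullet> n) / (n \<bullet> n)) * (refl n x \<bullet> n)"
    by (subst (2) refl_def) (simp add: inner_diff_right)
  also have "\<dots> = x \<bullet> y"
    unfolding inner_refl_normal inner_commute[of y n] by (simp add: refl_def inner_diff_left)
  finally show ?thesis .
qed simp

lemma norm_refl [simp]: "norm (refl n x) = norm x"
  by (simp add: norm_eq_sqrt_inner)

lemma orthogonal_refl: "orthogonal_transformation (refl n)"
  by (simp add: orthogonal_transformation_def linear_refl)

lemma refl_measurable [measurable]: "refl n \<in> borel_measurable borel"
  by (intro borel_measurable_continuous_onI linear_continuous_on linear_conv_bounded_linear[THEN iffD1] linear_refl)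

lemma refl_swap:
  assumes "norm a = norm b" shows "refl (a - b) a = b"
proof (cases "a = b")
  case False
  have "a \<bullet> a = b \<bullet> b" using assms by (simp add: norm_eq_sqrt_inner)
  then have "2 * (a \<bullet> (a - b)) = (a - b) \<bullet> (a - b)" by (simp add: inner_simps inner_commute)
  moreover have "(a - b) \<bullet> (a - b) \<noteq> 0" using False by simp
  ultimately show ?thesis by (simp add: refl_def)
qed simp

lemma distr_refl_cart:
  "distr lborel borel (refl n) = (lborel :: (real^'n::{finite,wellorder}) measure)"
proof (rule measure_eqI)
  fix A assume "A \<in> sets (distr lborel borel (refl n))"
  then have [measurable]: "A \<in> sets borel" by simp
  have "emeasure lborel (refl n -` A \<inter> UNIV) = (\<integral>\<^sup>+x. indicator (A \<inter> UNIV) x * ennreal ((\<lambda>_. 1) x) \<partial>lborel)"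
    by (rule emeasure_involution_cart[where f'="\<lambda>_. refl n"])
      (auto intro!: linear_imp_has_derivative linear_refl simp: orthogonal_refl)
  then show "emeasure (distr lborel borel (refl n)) A = emeasure lborel A"
    by (simp add: emeasure_distr)
qed simp

lemma from_cart_refl: "from_cart (refl n x) = refl (from_cart n) (from_cart x)"
  by (simp add: refl_def inner_from_cart linear_diff[OF linear_from_cart] linear_cmul[OF linear_from_cart])

lemma nn_integral_refl:
  fixes f :: "'a::euclidean_space \<Rightarrow> ennreal"
  assumes [measurable]: "f \<in> borel_measurable borel"
  shows "(\<integral>\<^sup>+x. f (refl n x) \<partial>lborel) = (\<integral>\<^sup>+x. f x \<partial>lborel)"
proof -
  obtain m where m: "from_cart m = n" using surj_from_cart by blast
  have "(\<integral>\<^sup>+x. f (refl n x) \<partial>lborel) = (\<integral>\<^sup>+x. f (from_cart (refl m x)) \<partial>lborel)"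
    by (subst nn_integral_from_cart) (auto simp: from_cart_refl m)
  also have "\<dots> = (\<integral>\<^sup>+x. f (from_cart x) \<partial>distr lborel borel (refl m))"
    by (subst nn_integral_distr) auto
  also have "\<dots> = (\<integral>\<^sup>+x. f x \<partial>lborel)"
    unfolding distr_refl_cart by (rule nn_integral_from_cart[symmetric]) simp
  finally show ?thesis .
qed

definition inversion :: "'a::euclidean_space \<Rightarrow> 'a" where
  "inversion x = (1 / (x \<bullet> x)) *\<^sub>R x"

lemma inversion_measurable [measurable]: "inversion \<in> borel_measurable borel"
  unfolding inversion_def[abs_def] by measurable

lemma inversion_invol [simp]: "inversion (inversion x) = x"
  by (simp add: inversion_def)

lemma inversion_eq_0 [simp]: "inversion x = 0 \<longleftrightarrow> x = 0"
  by (auto simp: inversion_def)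

lemma has_derivative_inversion:
  assumes "x \<noteq> 0"
  shows "(inversion has_derivative (\<lambda>h. (1 / (x \<bullet> x)) *\<^sub>R refl x h)) (at x)"
proof -
  have "((\<lambda>x. (1 / (x \<bullet> x)) *\<^sub>R x) has_derivative
      (\<lambda>h. (1 / (x \<bullet> x)) *\<^sub>R h + (- (inverse (x \<bullet> x) * (h \<bullet> x + x \<bullet> h) * inverse (x \<bullet> x))) *\<^sub>R x)) (at x)"
    using assms by (auto intro!: derivative_eq_intros simp: inverse_eq_divide fun_eq_iff minus_divide_left
        simp flip: scaleR_minus_left)
  moreover have "(1 / (x \<bullet> x)) *\<^sub>R h + (- (inverse (x \<bullet> x) * (h \<bullet> x + x \<bullet> h) * inverse (x \<bullet> x))) *\<^sub>R x
      = (1 / (x \<bullet> x)) *\<^sub>R refl x h" for h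
    by (simp add: refl_def inner_commute[of x h] scaleR_diff_right inverse_eq_divide)
  ultimately show ?thesis by (simp add: inversion_def[abs_def])
qed

lemma distr_inversion_cart:
  "distr lborel borel inversion =
     density (lborel :: (real^'n::{finite,wellorder}) measure) (\<lambda>x. ennreal (norm x powr (- 2 * real CARD('n::_))))"
proof (rule measure_eqI)
  fix A :: "(real^'n::_) set" assume "A \<in> sets (distr lborel borel inversion)"
  then have [measurable]: "A \<in> sets borel" by simp
  have "emeasure lborel (inversion -` A \<inter> - {0}) =
      (\<integral>\<^sup>+x. indicator (A \<inter> - {0}) x * ennreal (norm x powr (- 2 * real CARD('n::_))) \<partial>lborel)"
  proof (rule emeasure_involution_cart[OF _ _ _ _ _ has_derivative_inversion])
    fix x :: "real^'n::_" assume "x \<in> - {0}"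
    then have x: "x \<noteq> 0" by simp
    have "matrix (\<lambda>h. (1 / (x \<bullet> x)) *\<^sub>R refl x h) = matrix ((*\<^sub>R) (1 / (x \<bullet> x))) ** matrix (refl x)"
      using matrix_compose[OF linear_refl[of x] linear_scaleR[of "1 / (x \<bullet> x)"]] by (simp add: o_def)
    then have "\<bar>det (matrix (\<lambda>h. (1 / (x \<bullet> x)) *\<^sub>R refl x h))\<bar> = \<bar>1 / (x \<bullet> x)\<bar> ^ CARD('n)"
      by (simp add: det_mul abs_mult orthogonal_refl power_abs)
    also have "\<dots> = (norm x powr (-2)) ^ CARD('n)"
      using x by (simp add: powr_minus dot_square_norm powr_numeral divide_simps)
    also have "\<dots> = norm x powr (- 2 * real CARD('n::_))"
      using x by (simp add: powr_powr powr_realpow[symmetric])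
    finally show "\<bar>det (matrix (\<lambda>h. (1 / (x \<bullet> x)) *\<^sub>R refl x h))\<bar> = norm x powr (- 2 * real CARD('n::_))" .
  qed auto
  also have "\<dots> = (\<integral>\<^sup>+x. indicator A x * ennreal (norm x powr (- 2 * real CARD('n::_))) \<partial>lborel)"
    by (intro nn_integral_cong) (auto simp: indicator_def)
  finally have *: "emeasure lborel (inversion -` A \<inter> - {0}) = \<dots>" .
  show "emeasure (distr lborel borel inversion) A =
      emeasure (density lborel (\<lambda>x. ennreal (norm x powr (- 2 * real CARD('n::_))))) A"
  proof -
    have "emeasure lborel (inversion -` A) = emeasure lborel (inversion -` A \<inter> - {0})"
      by (rule emeasure_eq_AE) (use AE_lborel_singleton[of 0] in \<open>auto simp: measurable_sets_borel[of inversion borel A, simplified]\<close>)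
    then show ?thesis
      using *
      by (simp add: emeasure_distr emeasure_density mult.commute)
  qed
qed simp

lemma from_cart_inversion: "from_cart (inversion x) = inversion (from_cart x)"
  by (simp add: inversion_def inner_from_cart linear_cmul[OF linear_from_cart])

lemma card_coord: "CARD('a::euclidean_space coord) = DIM('a)"
  using bij_betw_same_card[OF bij_basis_coord] .

lemma nn_integral_inversion:
  fixes f :: "'a::euclidean_space \<Rightarrow> ennreal"
  assumes [measurable]: "f \<in> borel_measurable borel"
  shows "(\<integral>\<^sup>+x. f (inversion x) * ennreal (norm x powr (- 2 * real DIM('a))) \<partial>lborel) = (\<integral>\<^sup>+x. f x \<partial>lborel)"
proof -
  have "(\<integral>\<^sup>+x. f (inversion x) * ennreal (norm x powr (- 2 * real DIM('a))) \<partial>lborel)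
      = (\<integral>\<^sup>+x. ennreal (norm x powr (- 2 * real CARD('a coord))) * f (from_cart (inversion x)) \<partial>lborel)"
    by (subst nn_integral_from_cart) (auto simp: from_cart_inversion card_coord mult.commute)
  also have "\<dots> = (\<integral>\<^sup>+x. f (from_cart (inversion x))
      \<partial>density lborel (\<lambda>x. ennreal (norm x powr (- 2 * real CARD('a coord)))))"
    by (subst nn_integral_density) auto
  also have "\<dots> = (\<integral>\<^sup>+x. f (from_cart (inversion x)) \<partial>distr lborel borel inversion)"
    by (simp add: distr_inversion_cart)
  also have "\<dots> = (\<integral>\<^sup>+x. f (from_cart x) \<partial>lborel)"
    by (subst nn_integral_distr) auto
  also have "\<dots> = (\<integral>\<^sup>+x. f x \<partial>lborel)"
    by (rule nn_integral_from_cart[symmetric]) simp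
  finally show ?thesis .
qed

section \<open>Affine changes of variables and powers of the norm\<close>

lemma nn_integral_affine:
  fixes f :: "'a::euclidean_space \<Rightarrow> ennreal"
  assumes [measurable]: "f \<in> borel_measurable borel" and c: "c \<noteq> 0"
  shows "(\<integral>\<^sup>+x. f x \<partial>lborel) = ennreal (\<bar>c\<bar> ^ DIM('a)) * (\<integral>\<^sup>+x. f (t + c *\<^sub>R x) \<partial>lborel)"
  by (subst lborel_affine[OF c, of t])
    (simp add: nn_integral_density nn_integral_distr nn_integral_cmult)

lemma nn_integral_translate:
  fixes f :: "'a::euclidean_space \<Rightarrow> ennreal"
  assumes [measurable]: "f \<in> borel_measurable borel"
  shows "(\<integral>\<^sup>+x. f (t + x) \<partial>lborel) = (\<integral>\<^sup>+x. f x \<partial>lborel)"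
  using nn_integral_affine[of f 1 t] by simp

lemma nn_integral_flip:
  fixes f :: "'a::euclidean_space \<Rightarrow> ennreal"
  assumes [measurable]: "f \<in> borel_measurable borel"
  shows "(\<integral>\<^sup>+x. f (t - x) \<partial>lborel) = (\<integral>\<^sup>+x. f x \<partial>lborel)"
  using nn_integral_affine[of f "-1" t] by simp

lemma integrable_affine_iff:
  fixes f :: "'a::euclidean_space \<Rightarrow> 'b::{banach, second_countable_topology}"
  assumes c: "c \<noteq> 0" and [measurable]: "f \<in> borel_measurable borel"
  shows "integrable lborel (\<lambda>x. f (t + c *\<^sub>R x)) \<longleftrightarrow> integrable lborel f"
proof -
  have "integrable lborel f \<longleftrightarrow> integrable (density (distr lborel borel (\<lambda>x. t + c *\<^sub>R x)) (\<lambda>_. ennreal (\<bar>c\<bar> ^ DIM('a)))) f"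
    using lborel_affine[OF c, of t] by simp
  also have "\<dots> \<longleftrightarrow> integrable lborel (\<lambda>x. \<bar>c\<bar> ^ DIM('a) *\<^sub>R f (t + c *\<^sub>R x))"
    by (subst integrable_density) (auto simp: integrable_distr_eq)
  also have "\<dots> \<longleftrightarrow> integrable lborel (\<lambda>x. f (t + c *\<^sub>R x))"
    using c integrable_scaleR_right[of "\<bar>c\<bar> ^ DIM('a)" lborel "\<lambda>x. f (t + c *\<^sub>R x)"]
      integrable_scaleR_right[of "inverse (\<bar>c\<bar> ^ DIM('a))" lborel "\<lambda>x. \<bar>c\<bar> ^ DIM('a) *\<^sub>R f (t + c *\<^sub>R x)"]
    by auto
  finally show ?thesis ..
qed

lemma integral_affine:
  fixes f :: "'a::euclidean_space \<Rightarrow> 'b::{banach, second_countable_topology}"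
  assumes c: "c \<noteq> 0" and [measurable]: "f \<in> borel_measurable borel"
  shows "integral\<^sup>L lborel f = \<bar>c\<bar> ^ DIM('a) *\<^sub>R (\<integral>x. f (t + c *\<^sub>R x) \<partial>lborel)"
  by (subst lborel_affine[OF c, of t]) (simp add: integral_density integral_distr)

lemma integrable_translate_iff:
  fixes f :: "'a::euclidean_space \<Rightarrow> 'b::{banach, second_countable_topology}"
  assumes "f \<in> borel_measurable borel"
  shows "integrable lborel (\<lambda>x. f (t + x)) \<longleftrightarrow> integrable lborel f"
  using integrable_affine_iff[of 1 f t] assms by simp

lemma integral_translate:
  fixes f :: "'a::euclidean_space \<Rightarrow> 'b::{banach, second_countable_topology}"
  assumes "f \<in> borel_measurable borel"
  shows "(\<integral>x. f (t + x) \<partial>lborel) = integral\<^sup>L lborel f"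
  using integral_affine[of 1 f t] assms by simp

lemma integrable_flip_iff:
  fixes f :: "'a::euclidean_space \<Rightarrow> 'b::{banach, second_countable_topology}"
  assumes "f \<in> borel_measurable borel"
  shows "integrable lborel (\<lambda>x. f (t - x)) \<longleftrightarrow> integrable lborel f"
  using integrable_affine_iff[of "-1" f t] assms by simp

lemma integral_flip:
  fixes f :: "'a::euclidean_space \<Rightarrow> 'b::{banach, second_countable_topology}"
  assumes "f \<in> borel_measurable borel"
  shows "(\<integral>x. f (t - x) \<partial>lborel) = integral\<^sup>L lborel f"
  using integral_affine[of "-1" f t] assms by simp

lemma distr_refl: "distr lborel borel (refl n) = (lborel :: 'a::euclidean_space measure)"
proof (rule measure_eqI)
  fix A assume "A \<in> sets (distr lborel borel (refl n))"
  then have [measurable]: "A \<in> sets borel" by simp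
  have "emeasure (distr lborel borel (refl n)) A = (\<integral>\<^sup>+x. indicator A x \<partial>distr lborel borel (refl n))"
    by simp
  also have "\<dots> = (\<integral>\<^sup>+x. indicator A (refl n x) \<partial>lborel)"
    by (rule nn_integral_distr) auto
  finally have "emeasure (distr lborel borel (refl n)) A = (\<integral>\<^sup>+x. indicator A (refl n x) \<partial>lborel)" .
  then show "emeasure (distr lborel borel (refl n)) A = emeasure lborel A"
    by (simp add: nn_integral_refl)
qed simp

lemma integrable_refl_iff:
  fixes f :: "'a::euclidean_space \<Rightarrow> 'b::{banach, second_countable_topology}"
  assumes "f \<in> borel_measurable borel"
  shows "integrable lborel (\<lambda>x. f (refl n x)) \<longleftrightarrow> integrable lborel f"
  using integrable_distr_eq[of "refl n" lborel borel f] assms by (simp add: distr_refl)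

lemma integral_refl:
  fixes f :: "'a::euclidean_space \<Rightarrow> 'b::{banach, second_countable_topology}"
  assumes "f \<in> borel_measurable borel"
  shows "(\<integral>x. f (refl n x) \<partial>lborel) = integral\<^sup>L lborel f"
  using integral_distr[of "refl n" lborel borel f] assms by (simp add: distr_refl)

lemma dyadic_bracket:
  fixes r :: real assumes "0 < r" "r < 1"
  shows "\<exists>k::nat. (1/2) ^ Suc k \<le> r \<and> r < (1/2) ^ k"
proof -
  obtain n :: nat where n: "(1/2) ^ n < r"
    using real_arch_pow_inv[of r "1/2"] assms by auto
  define m where "m = (LEAST n. (1/2::real) ^ n \<le> r)"
  have m: "(1/2) ^ m \<le> r" unfolding m_def by (rule LeastI[of _ n]) (use n in simp)
  have "m \<noteq> 0" using m assms by (cases m) auto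
  then obtain k where k: "m = Suc k" by (cases m) auto
  have "\<not> (1/2) ^ k \<le> r" using not_less_Least[of k "\<lambda>n. (1/2::real) ^ n \<le> r"] k m_def by auto
  then show ?thesis using m k by auto
qed

lemma nn_integral_norm_powr_ball:
  assumes a: "a < real DIM('a)"
  shows "(\<integral>\<^sup>+x. ennreal (norm x powr (- a)) * indicator (ball 0 1) x \<partial>(lborel :: 'a::euclidean_space measure)) < \<infinity>"
proof -
  let ?V = "emeasure lborel (ball (0::'a) 1)"
  have V: "?V < \<infinity>" using emeasure_bounded_finite[of "ball (0::'a) 1"] by simp
  define b where "b = max a 0"
  have b: "b \<ge> 0" "b \<ge> a" "b < real DIM('a)" using a by (auto simp: b_def)
  have ball: "emeasure lborel (ball (0::'a) ((1/2) ^ k)) = ennreal (((1/2) ^ k) ^ DIM('a)) * ?V" for k :: nat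
  proof -
    have "emeasure lborel (ball (0::'a) ((1/2) ^ k)) = (\<integral>\<^sup>+x. indicator (ball (0::'a) ((1/2) ^ k)) x \<partial>lborel)"
      by simp
    also have "\<dots> = ennreal (\<bar>(1/2) ^ k\<bar> ^ DIM('a)) * (\<integral>\<^sup>+x. indicator (ball (0::'a) ((1/2) ^ k)) (0 + (1/2) ^ k *\<^sub>R x) \<partial>lborel)"
      by (rule nn_integral_affine) (auto intro!: borel_measurable_indicator simp: borel_open)
    also have "(\<lambda>x. indicator (ball (0::'a) ((1/2) ^ k)) (0 + (1/2) ^ k *\<^sub>R x)) = (indicator (ball (0::'a) 1) :: 'a \<Rightarrow> ennreal)"
      by (rule ext) (auto simp: indicator_def)
    finally show ?thesis by simp
  qed
  have pw: "ennreal (norm x powr (- a)) * indicator (ball 0 1) x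
      \<le> (\<Sum>k. ennreal (2 powr (b * real (Suc k))) * indicator (ball 0 ((1/2) ^ k)) x)" for x :: 'a
  proof (cases "x = 0 \<or> norm x \<ge> 1")
    case False
    then obtain k :: nat where k: "(1/2) ^ Suc k \<le> norm x" "norm x < (1/2) ^ k"
      using dyadic_bracket[of "norm x"] by auto
    have "norm x powr (- a) \<le> norm x powr (- b)"
      using False b by (intro powr_mono') auto
    also have "\<dots> \<le> ((1/2) ^ Suc k) powr (- b)"
      using k b by (intro powr_mono2') auto
    also have "((1/2::real) ^ Suc k) = 2 powr (- real (Suc k))"
      by (simp only: powr_minus powr_realpow power_one_over inverse_eq_divide zero_less_numeral)
    also have "(2 powr (- real (Suc k))) powr (- b) = 2 powr (b * real (Suc k))"
      by (simp only: powr_powr) (simp add: algebra_simps)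
    finally have "ennreal (norm x powr (- a)) * indicator (ball 0 1) x
        \<le> (\<Sum>j\<in>{k}. ennreal (2 powr (b * real (Suc j))) * indicator (ball 0 ((1/2) ^ j)) x)"
      using False k by (simp add: ennreal_leI)
    also have "\<dots> \<le> (\<Sum>k. ennreal (2 powr (b * real (Suc k))) * indicator (ball 0 ((1/2) ^ k)) x)"
      by (rule sum_le_suminf) auto
    finally show ?thesis .
  qed auto
  have "(\<integral>\<^sup>+x. ennreal (norm x powr (- a)) * indicator (ball 0 1) x \<partial>(lborel :: 'a measure))
      \<le> (\<integral>\<^sup>+x. (\<Sum>k. ennreal (2 powr (b * real (Suc k))) * indicator (ball (0::'a) ((1/2) ^ k)) x) \<partial>lborel)"
    by (intro nn_integral_mono pw)
  also have "\<dots> = (\<Sum>k. \<integral>\<^sup>+x. ennreal (2 powr (b * real (Suc k))) * indicator (ball (0::'a) ((1/2) ^ k)) x \<partial>lborel)"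
    by (intro nn_integral_suminf borel_measurable_times_ennreal borel_measurable_const borel_measurable_indicator)
      (simp add: borel_open)
  also have "\<dots> = (\<Sum>k. ennreal (2 powr b * (2 powr (b - DIM('a))) ^ k) * ?V)"
  proof (intro suminf_cong)
    fix k
    have [measurable]: "ball (0::'a) ((1/2) ^ k) \<in> sets lborel" by (simp add: borel_open)
    have "2 powr (b * real (Suc k)) * ((1/2) ^ k) ^ DIM('a) = 2 powr b * (2 powr (b - DIM('a))) ^ k"
    proof -
      have "((1/2) ^ k) ^ DIM('a) = 2 powr (- (real k * real DIM('a)))"
        by (simp add: powr_minus powr_realpow[symmetric] powr_powr power_one_over inverse_eq_divide)
      moreover have "(2 powr (b - DIM('a))) ^ k = 2 powr ((b - DIM('a)) * real k)"
        by (simp add: powr_realpow[symmetric] powr_powr)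
      ultimately show ?thesis
        by (simp add: powr_add[symmetric] algebra_simps)
    qed
    then show "(\<integral>\<^sup>+x. ennreal (2 powr (b * real (Suc k))) * indicator (ball (0::'a) ((1/2) ^ k)) x \<partial>lborel) =
        ennreal (2 powr b * (2 powr (b - DIM('a))) ^ k) * ?V"
      by (simp add: nn_integral_cmult_indicator ball mult.assoc[symmetric] ennreal_mult[symmetric])
  qed
  also have "\<dots> = (\<Sum>k. ennreal (2 powr b * (2 powr (b - DIM('a))) ^ k)) * ?V"
    by simp
  also have "(\<Sum>k. ennreal (2 powr b * (2 powr (b - DIM('a))) ^ k)) = ennreal (\<Sum>k. 2 powr b * (2 powr (b - DIM('a))) ^ k)"
    using b by (intro suminf_ennreal2 summable_mult summable_geometric) (auto simp: powr_less_one)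
  also have "\<dots> * ?V < \<infinity>" using V by (simp add: ennreal_mult_less_top)
  finally show ?thesis .
qed

lemma nn_integral_norm_powr_outside:
  assumes a: "a > real DIM('a)"
  shows "(\<integral>\<^sup>+x. ennreal (norm x powr (- a)) * indicator (- cball 0 1) x \<partial>(lborel :: 'a::euclidean_space measure)) < \<infinity>"
proof -
  have "(\<integral>\<^sup>+x. ennreal (norm x powr (- a)) * indicator (- cball 0 1) x \<partial>(lborel :: 'a measure))
    = (\<integral>\<^sup>+x. ennreal (norm (inversion x) powr (- a)) * indicator (- cball 0 1) (inversion x)
        * ennreal (norm x powr (- 2 * real DIM('a))) \<partial>(lborel :: 'a measure))"
    by (rule nn_integral_inversion[symmetric]) measurable
  also have "\<dots> \<le> (\<integral>\<^sup>+x. ennreal (norm x powr (- (2 * DIM('a) - a))) * indicator (ball 0 1) x \<partial>(lborel :: 'a measure))"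
  proof (intro nn_integral_mono)
    fix x :: 'a
    have n: "norm (inversion x) = 1 / norm x" by (simp add: inversion_def dot_square_norm power2_eq_square)
    show "ennreal (norm (inversion x) powr (- a)) * indicator (- cball 0 1) (inversion x)
        * ennreal (norm x powr (- 2 * real DIM('a)))
      \<le> ennreal (norm x powr (- (2 * DIM('a) - a))) * indicator (ball 0 1) x"
    proof (cases "x = 0")
      case False
      then have "norm (inversion x) powr (- a) * norm x powr (- 2 * real DIM('a)) = norm x powr (- (2 * DIM('a) - a))"
        unfolding n by (simp add: powr_divide powr_minus_divide powr_diff powr_add field_simps)
      moreover have "indicator (- cball 0 1) (inversion x) = (indicator (ball 0 1) x :: ennreal)"
        using False by (auto simp: indicator_def n)
      ultimately show ?thesis by (auto simp: indicator_def ennreal_mult[symmetric])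
    qed (simp add: inversion_def)
  qed
  also have "\<dots> < \<infinity>" by (rule nn_integral_norm_powr_ball) (use a in simp)
  finally show ?thesis .
qed

section \<open>Riesz kernels on small sets, and the kernel of the fractional Laplacian\<close>

lemma nn_integral_riesz_ball:
  fixes y :: "'a::euclidean_space"
  assumes r: "r > 0"
  shows "(\<integral>\<^sup>+z. ennreal (norm (y - z) powr (- a)) * indicator (ball y r) z \<partial>lborel)
    = ennreal (r powr (real DIM('a) - a)) * (\<integral>\<^sup>+z. ennreal (norm z powr (- a)) * indicator (ball 0 1) z \<partial>(lborel :: 'a measure))"
proof -
  have "(\<integral>\<^sup>+z. ennreal (norm (y - z) powr (- a)) * indicator (ball y r) z \<partial>lborel)
    = ennreal (\<bar>r\<bar> ^ DIM('a)) * (\<integral>\<^sup>+z. ennreal (norm (y - (y + r *\<^sub>R z)) powr (- a)) * indicator (ball y r) (y + r *\<^sub>R z) \<partial>lborel)"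
    using r by (intro nn_integral_affine) (auto intro!: borel_measurable_times_ennreal borel_measurable_indicator simp: borel_open)
  also have "(\<lambda>z. ennreal (norm (y - (y + r *\<^sub>R z)) powr (- a)) * indicator (ball y r) (y + r *\<^sub>R z))
      = (\<lambda>z. ennreal (r powr (- a)) * (ennreal (norm z powr (- a)) * indicator (ball 0 1) z))"
    using r by (auto simp: fun_eq_iff indicator_def powr_mult ennreal_mult dist_norm)
  also have "(\<integral>\<^sup>+z. ennreal (r powr (- a)) * (ennreal (norm z powr (- a)) * indicator (ball 0 1) z) \<partial>(lborel :: 'a measure))
      = ennreal (r powr (- a)) * (\<integral>\<^sup>+z. ennreal (norm z powr (- a)) * indicator (ball 0 1) z \<partial>(lborel :: 'a measure))"
    by (intro nn_integral_cmult borel_measurable_times_ennreal borel_measurable_indicator) (auto simp: borel_open)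
  finally show ?thesis
    using r by (simp add: mult.assoc[symmetric] ennreal_mult[symmetric] powr_diff powr_minus divide_inverse powr_realpow)
qed

lemma nn_integral_riesz_set_le:
  fixes y :: "'a::euclidean_space"
  assumes r: "r > 0" and a: "a \<ge> 0" and E [measurable]: "E \<in> sets borel"
  shows "(\<integral>\<^sup>+z. ennreal (norm (y - z) powr (- a)) * indicator E z \<partial>lborel)
    \<le> ennreal (r powr (real DIM('a) - a)) * (\<integral>\<^sup>+z. ennreal (norm z powr (- a)) * indicator (ball 0 1) z \<partial>(lborel :: 'a measure))
       + ennreal (r powr (- a)) * emeasure lborel E"
proof -
  have [measurable]: "ball y r \<in> sets borel" by (simp add: borel_open)
  have "(\<integral>\<^sup>+z. ennreal (norm (y - z) powr (- a)) * indicator E z \<partial>lborel)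
    \<le> (\<integral>\<^sup>+z. ennreal (norm (y - z) powr (- a)) * indicator (ball y r) z + ennreal (r powr (- a)) * indicator E z \<partial>lborel)"
  proof (intro nn_integral_mono)
    fix z
    show "ennreal (norm (y - z) powr (- a)) * indicator E z
      \<le> ennreal (norm (y - z) powr (- a)) * indicator (ball y r) z + ennreal (r powr (- a)) * indicator E z"
    proof (cases "z \<in> ball y r")
      case False
      then have "norm (y - z) powr (- a) \<le> r powr (- a)"
        using r a by (intro powr_mono2') (auto simp: dist_norm)
      then show ?thesis using False by (auto simp: indicator_def ennreal_leI)
    qed (auto simp: indicator_def)
  qed
  also have "\<dots> = (\<integral>\<^sup>+z. ennreal (norm (y - z) powr (- a)) * indicator (ball y r) z \<partial>lborel) + ennreal (r powr (- a)) * emeasure lborel E"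
    by (subst nn_integral_add) (auto simp: nn_integral_cmult_indicator)
  finally show ?thesis using nn_integral_riesz_ball[OF r, of y a] by simp
qed

text \<open>Near the pole the singularity is integrable, and away from it the kernel is bounded, so the smallness of the measure alone controls the potential.\<close>

lemma riesz_small_sets:
  assumes a: "0 \<le> a" "a < real DIM('a::euclidean_space)" and e: "e > 0"
  obtains d where "d > 0"
    "\<And>E (y::'a). E \<in> sets borel \<Longrightarrow> emeasure lborel E \<le> ennreal d \<Longrightarrow>
       (\<integral>\<^sup>+z. ennreal (norm (y - z) powr (- a)) * indicator E z \<partial>lborel) \<le> ennreal e"
proof -
  obtain I where I: "I \<ge> 0" "(\<integral>\<^sup>+z. ennreal (norm z powr (- a)) * indicator (ball 0 1) z \<partial>(lborel :: 'a measure)) = ennreal I"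
    using nn_integral_norm_powr_ball[OF a(2)] by (auto simp: less_top_ennreal)
  define r where "r = (e / (2 * (I + 1))) powr (1 / (real DIM('a) - a))"
  have r: "r > 0" using e I by (simp add: r_def)
  have rp: "r powr (real DIM('a) - a) = e / (2 * (I + 1))"
    unfolding r_def powr_powr using a e I by simp
  define d where "d = e / 2 * r powr a"
  show ?thesis
  proof
    show "d > 0" using e r by (simp add: d_def)
    fix E :: "'a set" and y :: 'a assume E: "E \<in> sets borel" "emeasure lborel E \<le> ennreal d"
    have "(\<integral>\<^sup>+z. ennreal (norm (y - z) powr (- a)) * indicator E z \<partial>lborel)
      \<le> ennreal (r powr (real DIM('a) - a)) * ennreal I + ennreal (r powr (- a)) * emeasure lborel E"
      using nn_integral_riesz_set_le[OF r a(1) E(1), of y] by (simp add: I)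
    also have "\<dots> \<le> ennreal (r powr (real DIM('a) - a)) * ennreal I + ennreal (r powr (- a)) * ennreal d"
      using E by (intro add_left_mono mult_left_mono) auto
    also have "\<dots> = ennreal (r powr (real DIM('a) - a) * I + r powr (- a) * d)"
      using I r e by (simp add: d_def ennreal_mult[symmetric] ennreal_plus[symmetric] del: ennreal_plus)
    also have "r powr (real DIM('a) - a) * I + r powr (- a) * d \<le> e"
    proof -
      have "r powr (- a) * d = e / 2" using r by (simp add: d_def powr_minus field_simps)
      moreover have "e / (2 * (I + 1)) * I \<le> e / 2" using I e by (simp add: field_simps)
      ultimately show ?thesis unfolding rp by linarith
    qed
    finally show "(\<integral>\<^sup>+z. ennreal (norm (y - z) powr (- a)) * indicator E z \<partial>lborel) \<le> ennreal e"
      by (simp add: ennreal_leI)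
  qed
qed

lemma riesz_bounded_sets:
  fixes E :: "'a::euclidean_space set"
  assumes a: "0 \<le> a" "a < real DIM('a)" and E: "E \<in> sets borel" "emeasure lborel E < \<infinity>"
  obtains C where "C \<ge> 0" "\<And>y. (\<integral>\<^sup>+z. ennreal (norm (y - z) powr (- a)) * indicator E z \<partial>lborel) \<le> ennreal C"
proof -
  obtain I where I: "I \<ge> 0" "(\<integral>\<^sup>+z. ennreal (norm z powr (- a)) * indicator (ball 0 1) z \<partial>(lborel :: 'a measure)) = ennreal I"
    using nn_integral_norm_powr_ball[OF a(2)] by (auto simp: less_top_ennreal)
  obtain m where m: "m \<ge> 0" "emeasure lborel E = ennreal m" using E(2) by (auto simp: less_top_ennreal)
  show ?thesis
    by (rule that[of "I + m"]) (use nn_integral_riesz_set_le[of 1 a E] a E I m in \<open>auto simp: ennreal_plus\<close>)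
qed

definition kern :: "real \<Rightarrow> 'a::euclidean_space \<Rightarrow> real" where
  "kern s z = norm z powr (- (real DIM('a) + 2 * s))"

lemma kern_measurable [measurable]: "kern s \<in> borel_measurable borel"
  unfolding kern_def[abs_def] by measurable

lemma kern_nonneg [simp]: "kern s z \<ge> 0" by (simp add: kern_def)

lemma kern_pos: "z \<noteq> 0 \<Longrightarrow> kern s z > 0" by (simp add: kern_def)

lemma kern_minus [simp]: "kern s (- z) = kern s z" by (simp add: kern_def)

lemma kern_refl [simp]: "kern s (refl n z) = kern s z" by (simp add: kern_def)

lemma kern_scale: "c > 0 \<Longrightarrow> kern s (c *\<^sub>R z :: 'a::euclidean_space) = c powr (- (real DIM('a) + 2 * s)) * kern s z"
  by (simp add: kern_def powr_mult)

lemma integrable_min_kern: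
  assumes s: "s > 0" and \<alpha>: "\<alpha> > 2 * s"
  shows "integrable lborel (\<lambda>z :: 'a::euclidean_space. min (norm z powr \<alpha>) 1 * kern s z)"
proof (rule integrableI_nonneg)
  have [measurable]: "ball (0::'a) 1 \<in> sets borel" "cball (0::'a) 1 \<in> sets borel" by (simp_all add: borel_open borel_closed)
  show "(\<lambda>z::'a. min (norm z powr \<alpha>) 1 * kern s z) \<in> borel_measurable lborel" by measurable
  show "AE z in lborel. 0 \<le> min (norm (z::'a) powr \<alpha>) 1 * kern s z" by simp
  let ?A = "\<lambda>z::'a. ennreal (norm z powr (- (real DIM('a) + 2 * s - \<alpha>))) * indicator (ball 0 1) z"
  let ?B = "\<lambda>z::'a. ennreal (norm z powr (- (real DIM('a) + 2 * s))) * indicator (- cball 0 1) z"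
  have "(\<integral>\<^sup>+z. ennreal (min (norm z powr \<alpha>) 1 * kern s z) \<partial>(lborel::'a measure)) \<le>
      (\<integral>\<^sup>+z. ?A z + (?B z + indicator (cball 0 1) z) \<partial>lborel)"
  proof (intro nn_integral_mono)
    fix z :: 'a
    consider "norm z < 1" | "norm z = 1" | "norm z > 1" by linarith
    then show "ennreal (min (norm z powr \<alpha>) 1 * kern s z) \<le> ?A z + (?B z + indicator (cball 0 1) z)"
    proof cases
      case 1
      have "min (norm z powr \<alpha>) 1 * kern s z \<le> norm z powr \<alpha> * kern s z"
        by (intro mult_right_mono) auto
      also have "\<dots> = norm z powr (- (real DIM('a) + 2 * s - \<alpha>))"
        by (simp add: kern_def powr_add[symmetric] algebra_simps)
      finally have "ennreal (min (norm z powr \<alpha>) 1 * kern s z) \<le> ennreal (norm z powr (- (real DIM('a) + 2 * s - \<alpha>)))"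
        by (rule ennreal_leI)
      also have "\<dots> = ?A z" using 1 by simp
      finally show ?thesis by (simp add: add_increasing2)
    next
      case 2 then show ?thesis by (simp add: kern_def)
    next
      case 3
      have "min (norm z powr \<alpha>) 1 * kern s z \<le> 1 * kern s z"
        by (intro mult_right_mono) auto
      then have "ennreal (min (norm z powr \<alpha>) 1 * kern s z) \<le> ?B z"
        using 3 by (auto simp: kern_def intro!: ennreal_leI)
      then show ?thesis by (simp add: add_increasing add_increasing2)
    qed
  qed
  also have "\<dots> = (\<integral>\<^sup>+z. ?A z \<partial>lborel) + ((\<integral>\<^sup>+z. ?B z \<partial>lborel) + (\<integral>\<^sup>+z. indicator (cball (0::'a) 1) z \<partial>lborel))"
    by (simp add: nn_integral_add)
  also have "\<dots> < \<infinity>"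
    using nn_integral_norm_powr_ball[where 'a='a, of "real DIM('a) + 2 * s - \<alpha>"]
      nn_integral_norm_powr_outside[where 'a='a, of "real DIM('a) + 2 * s"] s \<alpha>
      emeasure_bounded_finite[of "cball (0::'a) 1"] by auto
  finally show "(\<integral>\<^sup>+z. ennreal (min (norm z powr \<alpha>) 1 * kern s z) \<partial>(lborel::'a measure)) < \<infinity>" .
qed

text \<open>The integrals over large increments need a bound of the kernel by the weight at infinity, uniform in the base point.\<close>

definition far_const :: "real \<Rightarrow> real \<Rightarrow> real \<Rightarrow> real" where
  "far_const m \<delta> R = \<delta> powr (- m) + (R / \<delta> + 1) powr m"

lemma kern_far_le:
  fixes x z :: "'a::euclidean_space"
  assumes "m \<ge> 0" "\<delta> > 0" "norm x \<le> R" "norm z \<ge> \<delta>"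
  shows "norm z powr (- m) \<le> far_const m \<delta> R * (1 / (1 + norm (x + z) powr m))"
proof -
  have z: "norm z > 0" using assms by linarith
  have R: "R \<ge> 0" using assms norm_ge_zero order_trans by blast
  have "norm (x + z) \<le> R + norm z" using norm_triangle_ineq[of x z] assms by linarith
  also have "\<dots> \<le> R / \<delta> * norm z + norm z"
    using mult_left_mono[OF assms(4), of "R / \<delta>"] R assms(2) by simp
  finally have "norm (x + z) \<le> (R / \<delta> + 1) * norm z" by (simp add: algebra_simps)
  then have "norm (x + z) powr m \<le> ((R / \<delta> + 1) * norm z) powr m"
    using assms by (intro powr_mono2) auto
  also have "\<dots> = (R / \<delta> + 1) powr m * norm z powr m"
    using R assms z by (intro powr_mult)
  finally have 1: "norm (x + z) powr m * norm z powr (- m) \<le> (R / \<delta> + 1) powr m"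
    using z by (simp add: powr_minus field_simps)
  have 2: "norm z powr (- m) \<le> \<delta> powr (- m)"
    using assms by (intro powr_mono2') auto
  have "norm z powr (- m) * (1 + norm (x + z) powr m) \<le> far_const m \<delta> R"
    using 1 2 by (simp add: far_const_def algebra_simps)
  then show ?thesis
    by (simp add: field_simps add_pos_nonneg)
qed

definition weighted :: "real \<Rightarrow> ('a::euclidean_space \<Rightarrow> real) \<Rightarrow> bool" where
  "weighted s u \<longleftrightarrow> u \<in> borel_measurable borel \<and>
     integrable lborel (\<lambda>x. \<bar>u x\<bar> / (1 + norm x powr (real DIM('a) + 2 * s)))"

lemma weighted_measurable: "weighted s u \<Longrightarrow> u \<in> borel_measurable borel" by (simp add: weighted_def)

lemma weighted_far:
  fixes u :: "'a::euclidean_space \<Rightarrow> real"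
  assumes u: "weighted s u" and s: "s > 0" and \<delta>: "\<delta> > 0" and R: "norm x \<le> R"
  shows "integrable lborel (\<lambda>z. \<bar>u (x + z)\<bar> * kern s z * indicator (- ball 0 \<delta>) z)" (is "integrable _ ?f")
    and "(\<integral>z. \<bar>u (x + z)\<bar> * kern s z * indicator (- ball 0 \<delta>) z \<partial>lborel)
      \<le> far_const (real DIM('a) + 2 * s) \<delta> R * (\<integral>x. \<bar>u x\<bar> / (1 + norm x powr (real DIM('a) + 2 * s)) \<partial>lborel)"
proof -
  let ?m = "real DIM('a) + 2 * s"
  let ?g = "\<lambda>x. \<bar>u x\<bar> / (1 + norm x powr ?m)"
  let ?C = "far_const ?m \<delta> R"
  have [measurable]: "u \<in> borel_measurable borel" and gi: "integrable lborel ?g"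
    using u by (auto simp: weighted_def)
  have [measurable]: "ball (0::'a) \<delta> \<in> sets borel" by (simp add: borel_open)
  have gi': "integrable lborel (\<lambda>z. ?g (x + z))"
    by (subst integrable_translate_iff[where f = ?g]) (use gi in auto)
  have le: "?f z \<le> ?C * ?g (x + z)" for z
  proof (cases "z \<in> ball 0 \<delta>")
    case False
    then have "kern s z \<le> ?C * (1 / (1 + norm (x + z) powr ?m))"
      unfolding kern_def using kern_far_le[of ?m \<delta> x R z] s \<delta> R by auto
    then have "\<bar>u (x + z)\<bar> * kern s z \<le> \<bar>u (x + z)\<bar> * (?C * (1 / (1 + norm (x + z) powr ?m)))"
      by (intro mult_left_mono) auto
    then show ?thesis using False by (simp add: mult_ac)
  next
    case True
    then show ?thesis by (simp add: far_const_def)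
  qed
  show int: "integrable lborel ?f"
  proof (rule Bochner_Integration.integrable_bound[OF integrable_mult_right[OF gi', of ?C]])
    have "norm (?f z) \<le> norm (?C * ?g (x + z))" for z
    proof -
      have "norm (?f z) = ?f z" by simp
      then show ?thesis using le[of z] by (smt (verit) real_norm_def)
    qed
    then show "AE z in lborel. norm (?f z) \<le> norm (?C * ?g (x + z))" by simp
  qed measurable
  have "(\<integral>z. ?f z \<partial>lborel) \<le> (\<integral>z. ?C * ?g (x + z) \<partial>lborel)"
    by (intro integral_mono int integrable_mult_right gi' le)
  also have "\<dots> = ?C * (\<integral>z. ?g z \<partial>lborel)"
    using integral_translate[where f = ?g and t = x] by (simp del: times_divide_eq_right)
  finally show "(\<integral>z. ?f z \<partial>lborel) \<le> ?C * (\<integral>z. ?g z \<partial>lborel)" .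
qed

section \<open>Second differences\<close>

definition sdiff :: "('a::euclidean_space \<Rightarrow> real) \<Rightarrow> 'a \<Rightarrow> 'a \<Rightarrow> real" where
  "sdiff f z x = 2 * f x - f (x + z) - f (x - z)"

definition slap :: "real \<Rightarrow> ('a::euclidean_space \<Rightarrow> real) \<Rightarrow> 'a \<Rightarrow> real" where
  "slap s f x = (\<integral>z. sdiff f z x * kern s z \<partial>lborel) / 2"

lemma sdiff_measurable [measurable]:
  assumes [measurable]: "f \<in> borel_measurable borel"
  shows "(\<lambda>z. sdiff f z x) \<in> borel_measurable borel"
  unfolding sdiff_def by measurable

lemma sdiff_measurable_pair [measurable]:
  assumes [measurable]: "f \<in> borel_measurable borel"
  shows "(\<lambda>p. sdiff f (fst p) (snd p)) \<in> borel_measurable (borel \<Otimes>\<^sub>M borel)"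
  unfolding sdiff_def by measurable

lemma slap_scale:
  fixes f :: "'a::euclidean_space \<Rightarrow> real"
  assumes [measurable]: "f \<in> borel_measurable borel" and c: "c > 0"
  shows "slap s (\<lambda>x. f (c *\<^sub>R x)) x = c powr (2 * s) * slap s f (c *\<^sub>R x)"
proof -
  have "(\<integral>z. sdiff f z (c *\<^sub>R x) * kern s z \<partial>lborel)
      = \<bar>c\<bar> ^ DIM('a) *\<^sub>R (\<integral>z. sdiff f (0 + c *\<^sub>R z) (c *\<^sub>R x) * kern s (0 + c *\<^sub>R z) \<partial>lborel)"
    using c by (intro integral_affine) auto
  also have "\<dots> = (\<integral>z. c powr (- (2 * s)) * (sdiff f (c *\<^sub>R z) (c *\<^sub>R x) * kern s z) \<partial>lborel)"
    using c by (subst integral_scaleR_right[symmetric])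
      (auto intro!: Bochner_Integration.integral_cong simp: kern_scale powr_add powr_realpow[symmetric] powr_minus field_simps powr_diff)
  also have "\<dots> = c powr (- (2 * s)) * (\<integral>z. sdiff f (c *\<^sub>R z) (c *\<^sub>R x) * kern s z \<partial>lborel)"
    by simp
  finally show ?thesis
    using c by (simp add: slap_def sdiff_def powr_minus field_simps scaleR_add_right scaleR_diff_right)
qed

lemma slap_refl:
  assumes [measurable]: "f \<in> borel_measurable borel"
  shows "slap s (\<lambda>x. f (refl n x)) x = slap s f (refl n x)"
proof -
  have "(\<integral>z. sdiff f z (refl n x) * kern s z \<partial>lborel) = (\<integral>z. sdiff f (refl n z) (refl n x) * kern s (refl n z) \<partial>lborel)"
    by (rule integral_refl[symmetric]) measurable
  then show ?thesis
    by (simp add: slap_def sdiff_def linear_add[OF linear_refl] linear_diff[OF linear_refl])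
qed

lemma sdiff_flip: "sdiff (\<lambda>x. f (a - x)) z x = sdiff f z (a - x)"
  by (simp add: sdiff_def algebra_simps)

lemma slap_flip: "slap s (\<lambda>x. f (a - x)) x = slap s f (a - x)"
  by (simp add: slap_def sdiff_flip)

lemma sdiff_bound_of_derivative:
  fixes f :: "'a::euclidean_space \<Rightarrow> real"
  assumes der: "\<And>y. y \<in> cball x (norm z) \<Longrightarrow> (f has_derivative f' y) (at y)"
    and M: "\<And>y h. y \<in> cball x (norm z) \<Longrightarrow> \<bar>f' y h - f' x h\<bar> \<le> M * norm (y - x) powr \<tau> * norm h"
    and \<tau>: "\<tau> \<ge> 0"
  shows "\<bar>f (x + z) - f x - f' x z\<bar> \<le> M * norm z powr (1 + \<tau>)"
    and "\<bar>sdiff f z x\<bar> \<le> 2 * M * norm z powr (1 + \<tau>)"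
proof -
  have step: "\<bar>f (x + w) - f x - f' x w\<bar> \<le> M * norm z powr (1 + \<tau>)" if w: "norm w = norm z" for w
  proof (cases "z = 0")
    case True
    then have "w = 0" using w by simp
    moreover have "f' x 0 = 0" using der[of x] by (simp add: linear_0 has_derivative_linear)
    ultimately show ?thesis using True by simp
  next
    case False
    then have z: "norm z > 0" by simp
    let ?g = "\<lambda>t. f (x + t *\<^sub>R w) - t * f' x w"
    have inb: "x + t *\<^sub>R w \<in> cball x (norm z)" if "0 \<le> t" "t \<le> 1" for t
      using that w by (simp add: dist_norm mult_left_le_one_le)
    have dg: "(?g has_real_derivative (f' (x + t *\<^sub>R w) w - f' x w)) (at t)" if t: "0 \<le> t" "t \<le> 1" for t
    proof -
      have "((\<lambda>t. f (x + t *\<^sub>R w)) has_derivative (\<lambda>h. f' (x + t *\<^sub>R w) (h *\<^sub>R w))) (at t)"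
        by (rule has_derivative_compose[of "\<lambda>t. x + t *\<^sub>R w" "\<lambda>h. h *\<^sub>R w" t UNIV f "f' (x + t *\<^sub>R w)", OF _ der[OF inb[OF t]]])
          (auto intro!: derivative_eq_intros)
      moreover have "(\<lambda>h. f' (x + t *\<^sub>R w) (h *\<^sub>R w)) = (*) (f' (x + t *\<^sub>R w) w)"
        using der[OF inb[OF t]] by (simp add: fun_eq_iff linear_cmul has_derivative_linear)
      ultimately have "((\<lambda>t. f (x + t *\<^sub>R w)) has_real_derivative f' (x + t *\<^sub>R w) w) (at t)"
        by (simp add: has_field_derivative_def)
      then show ?thesis by (auto intro!: derivative_eq_intros)
    qed
    obtain \<xi> where \<xi>: "0 < \<xi>" "\<xi> < 1" "?g 1 - ?g 0 = (1 - 0) * (f' (x + \<xi> *\<^sub>R w) w - f' x w)"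
      using MVT2[of 0 1 ?g "\<lambda>t. f' (x + t *\<^sub>R w) w - f' x w"] dg by auto
    have M0: "0 \<le> M * norm z powr \<tau> * norm z"
      using M[of "x + w" w] w by (smt (verit) abs_ge_zero add_diff_cancel_left' dist_add_cancel dist_norm mem_cball order_trans norm_minus_commute)
    have "\<bar>f (x + w) - f x - f' x w\<bar> = \<bar>f' (x + \<xi> *\<^sub>R w) w - f' x w\<bar>"
      using \<xi>(3) by simp
    also have "\<dots> \<le> M * norm (x + \<xi> *\<^sub>R w - x) powr \<tau> * norm w"
      by (rule M) (use inb \<xi> in auto)
    also have "\<dots> = \<xi> powr \<tau> * (M * norm z powr \<tau> * norm z)"
      using \<xi> w by (simp add: powr_mult)
    also have "\<dots> \<le> 1 * (M * norm z powr \<tau> * norm z)"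
      using \<xi> \<tau> M0 by (intro mult_right_mono) (auto simp: powr_le1)
    also have "\<dots> = M * norm z powr (1 + \<tau>)" using z by (simp add: powr_add)
    finally show ?thesis .
  qed
  show "\<bar>f (x + z) - f x - f' x z\<bar> \<le> M * norm z powr (1 + \<tau>)" by (rule step) simp
  have "f' x (- z) = - f' x z" using der[of x] by (simp add: linear_neg has_derivative_linear)
  then have "\<bar>sdiff f z x\<bar> \<le> \<bar>f (x + z) - f x - f' x z\<bar> + \<bar>f (x + - z) - f x - f' x (- z)\<bar>"
    by (simp add: sdiff_def)
  also have "\<dots> \<le> M * norm z powr (1 + \<tau>) + M * norm z powr (1 + \<tau>)"
    by (intro add_mono step) auto
  finally show "\<bar>sdiff f z x\<bar> \<le> 2 * M * norm z powr (1 + \<tau>)" by simp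
qed

lemma sdiff_kern_bound:
  assumes "\<delta> > 0" "\<alpha> \<ge> 0" "\<And>z. norm z \<le> \<delta> \<Longrightarrow> \<bar>sdiff u z x\<bar> \<le> M * norm z powr \<alpha>"
  shows "\<bar>sdiff u z x * kern s z\<bar> \<le> max 1 (\<delta> powr \<alpha>) * \<bar>M\<bar> * (min (norm z powr \<alpha>) 1 * kern s z)
    + (2 * \<bar>u x\<bar> + \<bar>u (x + z)\<bar> + \<bar>u (x - z)\<bar>) * kern s z * indicator (- ball 0 \<delta>) z"
proof (cases "norm z < \<delta>")
  case True
  have "\<bar>sdiff u z x\<bar> \<le> M * norm z powr \<alpha>" using assms True by auto
  also have "\<dots> \<le> \<bar>M\<bar> * norm z powr \<alpha>" by (intro mult_right_mono) auto
  also have "\<dots> \<le> \<bar>M\<bar> * (max 1 (\<delta> powr \<alpha>) * min (norm z powr \<alpha>) 1)"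
  proof (intro mult_left_mono)
    have "norm z powr \<alpha> \<le> \<delta> powr \<alpha>" using True assms by (intro powr_mono2) auto
    moreover have "norm z powr \<alpha> \<le> max 1 (\<delta> powr \<alpha>) * norm z powr \<alpha>"
      using mult_right_mono[of 1 "max 1 (\<delta> powr \<alpha>)" "norm z powr \<alpha>"] by simp
    ultimately show "norm z powr \<alpha> \<le> max 1 (\<delta> powr \<alpha>) * min (norm z powr \<alpha>) 1"
      by (auto simp: min_def)
  qed auto
  finally have "\<bar>sdiff u z x\<bar> * kern s z \<le> \<bar>M\<bar> * (max 1 (\<delta> powr \<alpha>) * min (norm z powr \<alpha>) 1) * kern s z"
    by (intro mult_right_mono) auto
  then show ?thesis using True by (simp add: abs_mult mult_ac)
next
  case False
  have "\<bar>sdiff u z x\<bar> \<le> 2 * \<bar>u x\<bar> + \<bar>u (x + z)\<bar> + \<bar>u (x - z)\<bar>"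
    unfolding sdiff_def by linarith
  then have "\<bar>sdiff u z x\<bar> * kern s z \<le> (2 * \<bar>u x\<bar> + \<bar>u (x + z)\<bar> + \<bar>u (x - z)\<bar>) * kern s z"
    by (intro mult_right_mono) auto
  moreover have "0 \<le> max 1 (\<delta> powr \<alpha>) * \<bar>M\<bar> * (min (norm z powr \<alpha>) 1 * kern s z)"
    by (intro mult_nonneg_nonneg) auto
  ultimately show ?thesis using False by (simp add: abs_mult add_increasing)
qed

lemma integrable_kern_far:
  assumes "s > 0" "\<delta> > 0"
  shows "integrable lborel (\<lambda>z::'a::euclidean_space. kern s z * indicator (- ball 0 \<delta>) z)"
proof (rule Bochner_Integration.integrable_bound)
  have [measurable]: "ball (0::'a) \<delta> \<in> sets borel" by (simp add: borel_open)
  let ?\<alpha> = "2 * s + 1"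
  define c where "c = max 1 (\<delta> powr (- ?\<alpha>))"
  show "integrable lborel (\<lambda>z::'a. c * (min (norm z powr ?\<alpha>) 1 * kern s z))"
    using integrable_min_kern[of s ?\<alpha>] assms by auto
  show "(\<lambda>z::'a. kern s z * indicator (- ball 0 \<delta>) z) \<in> borel_measurable lborel" by measurable
  show "AE z::'a in lborel. norm (kern s z * indicator (- ball 0 \<delta>) z) \<le> norm (c * (min (norm z powr ?\<alpha>) 1 * kern s z))"
  proof (rule AE_I2)
    fix z :: 'a
    have "indicator (- ball 0 \<delta>) z \<le> c * min (norm z powr ?\<alpha>) 1"
    proof (cases "norm z < \<delta>")
      case False
      have "\<delta> powr ?\<alpha> \<le> norm z powr ?\<alpha>" using False assms by (intro powr_mono2) auto
      then have "1 \<le> \<delta> powr (- ?\<alpha>) * norm z powr ?\<alpha>"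
        unfolding powr_minus using assms by (simp add: field_simps)
      also have "\<dots> \<le> c * norm z powr ?\<alpha>" by (intro mult_right_mono) (auto simp: c_def)
      finally have "1 \<le> c * norm z powr ?\<alpha>" .
      moreover have "1 \<le> c" by (simp add: c_def)
      ultimately show ?thesis using False by (auto simp: min_def)
    qed (auto simp: c_def)
    then have "kern s z * indicator (- ball 0 \<delta>) z \<le> kern s z * (c * min (norm z powr ?\<alpha>) 1)"
      by (intro mult_left_mono) auto
    moreover have "c \<ge> 0" by (simp add: c_def)
    ultimately show "norm (kern s z * indicator (- ball 0 \<delta>) z) \<le> norm (c * (min (norm z powr ?\<alpha>) 1 * kern s z))"
      by (simp add: abs_mult mult_ac)
  qed
qed

lemma integrable_sdiff_majorant:
  fixes u :: "'a::euclidean_space \<Rightarrow> real"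
  assumes u: "weighted s u" and s: "s > 0" and \<alpha>: "\<alpha> > 2 * s" and \<delta>: "\<delta> > 0"
  shows "integrable lborel (\<lambda>z. c * (min (norm z powr \<alpha>) 1 * kern s z)
    + (2 * \<bar>u x\<bar> + \<bar>u (x + z)\<bar> + \<bar>u (x - z)\<bar>) * kern s z * indicator (- ball 0 \<delta>) z)"
proof -
  note [measurable] = weighted_measurable[OF u]
  have [measurable]: "ball (0::'a) \<delta> \<in> sets borel" by (simp add: borel_open)
  have 1: "integrable lborel (\<lambda>z. \<bar>u (x + z)\<bar> * kern s z * indicator (- ball 0 \<delta>) z)"
    by (rule weighted_far(1)[OF u s \<delta> order_refl])
  have "integrable lborel (\<lambda>z. \<bar>u (x + (0 - z))\<bar> * kern s (0 - z) * indicator (- ball 0 \<delta>) (0 - z))"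
    by (subst integrable_flip_iff[where f = "\<lambda>z. \<bar>u (x + z)\<bar> * kern s z * indicator (- ball 0 \<delta>) z"]) (use 1 in auto)
  then have 2: "integrable lborel (\<lambda>z. \<bar>u (x - z)\<bar> * kern s z * indicator (- ball 0 \<delta>) z)"
    by (simp add: indicator_def)
  have "integrable lborel (\<lambda>z. c * (min (norm z powr \<alpha>) 1 * kern s z) +
      (2 * \<bar>u x\<bar> * (kern s z * indicator (- ball 0 \<delta>) z) + \<bar>u (x + z)\<bar> * kern s z * indicator (- ball 0 \<delta>) z
        + \<bar>u (x - z)\<bar> * kern s z * indicator (- ball 0 \<delta>) z))"
    using 1 2 integrable_kern_far[OF s \<delta>] integrable_min_kern[OF s \<alpha>]
    by (intro Bochner_Integration.integrable_add integrable_mult_right)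
  then show ?thesis by (simp add: algebra_simps)
qed

lemma sdiff_kern_integrable:
  fixes u :: "'a::euclidean_space \<Rightarrow> real"
  assumes u: "weighted s u" and s: "s > 0" and \<alpha>: "\<alpha> > 2 * s" and \<delta>: "\<delta> > 0"
    and M: "\<And>z. norm z \<le> \<delta> \<Longrightarrow> \<bar>sdiff u z x\<bar> \<le> M * norm z powr \<alpha>"
  shows "integrable lborel (\<lambda>z. sdiff u z x * kern s z)"
proof -
  note [measurable] = weighted_measurable[OF u]
  show ?thesis
    by (rule Bochner_Integration.integrable_bound[OF integrable_sdiff_majorant[OF u s \<alpha> \<delta>, of "max 1 (\<delta> powr \<alpha>) * \<bar>M\<bar>" x]])
      (use sdiff_kern_bound[of \<delta> \<alpha> u x M, OF \<delta> _ M] \<alpha> s in \<open>auto intro!: AE_I2 order_trans[OF _ abs_ge_self]\<close>)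
qed


section \<open>The principal value as an absolutely convergent integral\<close>

text \<open>Averaging the truncated integral over a point and its mirror image replaces first differences by second ones, which are absolutely integrable.\<close>

lemma pv_integral_eq_slap:
  fixes u :: "'a::euclidean_space \<Rightarrow> real"
  assumes u: "weighted s u" and s: "s > 0"
    and int: "integrable lborel (\<lambda>z. sdiff u z x * kern s z)"
  shows "pv_integral s u x = slap s u x"
proof -
  note [measurable] = weighted_measurable[OF u]
  define A where "A \<epsilon> = (LINT y:(- ball x \<epsilon>)|lebesgue. (u x - u y) / norm (x - y) powr (real DIM('a) + 2 * s))" for \<epsilon>
  define B where "B \<epsilon> = (\<integral>z. indicator (- ball 0 \<epsilon>) z *\<^sub>R (sdiff u z x * kern s z) \<partial>lborel)" for \<epsilon>
  have AB: "A \<epsilon> = B \<epsilon> / 2" if e: "\<epsilon> > 0" for \<epsilon>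
  proof -
    have [measurable]: "ball (0::'a) \<epsilon> \<in> sets borel" "ball x \<epsilon> \<in> sets borel" by (simp_all add: borel_open)
    define h where "h y = indicator (- ball x \<epsilon>) y *\<^sub>R ((u x - u y) / norm (x - y) powr (real DIM('a) + 2 * s))" for y
    have [measurable]: "h \<in> borel_measurable borel" unfolding h_def by measurable
    have k: "kern s w = inverse (norm w powr (real DIM('a) + 2 * s))" for w :: 'a
      by (simp only: kern_def powr_minus)
    have h1: "h (x + z) = indicator (- ball 0 \<epsilon>) z * ((u x - u (x + z)) * kern s z)" for z
      by (simp add: h_def indicator_def dist_norm k divide_inverse)
    have h2: "h (x - z) = indicator (- ball 0 \<epsilon>) z * ((u x - u (x - z)) * kern s z)" for z
      by (simp add: h_def indicator_def dist_norm k divide_inverse)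
    have "integrable lborel (\<lambda>z. u x * (kern s z * indicator (- ball 0 \<epsilon>) z))"
      using integrable_kern_far[OF s e] by (rule integrable_mult_right)
    moreover have "integrable lborel (\<lambda>z. u (x + z) * kern s z * indicator (- ball 0 \<epsilon>) z)"
      by (rule Bochner_Integration.integrable_bound[OF weighted_far(1)[OF u s e order_refl, of x]]) (auto simp: abs_mult)
    ultimately have "integrable lborel (\<lambda>z. u x * (kern s z * indicator (- ball 0 \<epsilon>) z) - u (x + z) * kern s z * indicator (- ball 0 \<epsilon>) z)"
      by (rule Bochner_Integration.integrable_diff)
    moreover have "(\<lambda>z. h (x + z)) = (\<lambda>z. u x * (kern s z * indicator (- ball 0 \<epsilon>) z) - u (x + z) * kern s z * indicator (- ball 0 \<epsilon>) z)"
      by (simp add: h1 fun_eq_iff left_diff_distrib right_diff_distrib mult_ac)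
    ultimately have i1: "integrable lborel (\<lambda>z. h (x + z))" by simp
    then have i0: "integrable lborel h"
      by (subst (asm) integrable_translate_iff) auto
    then have i2: "integrable lborel (\<lambda>z. h (x - z))"
      by (subst integrable_flip_iff) auto
    have "A \<epsilon> = (\<integral>y. h y \<partial>lebesgue)" by (simp add: A_def set_lebesgue_integral_def h_def)
    also have "\<dots> = (\<integral>y. h y \<partial>lborel)" by (rule integral_completion) simp
    finally have "A \<epsilon> = integral\<^sup>L lborel h" .
    then have "2 * A \<epsilon> = (\<integral>z. h (x + z) \<partial>lborel) + (\<integral>z. h (x - z) \<partial>lborel)"
      by (simp add: integral_translate integral_flip)
    also have "\<dots> = (\<integral>z. h (x + z) + h (x - z) \<partial>lborel)"
      using i1 i2 by simp
    also have "\<dots> = B \<epsilon>"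
      unfolding B_def h1 h2 by (intro Bochner_Integration.integral_cong) (auto simp: sdiff_def algebra_simps)
    finally show ?thesis by simp
  qed
  have B: "(B \<longlongrightarrow> (\<integral>z. sdiff u z x * kern s z \<partial>lborel)) (at_right 0)"
    unfolding tendsto_at_iff_sequentially
  proof safe
    fix X :: "nat \<Rightarrow> real" assume X: "\<forall>i. X i \<in> {0<..} - {0}" "X \<longlonglongrightarrow> 0"
    have [measurable]: "ball (0::'a) (X i) \<in> sets borel" for i by (simp add: borel_open)
    show "(B \<circ> X) \<longlonglongrightarrow> (\<integral>z. sdiff u z x * kern s z \<partial>lborel)"
      unfolding o_def B_def
    proof (rule integral_dominated_convergence[where w = "\<lambda>z. norm (sdiff u z x * kern s z)"])
      show "AE z in lborel. (\<lambda>i. indicator (- ball 0 (X i)) z *\<^sub>R (sdiff u z x * kern s z)) \<longlonglongrightarrow> sdiff u z x * kern s z"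
      proof (rule AE_I2)
        fix z :: 'a
        show "(\<lambda>i. indicator (- ball 0 (X i)) z *\<^sub>R (sdiff u z x * kern s z)) \<longlonglongrightarrow> sdiff u z x * kern s z"
        proof (cases "z = 0")
          case False
          then have "\<forall>\<^sub>F i in sequentially. X i < norm z" using X(2) by (intro order_tendstoD) auto
          then have "\<forall>\<^sub>F i in sequentially. indicator (- ball 0 (X i)) z *\<^sub>R (sdiff u z x * kern s z) = sdiff u z x * kern s z"
            by eventually_elim (simp add: indicator_def)
          then show ?thesis by (rule tendsto_eventually)
        qed (simp add: sdiff_def)
      qed
      show "integrable lborel (\<lambda>z. norm (sdiff u z x * kern s z))" using int by (rule integrable_norm)
      show "AE z in lborel. norm (indicator (- ball 0 (X i)) z *\<^sub>R (sdiff u z x * kern s z)) \<le> norm (sdiff u z x * kern s z)" for i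
        by (intro AE_I2) (simp add: indicator_def)
    qed measurable
  qed
  have "(A \<longlongrightarrow> slap s u x) (at_right 0)"
  proof (rule Lim_transform_eventually)
    show "((\<lambda>\<epsilon>. B \<epsilon> / 2) \<longlongrightarrow> slap s u x) (at_right 0)"
      unfolding slap_def by (intro tendsto_intros B) simp
    show "\<forall>\<^sub>F \<epsilon> in at_right 0. B \<epsilon> / 2 = A \<epsilon>"
      using eventually_at_right_less[of "0::real"] by eventually_elim (simp add: AB)
  qed
  then show ?thesis
    unfolding pv_integral_def A_def[symmetric] using tendsto_Lim[of "at_right (0::real)" A] by simp
qed

section \<open>The normalising constant is positive\<close>

lemma slap_measurable [measurable]:
  assumes [measurable]: "f \<in> borel_measurable borel"
  shows "slap s f \<in> borel_measurable borel"
proof -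
  have "(\<lambda>x. \<integral>z. sdiff f z x * kern s z \<partial>lborel) \<in> borel_measurable borel"
    unfolding sdiff_def by (rule lborel.borel_measurable_lebesgue_integral) measurable
  then show ?thesis unfolding slap_def[abs_def] by measurable
qed

lemma slap_fubini:
  fixes f :: "'a::euclidean_space \<Rightarrow> real" and \<phi> :: "'a \<Rightarrow> 'b::{banach, second_countable_topology}"
  assumes [measurable]: "f \<in> borel_measurable borel" "\<phi> \<in> borel_measurable borel"
    and s: "s > 0" and \<alpha>: "\<alpha> > 2 * s" and C: "C \<ge> 0"
    and int: "\<And>x. integrable lborel (\<lambda>z. sdiff f z x * kern s z)"
    and bd: "\<And>z. (\<integral>\<^sup>+x. ennreal (\<bar>sdiff f z x\<bar> * norm (\<phi> x)) \<partial>lborel) \<le> ennreal (C * min (norm z powr \<alpha>) 1)"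
  shows "integrable lborel (\<lambda>x. slap s f x *\<^sub>R \<phi> x)"
    and "(\<integral>x. slap s f x *\<^sub>R \<phi> x \<partial>lborel) = (1/2) *\<^sub>R (\<integral>z. kern s z *\<^sub>R (\<integral>x. sdiff f z x *\<^sub>R \<phi> x \<partial>lborel) \<partial>lborel)"
    and "integrable lborel (\<lambda>z. kern s z *\<^sub>R (\<integral>x. sdiff f z x *\<^sub>R \<phi> x \<partial>lborel))"
proof -
  let ?F = "\<lambda>x z. (sdiff f z x * kern s z) *\<^sub>R \<phi> x"
  have m [measurable]: "case_prod ?F \<in> borel_measurable (lborel \<Otimes>\<^sub>M lborel)"
    unfolding sdiff_def by measurable
  have fin: "(\<integral>\<^sup>+z. (\<integral>\<^sup>+x. norm (?F x z) \<partial>lborel) \<partial>lborel) < \<infinity>"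
  proof -
    have "(\<integral>\<^sup>+z. (\<integral>\<^sup>+x. norm (?F x z) \<partial>lborel) \<partial>lborel) \<le> (\<integral>\<^sup>+z. ennreal (C * (min (norm z powr \<alpha>) 1 * kern s z)) \<partial>(lborel :: 'a measure))"
    proof (intro nn_integral_mono)
      fix z :: 'a
      have "(\<integral>\<^sup>+x. norm (?F x z) \<partial>lborel) = (\<integral>\<^sup>+x. ennreal (kern s z) * ennreal (\<bar>sdiff f z x\<bar> * norm (\<phi> x)) \<partial>lborel)"
        by (intro nn_integral_cong) (simp add: ennreal_mult[symmetric] abs_mult mult_ac)
      also have "\<dots> = ennreal (kern s z) * (\<integral>\<^sup>+x. ennreal (\<bar>sdiff f z x\<bar> * norm (\<phi> x)) \<partial>lborel)"
        unfolding sdiff_def by (rule nn_integral_cmult) measurable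
      also have "\<dots> \<le> ennreal (kern s z) * ennreal (C * min (norm z powr \<alpha>) 1)"
        by (intro mult_left_mono bd) simp
      also have "\<dots> = ennreal (C * (min (norm z powr \<alpha>) 1 * kern s z))"
        using C by (simp add: ennreal_mult[symmetric] mult_ac)
      finally show "(\<integral>\<^sup>+x. norm (?F x z) \<partial>lborel) \<le> ennreal (C * (min (norm z powr \<alpha>) 1 * kern s z))" .
    qed
    also have "\<dots> = ennreal (\<integral>z. C * (min (norm z powr \<alpha>) 1 * kern s z) \<partial>(lborel :: 'a measure))"
      using C by (intro nn_integral_eq_integral integrable_mult_right integrable_min_kern s \<alpha>) auto
    also have "\<dots> < \<infinity>" by simp
    finally show ?thesis .
  qed
  have I: "integrable (lborel \<Otimes>\<^sub>M lborel) (case_prod ?F)"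
  proof (rule integrableI_bounded[OF m])
    have "(\<integral>\<^sup>+p. ennreal (norm (case_prod ?F p)) \<partial>(lborel \<Otimes>\<^sub>M lborel)) = (\<integral>\<^sup>+z. (\<integral>\<^sup>+x. norm (?F x z) \<partial>lborel) \<partial>lborel)"
      using lborel_pair.nn_integral_snd[of "\<lambda>p. ennreal (norm (case_prod ?F p))"] m by simp
    then show "(\<integral>\<^sup>+p. ennreal (norm (case_prod ?F p)) \<partial>(lborel \<Otimes>\<^sub>M lborel)) < \<infinity>" using fin by simp
  qed
  have inner: "(\<integral>z. ?F x z \<partial>lborel) = 2 *\<^sub>R (slap s f x *\<^sub>R \<phi> x)" for x
    using integral_scaleR_left[of "\<phi> x" lborel "\<lambda>z. sdiff f z x * kern s z"] int[of x] by (simp add: slap_def)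
  have "integrable lborel (\<lambda>x. \<integral>z. ?F x z \<partial>lborel)"
    using lborel_pair.integrable_fst[OF I] by simp
  then have "integrable lborel (\<lambda>x. (1/2) *\<^sub>R (2 *\<^sub>R (slap s f x *\<^sub>R \<phi> x)))"
    unfolding inner by (rule integrable_scaleR_right)
  then show "integrable lborel (\<lambda>x. slap s f x *\<^sub>R \<phi> x)" by simp
  have outer: "(\<integral>x. ?F x z \<partial>lborel) = kern s z *\<^sub>R (\<integral>x. sdiff f z x *\<^sub>R \<phi> x \<partial>lborel)" for z
    by (subst integral_scaleR_right[symmetric]) (simp add: mult.commute)
  show "integrable lborel (\<lambda>z. kern s z *\<^sub>R (\<integral>x. sdiff f z x *\<^sub>R \<phi> x \<partial>lborel))"
    using lborel_pair.integrable_snd[OF I] by (simp add: outer)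
  have "(\<integral>z. (\<integral>x. ?F x z \<partial>lborel) \<partial>lborel) = (\<integral>x. (\<integral>z. ?F x z \<partial>lborel) \<partial>lborel)"
    using lborel_pair.Fubini_integral[OF I] .
  then have "(\<integral>z. kern s z *\<^sub>R (\<integral>x. sdiff f z x *\<^sub>R \<phi> x \<partial>lborel) \<partial>lborel) = (\<integral>x. 2 *\<^sub>R (slap s f x *\<^sub>R \<phi> x) \<partial>lborel)"
    by (simp only: inner outer)
  also have "\<dots> = 2 *\<^sub>R (\<integral>x. slap s f x *\<^sub>R \<phi> x \<partial>lborel)"
    by (rule integral_scaleR_right)
  finally show "(\<integral>x. slap s f x *\<^sub>R \<phi> x \<partial>lborel) = (1/2) *\<^sub>R (\<integral>z. kern s z *\<^sub>R (\<integral>x. sdiff f z x *\<^sub>R \<phi> x \<partial>lborel) \<partial>lborel)"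
    by simp
qed

lemma frechet_derivative_eq_sum:
  fixes f :: "'a::euclidean_space \<Rightarrow> real"
  assumes "f differentiable (at y)"
  shows "frechet_derivative f (at y) h = (\<Sum>b\<in>Basis. (h \<bullet> b) * iter_pderiv [b] f y)"
proof -
  have "linear (frechet_derivative f (at y))"
    using assms by (rule linear_frechet_derivative)
  then have "frechet_derivative f (at y) (\<Sum>b\<in>Basis. (h \<bullet> b) *\<^sub>R b) = (\<Sum>b\<in>Basis. (h \<bullet> b) * frechet_derivative f (at y) b)"
    by (simp add: linear_sum linear_cmul)
  then show ?thesis by (simp add: euclidean_representation)
qed

lemma sdiff_bound_C2:
  fixes f :: "'a::euclidean_space \<Rightarrow> real"
  assumes d1: "\<And>y. y \<in> cball x r \<Longrightarrow> f differentiable (at y)"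
    and d2: "\<And>y b. y \<in> cball x r \<Longrightarrow> b \<in> Basis \<Longrightarrow> iter_pderiv [b] f differentiable (at y)"
    and A: "\<And>y b c. y \<in> cball x r \<Longrightarrow> b \<in> Basis \<Longrightarrow> c \<in> Basis \<Longrightarrow> \<bar>iter_pderiv [c, b] f y\<bar> \<le> A"
    and z: "norm z \<le> r"
  shows "\<bar>sdiff f z x\<bar> \<le> 2 * (real DIM('a) ^ 2 * A) * norm z powr 2"
proof -
  have A0: "A \<ge> 0"
  proof -
    obtain b :: 'a where "b \<in> Basis" using nonempty_Basis by blast
    then show ?thesis using A[of x b b] z by (smt (verit) abs_ge_zero centre_in_cball norm_ge_zero)
  qed
  have lip: "\<bar>iter_pderiv [b] f y - iter_pderiv [b] f x\<bar> \<le> (real DIM('a) * A) * norm (y - x)"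
    if y: "y \<in> cball x r" and b: "b \<in> Basis" for y b
  proof -
    have "norm (iter_pderiv [b] f y - iter_pderiv [b] f x) \<le> (real DIM('a) * A) * norm (y - x)"
    proof (rule differentiable_bound[of "cball x r"])
      fix w assume w: "w \<in> cball x r"
      show "(iter_pderiv [b] f has_derivative frechet_derivative (iter_pderiv [b] f) (at w)) (at w within cball x r)"
        by (rule has_derivative_at_withinI[OF frechet_derivative_works[THEN iffD1, OF d2[OF w b]]])
      show "onorm (frechet_derivative (iter_pderiv [b] f) (at w)) \<le> real DIM('a) * A"
      proof (rule onorm_bound)
        show "0 \<le> real DIM('a) * A" using A0 by simp
        fix h :: 'a
        have "\<bar>frechet_derivative (iter_pderiv [b] f) (at w) h\<bar> = \<bar>\<Sum>c\<in>Basis. (h \<bullet> c) * iter_pderiv [c, b] f w\<bar>"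
          by (subst frechet_derivative_eq_sum[OF d2[OF w b]]) simp
        also have "\<dots> \<le> (\<Sum>c\<in>(Basis::'a set). norm h * A)"
        proof (rule order_trans[OF sum_abs], rule sum_mono)
          fix c :: 'a assume "c \<in> Basis"
          then show "\<bar>(h \<bullet> c) * iter_pderiv [c, b] f w\<bar> \<le> norm h * A"
            unfolding abs_mult by (intro mult_mono Basis_le_norm A w b) auto
        qed
        finally show "norm (frechet_derivative (iter_pderiv [b] f) (at w) h) \<le> real DIM('a) * A * norm h"
          by (simp add: mult_ac)
      qed
    qed (use y z in \<open>auto intro: order_trans[OF norm_ge_zero]\<close>)
    then show ?thesis by simp
  qed
  have "\<bar>sdiff f z x\<bar> \<le> 2 * (real DIM('a) ^ 2 * A) * norm z powr (1 + 1)"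
  proof (rule sdiff_bound_of_derivative(2)[where f' = "\<lambda>y. frechet_derivative f (at y)"])
    fix y assume "y \<in> cball x (norm z)"
    then have y: "y \<in> cball x r" using z by auto
    have x: "x \<in> cball x r" using z norm_ge_zero[of z] by (simp del: norm_ge_zero)
    show "(f has_derivative frechet_derivative f (at y)) (at y)"
      by (rule frechet_derivative_works[THEN iffD1, OF d1[OF y]])
    fix h :: 'a
    have "\<bar>frechet_derivative f (at y) h - frechet_derivative f (at x) h\<bar>
        = \<bar>\<Sum>b\<in>Basis. (h \<bullet> b) * (iter_pderiv [b] f y - iter_pderiv [b] f x)\<bar>"
      by (simp only: frechet_derivative_eq_sum[OF d1[OF y]] frechet_derivative_eq_sum[OF d1[OF x]] sum_subtractf[symmetric] right_diff_distrib)
    also have "\<dots> \<le> (\<Sum>b\<in>(Basis::'a set). norm h * ((real DIM('a) * A) * norm (y - x)))"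
    proof (rule order_trans[OF sum_abs], rule sum_mono)
      fix b :: 'a assume "b \<in> Basis"
      then show "\<bar>(h \<bullet> b) * (iter_pderiv [b] f y - iter_pderiv [b] f x)\<bar> \<le> norm h * ((real DIM('a) * A) * norm (y - x))"
        unfolding abs_mult by (intro mult_mono Basis_le_norm lip y) auto
    qed
    also have "\<dots> = real DIM('a) ^ 2 * A * norm (y - x) powr 1 * norm h"
      by (simp add: power2_eq_square)
    finally show "\<bar>frechet_derivative f (at y) h - frechet_derivative f (at x) h\<bar> \<le> real DIM('a) ^ 2 * A * norm (y - x) powr 1 * norm h" .
  qed simp
  then show ?thesis by simp
qed

lemma schwartz_bounds:
  fixes f :: "'a::euclidean_space \<Rightarrow> real"
  assumes f: "schwartz f" and bs: "set bs \<subseteq> Basis"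
  obtains A where "A \<ge> 0" "\<And>x. \<bar>iter_pderiv bs f x\<bar> \<le> A / (1 + norm x ^ m)"
proof -
  have "bounded (range (\<lambda>x. norm x ^ k * iter_pderiv bs f x))" for k
    using f bs unfolding schwartz_def by blast
  then have ex: "\<exists>B. \<forall>x. \<bar>norm x ^ k * iter_pderiv bs f x\<bar> \<le> B" for k
    unfolding bounded_iff by auto
  obtain B0 where B0: "\<And>x. \<bar>iter_pderiv bs f x\<bar> \<le> B0" using ex[of 0] by auto
  obtain B where B: "\<And>x. \<bar>norm x ^ m * iter_pderiv bs f x\<bar> \<le> B" using ex[of m] by blast
  show ?thesis
  proof
    show "B0 + B \<ge> 0" using B0[of 0] B[of 0] by (smt (verit) abs_ge_zero)
    fix x :: 'a
    have "\<bar>iter_pderiv bs f x\<bar> * (1 + norm x ^ m) \<le> B0 + B"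
      using B0[of x] B[of x] by (simp add: abs_mult algebra_simps)
    then show "\<bar>iter_pderiv bs f x\<bar> \<le> (B0 + B) / (1 + norm x ^ m)"
      by (simp add: pos_le_divide_eq add_pos_nonneg)
  qed
qed

lemma integrable_weight:
  "integrable lborel (\<lambda>x :: 'a::euclidean_space. 1 / (1 + norm x ^ (DIM('a) + 1)))"
proof (rule Bochner_Integration.integrable_bound)
  have [measurable]: "ball (0::'a) 1 \<in> sets borel" by (simp add: borel_open)
  show "integrable lborel (\<lambda>x::'a. indicator (ball 0 1) x + kern (1/2) x * indicator (- ball 0 1) x)"
    by (intro Bochner_Integration.integrable_add integrable_kern_far integrable_real_indicator)
      (use emeasure_bounded_finite[of "ball (0::'a) 1"] in auto)
  show "(\<lambda>x::'a. 1 / (1 + norm x ^ (DIM('a) + 1))) \<in> borel_measurable lborel" by measurable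
  show "AE x::'a in lborel. norm (1 / (1 + norm x ^ (DIM('a) + 1))) \<le> norm (indicator (ball 0 1) x + kern (1/2) x * indicator (- ball 0 1) x)"
  proof (rule AE_I2)
    fix x :: 'a
    show "norm (1 / (1 + norm x ^ (DIM('a) + 1))) \<le> norm (indicator (ball 0 1) x + kern (1/2) x * indicator (- ball 0 1) x)"
    proof (cases "norm x < 1")
      case False
      have x: "norm x > 0" using False by linarith
      have "kern (1/2) x = norm x powr (- real (DIM('a) + 1))" by (simp add: kern_def algebra_simps)
      also have "\<dots> = 1 / norm x ^ (DIM('a) + 1)"
        unfolding powr_minus powr_realpow[OF x] by (rule inverse_eq_divide)
      finally have "kern (1/2) x = 1 / norm x ^ (DIM('a) + 1)" .
      moreover have "1 / (1 + norm x ^ (DIM('a) + 1)) \<le> 1 / norm x ^ (DIM('a) + 1)"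
        using False by (intro divide_left_mono mult_pos_pos zero_less_power add_pos_pos) auto
      ultimately show ?thesis using False by simp
    qed (simp add: divide_le_eq add_pos_nonneg)
  qed
qed

lemma weight_shift:
  fixes x y :: "'a::real_normed_vector"
  assumes "norm (y - x) \<le> 1"
  shows "1 / (1 + norm y ^ m) \<le> (1 + 2 ^ m) / (1 + norm x ^ m)"
proof -
  have "norm x \<le> norm y + 1" using norm_triangle_ineq2[of x y] assms by (simp add: norm_minus_commute)
  also have "\<dots> \<le> 2 * max (norm y) 1" by simp
  finally have "norm x ^ m \<le> (2 * max (norm y) 1) ^ m" by (intro power_mono) auto
  also have "\<dots> = 2 ^ m * max (norm y) 1 ^ m" by (simp add: power_mult_distrib)
  also have "max (norm y) 1 ^ m \<le> norm y ^ m + 1" by (simp add: max_def)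
  finally have "norm x ^ m \<le> 2 ^ m * (norm y ^ m + 1)" by simp
  moreover have "(1 + 2 ^ m) * (1 + norm y ^ m) = 1 + norm y ^ m + 2 ^ m * (norm y ^ m + 1)"
    by (simp add: algebra_simps)
  moreover have "0 \<le> norm y ^ m" by simp
  ultimately have "1 + norm x ^ m \<le> (1 + 2 ^ m) * (1 + norm y ^ m)" by linarith
  then show ?thesis
    by (simp add: divide_le_eq pos_le_divide_eq add_pos_nonneg)
qed


lemma schwartz_facts:
  fixes f :: "'a::euclidean_space \<Rightarrow> real"
  assumes f: "schwartz f"
  shows "continuous_on UNIV f" "f \<in> borel_measurable borel" "integrable lborel f"
proof -
  have "f differentiable (at x)" for x
    using f unfolding schwartz_def by (metis empty_set empty_subsetI iter_pderiv.simps(1))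
  then show c: "continuous_on UNIV f"
    by (simp add: continuous_at_imp_continuous_on differentiable_imp_continuous_within)
  then show m: "f \<in> borel_measurable borel" by (rule borel_measurable_continuous_onI)
  obtain A where A: "A \<ge> 0" "\<And>x. \<bar>iter_pderiv [] f x\<bar> \<le> A / (1 + norm x ^ (DIM('a) + 1))"
    by (rule schwartz_bounds[OF f, of "[]" "DIM('a) + 1"]) auto
  show "integrable lborel f"
  proof (rule Bochner_Integration.integrable_bound[OF integrable_mult_right[OF integrable_weight, of A]])
    show "AE x in lborel. norm (f x) \<le> norm (A * (1 / (1 + norm x ^ (DIM('a) + 1))))"
      using A by (intro AE_I2) (simp add: add_nonneg_nonneg)
  qed (use m in simp)
qed

lemma schwartz_sdiff:
  fixes f :: "'a::euclidean_space \<Rightarrow> real"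
  assumes f: "schwartz f"
  obtains A where "A \<ge> 0"
    "\<And>x z. norm z \<le> 1 \<Longrightarrow> \<bar>sdiff f z x\<bar> \<le> A * norm z powr 2 / (1 + norm x ^ (DIM('a) + 1))"
proof -
  let ?m = "DIM('a) + 1"
  have d: "iter_pderiv bs f differentiable (at x)" if "set bs \<subseteq> Basis" for bs x
    using f that unfolding schwartz_def by blast
  have ex: "\<exists>A\<ge>0. \<forall>x. \<bar>iter_pderiv bs f x\<bar> \<le> A / (1 + norm x ^ ?m)" if "set bs \<subseteq> Basis" for bs
  proof (rule schwartz_bounds[OF f that, of ?m])
    fix A assume "A \<ge> 0" "\<And>x. \<bar>iter_pderiv bs f x\<bar> \<le> A / (1 + norm x ^ ?m)"
    then show ?thesis by (intro exI[of _ A] conjI allI)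
  qed
  define Q where "Q bs = (SOME A. A \<ge> 0 \<and> (\<forall>x. \<bar>iter_pderiv bs f x\<bar> \<le> A / (1 + norm x ^ ?m)))" for bs
  have Q: "Q bs \<ge> 0 \<and> (\<forall>x. \<bar>iter_pderiv bs f x\<bar> \<le> Q bs / (1 + norm x ^ ?m))" if "set bs \<subseteq> Basis" for bs
    unfolding Q_def by (rule someI_ex) (use ex[OF that] in blast)
  define S where "S = (\<Sum>b\<in>Basis. \<Sum>c\<in>Basis. Q [c, b])"
  have QS: "Q [c, b] \<le> S" if "b \<in> Basis" "c \<in> Basis" for b c
  proof -
    have "Q [c, b] \<le> (\<Sum>c\<in>Basis. Q [c, b])"
      using that Q by (intro member_le_sum) auto
    also have "\<dots> \<le> S" unfolding S_def
      using that Q by (intro member_le_sum[of b Basis "\<lambda>b. \<Sum>c\<in>Basis. Q [c, b]"] sum_nonneg) auto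
    finally show ?thesis .
  qed
  have S0: "S \<ge> 0" unfolding S_def using Q by (intro sum_nonneg) auto
  define A where "A = 2 * (real DIM('a) ^ 2 * (S * (1 + 2 ^ ?m)))"
  show ?thesis
  proof
    show "A \<ge> 0" using S0 by (simp add: A_def)
    fix x z :: 'a assume z: "norm z \<le> 1"
    have "\<bar>sdiff f z x\<bar> \<le> 2 * (real DIM('a) ^ 2 * (S * ((1 + 2 ^ ?m) / (1 + norm x ^ ?m)))) * norm z powr 2"
    proof (rule sdiff_bound_C2[OF _ _ _ z])
      fix y :: 'a assume "y \<in> cball x 1"
      then have y: "norm (y - x) \<le> 1" by (simp add: dist_norm norm_minus_commute)
      show "f differentiable (at y)" using d[of "[]" y] by simp
      fix b :: 'a assume b: "b \<in> Basis"
      show "iter_pderiv [b] f differentiable (at y)" using d[of "[b]" y] b by simp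
      fix c :: 'a assume c: "c \<in> Basis"
      have "\<bar>iter_pderiv [c, b] f y\<bar> \<le> Q [c, b] / (1 + norm y ^ ?m)"
        using Q[of "[c, b]"] b c by (simp del: iter_pderiv.simps)
      also have "\<dots> \<le> S * (1 / (1 + norm y ^ ?m))"
        using QS[OF b c] by (simp add: divide_right_mono add_nonneg_nonneg)
      also have "\<dots> \<le> S * ((1 + 2 ^ ?m) / (1 + norm x ^ ?m))"
        by (intro mult_left_mono weight_shift y S0)
      finally show "\<bar>iter_pderiv [c, b] f y\<bar> \<le> S * ((1 + 2 ^ ?m) / (1 + norm x ^ ?m))" .
    qed
    then show "\<bar>sdiff f z x\<bar> \<le> A * norm z powr 2 / (1 + norm x ^ ?m)"
      by (simp add: A_def mult_ac)
  qed
qed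

lemma schwartz_sdiff_L1:
  fixes f :: "'a::euclidean_space \<Rightarrow> real"
  assumes f: "schwartz f"
  obtains C where "C \<ge> 0" "\<And>z. (\<integral>\<^sup>+x. ennreal \<bar>sdiff f z x\<bar> \<partial>lborel) \<le> ennreal (C * min (norm z powr 2) 1)"
proof -
  let ?w = "\<lambda>x::'a. 1 / (1 + norm x ^ (DIM('a) + 1))"
  obtain A where A: "A \<ge> 0" "\<And>x z. norm z \<le> 1 \<Longrightarrow> \<bar>sdiff f z x\<bar> \<le> A * norm z powr 2 / (1 + norm x ^ (DIM('a) + 1))"
    by (rule schwartz_sdiff[OF f], rule that, assumption+)
  note [measurable] = schwartz_facts(2)[OF f]
  define W I where "W = (\<integral>x. ?w x \<partial>lborel)" and "I = (\<integral>x. \<bar>f x\<bar> \<partial>lborel)"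
  have W0: "W \<ge> 0" "I \<ge> 0" unfolding W_def I_def by (auto intro!: integral_nonneg_AE AE_I2 simp: add_nonneg_nonneg)
  have "(\<integral>\<^sup>+x. ?w x \<partial>lborel) = ennreal W"
    unfolding W_def by (intro nn_integral_eq_integral integrable_weight) (auto simp: add_nonneg_nonneg)
  have fI: "(\<integral>\<^sup>+x. \<bar>f x\<bar> \<partial>lborel) = ennreal I"
    unfolding I_def by (intro nn_integral_eq_integral integrable_abs schwartz_facts(3) f) auto
  show ?thesis
  proof (rule that[of "A * W + 4 * I"])
    show "A * W + 4 * I \<ge> 0" using A W0 by simp
    fix z :: 'a
    show "(\<integral>\<^sup>+x. ennreal \<bar>sdiff f z x\<bar> \<partial>lborel) \<le> ennreal ((A * W + 4 * I) * min (norm z powr 2) 1)"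
    proof (cases "norm z \<le> 1")
      case True
      have "(\<integral>\<^sup>+x. ennreal \<bar>sdiff f z x\<bar> \<partial>lborel) \<le> (\<integral>\<^sup>+x. ennreal ((A * norm z powr 2) * ?w x) \<partial>lborel)"
        using A True by (intro nn_integral_mono ennreal_leI) auto
      also have "\<dots> = ennreal (\<integral>x. (A * norm z powr 2) * ?w x \<partial>lborel)"
        using A by (intro nn_integral_eq_integral integrable_mult_right integrable_weight) (auto simp: add_nonneg_nonneg)
      also have "(\<integral>x. (A * norm z powr 2) * ?w x \<partial>lborel) = A * norm z powr 2 * W"
        unfolding W_def by (rule integral_mult_right_zero)
      also have "\<dots> \<le> (A * W + 4 * I) * min (norm z powr 2) 1"
      proof -
        have "norm z powr 2 \<le> 1" using True by (simp add: power_le_one)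
        then have "min (norm z powr 2) 1 = norm z powr 2" by simp
        moreover have "0 \<le> I * norm z powr 2" using W0 by simp
        ultimately show ?thesis by (simp only:) (simp add: algebra_simps)
      qed
      finally show ?thesis by (simp add: ennreal_leI)
    next
      case False
      have "(\<integral>\<^sup>+x. ennreal \<bar>sdiff f z x\<bar> \<partial>lborel)
          \<le> (\<integral>\<^sup>+x. 2 * ennreal \<bar>f x\<bar> + (ennreal \<bar>f (z + x)\<bar> + ennreal \<bar>f (- z + x)\<bar>) \<partial>lborel)"
      proof (intro nn_integral_mono)
        fix x
        have "\<bar>sdiff f z x\<bar> \<le> 2 * \<bar>f x\<bar> + (\<bar>f (z + x)\<bar> + \<bar>f (- z + x)\<bar>)"
          unfolding sdiff_def by (simp add: add.commute)
        then show "ennreal \<bar>sdiff f z x\<bar> \<le> 2 * ennreal \<bar>f x\<bar> + (ennreal \<bar>f (z + x)\<bar> + ennreal \<bar>f (- z + x)\<bar>)"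
          by (simp add: ennreal_mult'[symmetric] ennreal_plus[symmetric] ennreal_leI flip: ennreal_numeral del: ennreal_plus)
      qed
      also have "\<dots> = 2 * ennreal I + (ennreal I + ennreal I)"
        using nn_integral_translate[of "\<lambda>x. ennreal \<bar>f x\<bar>" z] nn_integral_translate[of "\<lambda>x. ennreal \<bar>f x\<bar>" "- z"]
        by (simp add: nn_integral_add nn_integral_cmult fI)
      also have "\<dots> = ennreal (4 * I)"
        using W0 by (simp add: ennreal_mult'[symmetric] ennreal_plus[symmetric] flip: ennreal_numeral del: ennreal_plus)
      also have "\<dots> \<le> ennreal ((A * W + 4 * I) * min (norm z powr 2) 1)"
      proof -
        have "norm z powr 2 \<ge> 1" using False by (intro ge_one_powr_ge_zero) auto
        then show ?thesis using A W0 by (auto simp: min_def intro!: ennreal_leI)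
      qed
      finally show ?thesis .
    qed
  qed
qed

lemma AE_lborel_open_witness:
  fixes S :: "'a::euclidean_space set"
  assumes ae: "AE x in lborel. P x" and S: "open S" "S \<noteq> {}"
  obtains x where "x \<in> S" "P x"
proof (rule ccontr)
  assume "\<not> thesis"
  then have "\<not> P x" if "x \<in> S" for x using that \<open>\<And>x. x \<in> S \<Longrightarrow> P x \<Longrightarrow> thesis\<close> by blast
  then have "AE x in lborel. x \<notin> S" using ae by (auto elim!: eventually_mono)
  then have "S \<in> null_sets lborel" using S(1) by (subst (asm) AE_iff_null_sets[symmetric]) (auto simp: borel_open)
  then have "negligible S" by (simp add: negligible_iff_null_sets null_sets_completionI)
  then show False using open_not_negligible S by blast
qed

lemma integral_pos_open:
  fixes f :: "'a::euclidean_space \<Rightarrow> real"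
  assumes int: "integrable lborel f" and nn: "AE x in lborel. f x \<ge> 0"
    and S: "open S" "S \<noteq> {}" and pos: "\<And>x. x \<in> S \<Longrightarrow> f x > 0"
  shows "(\<integral>x. f x \<partial>lborel) > 0"
proof -
  have "(\<integral>x. f x \<partial>lborel) \<noteq> 0"
  proof
    assume "(\<integral>x. f x \<partial>lborel) = 0"
    then have "AE x in lborel. f x = 0" using integral_nonneg_eq_0_iff_AE[OF int nn] by simp
    then obtain x where "x \<in> S" "f x = 0" by (rule AE_lborel_open_witness[OF _ S])
    then show False using pos by fastforce
  qed
  moreover have "(\<integral>x. f x \<partial>lborel) \<ge> 0" using nn by (rule integral_nonneg_AE)
  ultimately show ?thesis by simp
qed

lemma integrable_weight_powr:
  assumes "s > 0"
  shows "integrable lborel (\<lambda>x :: 'a::euclidean_space. 1 / (1 + norm x powr (real DIM('a) + 2 * s)))"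
proof (rule Bochner_Integration.integrable_bound)
  have [measurable]: "ball (0::'a) 1 \<in> sets borel" by (simp add: borel_open)
  show "integrable lborel (\<lambda>x::'a. indicator (ball 0 1) x + kern s x * indicator (- ball 0 1) x)"
    by (intro Bochner_Integration.integrable_add integrable_kern_far integrable_real_indicator assms)
      (use emeasure_bounded_finite[of "ball (0::'a) 1"] in auto)
  show "(\<lambda>x::'a. 1 / (1 + norm x powr (real DIM('a) + 2 * s))) \<in> borel_measurable lborel" by measurable
  show "AE x::'a in lborel. norm (1 / (1 + norm x powr (real DIM('a) + 2 * s))) \<le> norm (indicator (ball 0 1) x + kern s x * indicator (- ball 0 1) x)"
  proof (rule AE_I2)
    fix x :: 'a
    show "norm (1 / (1 + norm x powr (real DIM('a) + 2 * s))) \<le> norm (indicator (ball 0 1) x + kern s x * indicator (- ball 0 1) x)"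
    proof (cases "norm x < 1")
      case False
      then have x: "norm x > 0" by linarith
      have "kern s x = 1 / norm x powr (real DIM('a) + 2 * s)"
        unfolding kern_def powr_minus by (rule inverse_eq_divide)
      moreover have "1 / (1 + norm x powr (real DIM('a) + 2 * s)) \<le> 1 / norm x powr (real DIM('a) + 2 * s)"
        using x by (intro divide_left_mono mult_pos_pos add_pos_pos) auto
      ultimately show ?thesis using False by (simp add: add_nonneg_nonneg)
    qed (simp add: divide_le_eq add_pos_nonneg)
  qed
qed

lemma weighted_bounded:
  fixes u :: "'a::euclidean_space \<Rightarrow> real"
  assumes s: "s > 0" and m: "u \<in> borel_measurable borel" and B: "\<And>x. \<bar>u x\<bar> \<le> B"
  shows "weighted s u"
  unfolding weighted_def
proof
  show "integrable lborel (\<lambda>x. \<bar>u x\<bar> / (1 + norm x powr (real DIM('a) + 2 * s)))"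
  proof (rule Bochner_Integration.integrable_bound[OF integrable_mult_right[OF integrable_weight_powr[OF s], of B]])
    show "AE x in lborel. norm (\<bar>u x\<bar> / (1 + norm x powr (real DIM('a) + 2 * s))) \<le> norm (B * (1 / (1 + norm x powr (real DIM('a) + 2 * s))))"
    proof (rule AE_I2)
      fix x :: 'a
      have "0 \<le> B" using B[of x] by linarith
      then show "norm (\<bar>u x\<bar> / (1 + norm x powr (real DIM('a) + 2 * s))) \<le> norm (B * (1 / (1 + norm x powr (real DIM('a) + 2 * s))))"
        using B[of x] by (simp add: divide_right_mono)
    qed
  qed (use m in measurable)
qed (rule m)

lemma one_minus_cos_le: "2 - 2 * cos t \<le> (t::real)\<^sup>2"
proof -
  have "2 - 2 * cos t = 4 * (sin (t / 2))\<^sup>2"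
    using cos_double_sin[of "t / 2"] by simp
  also have "\<dots> \<le> 4 * (t / 2)\<^sup>2"
    using abs_sin_x_le_abs_x[of "t / 2"] by (simp add: abs_le_square_iff[symmetric])
  finally show ?thesis by (simp add: power2_eq_square)
qed

definition symbol :: "real \<Rightarrow> 'a::euclidean_space \<Rightarrow> real" where
  "symbol s \<xi> = slap s (\<lambda>x. cos (x \<bullet> \<xi>)) 0"

lemma sdiff_cos: "sdiff (\<lambda>x. cos (x \<bullet> \<xi>)) z 0 = 2 - 2 * cos (z \<bullet> \<xi>)"
  by (simp add: sdiff_def)

lemma symbol_integrable:
  fixes \<xi> :: "'a::euclidean_space"
  assumes s: "0 < s" "s < 1"
  shows "integrable lborel (\<lambda>z. (2 - 2 * cos (z \<bullet> \<xi>)) * kern s z)"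
proof -
  have "weighted s (\<lambda>x. cos (x \<bullet> \<xi>))" by (rule weighted_bounded[OF s(1), of _ 1]) auto
  then have "integrable lborel (\<lambda>z. sdiff (\<lambda>x. cos (x \<bullet> \<xi>)) z 0 * kern s z)"
  proof (rule sdiff_kern_integrable[where \<alpha> = 2 and \<delta> = 1 and M = "(norm \<xi>)\<^sup>2"])
    fix z :: 'a
    have "2 - 2 * cos (z \<bullet> \<xi>) \<le> (z \<bullet> \<xi>)\<^sup>2" by (rule one_minus_cos_le)
    also have "\<dots> \<le> (norm z * norm \<xi>)\<^sup>2"
      by (metis Cauchy_Schwarz_ineq2 abs_ge_zero power2_abs power_mono)
    finally show "\<bar>sdiff (\<lambda>x. cos (x \<bullet> \<xi>)) z 0\<bar> \<le> (norm \<xi>)\<^sup>2 * norm z powr 2"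
      by (simp add: sdiff_cos power_mult_distrib mult.commute)
  qed (use s in auto)
  then show ?thesis by (simp add: sdiff_cos)
qed

lemma symbol_scale: "c > 0 \<Longrightarrow> symbol s (c *\<^sub>R \<xi>) = c powr (2 * s) * symbol s \<xi>"
  using slap_scale[of "\<lambda>x. cos (x \<bullet> \<xi>)" c s 0] by (simp add: symbol_def)

lemma symbol_refl: "symbol s (refl n \<xi>) = symbol s \<xi>"
proof -
  have "refl n x \<bullet> \<xi> = x \<bullet> refl n \<xi>" for x
    using inner_refl[of n x "refl n \<xi>"] by simp
  then show ?thesis
    using slap_refl[of "\<lambda>x. cos (x \<bullet> \<xi>)" s n 0] by (simp add: symbol_def linear_0[OF linear_refl])
qed

lemma symbol_eq:
  fixes \<xi> e :: "'a::euclidean_space"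
  assumes e: "norm e = 1"
  shows "symbol s \<xi> = norm \<xi> powr (2 * s) * symbol s e"
proof (cases "\<xi> = 0")
  case False
  define \<eta> where "\<eta> = (1 / norm \<xi>) *\<^sub>R \<xi>"
  have "refl (\<eta> - e) \<eta> = e" using False e by (intro refl_swap) (simp add: \<eta>_def)
  then have "symbol s \<eta> = symbol s e" using symbol_refl[of s "\<eta> - e" \<eta>] by simp
  moreover have "\<xi> = norm \<xi> *\<^sub>R \<eta>" using False by (simp add: \<eta>_def)
  ultimately show ?thesis using False symbol_scale[of "norm \<xi>" s \<eta>] by simp
qed (simp add: symbol_def slap_def sdiff_def)

lemma symbol_pos:
  fixes e :: "'a::euclidean_space"
  assumes s: "0 < s" "s < 1" and e: "norm e = 1"
  shows "symbol s e > 0"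
proof -
  have "(\<integral>z. (2 - 2 * cos (z \<bullet> e)) * kern s z \<partial>lborel) > 0"
  proof (rule integral_pos_open[OF symbol_integrable[OF s]])
    show "AE z in lborel. 0 \<le> (2 - 2 * cos (z \<bullet> e)) * kern s z" by simp
    show "open {z. 0 < z \<bullet> e \<and> z \<bullet> e < 1}"
      by (intro open_Collect_conj open_Collect_less continuous_intros)
    have "(1/2) *\<^sub>R e \<in> {z. 0 < z \<bullet> e \<and> z \<bullet> e < 1}" using e by (simp add: dot_square_norm)
    then show "{z. 0 < z \<bullet> e \<and> z \<bullet> e < 1} \<noteq> {}" by blast
    fix z assume "z \<in> {z. 0 < z \<bullet> e \<and> z \<bullet> e < 1}"
    then have z: "0 < z \<bullet> e" "z \<bullet> e < 1" by auto
    have "cos (z \<bullet> e) < cos 0" using z pi_gt3 by (intro cos_monotone_0_pi) auto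
    moreover have "z \<noteq> 0" using z by auto
    ultimately show "0 < (2 - 2 * cos (z \<bullet> e)) * kern s z" by (simp add: kern_pos)
  qed
  then show ?thesis by (simp add: symbol_def slap_def sdiff_cos)
qed

lemma fourier_slap:
  fixes f :: "'a::euclidean_space \<Rightarrow> real"
  assumes f: "schwartz f" and s: "0 < s" "s < 1"
  shows "fourier (\<lambda>x. c * pv_integral s f x) \<xi> = of_real (c * symbol s \<xi>) * fourier f \<xi>"
proof -
  note [measurable] = schwartz_facts(2)[OF f]
  obtain A where A: "A \<ge> 0"
    "\<And>x z. norm z \<le> 1 \<Longrightarrow> \<bar>sdiff f z x\<bar> \<le> A * norm z powr 2 / (1 + norm x ^ (DIM('a) + 1))"
    by (rule schwartz_sdiff[OF f], rule that, assumption+)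
  obtain C where C: "C \<ge> 0" "\<And>z. (\<integral>\<^sup>+x. ennreal \<bar>sdiff f z x\<bar> \<partial>lborel) \<le> ennreal (C * min (norm z powr 2) 1)"
    by (rule schwartz_sdiff_L1[OF f], rule that, assumption+)
  have w: "weighted s f"
    unfolding weighted_def
  proof
    show "integrable lborel (\<lambda>x. \<bar>f x\<bar> / (1 + norm x powr (real DIM('a) + 2 * s)))"
      by (rule Bochner_Integration.integrable_bound[OF schwartz_facts(3)[OF f]])
        (auto intro!: AE_I2 simp: divide_le_eq add_pos_nonneg algebra_simps)
  qed simp
  have int: "integrable lborel (\<lambda>z. sdiff f z x * kern s z)" for x
  proof (rule sdiff_kern_integrable[OF w s(1), where \<alpha> = 2 and \<delta> = 1 and M = A])
    fix z :: 'a assume "norm z \<le> 1"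
    then have "\<bar>sdiff f z x\<bar> \<le> A * norm z powr 2 / (1 + norm x ^ (DIM('a) + 1))" by (rule A)
    also have "\<dots> \<le> A * norm z powr 2"
      using A(1) by (simp add: divide_le_eq add_pos_nonneg algebra_simps)
    finally show "\<bar>sdiff f z x\<bar> \<le> A * norm z powr 2" .
  qed (use s in auto)
  have pv: "pv_integral s f = slap s f"
    by (rule ext) (rule pv_integral_eq_slap[OF w s(1) int])
  define \<phi> where "\<phi> x = cis (- (x \<bullet> \<xi>))" for x
  have [measurable]: "\<phi> \<in> borel_measurable borel"
    unfolding \<phi>_def by (intro borel_measurable_continuous_onI continuous_intros)
  have n\<phi>: "norm (\<phi> x) = 1" for x by (simp add: \<phi>_def)
  define H where "H = (\<integral>x. f x *\<^sub>R \<phi> x \<partial>lborel)"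
  have fi: "integrable lborel (\<lambda>x. f x *\<^sub>R \<phi> x)"
    by (rule Bochner_Integration.integrable_bound[OF schwartz_facts(3)[OF f]]) (auto simp: n\<phi>)
  have four: "fourier g \<xi> = (\<integral>x. g x *\<^sub>R \<phi> x \<partial>lborel)" if [measurable]: "g \<in> borel_measurable borel" for g
    unfolding fourier_def
    by (subst integral_completion) (auto simp: \<phi>_def[symmetric] scaleR_conv_of_real mult.commute)
  have shift: "integrable lborel (\<lambda>x. f (x + w) *\<^sub>R \<phi> x)" "(\<integral>x. f (x + w) *\<^sub>R \<phi> x \<partial>lborel) = cis (w \<bullet> \<xi>) * H" for w
  proof -
    let ?g = "\<lambda>y. cis (w \<bullet> \<xi>) * (f y *\<^sub>R \<phi> y)"
    have *: "(\<lambda>x. f (x + w) *\<^sub>R \<phi> x) = (\<lambda>x. ?g (w + x))"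
      by (rule ext) (simp add: \<phi>_def add.commute inner_add_left cis_mult)
    have "integrable lborel ?g" using fi by (rule integrable_mult_right)
    then show "integrable lborel (\<lambda>x. f (x + w) *\<^sub>R \<phi> x)"
      unfolding * by (subst integrable_translate_iff) auto
    show "(\<integral>x. f (x + w) *\<^sub>R \<phi> x \<partial>lborel) = cis (w \<bullet> \<xi>) * H"
    proof -
      have "(\<integral>x. ?g (w + x) \<partial>lborel) = (\<integral>x. ?g x \<partial>lborel)" by (rule integral_translate) measurable
      also have "\<dots> = cis (w \<bullet> \<xi>) * H" unfolding H_def by (rule integral_mult_right_zero)
      finally show ?thesis unfolding * .
    qed
  qed
  have inner: "(\<integral>x. sdiff f z x *\<^sub>R \<phi> x \<partial>lborel) = (2 - 2 * cos (z \<bullet> \<xi>)) *\<^sub>R H" for z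
  proof -
    have "(\<integral>x. sdiff f z x *\<^sub>R \<phi> x \<partial>lborel)
        = (\<integral>x. 2 *\<^sub>R (f x *\<^sub>R \<phi> x) - f (x + z) *\<^sub>R \<phi> x - f (x + - z) *\<^sub>R \<phi> x \<partial>lborel)"
      by (intro Bochner_Integration.integral_cong) (auto simp: sdiff_def scaleR_diff_left)
    also have "\<dots> = 2 *\<^sub>R H - cis (z \<bullet> \<xi>) * H - cis (- z \<bullet> \<xi>) * H"
      using fi shift[of z] shift[of "- z"]
      by (simp only: Bochner_Integration.integral_diff Bochner_Integration.integrable_diff integrable_scaleR_right
          integral_scaleR_right H_def)
    also have "\<dots> = (2 - 2 * cos (z \<bullet> \<xi>)) *\<^sub>R H"
      by (simp add: complex_eq_iff cis.ctr algebra_simps)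
    finally show ?thesis .
  qed
  have "fourier (\<lambda>x. c * pv_integral s f x) \<xi> = (\<integral>x. c *\<^sub>R (slap s f x *\<^sub>R \<phi> x) \<partial>lborel)"
    unfolding pv by (subst four) auto
  also have "\<dots> = c *\<^sub>R (\<integral>x. slap s f x *\<^sub>R \<phi> x \<partial>lborel)"
    by (rule integral_scaleR_right)
  also have "(\<integral>x. slap s f x *\<^sub>R \<phi> x \<partial>lborel)
      = (1/2) *\<^sub>R (\<integral>z. kern s z *\<^sub>R (\<integral>x. sdiff f z x *\<^sub>R \<phi> x \<partial>lborel) \<partial>lborel)"
    by (rule slap_fubini(2)[where \<alpha> = 2 and C = C]) (use s C int in \<open>auto simp: n\<phi>\<close>)
  also have "(\<integral>z. kern s z *\<^sub>R (\<integral>x. sdiff f z x *\<^sub>R \<phi> x \<partial>lborel) \<partial>lborel)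
      = (\<integral>z. ((2 - 2 * cos (z \<bullet> \<xi>)) * kern s z) *\<^sub>R H \<partial>lborel)"
    by (intro Bochner_Integration.integral_cong refl) (simp only: inner scaleR_scaleR mult.commute)
  also have "\<dots> = (2 * symbol s \<xi>) *\<^sub>R H"
    by (subst integral_scaleR_left) (use symbol_integrable[OF s] in \<open>auto simp: symbol_def slap_def sdiff_cos\<close>)
  finally show ?thesis
    using four[of f] by (simp add: H_def scaleR_conv_of_real)
qed

text \<open>To pin down the constant it suffices to have one Schwartz function with a nowhere vanishing Fourier integral; the class below is closed under partial derivatives and contains the Gaussian.\<close>

inductive gaussian_type :: "('a::euclidean_space \<Rightarrow> real) \<Rightarrow> bool" where
  gauss: "gaussian_type (\<lambda>x. exp (- (x \<bullet> x)))"
| coord_mult: "gaussian_type f \<Longrightarrow> gaussian_type (\<lambda>x. (x \<bullet> b) * f x)"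
| scale: "gaussian_type f \<Longrightarrow> gaussian_type (\<lambda>x. c * f x)"
| add: "gaussian_type f \<Longrightarrow> gaussian_type g \<Longrightarrow> gaussian_type (\<lambda>x. f x + g x)"

lemma gaussian_type_deriv:
  "gaussian_type f \<Longrightarrow> (\<forall>x. f differentiable (at x)) \<and> (\<forall>b. gaussian_type (\<lambda>x. frechet_derivative f (at x) b))"
proof (induction rule: gaussian_type.induct)
  case gauss
  have d: "((\<lambda>x. exp (- (x \<bullet> x))) has_derivative (\<lambda>h. (- 2) * ((x \<bullet> h) * exp (- (x \<bullet> x))))) (at x)" for x :: 'a
    by (auto intro!: derivative_eq_intros simp: inner_commute fun_eq_iff)
  have "frechet_derivative (\<lambda>x. exp (- (x \<bullet> x))) (at x) b = (- 2) * ((x \<bullet> b) * exp (- (x \<bullet> x)))" for x b :: 'a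
    using frechet_derivative_at[OF d[of x]] by metis
  moreover have "gaussian_type (\<lambda>x. (- 2) * ((x \<bullet> b) * exp (- (x \<bullet> x))))" for b :: 'a
    by (intro gaussian_type.intros)
  ultimately show ?case by (intro conjI allI differentiableI[OF d]) simp
next
  case (coord_mult f c)
  then have f: "(f has_derivative frechet_derivative f (at x)) (at x)" for x
    by (simp add: frechet_derivative_works)
  have d: "((\<lambda>x. (x \<bullet> c) * f x) has_derivative (\<lambda>h. (x \<bullet> c) * frechet_derivative f (at x) h + (h \<bullet> c) * f x)) (at x)" for x
    by (rule has_derivative_mult) (auto intro!: derivative_eq_intros f)
  have "frechet_derivative (\<lambda>x. (x \<bullet> c) * f x) (at x) b = (x \<bullet> c) * frechet_derivative f (at x) b + (b \<bullet> c) * f x" for x b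
    using frechet_derivative_at[OF d[of x]] by metis
  moreover have "gaussian_type (\<lambda>x. (x \<bullet> c) * frechet_derivative f (at x) b + (b \<bullet> c) * f x)" for b
    using coord_mult by (intro gaussian_type.add gaussian_type.coord_mult gaussian_type.scale) auto
  ultimately show ?case by (intro conjI allI differentiableI[OF d]) simp
next
  case (scale f c)
  then have f: "(f has_derivative frechet_derivative f (at x)) (at x)" for x
    by (simp add: frechet_derivative_works)
  have d: "((\<lambda>x. c * f x) has_derivative (\<lambda>h. c * frechet_derivative f (at x) h)) (at x)" for x
    by (rule has_derivative_mult_right) (rule f)
  have "frechet_derivative (\<lambda>x. c * f x) (at x) b = c * frechet_derivative f (at x) b" for x b
    using frechet_derivative_at[OF d[of x]] by metis
  moreover have "gaussian_type (\<lambda>x. c * frechet_derivative f (at x) b)" for b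
    using scale by (intro gaussian_type.scale) auto
  ultimately show ?case by (intro conjI allI differentiableI[OF d]) simp
next
  case (add f g)
  then have f: "(f has_derivative frechet_derivative f (at x)) (at x)"
    and g: "(g has_derivative frechet_derivative g (at x)) (at x)" for x
    by (simp_all add: frechet_derivative_works)
  have d: "((\<lambda>x. f x + g x) has_derivative (\<lambda>h. frechet_derivative f (at x) h + frechet_derivative g (at x) h)) (at x)" for x
    by (rule has_derivative_add[OF f g])
  have "frechet_derivative (\<lambda>x. f x + g x) (at x) b = frechet_derivative f (at x) b + frechet_derivative g (at x) b" for x b
    using frechet_derivative_at[OF d[of x]] by metis
  moreover have "gaussian_type (\<lambda>x. frechet_derivative f (at x) b + frechet_derivative g (at x) b)" for b
    using add by (intro gaussian_type.add) auto
  ultimately show ?case by (intro conjI allI differentiableI[OF d]) simp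
qed

lemma gaussian_type_decay: "gaussian_type f \<Longrightarrow> \<exists>B. \<forall>x. norm x ^ m * \<bar>f x\<bar> \<le> B"
proof (induction arbitrary: m rule: gaussian_type.induct)
  case gauss
  show ?case
  proof (intro exI allI)
    fix x :: 'a
    let ?t = "x \<bullet> x"
    have "(\<Sum>n\<in>{m}. ?t ^ n /\<^sub>R fact n) \<le> exp ?t"
      unfolding exp_def by (rule sum_le_suminf[OF summable_exp_generic]) auto
    then have "?t ^ m \<le> fact m * exp ?t" by (simp add: field_simps)
    then have t: "?t ^ m * exp (- ?t) \<le> fact m" by (simp add: exp_minus field_simps)
    have "norm x ^ m \<le> 1 + ?t ^ m"
    proof (cases "norm x \<le> 1")
      case True
      then have "norm x ^ m \<le> 1" by (simp add: power_le_one)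
      moreover have "0 \<le> ?t ^ m" by simp
      ultimately show ?thesis by linarith
    next
      case False
      then have "norm x ^ m \<le> norm x ^ (2 * m)" by (intro power_increasing) auto
      then show ?thesis by (simp add: dot_square_norm power_mult)
    qed
    then have "norm x ^ m * exp (- ?t) \<le> (1 + ?t ^ m) * exp (- ?t)" by (intro mult_right_mono) auto
    also have "\<dots> \<le> 1 + fact m"
    proof -
      have "exp (- ?t) \<le> 1" by simp
      then show ?thesis using t unfolding distrib_right by linarith
    qed
    finally show "norm x ^ m * \<bar>exp (- (x \<bullet> x))\<bar> \<le> 1 + fact m" by simp
  qed
next
  case (coord_mult f b)
  obtain B where B: "\<forall>x. norm x ^ Suc m * \<bar>f x\<bar> \<le> B" using coord_mult by blast
  have "norm x ^ m * \<bar>(x \<bullet> b) * f x\<bar> \<le> norm b * B" for x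
  proof -
    have "norm x ^ m * \<bar>(x \<bullet> b) * f x\<bar> \<le> norm x ^ m * ((norm x * norm b) * \<bar>f x\<bar>)"
      unfolding abs_mult by (intro mult_left_mono mult_right_mono Cauchy_Schwarz_ineq2) auto
    also have "\<dots> = norm b * (norm x ^ Suc m * \<bar>f x\<bar>)" by simp
    also have "\<dots> \<le> norm b * B" using B by (intro mult_left_mono) auto
    finally show ?thesis .
  qed
  then show ?case by blast
next
  case (scale f c)
  obtain B where B: "\<forall>x. norm x ^ m * \<bar>f x\<bar> \<le> B" using scale by blast
  have "norm x ^ m * \<bar>c * f x\<bar> \<le> \<bar>c\<bar> * B" for x
    using mult_left_mono[OF B[rule_format, of x], of "\<bar>c\<bar>"] by (simp add: abs_mult mult_ac)
  then show ?case by blast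
next
  case (add f g)
  obtain B1 where B1: "\<forall>x. norm x ^ m * \<bar>f x\<bar> \<le> B1" using add by blast
  obtain B2 where B2: "\<forall>x. norm x ^ m * \<bar>g x\<bar> \<le> B2" using add by blast
  have "norm x ^ m * \<bar>f x + g x\<bar> \<le> B1 + B2" for x
  proof -
    have "norm x ^ m * \<bar>f x + g x\<bar> \<le> norm x ^ m * (\<bar>f x\<bar> + \<bar>g x\<bar>)"
      by (intro mult_left_mono) auto
    then show ?thesis using B1[rule_format, of x] B2[rule_format, of x] by (simp add: distrib_left)
  qed
  then show ?case by blast
qed

lemma schwartz_gaussian: "schwartz (\<lambda>x :: 'a::euclidean_space. exp (- (x \<bullet> x)))"
proof -
  have g: "gaussian_type (iter_pderiv bs (\<lambda>x :: 'a. exp (- (x \<bullet> x))))" for bs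
    by (induction bs) (use gaussian_type.gauss gaussian_type_deriv in auto)
  show ?thesis
    unfolding schwartz_def
  proof (intro allI impI conjI)
    fix bs :: "'a list" and x :: 'a and m :: nat
    show "iter_pderiv bs (\<lambda>x. exp (- (x \<bullet> x))) differentiable (at x)"
      using gaussian_type_deriv[OF g] by blast
    obtain B where "\<forall>x. norm x ^ m * \<bar>iter_pderiv bs (\<lambda>x :: 'a. exp (- (x \<bullet> x))) x\<bar> \<le> B"
      using gaussian_type_decay[OF g] by blast
    then show "bounded (range (\<lambda>x. norm x ^ m * iter_pderiv bs (\<lambda>x. exp (- (x \<bullet> x))) x))"
      unfolding bounded_iff by (intro exI[of _ B]) (auto simp: abs_mult)
  qed
qed

lemma gaussian_fourier_nonzero:
  "\<exists>\<xi> :: 'a::euclidean_space. \<xi> \<noteq> 0 \<and> fourier (\<lambda>x :: 'a. exp (- (x \<bullet> x))) \<xi> \<noteq> 0"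
proof (rule ccontr)
  assume "\<not> ?thesis"
  then have z: "fourier (\<lambda>x :: 'a. exp (- (x \<bullet> x))) \<xi> = 0" if "\<xi> \<noteq> 0" for \<xi> using that by blast
  obtain e :: 'a where e: "e \<in> Basis" using nonempty_Basis by blast
  let ?g = "\<lambda>x::'a. exp (- (x \<bullet> x))"
  let ?F = "\<lambda>\<xi> x. cis (- (x \<bullet> \<xi>)) * of_real (?g x)"
  have gi: "integrable lborel ?g" by (rule schwartz_facts(3)[OF schwartz_gaussian])
  define X where "X n = (1 / real (Suc n)) *\<^sub>R e" for n
  have [measurable]: "?F \<xi> \<in> borel_measurable borel" for \<xi>
    by (intro borel_measurable_continuous_onI continuous_intros)
  have "(\<lambda>n. \<integral>x. ?F (X n) x \<partial>lborel) \<longlonglongrightarrow> (\<integral>x. of_real (?g x) \<partial>lborel)"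
  proof (rule integral_dominated_convergence[where w = ?g])
    show "AE x in lborel. (\<lambda>n. ?F (X n) x) \<longlonglongrightarrow> complex_of_real (?g x)"
    proof (rule AE_I2)
      fix x :: 'a
      have "(\<lambda>n. 1 / real (Suc n)) \<longlonglongrightarrow> 0" by (rule LIMSEQ_Suc[OF lim_1_over_n])
      then have "(\<lambda>n. ?F (X n) x) \<longlonglongrightarrow> cis (- (x \<bullet> (0 *\<^sub>R e))) * of_real (?g x)"
        unfolding X_def by (intro tendsto_intros)
      then show "(\<lambda>n. ?F (X n) x) \<longlonglongrightarrow> complex_of_real (?g x)" by simp
    qed
    show "AE x in lborel. norm (?F (X n) x) \<le> ?g x" for n by (simp add: norm_mult)
    show "integrable lborel ?g" by (rule gi)
  qed auto
  moreover have "(\<integral>x. ?F (X n) x \<partial>lborel) = 0" for n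
  proof -
    have "X n \<noteq> 0" using e by (auto simp: X_def)
    from z[OF this] show ?thesis unfolding fourier_def by (subst (asm) integral_completion) auto
  qed
  ultimately have "(\<integral>x. complex_of_real (?g x) \<partial>lborel) = 0"
    using LIMSEQ_unique tendsto_const by fastforce
  then have "(\<integral>x. ?g x \<partial>lborel) = 0" by simp
  moreover have "(\<integral>x. ?g x \<partial>lborel) > 0"
    by (rule integral_pos_open[OF gi, of UNIV]) auto
  ultimately show False by simp
qed

text \<open>Both sides have explicit Fourier multipliers with the same homogeneity and rotation invariance, so a unique positive constant makes them agree.\<close>

lemma frac_laplacian_const_pos:
  assumes s: "0 < s" "s < 1"
  shows "frac_laplacian_const TYPE('a::euclidean_space) s > 0"
proof -
  let ?P = "\<lambda>C. C > 0 \<and> (\<forall>f::'a \<Rightarrow> real. schwartz f \<longrightarrow>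
        (\<forall>\<xi>. fourier (\<lambda>x. C * pv_integral s f x) \<xi> = of_real (norm \<xi> powr (2 * s)) * fourier f \<xi>))"
  obtain e :: 'a where e: "e \<in> Basis" using nonempty_Basis by blast
  then have ne: "norm e = 1" by simp
  let ?K = "symbol s e"
  have K: "?K > 0" by (rule symbol_pos[OF s ne])
  have four: "fourier (\<lambda>x. C * pv_integral s f x) \<xi> = of_real (C * ?K * norm \<xi> powr (2 * s)) * fourier f \<xi>"
    if "schwartz f" for f :: "'a \<Rightarrow> real" and C \<xi>
    unfolding fourier_slap[OF that s] symbol_eq[OF ne, of s \<xi>] by (simp add: mult_ac)
  have "\<exists>!C. ?P C"
  proof (rule ex1I[of _ "1 / ?K"])
    show "?P (1 / ?K)"
      using K by (intro conjI allI impI) (simp, subst four, simp_all)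
    fix C assume C: "?P C"
    obtain \<xi> :: 'a where \<xi>: "\<xi> \<noteq> 0" "fourier (\<lambda>x :: 'a. exp (- (x \<bullet> x))) \<xi> \<noteq> 0"
      using gaussian_fourier_nonzero by blast
    have "of_real (C * ?K * norm \<xi> powr (2 * s)) * fourier (\<lambda>x :: 'a. exp (- (x \<bullet> x))) \<xi>
        = of_real (norm \<xi> powr (2 * s)) * fourier (\<lambda>x :: 'a. exp (- (x \<bullet> x))) \<xi>"
      using C schwartz_gaussian four[OF schwartz_gaussian, of C \<xi>] by metis
    then have "complex_of_real (C * ?K * norm \<xi> powr (2 * s)) = of_real (norm \<xi> powr (2 * s))"
      using \<xi>(2) by simp
    then have "C * ?K * norm \<xi> powr (2 * s) = norm \<xi> powr (2 * s)" by (simp only: of_real_eq_iff)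
    then show "C = 1 / ?K" using \<xi>(1) K by (simp add: field_simps)
  qed
  from theI'[OF this] show ?thesis unfolding frac_laplacian_const_def by blast
qed

section \<open>The Riesz kernel and its cut-offs\<close>

definition cap :: "real \<Rightarrow> real \<Rightarrow> real" where
  "cap \<theta> t = (if 1 \<le> t then t powr (- \<theta>) else 1 + \<theta> - \<theta> * t)"

definition cap' :: "real \<Rightarrow> real \<Rightarrow> real" where
  "cap' \<theta> t = (if 1 \<le> t then - \<theta> * t powr (- \<theta> - 1) else - \<theta>)"

lemma cap_measurable [measurable]: "cap \<theta> \<in> borel_measurable borel"
  unfolding cap_def[abs_def] by measurable

lemma has_derivative_cap: "(cap \<theta> has_real_derivative cap' \<theta> t) (at t)"
proof (cases "t = 1")
  case True
  have 1: "(cap \<theta> has_real_derivative - \<theta>) (at 1 within {1..})"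
  proof (rule has_field_derivative_transform_within[where d = 1])
    show "((\<lambda>t. t powr (- \<theta>)) has_real_derivative - \<theta>) (at 1 within {1..})"
      by (auto intro!: derivative_eq_intros)
  qed (auto simp: cap_def)
  have 2: "(cap \<theta> has_real_derivative - \<theta>) (at 1 within {..1})"
  proof (rule has_field_derivative_transform_within[where d = 1])
    show "((\<lambda>t. 1 + \<theta> - \<theta> * t) has_real_derivative - \<theta>) (at 1 within {..1})"
      by (auto intro!: derivative_eq_intros)
  qed (auto simp: cap_def)
  have "{..1} \<union> {1..} = (UNIV :: real set)" by auto
  moreover have "((\<lambda>y. (cap \<theta> y - cap \<theta> 1) / (y - 1)) \<longlongrightarrow> - \<theta>) (at 1 within {..1} \<union> {1..})"
    unfolding at_within_union using 1 2 by (simp add: has_field_derivative_iff filterlim_sup)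
  ultimately have "(cap \<theta> has_real_derivative - \<theta>) (at 1)"
    by (simp add: has_field_derivative_iff)
  then show ?thesis using True by (simp add: cap'_def)
next
  case False
  show ?thesis
  proof (cases "t > 1")
    case True
    have "((\<lambda>t. t powr (- \<theta>)) has_real_derivative - \<theta> * t powr (- \<theta> - 1)) (at t)"
      using True by (auto intro!: derivative_eq_intros)
    then have "(cap \<theta> has_real_derivative - \<theta> * t powr (- \<theta> - 1)) (at t)"
      by (rule has_field_derivative_transform_within[where d = "t - 1"])
        (use True in \<open>auto simp: cap_def dist_real_def\<close>)
    then show ?thesis using True by (simp add: cap'_def)
  next
    case less: False
    have "((\<lambda>t. 1 + \<theta> - \<theta> * t) has_real_derivative - \<theta>) (at t)"
      by (auto intro!: derivative_eq_intros)
    then have "(cap \<theta> has_real_derivative - \<theta>) (at t)"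
      by (rule has_field_derivative_transform_within[where d = "1 - t"])
        (use less False in \<open>auto simp: cap_def dist_real_def\<close>)
    then show ?thesis using less False by (simp add: cap'_def)
  qed
qed

text \<open>Convexity of the negative power: its graph lies above the tangent line that defines the cut-off.\<close>

lemma powr_above_tangent:
  fixes t a \<theta> :: real
  assumes "t > 0" "a > 0" "\<theta> \<ge> 0"
  shows "a powr (- \<theta>) - \<theta> * a powr (- \<theta> - 1) * (t - a) \<le> t powr (- \<theta>)"
proof -
  have d: "((\<lambda>x. x powr (- \<theta>)) has_real_derivative - \<theta> * x powr (- \<theta> - 1)) (at x)" if "x > 0" for x
    using that by (auto intro!: derivative_eq_intros)
  have d': "((\<lambda>x. - \<theta> * x powr (- \<theta> - 1)) has_real_derivative - \<theta> * ((- \<theta> - 1) * x powr (- \<theta> - 1 - 1))) (at x)" if "x > 0" for x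
    using that by (auto intro!: derivative_eq_intros)
  have "- \<theta> * a powr (- \<theta> - 1) * (t - a) \<le> t powr (- \<theta>) - a powr (- \<theta>)"
  proof (rule f''_imp_f'[of "{0<..}" "\<lambda>x. x powr (- \<theta>)" "\<lambda>x. - \<theta> * x powr (- \<theta> - 1)" "\<lambda>x. - \<theta> * ((- \<theta> - 1) * x powr (- \<theta> - 1 - 1))"])
    fix x :: real assume "x \<in> {0<..}"
    then show "0 \<le> - \<theta> * ((- \<theta> - 1) * x powr (- \<theta> - 1 - 1))"
      using assms by (simp add: mult_nonneg_nonneg algebra_simps)
  qed (use assms d d' in auto)
  then show ?thesis by (simp add: algebra_simps)
qed

lemma cap_le_powr:
  assumes "t > 0" "\<theta> \<ge> 0" shows "cap \<theta> t \<le> t powr (- \<theta>)"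
  using powr_above_tangent[of t 1 \<theta>] assms by (auto simp: cap_def algebra_simps)

lemma cap_less_powr:
  assumes t: "0 < t" "t < 1" and th: "\<theta> > 0" shows "cap \<theta> t < t powr (- \<theta>)"
proof -
  define m where "m = (t + 1) / 2"
  have m: "t < m" "m < 1" using t by (auto simp: m_def)
  have 1: "m powr (- \<theta>) - \<theta> * m powr (- \<theta> - 1) * (t - m) \<le> t powr (- \<theta>)"
    using t m th by (intro powr_above_tangent) auto
  have 2: "1 - \<theta> * (m - 1) \<le> m powr (- \<theta>)"
    using powr_above_tangent[of m 1 \<theta>] t m th by simp
  have "1 < m powr (- \<theta> - 1)"
    using powr_less_mono2_neg[of "- \<theta> - 1" m 1] m t th by simp
  then have "\<theta> * (m - t) * 1 < \<theta> * (m - t) * m powr (- \<theta> - 1)"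
    using m th by (intro mult_strict_left_mono) auto
  then show ?thesis using 1 2 t by (simp add: cap_def algebra_simps)
qed

lemma cap_bounds:
  assumes "t \<ge> 0" "\<theta> > 0" shows "0 < cap \<theta> t" "cap \<theta> t \<le> 1 + \<theta>"
proof -
  show "0 < cap \<theta> t"
    using assms by (auto simp: cap_def) (smt (verit) mult_left_le)
  show "cap \<theta> t \<le> 1 + \<theta>"
  proof (cases "t \<ge> 1")
    case True
    then have "t powr (- \<theta>) \<le> 1" using assms powr_mono2'[of "- \<theta>" 1 t] by simp
    then show ?thesis using True assms by (simp add: cap_def)
  qed (use assms in \<open>simp add: cap_def\<close>)
qed

lemma cap_scaled_mono:
  assumes t: "t \<ge> 0" and r: "\<rho> \<ge> 1" and th: "\<theta> > 0"
  shows "\<rho> powr (- \<theta>) * cap \<theta> (t / \<rho>) \<le> cap \<theta> t"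
proof (cases "t \<ge> 1")
  case True
  have "\<rho> powr (- \<theta>) * cap \<theta> (t / \<rho>) \<le> \<rho> powr (- \<theta>) * (t / \<rho>) powr (- \<theta>)"
    using True r th by (intro mult_left_mono cap_le_powr) auto
  also have "\<dots> = t powr (- \<theta>)" using True r by (simp add: powr_divide)
  finally show ?thesis using True by (simp add: cap_def)
next
  case False
  then have tr: "t / \<rho> < 1" using r by (simp add: divide_less_eq)
  have one: "\<rho> powr (- \<theta>) * (1 + \<theta> - \<theta> * (1 / \<rho>)) \<le> 1"
    using powr_above_tangent[of 1 \<rho> \<theta>] r th by (simp add: powr_diff divide_simps algebra_simps)
  have "\<rho> powr (- \<theta>) * (\<theta> / \<rho>) \<le> 1 * (\<theta> / 1)"
    using r th powr_mono2'[of "- \<theta>" 1 \<rho>] by (intro mult_mono divide_left_mono) auto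
  then have "\<rho> powr (- \<theta>) * (\<theta> / \<rho>) * (1 - t) \<le> \<theta> * (1 - t)"
    using False by (intro mult_right_mono) auto
  moreover define q where "q = \<rho> powr (- \<theta>) * (\<theta> / \<rho>)"
  ultimately have A: "q * (1 - t) \<le> \<theta> * (1 - t)" by simp
  have "\<rho> powr (- \<theta>) * (1 + \<theta> - \<theta> * (1 / \<rho>)) = \<rho> powr (- \<theta>) * (1 + \<theta>) - q"
    by (simp add: q_def algebra_simps)
  then have B: "\<rho> powr (- \<theta>) * (1 + \<theta>) - q \<le> 1" using one by simp
  have "\<rho> powr (- \<theta>) * cap \<theta> (t / \<rho>) = (\<rho> powr (- \<theta>) * (1 + \<theta>) - q) + q * (1 - t)"
    using tr by (simp add: q_def cap_def algebra_simps diff_divide_distrib)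
  also have "\<dots> \<le> 1 + \<theta> * (1 - t)" by (intro add_mono A B)
  also have "\<dots> = cap \<theta> t" using False by (simp add: cap_def algebra_simps)
  finally show ?thesis .
qed

text \<open>Seen from a point below the gluing point, increments of the cut-off are at most a fixed multiple of those of the power; this transfers superharmonicity from the Riesz kernel to the capped kernel.\<close>

lemma cap_concave:
  assumes a: "0 < a" "a \<le> 1" and t: "t > 0" and th: "\<theta> > 0"
  shows "cap \<theta> t - cap \<theta> a \<le> a powr (\<theta> + 1) * (t powr (- \<theta>) - a powr (- \<theta>))"
proof -
  have ca: "cap \<theta> a = 1 + \<theta> - \<theta> * a"
    using a by (cases "a = 1") (auto simp: cap_def)
  have inner: "1 + \<theta> - \<theta> * r - cap \<theta> a \<le> a powr (\<theta> + 1) * (r powr (- \<theta>) - a powr (- \<theta>))" if r: "r > 0" for r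
  proof -
    have "a powr (\<theta> + 1) * (- \<theta> * a powr (- \<theta> - 1) * (r - a)) \<le> a powr (\<theta> + 1) * (r powr (- \<theta>) - a powr (- \<theta>))"
      using powr_above_tangent[of r a \<theta>] a r th by (intro mult_left_mono) auto
    moreover have "a powr (\<theta> + 1) * a powr (- \<theta> - 1) = 1" using a by (simp add: powr_add[symmetric])
    then have "a powr (\<theta> + 1) * (- \<theta> * a powr (- \<theta> - 1) * (r - a)) = - \<theta> * (r - a)"
      by (simp add: mult_ac)
    ultimately show ?thesis using ca by (simp add: algebra_simps)
  qed
  show ?thesis
  proof (cases "t < 1")
    case True then show ?thesis using inner[OF t] by (simp add: cap_def)
  next
    case False
    have "a powr (\<theta> + 1) \<le> 1" using a th powr_mono2[of "\<theta> + 1" a 1] by simp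
    moreover have "t powr (- \<theta>) \<le> 1" using False th powr_mono2'[of "- \<theta>" 1 t] by simp
    ultimately have "(1 - a powr (\<theta> + 1)) * t powr (- \<theta>) \<le> (1 - a powr (\<theta> + 1)) * 1"
      by (intro mult_left_mono) auto
    then show ?thesis using inner[of 1] False by (simp add: cap_def algebra_simps)
  qed
qed

lemma cap'_times_lipschitz:
  fixes x y :: "'a::euclidean_space"
  assumes th: "\<theta> > 0"
  shows "norm (cap' \<theta> (y \<bullet> y) *\<^sub>R y - cap' \<theta> (x \<bullet> x) *\<^sub>R x) \<le> \<theta> * (2 * \<theta> + 3) * norm (y - x)"
proof -
  define w where "w r = (if 1 \<le> r then r powr (- (2 * \<theta> + 2)) else 1)" for r :: real
  define \<psi> where "\<psi> r = r * w r" for r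
  have w01: "0 \<le> w r" "w r \<le> 1" if "r \<ge> 0" for r
    using that th powr_mono2'[of "- (2 * \<theta> + 2)" 1 r] by (auto simp: w_def)
  have cw: "cap' \<theta> (x \<bullet> x) = - \<theta> * w (norm x)" for x :: 'a
  proof (cases "norm x \<ge> 1")
    case True
    then have "x \<bullet> x \<ge> 1" by (simp add: dot_square_norm)
    moreover have "(x \<bullet> x) powr (- \<theta> - 1) = norm x powr (- (2 * \<theta> + 2))"
    proof -
      have "x \<bullet> x = norm x powr 2" using True by (simp add: dot_square_norm)
      then have "(x \<bullet> x) powr (- \<theta> - 1) = norm x powr (2 * (- \<theta> - 1))" by (simp only: powr_powr)
      also have "2 * (- \<theta> - 1) = - (2 * \<theta> + 2)" by simp
      finally show ?thesis .
    qed
    ultimately show ?thesis using True by (simp add: cap'_def w_def)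
  next
    case False
    then have "\<not> x \<bullet> x \<ge> 1" by (simp add: dot_square_norm abs_square_less_1 not_le)
    then show ?thesis using False by (simp add: cap'_def w_def)
  qed
  have out: "\<bar>\<psi> b - \<psi> a\<bar> \<le> (2 * \<theta> + 1) * (b - a)" if "1 \<le> a" "a \<le> b" for a b
  proof -
    have e: "\<psi> r = r powr (- (2 * \<theta> + 1))" if "r \<ge> 1" for r
    proof -
      have "r * r powr (- (2 * \<theta> + 2)) = r powr (1 + (- (2 * \<theta> + 2)))"
        using that by (subst powr_add) simp
      also have "1 + (- (2 * \<theta> + 2)) = - (2 * \<theta> + 1)" by simp
      finally have "r * r powr (- (2 * \<theta> + 2)) = r powr (- (2 * \<theta> + 1))" .
      then show ?thesis using that by (simp add: \<psi>_def w_def)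
    qed
    have "norm (b powr (- (2 * \<theta> + 1)) - a powr (- (2 * \<theta> + 1))) \<le> (2 * \<theta> + 1) * norm (b - a)"
    proof (rule field_differentiable_bound[of "{1..}"])
      fix r :: real assume r: "r \<in> {1..}"
      show "((\<lambda>r. r powr (- (2 * \<theta> + 1))) has_field_derivative - (2 * \<theta> + 1) * r powr (- (2 * \<theta> + 1) - 1)) (at r within {1..})"
        using r by (auto intro!: derivative_eq_intros)
      have "r powr (- (2 * \<theta> + 1) - 1) \<le> 1" using r th powr_mono2'[of "- (2 * \<theta> + 1) - 1" 1 r] by auto
      then have "(2 * \<theta> + 1) * r powr (- (2 * \<theta> + 1) - 1) \<le> (2 * \<theta> + 1) * 1"
        using th by (intro mult_left_mono) auto
      moreover have "norm (- (2 * \<theta> + 1) * r powr (- (2 * \<theta> + 1) - 1)) = (2 * \<theta> + 1) * r powr (- (2 * \<theta> + 1) - 1)"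
        using th by (simp only: real_norm_def abs_mult) simp
      ultimately show "norm (- (2 * \<theta> + 1) * r powr (- (2 * \<theta> + 1) - 1)) \<le> 2 * \<theta> + 1"
        by (simp only: mult_1_right)
    qed (use that in auto)
    then show ?thesis using that e[of a] e[of b] by simp
  qed
  have lip: "\<bar>\<psi> b - \<psi> a\<bar> \<le> (2 * \<theta> + 1) * (b - a)" if "0 \<le> a" "a \<le> b" for a b
  proof -
    have inn: "\<psi> r = r" if "r \<le> 1" for r using that by (cases "r = 1") (auto simp: \<psi>_def w_def)
    consider "1 \<le> a" | "b \<le> 1" | "a < 1" "1 < b" by linarith
    then show ?thesis
    proof cases
      case 2
      have "0 \<le> 2 * \<theta> * (b - a)" using th that by simp
      then show ?thesis using 2 that inn[of a] inn[of b] by (simp add: algebra_simps)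
    next
      case 3
      have "0 \<le> 2 * \<theta> * (1 - a)" using th 3 by simp
      then show ?thesis using 3 out[of 1 b] inn[of a] inn[of 1] by (simp add: algebra_simps abs_le_iff)
    qed (use out that in auto)
  qed
  have main: "norm (w (norm y) *\<^sub>R y - w (norm x) *\<^sub>R x) \<le> (2 * \<theta> + 3) * norm (y - x)"
    if le: "norm x \<le> norm y" for x y :: 'a
  proof -
    have "norm (w (norm y) *\<^sub>R y - w (norm x) *\<^sub>R x) = norm ((w (norm y) - w (norm x)) *\<^sub>R y + w (norm x) *\<^sub>R (y - x))"
      by (simp add: algebra_simps)
    also have "\<dots> \<le> \<bar>w (norm y) - w (norm x)\<bar> * norm y + w (norm x) * norm (y - x)"
      using w01[of "norm x"] by (intro order_trans[OF norm_triangle_ineq]) simp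
    also have "\<bar>w (norm y) - w (norm x)\<bar> * norm y = \<bar>(\<psi> (norm y) - \<psi> (norm x)) - (norm y - norm x) * w (norm x)\<bar>"
    proof -
      have "\<bar>w (norm y) - w (norm x)\<bar> * norm y = \<bar>(w (norm y) - w (norm x)) * norm y\<bar>"
        by (simp only: abs_mult abs_norm_cancel)
      also have "(w (norm y) - w (norm x)) * norm y = (\<psi> (norm y) - \<psi> (norm x)) - (norm y - norm x) * w (norm x)"
        by (simp add: \<psi>_def algebra_simps)
      finally show ?thesis .
    qed
    also have "\<dots> \<le> (2 * \<theta> + 1) * (norm y - norm x) + (norm y - norm x) * 1"
    proof -
      have "\<bar>(norm y - norm x) * w (norm x)\<bar> = (norm y - norm x) * w (norm x)"
        using le w01[of "norm x"] by simp
      also have "\<dots> \<le> (norm y - norm x) * 1"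
        using le w01[of "norm x"] by (intro mult_left_mono) auto
      finally show ?thesis
        using lip[of "norm x" "norm y"] le abs_triangle_ineq4[of "\<psi> (norm y) - \<psi> (norm x)" "(norm y - norm x) * w (norm x)"]
        by simp
    qed
    also have "\<dots> = (2 * \<theta> + 2) * (norm y - norm x)" by (simp add: algebra_simps)
    also have "\<dots> \<le> (2 * \<theta> + 2) * norm (y - x)"
      using th norm_triangle_ineq2[of y x] by (intro mult_left_mono) auto
    finally have "norm (w (norm y) *\<^sub>R y - w (norm x) *\<^sub>R x) \<le> (2 * \<theta> + 2) * norm (y - x) + w (norm x) * norm (y - x)" by simp
    also have "w (norm x) * norm (y - x) \<le> 1 * norm (y - x)"
      using w01[of "norm x"] by (intro mult_right_mono) auto
    finally show ?thesis by (simp add: algebra_simps)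
  qed
  have "norm (w (norm y) *\<^sub>R y - w (norm x) *\<^sub>R x) \<le> (2 * \<theta> + 3) * norm (y - x)"
    using main[of x y] main[of y x] by (cases "norm x \<le> norm y") (auto simp: norm_minus_commute)
  then have "\<theta> * norm (w (norm y) *\<^sub>R y - w (norm x) *\<^sub>R x) \<le> \<theta> * ((2 * \<theta> + 3) * norm (y - x))"
    using th by (intro mult_left_mono) auto
  moreover have "cap' \<theta> (y \<bullet> y) *\<^sub>R y - cap' \<theta> (x \<bullet> x) *\<^sub>R x = (- \<theta>) *\<^sub>R (w (norm y) *\<^sub>R y - w (norm x) *\<^sub>R x)"
    by (simp add: cw algebra_simps)
  ultimately show ?thesis using th by (simp add: mult_ac)
qed

lemma sdiff_cap_bound:
  fixes x z :: "'a::euclidean_space"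
  assumes th: "\<theta> > 0"
  shows "\<bar>sdiff (\<lambda>x. cap \<theta> (x \<bullet> x)) z x\<bar> \<le> 4 * (\<theta> * (2 * \<theta> + 3)) * norm z powr 2"
proof -
  have "\<bar>sdiff (\<lambda>x. cap \<theta> (x \<bullet> x)) z x\<bar> \<le> 2 * (2 * (\<theta> * (2 * \<theta> + 3))) * norm z powr (1 + 1)"
  proof (rule sdiff_bound_of_derivative(2)[where f' = "\<lambda>y h. 2 * (cap' \<theta> (y \<bullet> y) * (y \<bullet> h))"])
    fix y :: 'a
    have "((\<lambda>x. cap \<theta> (x \<bullet> x)) has_derivative (\<lambda>h. (y \<bullet> h + h \<bullet> y) * cap' \<theta> (y \<bullet> y))) (at y)"
      by (rule has_derivative_compose[of "\<lambda>x. x \<bullet> x" "\<lambda>h. y \<bullet> h + h \<bullet> y" y UNIV "cap \<theta>" "\<lambda>h. h * cap' \<theta> (y \<bullet> y)"])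
        (auto intro!: derivative_eq_intros has_derivative_cap[unfolded has_field_derivative_def, THEN has_derivative_eq_rhs])
    then show "((\<lambda>x. cap \<theta> (x \<bullet> x)) has_derivative (\<lambda>h. 2 * (cap' \<theta> (y \<bullet> y) * (y \<bullet> h)))) (at y)"
      by (rule has_derivative_eq_rhs) (auto simp: inner_commute algebra_simps)
    fix h :: 'a
    have "\<bar>2 * (cap' \<theta> (y \<bullet> y) * (y \<bullet> h)) - 2 * (cap' \<theta> (x \<bullet> x) * (x \<bullet> h))\<bar>
        = 2 * \<bar>(cap' \<theta> (y \<bullet> y) *\<^sub>R y - cap' \<theta> (x \<bullet> x) *\<^sub>R x) \<bullet> h\<bar>"
    proof -
      have "\<bar>2 * a - 2 * b\<bar> = 2 * \<bar>a - b\<bar>" for a b :: real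
        using abs_mult[of 2 "a - b"] by (simp add: right_diff_distrib)
      then show ?thesis by (simp only: inner_diff_left inner_scaleR_left)
    qed
    also have "\<dots> \<le> 2 * ((\<theta> * (2 * \<theta> + 3) * norm (y - x)) * norm h)"
      by (intro mult_left_mono order_trans[OF Cauchy_Schwarz_ineq2] mult_right_mono cap'_times_lipschitz th) auto
    also have "\<dots> = 2 * (\<theta> * (2 * \<theta> + 3)) * norm (y - x) powr 1 * norm h"
      by simp
    finally show "\<bar>2 * (cap' \<theta> (y \<bullet> y) * (y \<bullet> h)) - 2 * (cap' \<theta> (x \<bullet> x) * (x \<bullet> h))\<bar>
        \<le> 2 * (\<theta> * (2 * \<theta> + 3)) * norm (y - x) powr 1 * norm h" .
  qed simp
  then show ?thesis by simp
qed

lemma inv_powr: "(\<epsilon>::real) > 0 \<Longrightarrow> (1 / \<epsilon>) powr a = inverse (\<epsilon> powr a)"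
  by (simp add: powr_divide inverse_eq_divide)

lemma sdiff_cmult: "sdiff (\<lambda>x. c * f x) z x = c * sdiff f z x"
  by (simp add: sdiff_def right_diff_distrib)

lemma slap_cmult: "slap s (\<lambda>x. c * f x) x = c * slap s f x"
  by (simp add: slap_def sdiff_cmult mult.assoc)

locale fractional =
  fixes s \<theta> :: real and T :: "'a::euclidean_space itself"
  assumes s0: "0 < s" and s1: "s < 1" and dim: "2 * s < real DIM('a)"
    and \<theta>_def: "\<theta> = (real DIM('a) - 2 * s) / 2"
begin

definition riesz :: "'a \<Rightarrow> real" where "riesz x = norm x powr (- (2 * \<theta>))"

definition capped :: "'a \<Rightarrow> real" where "capped x = cap \<theta> (x \<bullet> x)"

definition capped_at :: "real \<Rightarrow> 'a \<Rightarrow> real" where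
  "capped_at \<epsilon> x = \<epsilon> powr (- (2 * \<theta>)) * capped ((1 / \<epsilon>) *\<^sub>R x)"

lemma theta_pos: "\<theta> > 0" using dim by (simp add: \<theta>_def)

lemma two_theta: "2 * \<theta> = real DIM('a) - 2 * s" by (simp add: \<theta>_def)

lemma riesz_measurable [measurable]: "riesz \<in> borel_measurable borel"
  unfolding riesz_def[abs_def] by measurable

lemma capped_measurable [measurable]: "capped \<in> borel_measurable borel"
  unfolding capped_def[abs_def] by measurable

lemma capped_at_measurable [measurable]: "capped_at \<epsilon> \<in> borel_measurable borel"
  unfolding capped_at_def[abs_def] by measurable

lemma riesz_nonneg [simp]: "riesz x \<ge> 0" by (simp add: riesz_def)


lemma riesz_scale: "c > 0 \<Longrightarrow> riesz (c *\<^sub>R x) = c powr (- (2 * \<theta>)) * riesz x"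
  by (simp add: riesz_def powr_mult)

lemma riesz_eq: "riesz x = (x \<bullet> x) powr (- \<theta>)"
proof -
  have "x \<bullet> x = norm x powr 2" by (simp add: dot_square_norm)
  then have "(x \<bullet> x) powr (- \<theta>) = norm x powr (2 * (- \<theta>))" by (simp only: powr_powr)
  then show ?thesis by (simp add: riesz_def)
qed

lemma capped_pos: "capped x > 0" and capped_le: "capped x \<le> 1 + \<theta>"
  unfolding capped_def using cap_bounds[of "x \<bullet> x" \<theta>] theta_pos by auto

lemma capped_outside: "norm x \<ge> 1 \<Longrightarrow> capped x = riesz x"
  unfolding capped_def riesz_eq by (simp add: cap_def dot_square_norm)

lemma capped_le_riesz: "x \<noteq> 0 \<Longrightarrow> capped x \<le> riesz x"
  unfolding capped_def riesz_eq using theta_pos by (intro cap_le_powr) auto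

lemma capped_less_riesz: "x \<noteq> 0 \<Longrightarrow> norm x < 1 \<Longrightarrow> capped x < riesz x"
  unfolding capped_def riesz_eq using theta_pos
  by (intro cap_less_powr) (auto simp: dot_square_norm abs_square_less_1)

lemma capped_at_pos: "\<epsilon> > 0 \<Longrightarrow> capped_at \<epsilon> x > 0"
  by (simp add: capped_at_def capped_pos)

lemma capped_at_outside:
  assumes e: "\<epsilon> > 0" and x: "norm x \<ge> \<epsilon>" shows "capped_at \<epsilon> x = riesz x"
proof -
  have "capped ((1 / \<epsilon>) *\<^sub>R x) = riesz ((1 / \<epsilon>) *\<^sub>R x)" using e x by (intro capped_outside) simp
  also have "\<dots> = (1 / \<epsilon>) powr (- (2 * \<theta>)) * riesz x" using e by (intro riesz_scale) simp
  finally have "capped ((1 / \<epsilon>) *\<^sub>R x) = inverse (\<epsilon> powr (- (2 * \<theta>))) * riesz x"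
    by (simp only: inv_powr[OF e])
  then have "capped_at \<epsilon> x = \<epsilon> powr (- (2 * \<theta>)) * (inverse (\<epsilon> powr (- (2 * \<theta>))) * riesz x)"
    by (simp only: capped_at_def)
  then show ?thesis using e by simp
qed


lemma capped_at_mono_1: "\<rho> \<ge> 1 \<Longrightarrow> capped_at \<rho> x \<le> capped x"
proof -
  assume r: "\<rho> \<ge> 1"
  have "(\<rho>\<^sup>2) powr (- \<theta>) * cap \<theta> ((x \<bullet> x) / \<rho>\<^sup>2) \<le> cap \<theta> (x \<bullet> x)"
    by (rule cap_scaled_mono) (use r theta_pos in auto)
  moreover have "(\<rho>\<^sup>2) powr (- \<theta>) = \<rho> powr (- (2 * \<theta>))"
  proof -
    have "\<rho>\<^sup>2 = \<rho> powr 2" using r by simp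
    then have "(\<rho>\<^sup>2) powr (- \<theta>) = \<rho> powr (2 * (- \<theta>))" by (simp only: powr_powr)
    then show ?thesis by simp
  qed
  ultimately show ?thesis by (simp add: capped_at_def capped_def power2_eq_square)
qed

lemma capped_at_compose:
  assumes "a > 0" "b > 0"
  shows "capped_at (a * b) x = a powr (- (2 * \<theta>)) * capped_at b ((1 / a) *\<^sub>R x)"
  using assms by (simp add: capped_at_def powr_mult mult.commute[of b a])

lemma capped_at_antimono:
  assumes "0 < \<epsilon>" "\<epsilon> \<le> R" shows "capped_at R x \<le> capped_at \<epsilon> x"
proof -
  have "capped_at R x = \<epsilon> powr (- (2 * \<theta>)) * capped_at (R / \<epsilon>) ((1 / \<epsilon>) *\<^sub>R x)"
    using capped_at_compose[of \<epsilon> "R / \<epsilon>" x] assms by simp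
  also have "\<dots> \<le> \<epsilon> powr (- (2 * \<theta>)) * capped ((1 / \<epsilon>) *\<^sub>R x)"
    using assms by (intro mult_left_mono capped_at_mono_1) auto
  finally show ?thesis by (simp only: capped_at_def)
qed

lemma capped_at_bounded: "\<epsilon> > 0 \<Longrightarrow> capped_at \<epsilon> x \<le> \<epsilon> powr (- (2 * \<theta>)) * (1 + \<theta>)"
  unfolding capped_at_def by (intro mult_left_mono capped_le) auto

lemma capped_1: "capped_at 1 = capped" by (rule ext) (simp add: capped_at_def)

definition M0 :: real where "M0 = 4 * (\<theta> * (2 * \<theta> + 3))"

lemma M0_nonneg: "M0 \<ge> 0" using theta_pos by (simp add: M0_def)

lemma sdiff_capped: "\<bar>sdiff capped z x\<bar> \<le> M0 * norm z powr 2"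
  using sdiff_cap_bound[OF theta_pos, of z x] by (simp add: capped_def[abs_def] M0_def)

lemma sdiff_capped_at_eq: "sdiff (capped_at \<epsilon>) z x = \<epsilon> powr (- (2 * \<theta>)) * sdiff capped ((1 / \<epsilon>) *\<^sub>R z) ((1 / \<epsilon>) *\<^sub>R x)"
  by (simp add: sdiff_def capped_at_def algebra_simps)

lemma sdiff_capped_at: "\<exists>M\<ge>0. \<forall>x z. \<bar>sdiff (capped_at \<epsilon>) z x\<bar> \<le> M * norm z powr 2" if e: "\<epsilon> > 0"
proof (intro exI conjI allI)
  let ?M = "\<epsilon> powr (- (2 * \<theta>)) * (M0 * (1 / \<epsilon>) powr 2)"
  show "?M \<ge> 0" using M0_nonneg by simp
  fix x z :: 'a
  have "\<bar>sdiff (capped_at \<epsilon>) z x\<bar> \<le> \<epsilon> powr (- (2 * \<theta>)) * (M0 * norm ((1 / \<epsilon>) *\<^sub>R z) powr 2)"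
    unfolding sdiff_capped_at_eq abs_mult by (intro mult_mono sdiff_capped) auto
  also have "norm ((1 / \<epsilon>) *\<^sub>R z) powr 2 = (1 / \<epsilon>) powr 2 * norm z powr 2"
    using e by (simp add: power_mult_distrib power_divide)
  finally show "\<bar>sdiff (capped_at \<epsilon>) z x\<bar> \<le> ?M * norm z powr 2" by (simp add: mult_ac)
qed

lemma abs_capped_at: "\<epsilon> > 0 \<Longrightarrow> \<bar>capped_at \<epsilon> x\<bar> \<le> \<epsilon> powr (- (2 * \<theta>)) * (1 + \<theta>)"
  using capped_at_bounded[of \<epsilon> x] capped_at_pos[of \<epsilon> x] by linarith

lemma weighted_capped_at: "\<epsilon> > 0 \<Longrightarrow> weighted s (capped_at \<epsilon>)"
  by (rule weighted_bounded[OF s0 _ abs_capped_at]) auto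

lemma two_s: "2 * s < 2" using s1 by simp

lemma sdiff_capped_at_int: "\<epsilon> > 0 \<Longrightarrow> integrable lborel (\<lambda>z. sdiff (capped_at \<epsilon>) z x * kern s z)"
proof -
  assume e: "\<epsilon> > 0"
  obtain M where "\<And>x z. \<bar>sdiff (capped_at \<epsilon>) z x\<bar> \<le> M * norm z powr 2" using sdiff_capped_at[OF e] by blast
  then show ?thesis by (intro sdiff_kern_integrable[OF weighted_capped_at[OF e] s0 two_s, of 1]) auto
qed

definition \<Lambda> :: "'a \<Rightarrow> real" where "\<Lambda> = slap s capped"

lemma Lam_measurable [measurable]: "\<Lambda> \<in> borel_measurable borel" unfolding \<Lambda>_def by measurable

lemma slap_capped_at: "\<epsilon> > 0 \<Longrightarrow> slap s (capped_at \<epsilon>) x = \<epsilon> powr (- real DIM('a)) * \<Lambda> ((1 / \<epsilon>) *\<^sub>R x)"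
proof -
  assume e: "\<epsilon> > 0"
  have "slap s (capped_at \<epsilon>) x = \<epsilon> powr (- (2 * \<theta>)) * slap s (\<lambda>x. capped ((1 / \<epsilon>) *\<^sub>R x)) x"
    unfolding capped_at_def[abs_def] by (rule slap_cmult)
  also have "\<dots> = \<epsilon> powr (- (2 * \<theta>)) * ((1 / \<epsilon>) powr (2 * s) * \<Lambda> ((1 / \<epsilon>) *\<^sub>R x))"
    unfolding \<Lambda>_def using e by (subst slap_scale) auto
  also have "\<dots> = (\<epsilon> powr (- (2 * \<theta>)) * \<epsilon> powr (- (2 * s))) * \<Lambda> ((1 / \<epsilon>) *\<^sub>R x)"
    unfolding inv_powr[OF e] powr_minus[of \<epsilon> "2 * s"] by simp
  also have "\<epsilon> powr (- (2 * \<theta>)) * \<epsilon> powr (- (2 * s)) = \<epsilon> powr (- real DIM('a))"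
    unfolding powr_add[symmetric] two_theta by simp
  finally show ?thesis .
qed

text \<open>By rotation invariance and homogeneity the fractional Laplacian of the Riesz kernel is a multiple of a fixed power, so only one coefficient remains to be determined.\<close>

lemma riesz_integrable_ball: "integrable lborel (\<lambda>x. riesz x * indicator (ball 0 1) x)"
proof (rule integrableI_nonneg)
  have [measurable]: "ball (0::'a) 1 \<in> sets borel" by (simp add: borel_open)
  show "(\<lambda>x. riesz x * indicator (ball 0 1) x) \<in> borel_measurable lborel" by measurable
  have "(\<integral>\<^sup>+x. ennreal (riesz x * indicator (ball 0 1) x) \<partial>lborel)
      = (\<integral>\<^sup>+x. ennreal (norm x powr (- (2 * \<theta>))) * indicator (ball 0 1) x \<partial>(lborel :: 'a measure))"
    by (intro nn_integral_cong) (simp add: riesz_def indicator_def)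
  also have "\<dots> < \<infinity>" by (rule nn_integral_norm_powr_ball) (use s0 two_theta in simp)
  finally show "(\<integral>\<^sup>+x. ennreal (riesz x * indicator (ball 0 1) x) \<partial>lborel) < \<infinity>" .
qed simp

lemma weighted_riesz: "weighted s riesz"
  unfolding weighted_def
proof
  show "integrable lborel (\<lambda>x. \<bar>riesz x\<bar> / (1 + norm x powr (real DIM('a) + 2 * s)))"
  proof (rule Bochner_Integration.integrable_bound[OF Bochner_Integration.integrable_add[OF riesz_integrable_ball integrable_weight_powr[OF s0]]])
    show "AE x in lborel. norm (\<bar>riesz x\<bar> / (1 + norm x powr (real DIM('a) + 2 * s))) \<le> norm (riesz x * indicator (ball 0 1) x + 1 / (1 + norm x powr (real DIM('a) + 2 * s)))"
    proof (rule AE_I2)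
      fix x :: 'a
      have p: "1 + norm x powr (real DIM('a) + 2 * s) \<ge> 1" "1 + norm x powr (real DIM('a) + 2 * s) > 0"
        by (simp_all add: add_pos_nonneg)
      show "norm (\<bar>riesz x\<bar> / (1 + norm x powr (real DIM('a) + 2 * s))) \<le> norm (riesz x * indicator (ball 0 1) x + 1 / (1 + norm x powr (real DIM('a) + 2 * s)))"
      proof (cases "norm x < 1")
        case True
        have "riesz x / (1 + norm x powr (real DIM('a) + 2 * s)) \<le> riesz x / 1"
          using p by (intro divide_left_mono mult_pos_pos) auto
        moreover have "0 \<le> 1 / (1 + norm x powr (real DIM('a) + 2 * s))" using p by (intro divide_nonneg_nonneg) auto
        moreover have "norm (\<bar>riesz x\<bar> / (1 + norm x powr (real DIM('a) + 2 * s))) = riesz x / (1 + norm x powr (real DIM('a) + 2 * s))"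
          using p by (simp add: add_nonneg_nonneg)
        ultimately have "norm (\<bar>riesz x\<bar> / (1 + norm x powr (real DIM('a) + 2 * s))) \<le> riesz x * indicator (ball 0 1) x + 1 / (1 + norm x powr (real DIM('a) + 2 * s))"
          using True by (simp only: indicator_simps mem_ball_0)
        then show ?thesis using abs_ge_self order_trans unfolding real_norm_def by blast
      next
        case False
        have "riesz x \<le> 1" using False theta_pos powr_mono2'[of "- (2 * \<theta>)" 1 "norm x"] by (simp add: riesz_def)
        then show ?thesis using False p by (simp add: divide_right_mono)
      qed
    qed
  qed simp
qed simp

lemma sdiff_riesz_near:
  assumes "x \<noteq> 0" "norm z \<le> norm x / 2"
  shows "sdiff riesz z x = sdiff (capped_at (norm x / 2)) z x"
proof -
  have "norm (x + z) \<ge> norm x / 2" "norm (x - z) \<ge> norm x / 2"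
    using assms norm_triangle_ineq2[of x "-z"] norm_triangle_ineq2[of x z] by auto
  then show ?thesis using assms by (simp add: sdiff_def capped_at_outside)
qed

lemma sdiff_riesz_int:
  assumes x: "x \<noteq> 0" shows "integrable lborel (\<lambda>z. sdiff riesz z x * kern s z)"
proof -
  have e: "norm x / 2 > 0" using x by simp
  obtain M where M: "\<And>y z. \<bar>sdiff (capped_at (norm x / 2)) z y\<bar> \<le> M * norm z powr 2"
    using sdiff_capped_at[OF e] by blast
  show ?thesis
  proof (rule sdiff_kern_integrable[OF weighted_riesz s0 two_s e])
    fix z :: 'a assume "norm z \<le> norm x / 2"
    then show "\<bar>sdiff riesz z x\<bar> \<le> M * norm z powr 2" using M[of z x] by (simp only: sdiff_riesz_near[OF x])
  qed
qed

lemma slap_riesz_scale: "c > 0 \<Longrightarrow> slap s riesz (c *\<^sub>R x) = c powr (- real DIM('a)) * slap s riesz x"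
proof -
  assume c: "c > 0"
  have "slap s (\<lambda>x. riesz (c *\<^sub>R x)) x = c powr (- (2 * \<theta>)) * slap s riesz x"
    using c by (simp add: riesz_scale slap_cmult)
  then have "c powr (2 * s) * slap s riesz (c *\<^sub>R x) = c powr (- (2 * \<theta>)) * slap s riesz x"
    using slap_scale[of riesz c s x] c by simp
  then have "c powr (- (2 * s)) * (c powr (2 * s) * slap s riesz (c *\<^sub>R x)) = c powr (- (2 * s)) * (c powr (- (2 * \<theta>)) * slap s riesz x)"
    by simp
  then show ?thesis using c by (simp add: mult.assoc[symmetric] powr_add[symmetric] two_theta)
qed

lemma riesz_refl: "riesz (refl n x) = riesz x" by (simp add: riesz_def)

lemma slap_riesz_refl: "slap s riesz (refl n x) = slap s riesz x"
  using slap_refl[of riesz s n x] by (simp add: riesz_refl)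

lemma slap_riesz_form: "\<exists>k0. \<forall>x. x \<noteq> 0 \<longrightarrow> slap s riesz x = k0 * norm x powr (- real DIM('a))"
proof -
  obtain e :: 'a where e: "norm e = 1"
    by (metis nonempty_Basis ex_in_conv norm_Basis)
  have "slap s riesz x = slap s riesz e * norm x powr (- real DIM('a))" if x: "x \<noteq> 0" for x
  proof -
    define \<eta> where "\<eta> = (1 / norm x) *\<^sub>R x"
    have "refl (\<eta> - e) \<eta> = e" using x e by (intro refl_swap) (simp add: \<eta>_def)
    then have "slap s riesz \<eta> = slap s riesz e" using slap_riesz_refl[of "\<eta> - e" \<eta>] by simp
    moreover have "x = norm x *\<^sub>R \<eta>" using x by (simp add: \<eta>_def)
    ultimately show ?thesis using x slap_riesz_scale[of "norm x" \<eta>] by simp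
  qed
  then show ?thesis by blast
qed

definition \<kappa> :: real where "\<kappa> = (\<integral>x. \<Lambda> x \<partial>lborel)"

end

lemma norm_power_dim: "r > 0 \<Longrightarrow> (r::real) ^ DIM('a::euclidean_space) = r powr real DIM('a)"
  by (simp add: powr_realpow)

lemma slap_diff:
  assumes "integrable lborel (\<lambda>z. sdiff f z x * kern s z)" "integrable lborel (\<lambda>z. sdiff g z x * kern s z)"
  shows "integrable lborel (\<lambda>z. sdiff (\<lambda>x. f x - g x) z x * kern s z)"
    and "slap s (\<lambda>x. f x - g x) x = slap s f x - slap s g x"
proof -
  have e: "sdiff (\<lambda>x. f x - g x) z x * kern s z = sdiff f z x * kern s z - sdiff g z x * kern s z" for z
    by (simp add: sdiff_def algebra_simps)
  show "integrable lborel (\<lambda>z. sdiff (\<lambda>x. f x - g x) z x * kern s z)"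
    unfolding e using assms by (rule Bochner_Integration.integrable_diff)
  show "slap s (\<lambda>x. f x - g x) x = slap s f x - slap s g x"
    unfolding slap_def e using assms by (simp add: diff_divide_distrib)
qed

context fractional
begin

text \<open>A difference of two cut-offs at different scales has compact support, which makes it a test function; its fractional Laplacian is a difference of two rescaled copies of one integrable function.\<close>

definition test :: "real \<Rightarrow> real \<Rightarrow> 'a \<Rightarrow> real" where
  "test \<epsilon> R x = capped_at \<epsilon> x - capped_at R x"

lemma test_measurable [measurable]: "test \<epsilon> R \<in> borel_measurable borel"
  unfolding test_def[abs_def] by measurable

lemma test_nonneg: "0 < \<epsilon> \<Longrightarrow> \<epsilon> \<le> R \<Longrightarrow> 0 \<le> test \<epsilon> R x"
  using capped_at_antimono by (simp add: test_def)

lemma test_outside: "0 < \<epsilon> \<Longrightarrow> \<epsilon> \<le> R \<Longrightarrow> norm x \<ge> R \<Longrightarrow> test \<epsilon> R x = 0"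
  by (simp add: test_def capped_at_outside)

lemma test_le: assumes "0 < \<epsilon>" "\<epsilon> \<le> R" shows "\<bar>test \<epsilon> R x\<bar> \<le> \<epsilon> powr (- (2 * \<theta>)) * (1 + \<theta>)"
  using capped_at_bounded[of \<epsilon> x] capped_at_pos[of R x] test_nonneg[of \<epsilon> R x] assms unfolding test_def by linarith

lemma sdiff_test: "sdiff (test \<epsilon> R) z x = sdiff (capped_at \<epsilon>) z x - sdiff (capped_at R) z x"
  by (simp add: sdiff_def test_def)

lemma
  assumes e: "0 < \<epsilon>" "\<epsilon> \<le> R"
  shows slap_test_int: "integrable lborel (\<lambda>z. sdiff (test \<epsilon> R) z x * kern s z)"
    and slap_test: "slap s (test \<epsilon> R) x = \<epsilon> powr (- real DIM('a)) * \<Lambda> ((1 / \<epsilon>) *\<^sub>R x) - R powr (- real DIM('a)) * \<Lambda> ((1 / R) *\<^sub>R x)"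
  using slap_diff[OF sdiff_capped_at_int[of \<epsilon> x] sdiff_capped_at_int[of R x]] slap_capped_at[of \<epsilon> x] slap_capped_at[of R x] e
  unfolding test_def[abs_def] by auto

lemma sdiff_test_bound:
  assumes e: "0 < \<epsilon>" "\<epsilon> \<le> R"
  obtains K where "K \<ge> 0" "\<And>x z. \<bar>sdiff (test \<epsilon> R) z x\<bar> \<le> K * min (norm z powr 2) 1"
proof -
  obtain M1 where M1: "M1 \<ge> 0" "\<And>x z. \<bar>sdiff (capped_at \<epsilon>) z x\<bar> \<le> M1 * norm z powr 2" using sdiff_capped_at[of \<epsilon>] e by blast
  obtain M2 where M2: "M2 \<ge> 0" "\<And>x z. \<bar>sdiff (capped_at R) z x\<bar> \<le> M2 * norm z powr 2" using sdiff_capped_at[of R] e by force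
  define B where "B = \<epsilon> powr (- (2 * \<theta>)) * (1 + \<theta>)"
  have B0: "B \<ge> 0" using theta_pos by (simp add: B_def)
  show ?thesis
  proof (rule that[of "M1 + M2 + 4 * B"])
    show "M1 + M2 + 4 * B \<ge> 0" using M1 M2 B0 by simp
    fix x z :: 'a
    have 1: "\<bar>sdiff (test \<epsilon> R) z x\<bar> \<le> (M1 + M2 + 4 * B) * norm z powr 2"
    proof -
      have "\<bar>sdiff (test \<epsilon> R) z x\<bar> \<le> M1 * norm z powr 2 + M2 * norm z powr 2"
        unfolding sdiff_test using M1(2)[of z x] M2(2)[of z x] by linarith
      moreover have "0 \<le> 4 * B * norm z powr 2" using B0 by simp
      ultimately show ?thesis by (simp only: distrib_right)
    qed
    have 2: "\<bar>sdiff (test \<epsilon> R) z x\<bar> \<le> M1 + M2 + 4 * B"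
      using test_le[OF e, of x] test_le[OF e, of "x + z"] test_le[OF e, of "x - z"] M1(1) M2(1)
      unfolding B_def[symmetric] sdiff_def by linarith
    show "\<bar>sdiff (test \<epsilon> R) z x\<bar> \<le> (M1 + M2 + 4 * B) * min (norm z powr 2) 1"
      using 1 2 by (simp add: min_def)
  qed
qed

lemma sdiff_test_L1:
  assumes e: "0 < \<epsilon>" "\<epsilon> \<le> R"
  obtains C where "C \<ge> 0" "\<And>z. (\<integral>\<^sup>+x. ennreal \<bar>sdiff (test \<epsilon> R) z x\<bar> \<partial>lborel) \<le> ennreal (C * min (norm z powr 2) 1)"
proof -
  obtain K where K: "K \<ge> 0" "\<And>x z. \<bar>sdiff (test \<epsilon> R) z x\<bar> \<le> K * min (norm z powr 2) 1"
    by (rule sdiff_test_bound[OF e], rule that, assumption+)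
  have [measurable]: "ball (0::'a) R \<in> sets borel" by (simp add: borel_open)
  obtain V where V: "V \<ge> 0" "emeasure lborel (ball (0::'a) R) = ennreal V"
    using emeasure_bounded_finite[of "ball (0::'a) R"] by (auto simp: less_top_ennreal)
  have tr: "(\<integral>\<^sup>+x. indicator (ball 0 R) (w + x) \<partial>lborel) = ennreal V" for w :: 'a
    using nn_integral_translate[of "indicator (ball 0 R)" w] V by simp
  show ?thesis
  proof (rule that[of "3 * V * K"])
    show "3 * V * K \<ge> 0" using V K by simp
    fix z :: 'a
    let ?k = "K * min (norm z powr 2) 1"
    have "(\<integral>\<^sup>+x. ennreal \<bar>sdiff (test \<epsilon> R) z x\<bar> \<partial>lborel)
      \<le> (\<integral>\<^sup>+x. ennreal ?k * (indicator (ball 0 R) (0 + x) + (indicator (ball 0 R) (z + x) + indicator (ball 0 R) (- z + x))) \<partial>lborel)"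
    proof (intro nn_integral_mono)
      fix x :: 'a
      show "ennreal \<bar>sdiff (test \<epsilon> R) z x\<bar> \<le> ennreal ?k * (indicator (ball 0 R) (0 + x) + (indicator (ball 0 R) (z + x) + indicator (ball 0 R) (- z + x)))"
      proof (cases "x \<in> ball 0 R \<or> z + x \<in> ball 0 R \<or> - z + x \<in> ball 0 R")
        case True
        have "ennreal \<bar>sdiff (test \<epsilon> R) z x\<bar> \<le> ennreal ?k * 1" using K by (simp add: ennreal_leI)
        also have "\<dots> \<le> ennreal ?k * (indicator (ball 0 R) (0 + x) + (indicator (ball 0 R) (z + x) + indicator (ball 0 R) (- z + x)))"
          using True by (intro mult_left_mono) (auto simp: indicator_def add_increasing2 add_increasing)
        finally show ?thesis .
      next
        case False
        then have "sdiff (test \<epsilon> R) z x = 0"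
          using e by (simp add: sdiff_def test_outside add.commute)
        then show ?thesis by simp
      qed
    qed
    also have "\<dots> = ennreal ?k * ((\<integral>\<^sup>+x. indicator (ball 0 R) (0 + x) \<partial>(lborel :: 'a measure))
        + ((\<integral>\<^sup>+x. indicator (ball 0 R) (z + x) \<partial>lborel) + (\<integral>\<^sup>+x. indicator (ball 0 R) (- z + x) \<partial>lborel)))"
      by (simp add: nn_integral_cmult nn_integral_add)
    also have "\<dots> = ennreal ?k * (ennreal V + (ennreal V + ennreal V))" by (simp only: tr)
    also have "\<dots> = ennreal (3 * V * K * min (norm z powr 2) 1)"
      using V K by (simp add: ennreal_plus[symmetric] ennreal_mult[symmetric] mult_ac del: ennreal_plus)
    finally show "(\<integral>\<^sup>+x. ennreal \<bar>sdiff (test \<epsilon> R) z x\<bar> \<partial>lborel) \<le> ennreal (3 * V * K * min (norm z powr 2) 1)" .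
  qed
qed

lemma test_integrable:
  assumes e: "0 < \<epsilon>" "\<epsilon> \<le> R" shows "integrable lborel (test \<epsilon> R)"
proof (rule Bochner_Integration.integrable_bound)
  let ?B = "\<epsilon> powr (- (2 * \<theta>)) * (1 + \<theta>)"
  have [measurable]: "ball (0::'a) R \<in> sets borel" by (simp add: borel_open)
  show "integrable lborel (\<lambda>x::'a. ?B * indicator (ball 0 R) x)"
    using emeasure_bounded_finite[of "ball (0::'a) R"] by (intro integrable_mult_right integrable_real_indicator) auto
  show "AE x in lborel. norm (test \<epsilon> R x) \<le> norm (?B * indicator (ball 0 R) x)"
  proof (rule AE_I2)
    fix x show "norm (test \<epsilon> R x) \<le> norm (?B * indicator (ball 0 R) x)"
    proof (cases "norm x < R")
      case True
      have "norm (test \<epsilon> R x) \<le> ?B" using test_le[OF e] by simp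
      also have "?B \<le> norm (?B * indicator (ball 0 R) x)" using True by simp
      finally show ?thesis .
    qed (use test_outside[OF e, of x] in simp)
  qed
qed measurable

text \<open>Symmetry of the fractional Laplacian, by Fubini for absolutely integrable second differences.\<close>

lemma duality:
  fixes v :: "'a \<Rightarrow> real"
  assumes e: "0 < \<epsilon>" "\<epsilon> \<le> R" and [measurable]: "v \<in> borel_measurable borel" and B: "\<And>x. \<bar>v x\<bar> \<le> B"
  shows "integrable lborel (\<lambda>x. slap s (test \<epsilon> R) x * v x)"
    and "(\<integral>x. slap s (test \<epsilon> R) x * v x \<partial>lborel) = (1/2) * (\<integral>z. kern s z * (\<integral>x. test \<epsilon> R x * sdiff v z x \<partial>lborel) \<partial>lborel)"
proof -
  obtain C where C: "C \<ge> 0" "\<And>z. (\<integral>\<^sup>+x. ennreal \<bar>sdiff (test \<epsilon> R) z x\<bar> \<partial>lborel) \<le> ennreal (C * min (norm z powr 2) 1)"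
    by (rule sdiff_test_L1[OF e], rule that, assumption+)
  have B0: "B \<ge> 0" using B[of 0] by linarith
  have bd: "(\<integral>\<^sup>+x. ennreal (\<bar>sdiff (test \<epsilon> R) z x\<bar> * norm (v x)) \<partial>lborel) \<le> ennreal (C * B * min (norm z powr 2) 1)" for z
  proof -
    have "(\<integral>\<^sup>+x. ennreal (\<bar>sdiff (test \<epsilon> R) z x\<bar> * norm (v x)) \<partial>lborel) \<le> (\<integral>\<^sup>+x. ennreal B * ennreal \<bar>sdiff (test \<epsilon> R) z x\<bar> \<partial>lborel)"
    proof (intro nn_integral_mono)
      fix x
      have "\<bar>sdiff (test \<epsilon> R) z x\<bar> * norm (v x) \<le> \<bar>sdiff (test \<epsilon> R) z x\<bar> * B"
        using B[of x] by (intro mult_left_mono) auto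
      then show "ennreal (\<bar>sdiff (test \<epsilon> R) z x\<bar> * norm (v x)) \<le> ennreal B * ennreal \<bar>sdiff (test \<epsilon> R) z x\<bar>"
        using B0 by (simp add: ennreal_mult[symmetric] mult.commute ennreal_leI)
    qed
    also have "\<dots> = ennreal B * (\<integral>\<^sup>+x. ennreal \<bar>sdiff (test \<epsilon> R) z x\<bar> \<partial>lborel)"
      unfolding sdiff_def by (rule nn_integral_cmult) measurable
    also have "\<dots> \<le> ennreal B * ennreal (C * min (norm z powr 2) 1)" by (intro mult_left_mono C(2)) simp
    also have "\<dots> = ennreal (C * B * min (norm z powr 2) 1)" using B0 C(1) by (simp add: ennreal_mult[symmetric] mult_ac)
    finally show ?thesis .
  qed
  note F = slap_fubini[of "test \<epsilon> R" v s 2 "C * B", OF test_measurable _ s0 two_s _ slap_test_int[OF e] bd]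
  show "integrable lborel (\<lambda>x. slap s (test \<epsilon> R) x * v x)" using F(1) C B0 by simp
  have ti: "integrable lborel (test \<epsilon> R)" by (rule test_integrable[OF e])
  have tw: "integrable lborel (\<lambda>x. test \<epsilon> R x * g x)" if [measurable]: "g \<in> borel_measurable borel" and "\<And>x. \<bar>g x\<bar> \<le> B" for g
  proof (rule Bochner_Integration.integrable_bound[OF integrable_mult_right[OF ti, of B]])
    show "AE x in lborel. norm (test \<epsilon> R x * g x) \<le> norm (B * test \<epsilon> R x)"
      using that(2) B0 by (intro AE_I2) (auto simp: abs_mult mult.commute[of B] intro!: mult_left_mono)
  qed simp
  have inner: "(\<integral>x. sdiff (test \<epsilon> R) z x * v x \<partial>lborel) = (\<integral>x. test \<epsilon> R x * sdiff v z x \<partial>lborel)" for z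
  proof -
    let ?t = "test \<epsilon> R"
    have sh: "integrable lborel (\<lambda>x. ?t (x + w) * v x)" "(\<integral>x. ?t (x + w) * v x \<partial>lborel) = (\<integral>x. ?t x * v (x - w) \<partial>lborel)" for w
    proof -
      let ?g = "\<lambda>x. ?t x * v (x - w)"
      have *: "(\<lambda>x. ?t (x + w) * v x) = (\<lambda>x. ?g (w + x))" by (simp add: add.commute)
      show "integrable lborel (\<lambda>x. ?t (x + w) * v x)"
        unfolding * by (subst integrable_translate_iff) (auto intro!: tw B)
      show "(\<integral>x. ?t (x + w) * v x \<partial>lborel) = (\<integral>x. ?t x * v (x - w) \<partial>lborel)"
        unfolding * by (rule integral_translate) measurable
    qed
    have i0: "integrable lborel (\<lambda>x. ?t x * v x)" and i1: "integrable lborel (\<lambda>x. ?t x * v (x - w))" for w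
      by (auto intro!: tw B)
    have i2: "integrable lborel (\<lambda>x. ?t x * v (x + z))"
      using i1[of "- z"] by simp
    have "(\<integral>x. sdiff ?t z x * v x \<partial>lborel) = (\<integral>x. 2 * (?t x * v x) - ?t (x + z) * v x - ?t (x + - z) * v x \<partial>lborel)"
      by (intro Bochner_Integration.integral_cong refl) (simp add: sdiff_def algebra_simps)
    also have "\<dots> = 2 * (\<integral>x. ?t x * v x \<partial>lborel) - (\<integral>x. ?t x * v (x - z) \<partial>lborel) - (\<integral>x. ?t x * v (x - - z) \<partial>lborel)"
      using i0 sh(1)[of z] sh(1)[of "- z"] sh(2)[of z] sh(2)[of "- z"] by simp
    also have "\<dots> = (\<integral>x. 2 * (?t x * v x) - ?t x * v (x - z) - ?t x * v (x + z) \<partial>lborel)"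
      using i0 i1[of z] i2 by simp
    also have "\<dots> = (\<integral>x. ?t x * sdiff v z x \<partial>lborel)"
      by (intro Bochner_Integration.integral_cong refl) (simp add: sdiff_def algebra_simps)
    finally show ?thesis .
  qed
  show "(\<integral>x. slap s (test \<epsilon> R) x * v x \<partial>lborel) = (1/2) * (\<integral>z. kern s z * (\<integral>x. test \<epsilon> R x * sdiff v z x \<partial>lborel) \<partial>lborel)"
    using F(2) C B0 by (simp add: inner)
qed

lemma integral_slap_test: assumes e: "0 < \<epsilon>" "\<epsilon> \<le> R"
  shows "integrable lborel (slap s (test \<epsilon> R))" "(\<integral>x. slap s (test \<epsilon> R) x \<partial>lborel) = 0"
  using duality[OF e, of "\<lambda>_. 1" 1] by (simp_all add: sdiff_def)

text \<open>The part of the Riesz kernel removed by the cap; it has compact support, so far away it changes the fractional Laplacian only through a convergent tail integral.\<close>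

definition excess :: "'a \<Rightarrow> real" where "excess x = riesz x - capped x"

lemma excess_measurable [measurable]: "excess \<in> borel_measurable borel"
  unfolding excess_def[abs_def] by measurable

lemma excess_outside: "norm x \<ge> 1 \<Longrightarrow> excess x = 0"
  by (simp add: excess_def capped_outside)

lemma excess_nonneg: "x \<noteq> 0 \<Longrightarrow> excess x \<ge> 0"
  by (simp add: excess_def capped_le_riesz)

lemma AE_nonzero: "AE x in lborel. (x::'a) \<noteq> 0" by (rule AE_lborel_singleton)

lemma excess_integrable: "integrable lborel excess"
proof (rule Bochner_Integration.integrable_bound[OF riesz_integrable_ball])
  show "AE x in lborel. norm (excess x) \<le> norm (riesz x * indicator (ball 0 1) x)"
    using AE_nonzero
  proof eventually_elim
    case (elim x)
    then show ?case
      using excess_outside[of x] excess_nonneg[of x] capped_pos[of x]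
      by (cases "norm x < 1") (auto simp: excess_def)
  qed
qed measurable

definition tail :: "'a \<Rightarrow> real" where "tail x = (\<integral>y. excess y * kern s (y - x) \<partial>lborel)"

lemma kern_tail_le:
  assumes x: "norm x > 1" and y: "norm y < 1"
  shows "kern s (y - x :: 'a) \<le> (norm x - 1) powr (- (real DIM('a) + 2 * s))"
proof -
  have "norm x - 1 \<le> norm (y - x)" using y norm_triangle_ineq2[of x y] by (simp add: norm_minus_commute)
  then show ?thesis unfolding kern_def using x s0 by (intro powr_mono2') auto
qed

lemma tail_integrable:
  assumes x: "norm x > 1"
  shows "integrable lborel (\<lambda>y. excess y * kern s (y - x))"
    and "tail x \<le> (norm x - 1) powr (- (real DIM('a) + 2 * s)) * (\<integral>y. excess y \<partial>lborel)"
    and "tail x > 0"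
proof -
  let ?c = "(norm x - 1) powr (- (real DIM('a) + 2 * s))"
  have le: "AE y in lborel. excess y * kern s (y - x) \<le> ?c * excess y"
    using AE_nonzero
  proof eventually_elim
    case (elim y)
    then show ?case
      using excess_outside[of y] mult_left_mono[OF kern_tail_le[OF x, of y] excess_nonneg[of y]]
      by (cases "norm y < 1") (auto simp: mult.commute)
  qed
  have nn: "AE y in lborel. 0 \<le> excess y * kern s (y - x)"
    using AE_nonzero by eventually_elim (simp add: excess_nonneg)
  show i: "integrable lborel (\<lambda>y. excess y * kern s (y - x))"
  proof (rule Bochner_Integration.integrable_bound[OF integrable_mult_right[OF excess_integrable, of ?c]])
    show "AE y in lborel. norm (excess y * kern s (y - x)) \<le> norm (?c * excess y)"
      using le nn by eventually_elim (simp only: real_norm_def abs_of_nonneg order_trans[OF _ abs_ge_self])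
  qed measurable
  show "tail x \<le> ?c * (\<integral>y. excess y \<partial>lborel)"
    unfolding tail_def integral_mult_right_zero[symmetric]
    by (rule integral_mono_AE[OF i integrable_mult_right[OF excess_integrable] le])
  show "tail x > 0"
    unfolding tail_def
  proof (rule integral_pos_open[OF i nn, of "ball 0 1 - {0}"])
    show "open (ball 0 1 - {0::'a})" by (intro open_Diff) auto
    obtain e :: 'a where "e \<in> Basis" using nonempty_Basis by blast
    then have "(1/2) *\<^sub>R e \<in> ball 0 1 - {0}" by auto
    then show "ball 0 1 - {0::'a} \<noteq> {}" by blast
    fix y :: 'a assume "y \<in> ball 0 1 - {0}"
    then show "0 < excess y * kern s (y - x)"
      using x by (intro mult_pos_pos kern_pos) (auto simp: excess_def capped_less_riesz)
  qed
qed

lemma Lam_far: assumes x: "norm x > 1" shows "\<Lambda> x = slap s riesz x + tail x"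
proof -
  have x0: "x \<noteq> 0" using x by auto
  let ?f = "\<lambda>y. excess y * kern s (y - x)"
  have fm: "?f \<in> borel_measurable borel" by measurable
  note fi = tail_integrable(1)[OF x]
  have i1: "integrable lborel (\<lambda>z. ?f (x + z))" using fi by (subst integrable_translate_iff[OF fm])
  have i2: "integrable lborel (\<lambda>z. ?f (x - z))" using fi by (subst integrable_flip_iff[OF fm])
  have e: "sdiff capped z x * kern s z = sdiff riesz z x * kern s z + (?f (x + z) + ?f (x - z))" for z
    using excess_outside[of x] x kern_minus[of s z] by (simp add: sdiff_def excess_def algebra_simps del: kern_minus)
  have "(\<integral>z. sdiff capped z x * kern s z \<partial>lborel) = (\<integral>z. sdiff riesz z x * kern s z \<partial>lborel) + (tail x + tail x)"
    unfolding e
    using i1 i2 sdiff_riesz_int[OF x0] integral_translate[OF fm, of x] integral_flip[OF fm, of x] by (simp add: tail_def)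
  then show ?thesis by (simp add: \<Lambda>_def slap_def add_divide_distrib)
qed

lemma Lam_bounded: "\<exists>L\<ge>0. \<forall>x. \<bar>\<Lambda> x\<bar> \<le> L"
proof -
  define K where "K = M0 + 4 * (1 + \<theta>)"
  have K0: "K \<ge> 0" using M0_nonneg theta_pos by (simp add: K_def)
  have sd: "\<bar>sdiff capped z x\<bar> \<le> K * min (norm z powr 2) 1" for z x
  proof -
    have "\<bar>sdiff capped z x\<bar> \<le> 4 * (1 + \<theta>)"
      using capped_pos[of x] capped_pos[of "x + z"] capped_pos[of "x - z"]
        capped_le[of x] capped_le[of "x + z"] capped_le[of "x - z"] theta_pos
      unfolding sdiff_def by (intro abs_leI) (simp_all add: algebra_simps)
    then have 2: "\<bar>sdiff capped z x\<bar> \<le> K" using M0_nonneg by (simp add: K_def)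
    have "0 \<le> 4 * (1 + \<theta>) * norm z powr 2" using theta_pos by simp
    then have 1: "\<bar>sdiff capped z x\<bar> \<le> K * norm z powr 2"
      using sdiff_capped[of z x] unfolding K_def distrib_right by linarith
    show ?thesis using 1 2 by (simp add: min_def)
  qed
  define L where "L = (\<integral>z. K * (min (norm z powr 2) 1 * kern s z) \<partial>(lborel :: 'a measure)) / 2"
  have ki: "integrable lborel (\<lambda>z::'a. K * (min (norm z powr 2) 1 * kern s z))"
    by (intro integrable_mult_right integrable_min_kern s0 two_s)
  have "\<bar>\<Lambda> x\<bar> \<le> L" for x
  proof -
    have "\<bar>\<integral>z. sdiff capped z x * kern s z \<partial>lborel\<bar> \<le> (\<integral>z. K * (min (norm z powr 2) 1 * kern s z) \<partial>(lborel :: 'a measure))"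
    proof -
      have "norm (\<integral>z. sdiff capped z x * kern s z \<partial>lborel) \<le> (\<integral>z. norm (sdiff capped z x * kern s z) \<partial>lborel)"
        by (rule integral_norm_bound)
      also have "\<dots> \<le> (\<integral>z. K * (min (norm z powr 2) 1 * kern s z) \<partial>(lborel :: 'a measure))"
      proof (rule integral_mono)
        show "integrable lborel (\<lambda>z. norm (sdiff capped z x * kern s z))"
          using sdiff_capped_at_int[of 1 x] by (intro integrable_norm) (simp add: capped_1)
        fix z :: 'a
        show "norm (sdiff capped z x * kern s z) \<le> K * (min (norm z powr 2) 1 * kern s z)"
          using mult_right_mono[OF sd[of z x] kern_nonneg[of s z]] by (simp add: abs_mult mult.assoc)
      qed (rule ki)
      finally show ?thesis by simp
    qed
    then show ?thesis by (simp add: \<Lambda>_def slap_def L_def)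
  qed
  moreover have "L \<ge> 0" unfolding L_def using K0
    by (intro divide_nonneg_nonneg integral_nonneg_AE AE_I2) auto
  ultimately show ?thesis by blast
qed


lemma ball_integrable:
  assumes [measurable]: "g \<in> borel_measurable borel" and B: "\<And>x. \<bar>g x\<bar> \<le> B" and A: "A \<in> sets borel" "bounded A"
  shows "integrable lborel (\<lambda>x::'a. indicator A x * g x :: real)"
proof (rule Bochner_Integration.integrable_bound)
  show "integrable lborel (\<lambda>x::'a. B * indicator A x)"
    by (intro integrable_mult_right integrable_real_indicator) (use A(1) emeasure_bounded_finite[OF A(2)] in simp_all)
  show "AE x in lborel. norm (indicator A x * g x) \<le> norm (B * indicator A x)"
  proof (rule AE_I2)
    fix x :: 'a
    show "norm (indicator A x * g x) \<le> norm (B * indicator A x)"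
      using B[of x] by (simp add: indicator_def)
  qed
  show "(\<lambda>x::'a. indicator A x * g x) \<in> borel_measurable lborel"
    using A(1) assms(1) by (intro borel_measurable_times borel_measurable_indicator) simp_all
qed

text \<open>A nonzero coefficient would give the fractional Laplacian of the capped kernel a fixed amount of mass in every dyadic annulus, whereas the fractional Laplacian of a difference of two cut-offs integrates to zero.\<close>

lemma slap_riesz_zero: assumes x: "x \<noteq> 0" shows "slap s riesz x = 0"
proof -
  obtain k0 where k0: "\<And>x. x \<noteq> 0 \<Longrightarrow> slap s riesz x = k0 * norm x powr (- real DIM('a))"
    using slap_riesz_form by blast
  obtain L where L: "\<And>x. \<bar>\<Lambda> x\<bar> \<le> L" using Lam_bounded by blast
  let ?N = "real DIM('a)" and ?D = "slap s (test 1 2)"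
  have mb [measurable]: "ball (0::'a) r \<in> sets borel" for r by (simp add: borel_open)
  define A where "A = ball (0::'a) 1 - ball 0 (1/2)"
  have [measurable]: "A \<in> sets borel" unfolding A_def by (intro sets.Diff mb)
  have bA: "bounded A" unfolding A_def by (intro bounded_diff bounded_ball)
  define J where "J R = (\<integral>x. indicator (ball 0 R) x * ?D x \<partial>lborel)" for R
  have Di: "integrable lborel ?D" "(\<integral>x. ?D x \<partial>lborel) = 0"
    using integral_slap_test[of 1 2] by auto
  have J0: "(\<lambda>n. J (real n)) \<longlonglongrightarrow> 0"
    unfolding J_def Di(2)[symmetric]
  proof (rule integral_dominated_convergence[where w = "\<lambda>x. norm (?D x)"])
    show "integrable lborel (\<lambda>x. norm (?D x))" using Di(1) by (rule integrable_norm)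
    show "AE x in lborel. norm (indicator (ball 0 (real n)) x * ?D x) \<le> norm (?D x)" for n
      by (intro AE_I2) (simp add: indicator_def)
    show "AE x in lborel. (\<lambda>n. indicator (ball 0 (real n)) x * ?D x) \<longlonglongrightarrow> ?D x"
    proof (rule AE_I2)
      fix x :: 'a
      have "\<forall>\<^sub>F n in sequentially. norm x < real n"
        using filterlim_real_sequentially unfolding filterlim_at_top_dense by blast
      then have "\<forall>\<^sub>F n in sequentially. indicator (ball 0 (real n)) x * ?D x = ?D x"
        by eventually_elim simp
      then show "(\<lambda>n. indicator (ball 0 (real n)) x * ?D x) \<longlonglongrightarrow> ?D x" by (rule tendsto_eventually)
    qed
    have [measurable]: "?D \<in> borel_measurable lborel" using Di(1) by (rule borel_measurable_integrable)
    show "?D \<in> borel_measurable lborel" by fact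
    show "(\<lambda>x. indicator (ball 0 (real n)) x * ?D x) \<in> borel_measurable lborel" for n
      by (intro borel_measurable_times borel_measurable_indicator) (simp_all add: borel_open)
  qed
  have J1: "J R = (\<integral>y. indicator A y * (R powr ?N * \<Lambda> (R *\<^sub>R y)) \<partial>lborel)" if R: "R > 0" for R
  proof -
    have LI: "integrable lborel (\<lambda>x. indicator (ball 0 r) x * \<Lambda> x)" for r
      by (rule ball_integrable[OF _ L]) auto
    have D: "?D x = \<Lambda> x - 2 powr (- ?N) * \<Lambda> ((1/2) *\<^sub>R x)" for x
      using slap_test[of 1 2 x] by simp
    let ?g = "\<lambda>x. indicator (ball 0 R) x * (2 powr (- ?N) * \<Lambda> ((1/2) *\<^sub>R x))"
    have g2: "?g (0 + 2 *\<^sub>R x) = 2 powr (- ?N) * (indicator (ball 0 (R/2)) x * \<Lambda> x)" for x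
      by (auto simp: indicator_def)
    have gm: "?g \<in> borel_measurable borel" by measurable
    have gi: "integrable lborel ?g"
      using integrable_affine_iff[of 2 ?g 0] LI[of "R/2"] gm unfolding g2 by (simp add: integrable_mult_right)
    have "(\<integral>x. ?g x \<partial>lborel) = \<bar>2\<bar> ^ DIM('a) *\<^sub>R (\<integral>x. ?g (0 + 2 *\<^sub>R x) \<partial>lborel)"
      by (rule integral_affine[OF _ gm]) simp
    also have "\<dots> = (2 powr ?N * 2 powr (- ?N)) * (\<integral>x. indicator (ball 0 (R/2)) x * \<Lambda> x \<partial>lborel)"
      unfolding g2 by (simp add: norm_power_dim mult.assoc)
    also have "2 powr ?N * 2 powr (- ?N) = (1::real)" by (simp add: powr_add[symmetric])
    finally have G: "(\<integral>x. ?g x \<partial>lborel) = (\<integral>x. indicator (ball 0 (R/2)) x * \<Lambda> x \<partial>lborel)" by simp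
    have "J R = (\<integral>x. indicator (ball 0 R) x * \<Lambda> x - ?g x \<partial>lborel)"
      unfolding J_def D by (simp add: right_diff_distrib)
    also have "\<dots> = (\<integral>x. indicator (ball 0 R) x * \<Lambda> x \<partial>lborel) - (\<integral>x. indicator (ball 0 (R/2)) x * \<Lambda> x \<partial>lborel)"
      using LI[of R] gi G by simp
    also have "\<dots> = (\<integral>x. indicator (ball 0 R - ball 0 (R/2)) x * \<Lambda> x \<partial>lborel)"
    proof -
      have "indicator (ball 0 R - ball 0 (R/2)) x * \<Lambda> x = indicator (ball 0 R) x * \<Lambda> x - indicator (ball 0 (R/2)) x * \<Lambda> x" for x
        using R by (auto simp: indicator_def)
      then show ?thesis using LI[of R] LI[of "R/2"] by simp
    qed
    also have "\<dots> = \<bar>R\<bar> ^ DIM('a) *\<^sub>R (\<integral>y. indicator (ball 0 R - ball 0 (R/2)) (0 + R *\<^sub>R y) * \<Lambda> (0 + R *\<^sub>R y) \<partial>lborel)"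
      using R by (intro integral_affine) auto
    also have "\<dots> = (\<integral>y. indicator A y * (R powr ?N * \<Lambda> (R *\<^sub>R y)) \<partial>lborel)"
      using R unfolding real_scaleR_def integral_mult_right_zero[symmetric]
      by (intro Bochner_Integration.integral_cong) (auto simp: indicator_def A_def norm_power_dim)
    finally show ?thesis .
  qed
  define c where "c = (\<integral>y. indicator A y * norm y powr (- ?N) \<partial>lborel)"
  define d where "d = (\<integral>y. excess y \<partial>lborel)"
  have d0: "d \<ge> 0" unfolding d_def using AE_nonzero by (intro integral_nonneg_AE) (auto elim!: eventually_mono simp: excess_nonneg)
  have nA: "1/2 \<le> norm y" "norm y < 1" if "y \<in> A" for y using that by (auto simp: A_def)
  have ci: "integrable lborel (\<lambda>y. indicator A y * norm y powr (- ?N))"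
  proof -
    have "integrable lborel (\<lambda>y. indicator A y * min (norm y powr (- ?N)) ((1/2) powr (- ?N)))"
      by (rule ball_integrable[where B = "(1/2) powr (- ?N)"]) (auto simp: bA)
    moreover have "indicator A y * min (norm y powr (- ?N)) ((1/2) powr (- ?N)) = indicator A y * norm y powr (- ?N)" for y
      using nA[of y] powr_mono2'[of "- ?N" "1/2" "norm y"] by (auto simp: indicator_def)
    ultimately show ?thesis by simp
  qed
  have cpos: "c > 0" unfolding c_def
  proof (rule integral_pos_open[OF ci, of "ball 0 1 - cball 0 (1/2)"])
    show "open (ball 0 1 - cball (0::'a) (1/2))" by (intro open_Diff) auto
    obtain e :: 'a where "e \<in> Basis" using nonempty_Basis by blast
    then have "(3/4) *\<^sub>R e \<in> ball 0 1 - cball 0 (1/2)" by auto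
    then show "ball 0 1 - cball (0::'a) (1/2) \<noteq> {}" by blast
    fix y :: 'a assume y: "y \<in> ball 0 1 - cball 0 (1/2)"
    then have "y \<in> A" "y \<noteq> 0" by (auto simp: A_def)
    then show "0 < indicator A y * norm y powr (- ?N)" by simp
  qed simp
  define V :: real where "V = (\<integral>y. indicator A y \<partial>(lborel :: 'a measure))"
  have AI: "integrable lborel (indicator A :: 'a \<Rightarrow> real)"
    using emeasure_bounded_finite[OF bA] by (intro integrable_real_indicator) auto
  have est: "\<bar>J (real n) - k0 * c\<bar> \<le> 4 powr (?N + 2 * s) * d * V * real n powr (- (2 * s))" if n: "n \<ge> 4" for n :: nat
  proof -
    let ?r = "real n"
    have r: "?r \<ge> 4" using n by simp
    have LIr: "integrable lborel (\<lambda>y. indicator A y * (?r powr ?N * \<Lambda> (?r *\<^sub>R y)))"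
    proof (rule ball_integrable[where B = "?r powr ?N * L"])
      show "\<bar>?r powr ?N * \<Lambda> (?r *\<^sub>R y)\<bar> \<le> ?r powr ?N * L" for y
        unfolding abs_mult by (intro mult_mono L) auto
    qed (auto simp: bA)
    let ?e = "4 powr (?N + 2 * s) * d * ?r powr (- (2 * s))"
    have pt: "norm (indicator A y * (?r powr ?N * \<Lambda> (?r *\<^sub>R y)) - k0 * (indicator A y * norm y powr (- ?N))) \<le> indicator A y * ?e" for y
    proof (cases "y \<in> A")
      case True
      note y = nA[OF True]
      have ny: "norm (?r *\<^sub>R y) \<ge> ?r / 2" using mult_left_mono[OF y(1), of ?r] r by simp
      have far: "norm (?r *\<^sub>R y) > 1" using ny r by linarith
      have q: "?r / 4 \<le> norm (?r *\<^sub>R y) - 1" using ny r by linarith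
      have "\<Lambda> (?r *\<^sub>R y) = k0 * norm (?r *\<^sub>R y) powr (- ?N) + tail (?r *\<^sub>R y)"
        using Lam_far[OF far] k0[of "?r *\<^sub>R y"] far by fastforce
      also have "norm (?r *\<^sub>R y) powr (- ?N) = ?r powr (- ?N) * norm y powr (- ?N)"
        using r by (simp add: powr_mult)
      finally have "?r powr ?N * \<Lambda> (?r *\<^sub>R y) = (?r powr ?N * ?r powr (- ?N)) * (k0 * norm y powr (- ?N)) + ?r powr ?N * tail (?r *\<^sub>R y)"
        by (simp add: algebra_simps)
      also have "?r powr ?N * ?r powr (- ?N) = 1" using r by (simp add: powr_add[symmetric])
      finally have 1: "?r powr ?N * \<Lambda> (?r *\<^sub>R y) - k0 * norm y powr (- ?N) = ?r powr ?N * tail (?r *\<^sub>R y)" by simp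
      have "tail (?r *\<^sub>R y) \<le> (norm (?r *\<^sub>R y) - 1) powr (- (?N + 2 * s)) * d"
        unfolding d_def by (rule tail_integrable(2)[OF far])
      also have "\<dots> \<le> (?r / 4) powr (- (?N + 2 * s)) * d"
        using q r s0 d0 by (intro mult_right_mono powr_mono2') auto
      also have "(?r / 4) powr (- (?N + 2 * s)) = 4 powr (?N + 2 * s) * ?r powr (- (?N + 2 * s))"
        using r by (simp only: powr_divide powr_minus) (simp add: powr_divide field_simps)
      finally have "?r powr ?N * tail (?r *\<^sub>R y) \<le> ?r powr ?N * (4 powr (?N + 2 * s) * ?r powr (- (?N + 2 * s)) * d)"
        by (intro mult_left_mono) auto
      also have "\<dots> = 4 powr (?N + 2 * s) * d * (?r powr ?N * ?r powr (- (?N + 2 * s)))" by (simp add: mult_ac)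
      also have "?r powr ?N * ?r powr (- (?N + 2 * s)) = ?r powr (- (2 * s))" by (simp add: powr_add[symmetric])
      finally have 2: "?r powr ?N * tail (?r *\<^sub>R y) \<le> ?e" .
      have "0 \<le> ?r powr ?N * tail (?r *\<^sub>R y)" using tail_integrable(3)[OF far] by (intro mult_nonneg_nonneg) auto
      then show ?thesis using 1 2 True by simp
    qed simp
    define f1 f2 where "f1 y = indicator A y * (?r powr ?N * \<Lambda> (?r *\<^sub>R y))"
      and "f2 y = k0 * (indicator A y * norm y powr (- ?N))" for y
    define E where "E = ?e"
    have i1: "integrable lborel f1" unfolding f1_def[abs_def] by (rule LIr)
    have i2: "integrable lborel f2" unfolding f2_def[abs_def] using ci by (rule integrable_mult_right)
    have i3: "integrable lborel (\<lambda>y. norm (f1 y - f2 y))"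
      using i1 i2 by (intro integrable_norm Bochner_Integration.integrable_diff)
    have i4: "integrable lborel (\<lambda>y. indicator A y * E)" using AI by (rule integrable_mult_left)
    have "J ?r = integral\<^sup>L lborel f1" unfolding f1_def[abs_def] by (rule J1) (use r in linarith)
    moreover have "k0 * c = integral\<^sup>L lborel f2" unfolding f2_def[abs_def] c_def by (rule integral_mult_right_zero[symmetric])
    ultimately have "\<bar>J ?r - k0 * c\<bar> = norm (\<integral>y. f1 y - f2 y \<partial>lborel)"
      using i1 i2 by simp
    also have "\<dots> \<le> (\<integral>y. norm (f1 y - f2 y) \<partial>lborel)"
      by (rule integral_norm_bound)
    also have "\<dots> \<le> (\<integral>y. indicator A y * E \<partial>lborel)"
      by (rule integral_mono[OF i3 i4]) (unfold f1_def f2_def E_def, rule pt)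
    also have "\<dots> = E * V" unfolding V_def by simp
    also have "\<dots> = 4 powr (?N + 2 * s) * d * V * ?r powr (- (2 * s))" unfolding E_def by (simp only: mult_ac)
    finally show ?thesis .
  qed
  have J2: "(\<lambda>n. J (real n)) \<longlonglongrightarrow> k0 * c"
  proof -
    have "(\<lambda>n. 4 powr (?N + 2 * s) * d * V * real n powr (- (2 * s))) \<longlonglongrightarrow> 4 powr (?N + 2 * s) * d * V * 0"
      by (intro tendsto_mult tendsto_const tendsto_neg_powr filterlim_real_sequentially) (use s0 in simp)
    then have z: "(\<lambda>n. 4 powr (?N + 2 * s) * d * V * real n powr (- (2 * s))) \<longlonglongrightarrow> 0" by simp
    have "(\<lambda>n. J (real n) - k0 * c) \<longlonglongrightarrow> 0"
    proof (rule Lim_null_comparison[OF _ z])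
      show "\<forall>\<^sub>F n in sequentially. norm (J (real n) - k0 * c) \<le> 4 powr (?N + 2 * s) * d * V * real n powr (- (2 * s))"
        unfolding real_norm_def by (rule eventually_sequentiallyI[of 4], rule est)
    qed
    then show ?thesis by (rule LIM_zero_cancel)
  qed
  have "k0 * c = 0" using LIMSEQ_unique[OF J2 J0] .
  then show ?thesis using k0[OF x] cpos by simp
qed

lemma Lam_far_tail: "norm x > 1 \<Longrightarrow> \<Lambda> x = tail x"
  using Lam_far slap_riesz_zero[of x] by fastforce

lemma Lam_nonneg: assumes x: "x \<noteq> 0" shows "\<Lambda> x \<ge> 0"
proof (cases "norm x > 1")
  case True then show ?thesis using Lam_far_tail[OF True] tail_integrable(3)[OF True] by simp
next
  case False
  define c where "c = (x \<bullet> x) powr (\<theta> + 1)"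
  have xx: "0 < x \<bullet> x" "x \<bullet> x \<le> 1" using x False by (auto simp: dot_square_norm power_le_one)
  have key: "capped y - capped x \<le> c * (riesz y - riesz x)" if "y \<noteq> 0" for y
    unfolding capped_def riesz_eq c_def using that xx theta_pos by (intro cap_concave) auto
  have ne: "AE z in lborel. z \<noteq> x" "AE z in lborel. z \<noteq> - x" by (rule AE_lborel_singleton)+
  have "(\<integral>z. c * (sdiff riesz z x * kern s z) \<partial>lborel) \<le> (\<integral>z. sdiff capped z x * kern s z \<partial>lborel)"
  proof (rule integral_mono_AE)
    show "integrable lborel (\<lambda>z. c * (sdiff riesz z x * kern s z))"
      by (intro integrable_mult_right sdiff_riesz_int x)
    show "integrable lborel (\<lambda>z. sdiff capped z x * kern s z)"
      using sdiff_capped_at_int[of 1 x] by (simp add: capped_1)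
    show "AE z in lborel. c * (sdiff riesz z x * kern s z) \<le> sdiff capped z x * kern s z"
      using ne
    proof eventually_elim
      case (elim z)
      then have "x - z \<noteq> 0" "x + z \<noteq> 0" by (auto simp: add_eq_0_iff)
      then have "c * sdiff riesz z x \<le> sdiff capped z x"
        using key[of "x - z"] key[of "x + z"] by (simp add: sdiff_def algebra_simps)
      then have "c * sdiff riesz z x * kern s z \<le> sdiff capped z x * kern s z"
        by (rule mult_right_mono) simp
      then show ?case by (simp add: mult.assoc)
    qed
  qed
  moreover have "(\<integral>z. c * (sdiff riesz z x * kern s z) \<partial>lborel) = 0"
    using slap_riesz_zero[OF x] by (simp add: slap_def)
  ultimately have "0 \<le> (\<integral>z. sdiff capped z x * kern s z \<partial>lborel)" by linarith
  then show ?thesis by (simp add: \<Lambda>_def slap_def)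
qed

lemma Lam_decay: "\<exists>C\<ge>0. \<forall>x. \<bar>\<Lambda> x\<bar> \<le> C * (1 / (1 + norm x powr (real DIM('a) + 2 * s)))"
proof -
  let ?m = "real DIM('a) + 2 * s"
  obtain L where L: "L \<ge> 0" "\<And>x. \<bar>\<Lambda> x\<bar> \<le> L" using Lam_bounded by blast
  define d where "d = (\<integral>y. excess y \<partial>lborel)"
  have d0: "d \<ge> 0" unfolding d_def using AE_nonzero by (intro integral_nonneg_AE) (auto elim!: eventually_mono simp: excess_nonneg)
  define C where "C = L * (1 + 2 powr ?m) + 2 * (2 powr ?m * d)"
  have "\<bar>\<Lambda> x\<bar> \<le> C * (1 / (1 + norm x powr ?m))" for x
  proof -
    have p: "1 + norm x powr ?m > 0" by (simp add: add_pos_nonneg)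
    have "\<bar>\<Lambda> x\<bar> * (1 + norm x powr ?m) \<le> C"
    proof (cases "norm x < 2")
      case True
      then have "norm x powr ?m \<le> 2 powr ?m" using s0 by (intro powr_mono2) auto
      then have "\<bar>\<Lambda> x\<bar> * (1 + norm x powr ?m) \<le> L * (1 + 2 powr ?m)"
        using L by (intro mult_mono) auto
      then show ?thesis using d0 by (simp add: C_def add_increasing2)
    next
      case False
      then have far: "norm x > 1" and pos: "norm x > 0" by auto
      have "norm x powr ?m \<ge> 1" using far s0 by (intro ge_one_powr_ge_zero) auto
      have "\<bar>\<Lambda> x\<bar> = tail x" using Lam_far_tail[OF far] tail_integrable(3)[OF far] by simp
      also have "\<dots> \<le> (norm x - 1) powr (- ?m) * d" unfolding d_def by (rule tail_integrable(2)[OF far])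
      also have "\<dots> \<le> (norm x / 2) powr (- ?m) * d"
        using False d0 s0 by (intro mult_right_mono powr_mono2') auto
      also have "(norm x / 2) powr (- ?m) = 2 powr ?m * norm x powr (- ?m)"
        using pos by (simp only: powr_divide powr_minus) (simp add: powr_divide field_simps)
      finally have "\<bar>\<Lambda> x\<bar> * (1 + norm x powr ?m) \<le> (2 powr ?m * norm x powr (- ?m) * d) * (2 * norm x powr ?m)"
        using \<open>norm x powr ?m \<ge> 1\<close> d0 by (intro mult_mono) auto
      also have "\<dots> = 2 * (2 powr ?m * d) * (norm x powr (- ?m) * norm x powr ?m)" by (simp add: mult_ac)
      also have "norm x powr (- ?m) * norm x powr ?m = 1" using pos by (simp only: powr_add[symmetric]) simp
      finally show ?thesis using L by (simp add: C_def add_increasing)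
    qed
    then show ?thesis using p by (simp add: pos_le_divide_eq)
  qed
  moreover have "C \<ge> 0" using L d0 by (simp add: C_def)
  ultimately show ?thesis by blast
qed

lemma Lam_integrable: "integrable lborel \<Lambda>"
proof -
  obtain C where C: "\<And>x. \<bar>\<Lambda> x\<bar> \<le> C * (1 / (1 + norm x powr (real DIM('a) + 2 * s)))" using Lam_decay by blast
  show ?thesis
  proof (rule Bochner_Integration.integrable_bound[OF integrable_mult_right[OF integrable_weight_powr[OF s0], of C]])
    show "AE x in lborel. norm (\<Lambda> x) \<le> norm (C * (1 / (1 + norm x powr (real DIM('a) + 2 * s))))"
      by (rule AE_I2) (metis C abs_ge_self order_trans real_norm_def)
  qed measurable
qed

text \<open>The fractional Laplacian of the capped kernel is nonnegative away from the origin and positive far out, where only the removed mass contributes.\<close>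

lemma kappa_pos: "\<kappa> > 0"
  unfolding \<kappa>_def
proof (rule integral_pos_open[OF Lam_integrable, of "- cball 0 1"])
  show "AE x in lborel. 0 \<le> \<Lambda> x" using AE_nonzero by eventually_elim (rule Lam_nonneg)
  obtain e :: 'a where "e \<in> Basis" using nonempty_Basis by blast
  then have "2 *\<^sub>R e \<in> - cball 0 1" by auto
  then show "- cball (0::'a) 1 \<noteq> {}" by blast
  fix x :: 'a assume "x \<in> - cball 0 1"
  then show "0 < \<Lambda> x" using Lam_far_tail[of x] tail_integrable(3)[of x] by simp
qed (simp add: open_Compl)


lemma kappa_avg:
  fixes w :: "'a \<Rightarrow> real"
  assumes [measurable]: "w \<in> borel_measurable borel" and B: "\<And>x. \<bar>w x\<bar> \<le> B"
  shows avg_integrable: "integrable lborel (\<lambda>z. \<Lambda> z * w (c *\<^sub>R z))"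
    and avg_scale: "c > 0 \<Longrightarrow> integrable lborel (\<lambda>y. c powr (- real DIM('a)) * \<Lambda> ((1 / c) *\<^sub>R y) * w y) \<and>
      (\<integral>y. c powr (- real DIM('a)) * \<Lambda> ((1 / c) *\<^sub>R y) * w y \<partial>lborel) = (\<integral>z. \<Lambda> z * w (c *\<^sub>R z) \<partial>lborel)"
proof -
  have B0: "B \<ge> 0" using B[of 0] by linarith
  show 1: "integrable lborel (\<lambda>z. \<Lambda> z * w (c *\<^sub>R z))"
  proof (rule Bochner_Integration.integrable_bound[OF integrable_mult_left[OF Lam_integrable, of B]])
    show "AE z in lborel. norm (\<Lambda> z * w (c *\<^sub>R z)) \<le> norm (\<Lambda> z * B)"
    proof (rule AE_I2)
      fix z :: 'a
      have "\<bar>\<Lambda> z\<bar> * \<bar>w (c *\<^sub>R z)\<bar> \<le> \<bar>\<Lambda> z\<bar> * B" by (intro mult_left_mono B) simp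
      then show "norm (\<Lambda> z * w (c *\<^sub>R z)) \<le> norm (\<Lambda> z * B)" using B0 by (simp add: abs_mult)
    qed
  qed measurable
  assume c: "c > 0"
  let ?g = "\<lambda>y. c powr (- real DIM('a)) * \<Lambda> ((1 / c) *\<^sub>R y) * w y"
  have gm: "?g \<in> borel_measurable borel" by measurable
  have e: "?g (0 + c *\<^sub>R z) = c powr (- real DIM('a)) * (\<Lambda> z * w (c *\<^sub>R z))" for z using c by simp
  have i: "integrable lborel (\<lambda>z. ?g (0 + c *\<^sub>R z))" unfolding e using 1 by (rule integrable_mult_right)
  have "integrable lborel ?g" using i integrable_affine_iff[of c ?g 0] c gm by simp
  moreover have "(\<integral>y. ?g y \<partial>lborel) = \<bar>c\<bar> ^ DIM('a) *\<^sub>R (\<integral>z. ?g (0 + c *\<^sub>R z) \<partial>lborel)"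
    by (rule integral_affine[OF _ gm]) (use c in simp)
  moreover have "\<bar>c\<bar> ^ DIM('a) *\<^sub>R (\<integral>z. ?g (0 + c *\<^sub>R z) \<partial>lborel)
      = (c powr real DIM('a) * c powr (- real DIM('a))) * (\<integral>z. \<Lambda> z * w (c *\<^sub>R z) \<partial>lborel)"
    unfolding e integral_mult_right_zero using c by (simp add: norm_power_dim)
  moreover have "c powr real DIM('a) * c powr (- real DIM('a)) = 1" using c by (simp add: powr_add[symmetric])
  ultimately show "integrable lborel ?g \<and> (\<integral>y. ?g y \<partial>lborel) = (\<integral>z. \<Lambda> z * w (c *\<^sub>R z) \<partial>lborel)" by simp
qed

lemma test_identity:
  fixes w :: "'a \<Rightarrow> real"
  assumes e: "0 < \<epsilon>" "\<epsilon> \<le> R" and [measurable]: "w \<in> borel_measurable borel" and B: "\<And>x. \<bar>w x\<bar> \<le> B"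
    and \<alpha>: "\<alpha> > 2 * s" and K: "K \<ge> 0" "\<And>y z. norm y \<le> R \<Longrightarrow> \<bar>sdiff w z y\<bar> \<le> K * min (norm z powr \<alpha>) 1"
    and int: "\<And>y. integrable lborel (\<lambda>z. sdiff w z y * kern s z)"
  shows "integrable lborel (\<lambda>y. slap s w y * test \<epsilon> R y)"
    and "(\<integral>y. slap s w y * test \<epsilon> R y \<partial>lborel) = (\<integral>z. \<Lambda> z * w (\<epsilon> *\<^sub>R z) \<partial>lborel) - (\<integral>z. \<Lambda> z * w (R *\<^sub>R z) \<partial>lborel)"
proof -
  define I where "I = (\<integral>x. test \<epsilon> R x \<partial>lborel)"
  have ti: "integrable lborel (test \<epsilon> R)" by (rule test_integrable[OF e])
  have I0: "I \<ge> 0" unfolding I_def by (intro integral_nonneg_AE AE_I2 test_nonneg e)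
  have bd: "(\<integral>\<^sup>+y. ennreal (\<bar>sdiff w z y\<bar> * norm (test \<epsilon> R y)) \<partial>lborel) \<le> ennreal (K * I * min (norm z powr \<alpha>) 1)" for z
  proof -
    have "(\<integral>\<^sup>+y. ennreal (\<bar>sdiff w z y\<bar> * norm (test \<epsilon> R y)) \<partial>lborel) \<le> (\<integral>\<^sup>+y. ennreal ((K * min (norm z powr \<alpha>) 1) * test \<epsilon> R y) \<partial>lborel)"
    proof (intro nn_integral_mono ennreal_leI)
      fix y
      show "\<bar>sdiff w z y\<bar> * norm (test \<epsilon> R y) \<le> (K * min (norm z powr \<alpha>) 1) * test \<epsilon> R y"
      proof (cases "norm y \<le> R")
        case True
        then show ?thesis using K(2)[OF True, of z] test_nonneg[OF e, of y] by (simp add: mult_right_mono)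
      qed (simp add: test_outside[OF e])
    qed
    also have "\<dots> = ennreal (\<integral>y. (K * min (norm z powr \<alpha>) 1) * test \<epsilon> R y \<partial>lborel)"
      using K(1) by (intro nn_integral_eq_integral integrable_mult_right ti AE_I2 mult_nonneg_nonneg test_nonneg e) auto
    also have "(\<integral>y. (K * min (norm z powr \<alpha>) 1) * test \<epsilon> R y \<partial>lborel) = K * I * min (norm z powr \<alpha>) 1"
      unfolding I_def integral_mult_right_zero by simp
    finally show ?thesis .
  qed
  have KI: "K * I \<ge> 0" using K(1) I0 by simp
  note F = slap_fubini[of w "test \<epsilon> R" s \<alpha> "K * I", OF _ test_measurable s0 \<alpha> KI int bd]
  show "integrable lborel (\<lambda>y. slap s w y * test \<epsilon> R y)" using F(1) by simp
  have "(\<integral>y. slap s w y * test \<epsilon> R y \<partial>lborel) = (1/2) * (\<integral>z. kern s z * (\<integral>y. sdiff w z y * test \<epsilon> R y \<partial>lborel) \<partial>lborel)"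
    using F(2) by simp
  also have "\<dots> = (\<integral>y. slap s (test \<epsilon> R) y * w y \<partial>lborel)"
    using duality(2)[OF e _ B] by (simp add: mult.commute)
  also have "\<dots> = (\<integral>y. \<epsilon> powr (- real DIM('a)) * \<Lambda> ((1 / \<epsilon>) *\<^sub>R y) * w y - R powr (- real DIM('a)) * \<Lambda> ((1 / R) *\<^sub>R y) * w y \<partial>lborel)"
    by (simp only: slap_test[OF e] left_diff_distrib)
  also have "\<dots> = (\<integral>z. \<Lambda> z * w (\<epsilon> *\<^sub>R z) \<partial>lborel) - (\<integral>z. \<Lambda> z * w (R *\<^sub>R z) \<partial>lborel)"
    using avg_scale[OF assms(3) B, where c = \<epsilon>] avg_scale[OF assms(3) B, where c = R] e by simp
  finally show "(\<integral>y. slap s w y * test \<epsilon> R y \<partial>lborel) = (\<integral>z. \<Lambda> z * w (\<epsilon> *\<^sub>R z) \<partial>lborel) - (\<integral>z. \<Lambda> z * w (R *\<^sub>R z) \<partial>lborel)" .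
qed

lemma representation_0:
  fixes w :: "'a \<Rightarrow> real"
  assumes [measurable]: "w \<in> borel_measurable borel" and B: "\<And>x. \<bar>w x\<bar> \<le> B" and cont: "isCont w 0"
    and \<alpha>: "\<alpha> > 2 * s" and K: "\<And>R. \<exists>K\<ge>0. \<forall>y z. norm y \<le> R \<longrightarrow> \<bar>sdiff w z y\<bar> \<le> K * min (norm z powr \<alpha>) 1"
    and int: "\<And>y. integrable lborel (\<lambda>z. sdiff w z y * kern s z)"
    and nn: "\<And>y. slap s w y \<ge> 0"
    and avg: "(\<lambda>n. \<integral>z. \<Lambda> z * w (real (Suc n) *\<^sub>R z) \<partial>lborel) \<longlonglongrightarrow> 0"
  shows "(\<integral>\<^sup>+y. ennreal (riesz y * slap s w y) \<partial>lborel) = ennreal (\<kappa> * w 0)"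
proof -
  define \<epsilon> where "\<epsilon> n = 1 / real (Suc n)" for n
  define R where "R n = real (Suc n)" for n
  have eR: "0 < \<epsilon> n" "\<epsilon> n \<le> R n" for n
    by (auto simp: \<epsilon>_def R_def divide_le_eq intro: order_trans[of 1 "1 + real n"] mult_ge1_I)
  define a where "a n = (\<integral>y. slap s w y * test (\<epsilon> n) (R n) y \<partial>lborel)" for n
  have ai: "integrable lborel (\<lambda>y. slap s w y * test (\<epsilon> n) (R n) y)"
    and ae: "a n = (\<integral>z. \<Lambda> z * w (\<epsilon> n *\<^sub>R z) \<partial>lborel) - (\<integral>z. \<Lambda> z * w (R n *\<^sub>R z) \<partial>lborel)" for n
  proof -
    obtain K' where K': "K' \<ge> 0" "\<And>y z. norm y \<le> R n \<Longrightarrow> \<bar>sdiff w z y\<bar> \<le> K' * min (norm z powr \<alpha>) 1"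
      using K[of "R n"] by blast
    show "integrable lborel (\<lambda>y. slap s w y * test (\<epsilon> n) (R n) y)"
      "a n = (\<integral>z. \<Lambda> z * w (\<epsilon> n *\<^sub>R z) \<partial>lborel) - (\<integral>z. \<Lambda> z * w (R n *\<^sub>R z) \<partial>lborel)"
      unfolding a_def using test_identity[OF eR assms(1) B \<alpha> K' int] by blast+
  qed
  have e0: "\<epsilon> \<longlonglongrightarrow> 0" unfolding \<epsilon>_def by (rule LIMSEQ_Suc[OF lim_1_over_n])
  have "(\<lambda>n. \<integral>z. \<Lambda> z * w (\<epsilon> n *\<^sub>R z) \<partial>lborel) \<longlonglongrightarrow> (\<integral>z. \<Lambda> z * w 0 \<partial>lborel)"
  proof (rule integral_dominated_convergence[where w = "\<lambda>z. norm (\<Lambda> z * B)"])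
    show "integrable lborel (\<lambda>z. norm (\<Lambda> z * B))" by (intro integrable_norm integrable_mult_left Lam_integrable)
    show "AE z in lborel. (\<lambda>n. \<Lambda> z * w (\<epsilon> n *\<^sub>R z)) \<longlonglongrightarrow> \<Lambda> z * w 0"
    proof (rule AE_I2)
      fix z :: 'a
      have "(\<lambda>n. \<epsilon> n *\<^sub>R z) \<longlonglongrightarrow> 0 *\<^sub>R z" by (intro tendsto_intros e0)
      then have "(\<lambda>n. w (\<epsilon> n *\<^sub>R z)) \<longlonglongrightarrow> w 0" using isCont_tendsto_compose[OF cont] by simp
      then show "(\<lambda>n. \<Lambda> z * w (\<epsilon> n *\<^sub>R z)) \<longlonglongrightarrow> \<Lambda> z * w 0" by (intro tendsto_intros)
    qed
    show "AE z in lborel. norm (\<Lambda> z * w (\<epsilon> n *\<^sub>R z)) \<le> norm (\<Lambda> z * B)" for n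
    proof (rule AE_I2)
      fix z :: 'a
      have "\<bar>\<Lambda> z\<bar> * \<bar>w (\<epsilon> n *\<^sub>R z)\<bar> \<le> \<bar>\<Lambda> z\<bar> * \<bar>B\<bar>" using B[of "\<epsilon> n *\<^sub>R z"] by (intro mult_left_mono) auto
      then show "norm (\<Lambda> z * w (\<epsilon> n *\<^sub>R z)) \<le> norm (\<Lambda> z * B)" by (simp add: abs_mult)
    qed
  qed measurable
  moreover have "(\<integral>z. \<Lambda> z * w 0 \<partial>lborel) = \<kappa> * w 0" by (simp add: \<kappa>_def)
  ultimately have "(\<lambda>n. \<integral>z. \<Lambda> z * w (\<epsilon> n *\<^sub>R z) \<partial>lborel) \<longlonglongrightarrow> \<kappa> * w 0" by (simp only:)
  from tendsto_diff[OF this avg] have lim1: "a \<longlonglongrightarrow> \<kappa> * w 0"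
    unfolding ae[abs_def] R_def by simp
  define f where "f n y = ennreal (indicator (- {0}) y * (slap s w y * test (\<epsilon> n) (R n) y))" for n y
  have fa: "(\<integral>\<^sup>+y. f n y \<partial>lborel) = ennreal (a n)" for n
  proof -
    have "(\<integral>\<^sup>+y. f n y \<partial>lborel) = (\<integral>\<^sup>+y. ennreal (slap s w y * test (\<epsilon> n) (R n) y) \<partial>lborel)"
      by (rule nn_integral_cong_AE) (use AE_nonzero in eventually_elim, simp add: f_def)
    also have "\<dots> = ennreal (a n)" unfolding a_def
      by (intro nn_integral_eq_integral ai AE_I2 mult_nonneg_nonneg nn test_nonneg eR)
    finally show ?thesis .
  qed
  have "(\<lambda>n. \<integral>\<^sup>+y. f n y \<partial>lborel) \<longlonglongrightarrow> (\<integral>\<^sup>+y. ennreal (riesz y * slap s w y) \<partial>lborel)"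
  proof (rule nn_integral_LIMSEQ)
    show "incseq f"
    proof (rule incseq_SucI, rule le_funI)
      fix n y
      have "capped_at (\<epsilon> n) y \<le> capped_at (\<epsilon> (Suc n)) y"
        by (rule capped_at_antimono) (auto simp: \<epsilon>_def divide_le_eq field_simps)
      moreover have "capped_at (R (Suc n)) y \<le> capped_at (R n) y"
        by (rule capped_at_antimono) (auto simp: R_def)
      ultimately have "test (\<epsilon> n) (R n) y \<le> test (\<epsilon> (Suc n)) (R (Suc n)) y" by (simp add: test_def)
      then show "f n y \<le> f (Suc n) y" unfolding f_def using nn[of y] by (intro ennreal_leI mult_left_mono) auto
    qed
    show "f n \<in> borel_measurable lborel" for n
      unfolding f_def[abs_def] by measurable
    fix y :: 'a
    show "(\<lambda>n. f n y) \<longlonglongrightarrow> ennreal (riesz y * slap s w y)"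
    proof (cases "y = 0")
      case False
      have "\<forall>\<^sub>F n in sequentially. \<epsilon> n < norm y" using e0 False by (intro order_tendstoD) auto
      then have ev: "\<forall>\<^sub>F n in sequentially. capped_at (\<epsilon> n) y = riesz y"
        by eventually_elim (use eR in \<open>auto intro: capped_at_outside\<close>)
      have Rinf: "filterlim R at_top sequentially" unfolding R_def
        using filterlim_compose[OF filterlim_real_sequentially filterlim_Suc] by simp
      have "(\<lambda>n. capped_at (R n) y) \<longlonglongrightarrow> 0"
      proof (rule real_tendsto_sandwich[of "\<lambda>_. 0" _ _ "\<lambda>n. R n powr (- (2 * \<theta>)) * (1 + \<theta>)"])
        have "(\<lambda>n. R n powr (- (2 * \<theta>)) * (1 + \<theta>)) \<longlonglongrightarrow> 0 * (1 + \<theta>)"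
          by (intro tendsto_mult tendsto_const tendsto_neg_powr Rinf) (use theta_pos in simp)
        then show "(\<lambda>n. R n powr (- (2 * \<theta>)) * (1 + \<theta>)) \<longlonglongrightarrow> 0" by simp
        show "\<forall>\<^sub>F n in sequentially. 0 \<le> capped_at (R n) y"
          by (rule always_eventually) (use capped_at_pos in \<open>simp add: R_def less_imp_le\<close>)
        show "\<forall>\<^sub>F n in sequentially. capped_at (R n) y \<le> R n powr (- (2 * \<theta>)) * (1 + \<theta>)"
          by (rule always_eventually) (use capped_at_bounded in \<open>simp add: R_def\<close>)
      qed simp
      moreover have "(\<lambda>n. capped_at (\<epsilon> n) y) \<longlonglongrightarrow> riesz y" using ev by (rule tendsto_eventually)
      ultimately have "(\<lambda>n. test (\<epsilon> n) (R n) y) \<longlonglongrightarrow> riesz y - 0" unfolding test_def by (intro tendsto_diff)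
      then have "(\<lambda>n. slap s w y * test (\<epsilon> n) (R n) y) \<longlonglongrightarrow> slap s w y * riesz y" by (intro tendsto_intros) simp
      then show ?thesis unfolding f_def using False by (intro tendsto_ennrealI) (simp add: mult.commute)
    qed (simp add: f_def riesz_def)
  qed
  moreover have "(\<lambda>n. \<integral>\<^sup>+y. f n y \<partial>lborel) \<longlonglongrightarrow> ennreal (\<kappa> * w 0)"
    unfolding fa by (intro tendsto_ennrealI lim1)
  ultimately show ?thesis by (rule LIMSEQ_unique)
qed

text \<open>Testing with the difference of cut-offs at a small and a large scale: the small scale recovers the value at the point, the large one vanishes by the hypothesis on averages, and the test functions increase to the Riesz kernel.\<close>

theorem representation:
  fixes v :: "'a \<Rightarrow> real"
  assumes [measurable]: "v \<in> borel_measurable borel" and B: "\<And>x. \<bar>v x\<bar> \<le> B" and cont: "isCont v x"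
    and \<alpha>: "\<alpha> > 2 * s" and K: "\<And>R. \<exists>K\<ge>0. \<forall>y z. norm y \<le> R \<longrightarrow> \<bar>sdiff v z y\<bar> \<le> K * min (norm z powr \<alpha>) 1"
    and nn: "\<And>y. slap s v y \<ge> 0"
    and avg: "(\<lambda>n. \<integral>z. \<Lambda> z * v (x - real (Suc n) *\<^sub>R z) \<partial>lborel) \<longlonglongrightarrow> 0"
  shows "(\<integral>\<^sup>+y. ennreal (riesz (x - y) * slap s v y) \<partial>lborel) = ennreal (\<kappa> * v x)"
proof -
  have int: "integrable lborel (\<lambda>z. sdiff v z y * kern s z)" for y
  proof -
    obtain K' where K': "K' \<ge> 0" "\<forall>y' z. norm y' \<le> norm y \<longrightarrow> \<bar>sdiff v z y'\<bar> \<le> K' * min (norm z powr \<alpha>) 1"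
      using K by blast
    show ?thesis
    proof (rule sdiff_kern_integrable[OF weighted_bounded[OF s0 assms(1) B] s0 \<alpha> zero_less_one])
      fix z :: 'a
      have "\<bar>sdiff v z y\<bar> \<le> K' * min (norm z powr \<alpha>) 1" using K' by simp
      also have "\<dots> \<le> K' * norm z powr \<alpha>" using K' by (intro mult_left_mono) auto
      finally show "\<bar>sdiff v z y\<bar> \<le> K' * norm z powr \<alpha>" .
    qed
  qed
  have "(\<integral>\<^sup>+y. ennreal (riesz y * slap s (\<lambda>y. v (x - y)) y) \<partial>lborel) = ennreal (\<kappa> * v (x - 0))"
  proof (rule representation_0[OF _ _ _ \<alpha>])
    show "isCont (\<lambda>y. v (x - y)) 0"
      by (rule isCont_o2[where g = v]) (use cont in auto)
    fix R :: real
    obtain K' where K': "K' \<ge> 0" "\<And>y z. norm y \<le> norm x + R \<Longrightarrow> \<bar>sdiff v z y\<bar> \<le> K' * min (norm z powr \<alpha>) 1"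
      using K[of "norm x + R"] by blast
    have "\<bar>sdiff (\<lambda>y. v (x - y)) z y\<bar> \<le> K' * min (norm z powr \<alpha>) 1" if "norm y \<le> R" for y z
      unfolding sdiff_flip by (rule K') (use that norm_triangle_ineq4[of x y] in linarith)
    then show "\<exists>K\<ge>0. \<forall>y z. norm y \<le> R \<longrightarrow> \<bar>sdiff (\<lambda>y. v (x - y)) z y\<bar> \<le> K * min (norm z powr \<alpha>) 1"
      using K'(1) by blast
  qed (use B int nn avg in \<open>auto simp: sdiff_flip slap_flip\<close>)
  moreover have "(\<integral>\<^sup>+y. ennreal (riesz (x - (x - y)) * slap s v (x - y)) \<partial>lborel) = (\<integral>\<^sup>+y. ennreal (riesz (x - y) * slap s v y) \<partial>lborel)"
    by (rule nn_integral_flip[where f = "\<lambda>y. ennreal (riesz (x - y) * slap s v y)"]) measurable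
  ultimately show ?thesis by (simp add: slap_flip)
qed

end

section \<open>Truncations of a singular solution\<close>

definition trunc :: "real \<Rightarrow> real \<Rightarrow> real" where
  "trunc k t = (if t \<le> k then t else if t \<le> k + 1 then t - (t - k)\<^sup>2 / 2 else k + 1/2)"

definition slope :: "real \<Rightarrow> real \<Rightarrow> real" where
  "slope k t = max 0 (min 1 (1 - (t - k)))"

lemma slope_bounds: "0 \<le> slope k t" "slope k t \<le> 1" by (auto simp: slope_def)

lemma trunc_le_line:
  assumes c: "0 \<le> c" "c \<le> 1" shows "trunc k t \<le> k + c * (t - k) + (1 - c)\<^sup>2 / 2"
proof -
  consider "t \<le> k" | "k < t" "t \<le> k + 1" | "k + 1 < t" by linarith
  then show ?thesis
  proof cases
    case 1
    have "(1 - c) * (t - k) \<le> 0" using c 1 by (intro mult_nonneg_nonpos) auto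
    moreover have "0 \<le> (1 - c)\<^sup>2" by simp
    moreover have "c * (t - k) = (t - k) - (1 - c) * (t - k)" by (simp add: algebra_simps)
    moreover have "trunc k t = t" using 1 by (simp add: trunc_def)
    ultimately show ?thesis by linarith
  next
    case 2
    have "0 \<le> ((1 - c) - (t - k))\<^sup>2" by simp
    also have "((1 - c) - (t - k))\<^sup>2 = (1 - c)\<^sup>2 + (t - k)\<^sup>2 - 2 * (t - k) + 2 * (c * (t - k))"
      by (simp add: power2_eq_square algebra_simps)
    finally show ?thesis using 2 by (simp add: trunc_def)
  next
    case 3
    have "c * 1 \<le> c * (t - k)" using c 3 by (intro mult_left_mono) auto
    moreover have "(1 - c)\<^sup>2 = 1 - 2 * c + c\<^sup>2" by (simp add: power2_eq_square algebra_simps)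
    moreover have "0 \<le> c\<^sup>2" by simp
    moreover have "trunc k t = k + 1/2" using 3 by (simp add: trunc_def)
    ultimately show ?thesis by linarith
  qed
qed

lemma trunc_eq_line: "trunc k t = k + slope k t * (t - k) + (1 - slope k t)\<^sup>2 / 2"
  by (auto simp: trunc_def slope_def power2_eq_square algebra_simps)

text \<open>The truncation is concave, so it lies below its tangent lines.\<close>

lemma trunc_above: "trunc k b \<le> trunc k a + slope k a * (b - a)"
proof -
  have "trunc k b \<le> k + slope k a * (b - k) + (1 - slope k a)\<^sup>2 / 2"
    by (rule trunc_le_line) (rule slope_bounds)+
  also have "\<dots> = trunc k a + slope k a * (b - a)" by (subst trunc_eq_line) (simp add: algebra_simps)
  finally show ?thesis .
qed

lemma trunc_below: "trunc k a + slope k a * (b - a) - (b - a)\<^sup>2 \<le> trunc k b"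
proof -
  have "trunc k a \<le> trunc k b + slope k b * (a - b)" by (rule trunc_above)
  moreover have "(slope k a - slope k b) * (b - a) \<le> \<bar>slope k a - slope k b\<bar> * \<bar>b - a\<bar>"
    using abs_ge_self[of "(slope k a - slope k b) * (b - a)"] by (simp add: abs_mult)
  moreover have "\<bar>slope k a - slope k b\<bar> * \<bar>b - a\<bar> \<le> \<bar>b - a\<bar> * \<bar>b - a\<bar>"
    by (intro mult_right_mono) (auto simp: slope_def)
  moreover have "\<bar>b - a\<bar> * \<bar>b - a\<bar> = (b - a)\<^sup>2" by (simp add: power2_eq_square abs_mult_self_eq)
  moreover have "(slope k a - slope k b) * (b - a) = slope k a * (b - a) + slope k b * (a - b)"
    by (simp add: algebra_simps)
  ultimately show ?thesis by linarith
qed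

lemma trunc_le: "trunc k t \<le> t" using trunc_le_line[of 1 k t] by simp
lemma trunc_le_max: "trunc k t \<le> k + 1/2" using trunc_le_line[of 0 k t] by simp
lemma trunc_id: "t \<le> k \<Longrightarrow> trunc k t = t" by (simp add: trunc_def)
lemma trunc_top: "t \<ge> k + 1 \<Longrightarrow> trunc k t = k + 1/2" by (auto simp: trunc_def)

lemma trunc_nonneg: assumes "k \<ge> 0" "t \<ge> 0" shows "trunc k t \<ge> 0"
proof -
  have "slope k t * (t - k) \<ge> - k"
  proof (cases "t \<ge> k")
    case True then show ?thesis using mult_nonneg_nonneg[OF slope_bounds(1), of "t - k" k t] assms by linarith
  next
    case False
    then have "slope k t = 1" by (simp add: slope_def)
    then show ?thesis using assms by simp
  qed
  moreover have "0 \<le> (1 - slope k t)\<^sup>2 / 2" by simp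
  ultimately show ?thesis by (subst trunc_eq_line) linarith
qed

lemma continuous_on_trunc: "continuous_on UNIV (trunc k)"
proof -
  have "continuous_on UNIV (\<lambda>t. k + slope k t * (t - k) + (1 - slope k t)\<^sup>2 / 2)"
    unfolding slope_def by (intro continuous_intros) auto
  then show ?thesis by (simp add: trunc_eq_line[abs_def])
qed

lemma trunc_measurable [measurable]: "trunc k \<in> borel_measurable borel"
  by (rule borel_measurable_continuous_onI[OF continuous_on_trunc])

locale choquard = fractional s \<theta> T
  for s \<theta> :: real and T :: "'a::euclidean_space itself" +
  fixes u :: "'a \<Rightarrow> real" and \<mu> p q C \<alpha> :: real
  assumes uw: "weighted s u"
    and upos: "\<And>x. u x > 0"
    and ucont: "continuous_on (- {0}) u"
    and \<alpha>s: "\<alpha> > 2 * s"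
    and uloc: "\<And>K. compact K \<Longrightarrow> 0 \<notin> K \<Longrightarrow> \<exists>M\<ge>0. \<exists>\<delta>>0. \<forall>x\<in>K. \<forall>z. norm z \<le> \<delta> \<longrightarrow>
       \<bar>sdiff u z x\<bar> \<le> M * norm z powr \<alpha> \<and> (u (x + z) - u x)\<^sup>2 \<le> M * norm z powr \<alpha>"
    and \<mu>: "0 < \<mu>" "\<mu> < real DIM('a)"
    and p1: "p \<ge> 1" and q1: "q \<ge> 1"
    and psub: "p * (2 * \<theta>) \<le> 2 * real DIM('a) - \<mu>"
    and qsub: "q * (2 * \<theta>) \<le> real DIM('a) + 2 * s - \<mu>"
    and Hint: "\<And>x. x \<noteq> 0 \<Longrightarrow> integrable lborel (\<lambda>y. u y powr p * norm (x - y) powr (- \<mu>))"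
    and C: "C > 0"
    and eqn: "\<And>x. x \<noteq> 0 \<Longrightarrow> C * slap s u x = (\<integral>y. u y powr p * norm (x - y) powr (- \<mu>) \<partial>lborel) * u x powr q"
    and ulim: "filterlim u at_top (at 0)"
begin

definition H :: "'a \<Rightarrow> real" where "H x = (\<integral>y. u y powr p * norm (x - y) powr (- \<mu>) \<partial>lborel)"

lemma um [measurable]: "u \<in> borel_measurable borel" using uw by (rule weighted_measurable)

lemma H_nonneg: "H x \<ge> 0" unfolding H_def by (intro integral_nonneg_AE AE_I2) simp

definition v :: "real \<Rightarrow> 'a \<Rightarrow> real" where "v k x = (if x = 0 then k + 1/2 else trunc k (u x))"

lemma v_measurable [measurable]: "v k \<in> borel_measurable borel"
  unfolding v_def[abs_def] by measurable

lemma v_max: "v k x \<le> k + 1/2" by (simp add: v_def trunc_le_max)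

lemma v_nonneg: "k \<ge> 0 \<Longrightarrow> v k x \<ge> 0" using upos[of x] by (simp add: v_def trunc_nonneg less_imp_le)

lemma v_le: "x \<noteq> 0 \<Longrightarrow> v k x \<le> u x" by (simp add: v_def trunc_le)

lemma v_abs: "k \<ge> 0 \<Longrightarrow> \<bar>v k x\<bar> \<le> k + 1/2" using v_max[of k x] v_nonneg[of k x] by simp

lemma v_near: "\<exists>r>0. \<forall>x. norm x < r \<longrightarrow> v k x = k + 1/2"
proof -
  have "\<forall>\<^sub>F x in at 0. k + 1 \<le> u x" using ulim by (simp add: filterlim_at_top)
  then obtain r where r: "r > 0" "\<And>x. x \<noteq> 0 \<Longrightarrow> dist x 0 < r \<Longrightarrow> k + 1 \<le> u x"
    unfolding eventually_at by blast
  then show ?thesis by (intro exI[of _ r]) (auto simp: v_def trunc_top)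
qed

lemma v_cont: "isCont (v k) x"
proof (cases "x = 0")
  case True
  obtain r where r: "r > 0" "\<And>x. norm x < r \<Longrightarrow> v k x = k + 1/2" using v_near by blast
  have "\<forall>\<^sub>F y in nhds 0. v k y = k + 1/2"
    unfolding eventually_nhds_metric using r by (intro exI[of _ r]) simp
  then show ?thesis unfolding True by (subst isCont_cong) auto
next
  case False
  have "isCont u x" using ucont False by (simp add: continuous_on_eq_continuous_at open_Compl)
  moreover have "isCont (trunc k) (u x)" using continuous_on_trunc by (simp add: continuous_on_eq_continuous_at)
  ultimately have c: "isCont (\<lambda>x. trunc k (u x)) x" by (rule isCont_o2)
  have "\<forall>\<^sub>F y in nhds x. v k y = trunc k (u y)"
  proof -
    have "\<forall>\<^sub>F y in nhds x. y \<noteq> 0" using False by (rule t1_space_nhds)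
    then show ?thesis by eventually_elim (simp add: v_def)
  qed
  then show ?thesis using c by (subst isCont_cong) auto
qed

lemma sdiff_v_between:
  assumes x: "x \<noteq> 0" "x + z \<noteq> 0" "x - z \<noteq> 0"
  shows "slope k (u x) * sdiff u z x \<le> sdiff (v k) z x"
    and "sdiff (v k) z x \<le> slope k (u x) * sdiff u z x + (u (x + z) - u x)\<^sup>2 + (u (x + - z) - u x)\<^sup>2"
  using trunc_above[of k "u (x + z)" "u x"] trunc_above[of k "u (x - z)" "u x"]
    trunc_below[of k "u x" "u (x + z)"] trunc_below[of k "u x" "u (x - z)"] x
  by (simp_all add: sdiff_def v_def algebra_simps)

lemma v_loc:
  assumes K: "compact K" "0 \<notin> K"
  obtains M \<delta> where "M \<ge> 0" "\<delta> > 0"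
    "\<And>k x z. x \<in> K \<Longrightarrow> norm z \<le> \<delta> \<Longrightarrow> \<bar>sdiff (v k) z x\<bar> \<le> M * norm z powr \<alpha>"
    "\<And>x z. x \<in> K \<Longrightarrow> norm z \<le> \<delta> \<Longrightarrow> \<bar>sdiff u z x\<bar> \<le> M * norm z powr \<alpha>"
proof -
  obtain M \<delta> where M: "M \<ge> 0" "\<delta> > 0" and b: "\<And>x z. x \<in> K \<Longrightarrow> norm z \<le> \<delta> \<Longrightarrow>
       \<bar>sdiff u z x\<bar> \<le> M * norm z powr \<alpha> \<and> (u (x + z) - u x)\<^sup>2 \<le> M * norm z powr \<alpha>"
    using uloc[OF K] by blast
  obtain d where d: "d > 0" "\<And>x. x \<in> K \<Longrightarrow> d \<le> norm x"
    using separate_point_closed[OF compact_imp_closed[OF K(1)] K(2)] by (auto simp: dist_norm)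
  show ?thesis
  proof (rule that[of "3 * M" "min \<delta> (d / 2)"])
    show "3 * M \<ge> 0" "min \<delta> (d / 2) > 0" using M d by auto
    fix x z :: 'a assume x: "x \<in> K" and z: "norm z \<le> min \<delta> (d / 2)"
    have "norm z < norm x" using z d(2)[OF x] d(1) by auto
    then have nz: "x \<noteq> 0" "x + z \<noteq> 0" "x - z \<noteq> 0" by (auto simp: add_eq_0_iff)
    have z': "norm z \<le> \<delta>" "norm (- z) \<le> \<delta>" using z by auto
    have M0: "0 \<le> M * norm z powr \<alpha>" using M by simp
    have su: "\<bar>sdiff u z x\<bar> \<le> M * norm z powr \<alpha>" using b[OF x z'(1)] by blast
    then show "\<bar>sdiff u z x\<bar> \<le> 3 * M * norm z powr \<alpha>" using M0 by simp
    fix k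
    have "\<bar>slope k (u x) * sdiff u z x\<bar> \<le> 1 * \<bar>sdiff u z x\<bar>"
      unfolding abs_mult using slope_bounds[of k "u x"] by (intro mult_right_mono) auto
    then have "\<bar>slope k (u x) * sdiff u z x\<bar> \<le> M * norm z powr \<alpha>" using su by simp
    then show "\<bar>sdiff (v k) z x\<bar> \<le> 3 * M * norm z powr \<alpha>"
    proof -
      have "(u (x + z) - u x)\<^sup>2 \<le> M * norm z powr \<alpha>" "(u (x + - z) - u x)\<^sup>2 \<le> M * norm z powr \<alpha>"
        using b[OF x z'(1)] b[OF x z'(2)] by simp_all
      moreover have "3 * M * norm z powr \<alpha> = M * norm z powr \<alpha> + M * norm z powr \<alpha> + M * norm z powr \<alpha>" by simp
      ultimately show ?thesis
        using sdiff_v_between[OF nz, of k] \<open>\<bar>slope k (u x) * sdiff u z x\<bar> \<le> M * norm z powr \<alpha>\<close> M0 by linarith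
    qed
  qed
qed

lemma v_K: assumes k: "k \<ge> 0"
  shows "\<exists>K\<ge>0. \<forall>y z. norm y \<le> R \<longrightarrow> \<bar>sdiff (v k) z y\<bar> \<le> K * min (norm z powr \<alpha>) 1"
proof -
  have \<alpha>0: "\<alpha> > 0" using \<alpha>s s0 by linarith
  obtain r where r: "r > 0" "\<And>x. norm x < r \<Longrightarrow> v k x = k + 1/2" using v_near by blast
  define A where "A = cball (0::'a) R - ball 0 (r / 2)"
  have "compact A" unfolding A_def by (intro compact_diff) auto
  moreover have "0 \<notin> A" using r by (simp add: A_def)
  ultimately obtain M \<delta> where M: "M \<ge> 0" "\<delta> > 0"
    "\<And>k x z. x \<in> A \<Longrightarrow> norm z \<le> \<delta> \<Longrightarrow> \<bar>sdiff (v k) z x\<bar> \<le> M * norm z powr \<alpha>"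
    using v_loc by metis
  define \<eta> where "\<eta> = min 1 (min \<delta> (r / 2))"
  have \<eta>: "\<eta> > 0" "\<eta> \<le> 1" "\<eta> \<le> \<delta>" "\<eta> \<le> r / 2" using M r by (auto simp: \<eta>_def)
  define L where "L = 4 * (k + 1/2) * \<eta> powr (- \<alpha>)"
  have L0: "L \<ge> 4 * (k + 1/2)"
  proof -
    have "1 \<le> \<eta> powr (- \<alpha>)" using \<eta> \<alpha>0 powr_mono2'[of "- \<alpha>" \<eta> 1] by simp
    then show ?thesis unfolding L_def using k mult_left_mono[of 1 "\<eta> powr (- \<alpha>)" "4 * (k + 1/2)"] by simp
  qed
  have "\<bar>sdiff (v k) z y\<bar> \<le> (M + L) * min (norm z powr \<alpha>) 1" if y: "norm y \<le> R" for y z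
  proof (cases "norm z < \<eta>")
    case True
    have z1: "norm z powr \<alpha> \<le> 1" using True \<eta> \<alpha>0 powr_mono2[of \<alpha> "norm z" 1] by simp
    have "\<bar>sdiff (v k) z y\<bar> \<le> M * norm z powr \<alpha>"
    proof (cases "y \<in> A")
      case True then show ?thesis using M(3) \<open>norm z < \<eta>\<close> \<eta> by simp
    next
      case False
      then have "norm y < r / 2" using y by (simp add: A_def)
      moreover have "norm z < r / 2" using True \<eta> by simp
      ultimately have "norm (y + z) < r" "norm (y - z) < r" "norm y < r"
        using norm_triangle_ineq[of y z] norm_triangle_ineq4[of y z] r by auto
      then have "sdiff (v k) z y = 0" by (simp add: sdiff_def r)
      then show ?thesis using M by simp
    qed
    also have "\<dots> \<le> (M + L) * norm z powr \<alpha>" using L0 k by (intro mult_right_mono) auto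
    finally show ?thesis using z1 by simp
  next
    case False
    have b: "\<bar>sdiff (v k) z y\<bar> \<le> 4 * (k + 1/2)"
      using v_max[of k y] v_max[of k "y + z"] v_max[of k "y - z"] v_nonneg[OF k, of y] v_nonneg[OF k, of "y + z"] v_nonneg[OF k, of "y - z"] k
      unfolding sdiff_def by (intro abs_leI) (simp_all add: algebra_simps)
    have "1 \<le> \<eta> powr (- \<alpha>) * norm z powr \<alpha>"
    proof -
      have "\<eta> powr \<alpha> \<le> norm z powr \<alpha>" using False \<eta> \<alpha>0 by (intro powr_mono2) auto
      then show ?thesis unfolding powr_minus using \<eta> by (simp add: field_simps)
    qed
    then have "4 * (k + 1/2) * 1 \<le> 4 * (k + 1/2) * (\<eta> powr (- \<alpha>) * norm z powr \<alpha>)"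
      using k by (intro mult_left_mono) auto
    then have "4 * (k + 1/2) \<le> L * norm z powr \<alpha>" by (simp add: L_def mult_ac)
    moreover have "0 \<le> M * norm z powr \<alpha>" using M by simp
    ultimately have "\<bar>sdiff (v k) z y\<bar> \<le> (M + L) * norm z powr \<alpha>" using b by (simp add: distrib_right)
    moreover have "\<bar>sdiff (v k) z y\<bar> \<le> (M + L) * 1" using b L0 M by simp
    ultimately show ?thesis by (simp add: min_def)
  qed
  then show ?thesis using M L0 k by (intro exI[of _ "M + L"]) auto
qed

lemma v_int: assumes k: "k \<ge> 0" shows "integrable lborel (\<lambda>z. sdiff (v k) z y * kern s z)"
proof -
  obtain K where K: "K \<ge> 0" "\<forall>y' z. norm y' \<le> norm y \<longrightarrow> \<bar>sdiff (v k) z y'\<bar> \<le> K * min (norm z powr \<alpha>) 1"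
    using v_K[OF k, of "norm y"] by (elim exE conjE) (rule that)
  show ?thesis
  proof (rule sdiff_kern_integrable[OF weighted_bounded[OF s0 v_measurable v_abs[OF k]] s0 \<alpha>s zero_less_one])
    fix z :: 'a
    have "\<bar>sdiff (v k) z y\<bar> \<le> K * min (norm z powr \<alpha>) 1" using K by simp
    also have "\<dots> \<le> K * norm z powr \<alpha>" using K by (intro mult_left_mono) auto
    finally show "\<bar>sdiff (v k) z y\<bar> \<le> K * norm z powr \<alpha>" .
  qed
qed

lemma u_int: assumes x: "x \<noteq> 0" shows "integrable lborel (\<lambda>z. sdiff u z x * kern s z)"
proof -
  obtain M \<delta> where M: "M \<ge> 0" "\<delta> > 0" "\<And>k y z. y \<in> {x} \<Longrightarrow> norm z \<le> \<delta> \<Longrightarrow> \<bar>sdiff (v k) z y\<bar> \<le> M * norm z powr \<alpha>"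
    "\<And>y z. y \<in> {x} \<Longrightarrow> norm z \<le> \<delta> \<Longrightarrow> \<bar>sdiff u z y\<bar> \<le> M * norm z powr \<alpha>"
    by (rule v_loc[of "{x}"]) (use x in auto)
  show ?thesis by (rule sdiff_kern_integrable[OF uw s0 \<alpha>s M(2)]) (use M(4) in auto)
qed

lemma slap_u: "x \<noteq> 0 \<Longrightarrow> slap s u x = H x * u x powr q / C"
  using eqn[of x] C by (simp add: H_def field_simps)

lemma slap_u_nonneg: "x \<noteq> 0 \<Longrightarrow> slap s u x \<ge> 0"
  using slap_u C H_nonneg by simp

lemma slap_v_nonneg: assumes k: "k \<ge> 0" shows "slap s (v k) x \<ge> 0"
proof (cases "x = 0")
  case True
  have "sdiff (v k) z x \<ge> 0" for z
    using v_max[of k z] v_max[of k "- z"] by (simp add: True sdiff_def v_def)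
  then show ?thesis unfolding slap_def by (intro divide_nonneg_nonneg integral_nonneg_AE AE_I2 mult_nonneg_nonneg) auto
next
  case False
  have ne: "AE z in lborel. z \<noteq> x" "AE z in lborel. z \<noteq> - x" by (rule AE_lborel_singleton)+
  have "(\<integral>z. slope k (u x) * (sdiff u z x * kern s z) \<partial>lborel) \<le> (\<integral>z. sdiff (v k) z x * kern s z \<partial>lborel)"
  proof (rule integral_mono_AE[OF integrable_mult_right[OF u_int[OF False]] v_int[OF k]])
    show "AE z in lborel. slope k (u x) * (sdiff u z x * kern s z) \<le> sdiff (v k) z x * kern s z"
      using ne
    proof eventually_elim
      case (elim z)
      then have "x + z \<noteq> 0" "x - z \<noteq> 0" by (auto simp: add_eq_0_iff)
      from mult_right_mono[OF sdiff_v_between(1)[OF False this] kern_nonneg] show ?case by (simp add: mult.assoc)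
    qed
  qed
  moreover have "(\<integral>z. slope k (u x) * (sdiff u z x * kern s z) \<partial>lborel) = slope k (u x) * (2 * slap s u x)"
    by (simp add: slap_def)
  moreover have "0 \<le> slope k (u x) * (2 * slap s u x)" using slope_bounds slap_u_nonneg[OF False] by simp
  ultimately have "0 \<le> (\<integral>z. sdiff (v k) z x * kern s z \<partial>lborel)" by linarith
  then show ?thesis by (simp add: slap_def)
qed

end

context choquard
begin

lemma weighted_far_flip:
  assumes \<delta>: "\<delta> > 0" and R: "norm x \<le> R"
  shows "(\<integral>z. \<bar>u (x - z)\<bar> * kern s z * indicator (- ball 0 \<delta>) z \<partial>lborel)
      \<le> far_const (real DIM('a) + 2 * s) \<delta> R * (\<integral>x. \<bar>u x\<bar> / (1 + norm x powr (real DIM('a) + 2 * s)) \<partial>lborel)"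
    and "integrable lborel (\<lambda>z. \<bar>u (x - z)\<bar> * kern s z * indicator (- ball 0 \<delta>) z)"
proof -
  have [measurable]: "ball (0::'a) \<delta> \<in> sets borel" by (simp add: borel_open)
  let ?f = "\<lambda>z. \<bar>u (x + z)\<bar> * kern s z * indicator (- ball 0 \<delta>) z"
  have fm: "?f \<in> borel_measurable borel" by measurable
  have e: "?f (0 - z) = \<bar>u (x - z)\<bar> * kern s z * indicator (- ball 0 \<delta>) z" for z
    by (simp add: indicator_def)
  show "(\<integral>z. \<bar>u (x - z)\<bar> * kern s z * indicator (- ball 0 \<delta>) z \<partial>lborel)
      \<le> far_const (real DIM('a) + 2 * s) \<delta> R * (\<integral>x. \<bar>u x\<bar> / (1 + norm x powr (real DIM('a) + 2 * s)) \<partial>lborel)"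
    using integral_flip[OF fm, of 0] weighted_far(2)[OF uw s0 \<delta> R] unfolding e by simp
  show "integrable lborel (\<lambda>z. \<bar>u (x - z)\<bar> * kern s z * indicator (- ball 0 \<delta>) z)"
    using integrable_flip_iff[OF fm, of 0] weighted_far(1)[OF uw s0 \<delta> R] unfolding e by simp
qed

definition majorant :: "real \<Rightarrow> real \<Rightarrow> 'a \<Rightarrow> 'a \<Rightarrow> real" where
  "majorant c \<delta> x z = c * (min (norm z powr \<alpha>) 1 * kern s z)
    + (2 * \<bar>u x\<bar> + \<bar>u (x + z)\<bar> + \<bar>u (x - z)\<bar>) * kern s z * indicator (- ball 0 \<delta>) z"

lemma majorant_integrable: "\<delta> > 0 \<Longrightarrow> integrable lborel (majorant c \<delta> x)"
  unfolding majorant_def[abs_def] by (rule integrable_sdiff_majorant[OF uw s0 \<alpha>s])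

lemma v_majorant:
  assumes K: "compact K" "0 \<notin> K"
  obtains c \<delta> where "c \<ge> 0" "\<delta> > 0"
    "\<And>k x. k \<ge> 0 \<Longrightarrow> x \<in> K \<Longrightarrow> AE z in lborel. norm (sdiff (v k) z x * kern s z) \<le> majorant c \<delta> x z"
proof -
  have \<alpha>0: "\<alpha> \<ge> 0" using \<alpha>s s0 by linarith
  obtain M \<delta> where M: "M \<ge> 0" "\<delta> > 0"
    "\<And>k x z. x \<in> K \<Longrightarrow> norm z \<le> \<delta> \<Longrightarrow> \<bar>sdiff (v k) z x\<bar> \<le> M * norm z powr \<alpha>"
    by (rule v_loc[OF K], rule that, assumption+)
  define c where "c = max 1 (\<delta> powr \<alpha>) * \<bar>M\<bar>"
  show ?thesis
  proof (rule that[of c \<delta>])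
    show "c \<ge> 0" "\<delta> > 0" using M by (auto simp: c_def)
    fix k :: real and x :: 'a assume k: "k \<ge> 0" and x: "x \<in> K"
    have x0: "x \<noteq> 0" using x K by auto
    have ne: "AE z in lborel. z \<noteq> x" "AE z in lborel. z \<noteq> - x" by (rule AE_lborel_singleton)+
    show "AE z in lborel. norm (sdiff (v k) z x * kern s z) \<le> majorant c \<delta> x z"
      using ne
    proof eventually_elim
      case (elim z)
      then have nz: "x + z \<noteq> 0" "x - z \<noteq> 0" by (auto simp: add_eq_0_iff)
      have le: "\<bar>v k y\<bar> \<le> \<bar>u y\<bar>" if "y \<noteq> 0" for y using v_le[OF that, of k] v_nonneg[OF k, of y] by simp
      have "\<bar>sdiff (v k) z x * kern s z\<bar> \<le> c * (min (norm z powr \<alpha>) 1 * kern s z)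
        + (2 * \<bar>v k x\<bar> + \<bar>v k (x + z)\<bar> + \<bar>v k (x - z)\<bar>) * kern s z * indicator (- ball 0 \<delta>) z"
        unfolding c_def by (rule sdiff_kern_bound[OF M(2) \<alpha>0 M(3)[OF x]])
      also have "\<dots> \<le> majorant c \<delta> x z"
        unfolding majorant_def using le[OF x0] le[OF nz(1)] le[OF nz(2)]
        by (intro add_left_mono mult_right_mono add_mono) auto
      finally show ?case by simp
    qed
  qed
qed

lemma slap_v_tendsto: assumes x: "x \<noteq> 0" shows "(\<lambda>n. slap s (v (real n)) x) \<longlonglongrightarrow> slap s u x"
proof -
  obtain c \<delta> where c: "c \<ge> 0" "\<delta> > 0"
    "\<And>k y. k \<ge> 0 \<Longrightarrow> y \<in> {x} \<Longrightarrow> AE z in lborel. norm (sdiff (v k) z y * kern s z) \<le> majorant c \<delta> y z"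
    by (rule v_majorant[of "{x}"]) (use x in auto)
  have vu: "(\<lambda>n. v (real n) y) \<longlonglongrightarrow> u y" if "y \<noteq> 0" for y
  proof (rule tendsto_eventually)
    have "\<forall>\<^sub>F n in sequentially. u y < real n"
      by (rule filterlim_at_top_dense[THEN iffD1, OF filterlim_real_sequentially, rule_format])
    then show "\<forall>\<^sub>F n in sequentially. v (real n) y = u y"
      by eventually_elim (use that in \<open>simp add: v_def trunc_id\<close>)
  qed
  have "(\<lambda>n. \<integral>z. sdiff (v (real n)) z x * kern s z \<partial>lborel) \<longlonglongrightarrow> (\<integral>z. sdiff u z x * kern s z \<partial>lborel)"
  proof (rule integral_dominated_convergence[where w = "majorant c \<delta> x"])
    show "integrable lborel (majorant c \<delta> x)" by (rule majorant_integrable[OF c(2)])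
    show "AE z in lborel. norm (sdiff (v (real n)) z x * kern s z) \<le> majorant c \<delta> x z" for n
      by (rule c(3)) auto
    have ne: "AE z in lborel. z \<noteq> x" "AE z in lborel. z \<noteq> - x" by (rule AE_lborel_singleton)+
    show "AE z in lborel. (\<lambda>n. sdiff (v (real n)) z x * kern s z) \<longlonglongrightarrow> sdiff u z x * kern s z"
      using ne
    proof eventually_elim
      case (elim z)
      then have "x + z \<noteq> 0" "x - z \<noteq> 0" by (auto simp: add_eq_0_iff)
      then show ?case unfolding sdiff_def by (intro tendsto_intros vu x)
    qed
  qed measurable
  then show ?thesis unfolding slap_def by (intro tendsto_intros) auto
qed

lemma slap_v_bound:
  assumes K: "compact K" "0 \<notin> K"
  obtains B where "\<And>n x. x \<in> K \<Longrightarrow> slap s (v (real n)) x \<le> B" "\<And>x. x \<in> K \<Longrightarrow> slap s u x \<le> B"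
proof -
  obtain c \<delta> where c: "c \<ge> 0" "\<delta> > 0"
    "\<And>k x. k \<ge> 0 \<Longrightarrow> x \<in> K \<Longrightarrow> AE z in lborel. norm (sdiff (v k) z x * kern s z) \<le> majorant c \<delta> x z"
    by (rule v_majorant[OF K], rule that, assumption+)
  obtain R where R: "\<And>x. x \<in> K \<Longrightarrow> norm x \<le> R"
    using compact_imp_bounded[OF K(1)] unfolding bounded_iff by blast
  have "continuous_on K u" using ucont by (rule continuous_on_subset) (use K in auto)
  then have "bounded (u ` K)" using K(1) compact_continuous_image compact_imp_bounded by blast
  then obtain U where U: "\<And>x. x \<in> K \<Longrightarrow> \<bar>u x\<bar> \<le> U" unfolding bounded_iff by auto
  define I where "I = (\<integral>z. min (norm z powr \<alpha>) 1 * kern s z \<partial>(lborel :: 'a measure))"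
  define J where "J = (\<integral>z. kern s z * indicator (- ball 0 \<delta>) z \<partial>(lborel :: 'a measure))"
  define W where "W = far_const (real DIM('a) + 2 * s) \<delta> R * (\<integral>x. \<bar>u x\<bar> / (1 + norm x powr (real DIM('a) + 2 * s)) \<partial>lborel)"
  have J0: "J \<ge> 0" unfolding J_def by (intro integral_nonneg_AE AE_I2) auto
  define B where "B = c * I + 2 * U * J + W + W"
  have MB: "(\<integral>z. majorant c \<delta> x z \<partial>lborel) \<le> B" if x: "x \<in> K" for x
  proof -
    note i1 = integrable_min_kern[OF s0 \<alpha>s, where 'a = 'a] and i2 = integrable_kern_far[OF s0 c(2), where 'a = 'a]
    note i3 = weighted_far(1)[OF uw s0 c(2) R[OF x]] and i4 = weighted_far_flip(2)[OF c(2) R[OF x]]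
    have "(\<integral>z. majorant c \<delta> x z \<partial>lborel) = (\<integral>z. c * (min (norm z powr \<alpha>) 1 * kern s z) + 2 * \<bar>u x\<bar> * (kern s z * indicator (- ball 0 \<delta>) z)
       + \<bar>u (x + z)\<bar> * kern s z * indicator (- ball 0 \<delta>) z + \<bar>u (x - z)\<bar> * kern s z * indicator (- ball 0 \<delta>) z \<partial>lborel)"
      by (intro Bochner_Integration.integral_cong refl) (simp add: majorant_def algebra_simps)
    also have "\<dots> = c * I + 2 * \<bar>u x\<bar> * J + (\<integral>z. \<bar>u (x + z)\<bar> * kern s z * indicator (- ball 0 \<delta>) z \<partial>lborel)
       + (\<integral>z. \<bar>u (x - z)\<bar> * kern s z * indicator (- ball 0 \<delta>) z \<partial>lborel)"
      unfolding I_def J_def using i1 i2 i3 i4 by simp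
    also have "\<dots> \<le> c * I + 2 * U * J + W + W"
    proof -
      have "2 * \<bar>u x\<bar> * J \<le> 2 * U * J" using U[OF x] J0 by (intro mult_right_mono mult_left_mono) auto
      then show ?thesis
        using weighted_far(2)[OF uw s0 c(2) R[OF x]] weighted_far_flip(1)[OF c(2) R[OF x]] unfolding W_def by linarith
    qed
    finally show ?thesis unfolding B_def .
  qed
  have vb: "slap s (v (real n)) x \<le> B" if x: "x \<in> K" for n x
  proof -
    have "(\<integral>z. sdiff (v (real n)) z x * kern s z \<partial>lborel) \<le> (\<integral>z. majorant c \<delta> x z \<partial>lborel)"
      by (rule integral_mono_AE[OF v_int majorant_integrable[OF c(2)]])
        (use c(3)[OF _ x, of "real n"] in \<open>auto elim!: eventually_mono\<close>)
    then have "2 * slap s (v (real n)) x \<le> B" using MB[OF x] by (simp add: slap_def)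
    moreover have "slap s (v (real n)) x \<ge> 0" by (rule slap_v_nonneg) simp
    ultimately show ?thesis by linarith
  qed
  show ?thesis
  proof (rule that)
    fix x assume x: "x \<in> K"
    show "slap s u x \<le> B"
      by (rule LIMSEQ_le_const2[OF slap_v_tendsto]) (use x K vb in auto)
  qed (rule vb)
qed

lemma Lam_le_riesz: "\<exists>D\<ge>0. \<forall>z. z \<noteq> 0 \<longrightarrow> \<Lambda> z \<le> D * norm z powr (- \<mu>)"
proof -
  let ?m = "real DIM('a) + 2 * s"
  obtain D where D: "D \<ge> 0" "\<And>x. \<bar>\<Lambda> x\<bar> \<le> D * (1 / (1 + norm x powr ?m))" using Lam_decay by blast
  have "\<Lambda> z \<le> D * norm z powr (- \<mu>)" if z: "z \<noteq> 0" for z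
  proof -
    have "norm z powr \<mu> \<le> 1 + norm z powr ?m"
    proof (cases "norm z \<le> 1")
      case True
      then have "norm z powr \<mu> \<le> 1" using \<mu> powr_mono2[of \<mu> "norm z" 1] by simp
      then show ?thesis by (simp add: add_increasing2)
    next
      case False
      then have "norm z powr \<mu> \<le> norm z powr ?m" using \<mu> s0 by (intro powr_mono) auto
      then show ?thesis by simp
    qed
    then have "1 / (1 + norm z powr ?m) \<le> 1 / norm z powr \<mu>"
      using z by (intro divide_left_mono mult_pos_pos add_pos_nonneg) auto
    then have "1 / (1 + norm z powr ?m) \<le> norm z powr (- \<mu>)" by (simp add: powr_minus divide_inverse)
    then have "D * (1 / (1 + norm z powr ?m)) \<le> D * norm z powr (- \<mu>)" using D by (intro mult_left_mono) auto
    then show ?thesis using D(2)[of z] by linarith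
  qed
  then show ?thesis using D by blast
qed

lemma le_eps_plus_powr:
  fixes t w \<eta> :: real
  assumes "t \<le> w" "\<eta> > 0" "w > 0" shows "t \<le> \<eta> + \<eta> powr (1 - p) * w powr p"
proof (cases "t \<le> \<eta>")
  case False
  then have w: "\<eta> \<le> w" using assms by simp
  have "1 \<le> (w / \<eta>) powr (p - 1)" using w assms p1 by (intro ge_one_powr_ge_zero) auto
  then have "w * 1 \<le> w * (w / \<eta>) powr (p - 1)" using assms by (intro mult_left_mono) auto
  also have "\<dots> = \<eta> powr (1 - p) * w powr p"
    using assms by (simp add: powr_divide powr_diff powr_minus field_simps)
  finally show ?thesis using assms by simp
next
  case True
  have "0 \<le> \<eta> powr (1 - p) * w powr p" by simp
  then show ?thesis using True by linarith
qed

lemma v_avg: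
  assumes x: "x \<noteq> 0" and k: "k \<ge> 0"
  shows "(\<lambda>n. \<integral>z. \<Lambda> z * v k (x - real (Suc n) *\<^sub>R z) \<partial>lborel) \<longlonglongrightarrow> 0"
proof -
  obtain D where D: "D \<ge> 0" "\<And>z. z \<noteq> 0 \<Longrightarrow> \<Lambda> z \<le> D * norm z powr (- \<mu>)" using Lam_le_riesz by blast
  let ?N = "real DIM('a)"
  have est: "0 \<le> (\<integral>z. \<Lambda> z * v k (x - c *\<^sub>R z) \<partial>lborel) \<and>
      (\<integral>z. \<Lambda> z * v k (x - c *\<^sub>R z) \<partial>lborel) \<le> \<kappa> * \<eta> + \<eta> powr (1 - p) * D * H x * c powr (\<mu> - ?N)"
    if c: "c > 0" and \<eta>: "\<eta> > 0" for c \<eta>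
  proof -
    let ?h = "\<lambda>y. u y powr p * norm (x - y) powr (- \<mu>)"
    have hm: "?h \<in> borel_measurable borel" by measurable
    have e: "?h (x + (- c) *\<^sub>R z) = c powr (- \<mu>) * (u (x - c *\<^sub>R z) powr p * norm z powr (- \<mu>))" for z
      using c by (simp add: powr_mult)
    have "integrable lborel (\<lambda>z. ?h (x + (- c) *\<^sub>R z))"
      using integrable_affine_iff[OF _ hm, of "- c" x] c Hint[OF x] by simp
    then have "integrable lborel (\<lambda>z. c powr \<mu> * (c powr (- \<mu>) * (u (x - c *\<^sub>R z) powr p * norm z powr (- \<mu>))))"
      unfolding e by (rule integrable_mult_right)
    moreover have cc: "c powr \<mu> * (c powr (- \<mu>) * t) = t" for t using c by (simp add: powr_minus)
    ultimately have gi: "integrable lborel (\<lambda>z. u (x - c *\<^sub>R z) powr p * norm z powr (- \<mu>))" by simp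
    have "H x = c powr ?N * (c powr (- \<mu>) * (\<integral>z. u (x - c *\<^sub>R z) powr p * norm z powr (- \<mu>) \<partial>lborel))"
      unfolding H_def using integral_affine[OF _ hm, of "- c" x] c unfolding e by (simp add: norm_power_dim)
    then have "c powr (\<mu> - ?N) * H x = (c powr (\<mu> - ?N) * c powr ?N * c powr (- \<mu>)) * (\<integral>z. u (x - c *\<^sub>R z) powr p * norm z powr (- \<mu>) \<partial>lborel)"
      by (simp add: mult_ac)
    also have "c powr (\<mu> - ?N) * c powr ?N * c powr (- \<mu>) = 1" using c by (simp add: powr_add[symmetric])
    finally have G: "(\<integral>z. u (x - c *\<^sub>R z) powr p * norm z powr (- \<mu>) \<partial>lborel) = c powr (\<mu> - ?N) * H x" by simp
    have Li: "integrable lborel (\<lambda>z. \<Lambda> z * v k (x - c *\<^sub>R z))"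
      by (rule avg_integrable[where w = "\<lambda>y. v k (x - y)" and B = "k + 1/2"]) (use v_abs[OF k] in auto)
    have "AE z in lborel. z \<noteq> (1/c) *\<^sub>R x" by (rule AE_lborel_singleton)
    then have le: "AE z in lborel. \<Lambda> z * v k (x - c *\<^sub>R z) \<le> \<Lambda> z * \<eta> + (\<eta> powr (1 - p) * D) * (u (x - c *\<^sub>R z) powr p * norm z powr (- \<mu>))"
      using AE_nonzero
    proof eventually_elim
      case (elim z)
      have "x - c *\<^sub>R z \<noteq> 0"
      proof
        assume "x - c *\<^sub>R z = 0"
        then have "x = c *\<^sub>R z" by simp
        then show False using elim c by simp
      qed
      then have "v k (x - c *\<^sub>R z) \<le> \<eta> + \<eta> powr (1 - p) * u (x - c *\<^sub>R z) powr p"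
        by (intro le_eps_plus_powr v_le \<eta> upos)
      then have "\<Lambda> z * v k (x - c *\<^sub>R z) \<le> \<Lambda> z * (\<eta> + \<eta> powr (1 - p) * u (x - c *\<^sub>R z) powr p)"
        using Lam_nonneg elim by (intro mult_left_mono) auto
      also have "\<dots> = \<Lambda> z * \<eta> + \<Lambda> z * (\<eta> powr (1 - p) * u (x - c *\<^sub>R z) powr p)" by (simp add: distrib_left)
      also have "\<dots> \<le> \<Lambda> z * \<eta> + D * norm z powr (- \<mu>) * (\<eta> powr (1 - p) * u (x - c *\<^sub>R z) powr p)"
        using D(2) elim by (intro add_left_mono mult_right_mono) auto
      finally show ?case by (simp add: mult_ac)
    qed
    have "(\<integral>z. \<Lambda> z * v k (x - c *\<^sub>R z) \<partial>lborel) \<le> (\<integral>z. \<Lambda> z * \<eta> + (\<eta> powr (1 - p) * D) * (u (x - c *\<^sub>R z) powr p * norm z powr (- \<mu>)) \<partial>lborel)"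
      by (rule integral_mono_AE[OF Li Bochner_Integration.integrable_add[OF integrable_mult_left[OF Lam_integrable] integrable_mult_right[OF gi]] le])
    also have "\<dots> = \<kappa> * \<eta> + (\<eta> powr (1 - p) * D) * (c powr (\<mu> - ?N) * H x)"
      using Lam_integrable gi by (simp add: G \<kappa>_def)
    finally have 1: "(\<integral>z. \<Lambda> z * v k (x - c *\<^sub>R z) \<partial>lborel) \<le> \<kappa> * \<eta> + \<eta> powr (1 - p) * D * H x * c powr (\<mu> - ?N)"
      by (simp add: mult_ac)
    have "AE z in lborel. 0 \<le> \<Lambda> z * v k (x - c *\<^sub>R z)"
      using AE_nonzero by eventually_elim (use Lam_nonneg v_nonneg[OF k] in auto)
    then have "0 \<le> (\<integral>z. \<Lambda> z * v k (x - c *\<^sub>R z) \<partial>lborel)" by (rule integral_nonneg_AE)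
    then show ?thesis using 1 by (rule conjI)
  qed
  show ?thesis
  proof (rule tendstoI)
    fix e :: real assume e: "e > 0"
    define \<eta> where "\<eta> = e / (2 * \<kappa>)"
    have \<eta>: "\<eta> > 0" "\<kappa> * \<eta> = e / 2" using e kappa_pos by (auto simp: \<eta>_def)
    have "(\<lambda>n. real (Suc n) powr (\<mu> - ?N)) \<longlonglongrightarrow> 0"
      by (intro tendsto_neg_powr filterlim_compose[OF filterlim_real_sequentially filterlim_Suc]) (use \<mu> in simp)
    then have "(\<lambda>n. \<eta> powr (1 - p) * D * H x * real (Suc n) powr (\<mu> - ?N)) \<longlonglongrightarrow> \<eta> powr (1 - p) * D * H x * 0"
      by (intro tendsto_mult tendsto_const)
    then have "\<forall>\<^sub>F n in sequentially. \<eta> powr (1 - p) * D * H x * real (Suc n) powr (\<mu> - ?N) < e / 2"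
      using e by (intro order_tendstoD(2)[where y = "\<eta> powr (1 - p) * D * H x * 0"]) auto
    then show "\<forall>\<^sub>F n in sequentially. dist (\<integral>z. \<Lambda> z * v k (x - real (Suc n) *\<^sub>R z) \<partial>lborel) 0 < e"
    proof eventually_elim
      case (elim n)
      have "real (Suc n) > 0" by simp
      from est[OF this \<eta>(1)] elim \<eta>(2) show ?case unfolding dist_real_def by (simp only:) linarith
    qed
  qed
qed

text \<open>Finiteness of the Hartree potential makes the truncation small on average at infinity, so no additive constant appears.\<close>

lemma v_representation:
  assumes x: "x \<noteq> 0" and k: "k \<ge> 0"
  shows "(\<integral>\<^sup>+y. ennreal (riesz (x - y) * slap s (v k) y) \<partial>lborel) = ennreal (\<kappa> * v k x)"
  by (rule representation[OF v_measurable v_abs[OF k] v_cont \<alpha>s v_K[OF k] slap_v_nonneg[OF k] v_avg[OF x k]])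

end

section \<open>Kelvin transforms\<close>

locale kelvin =
  fixes a :: "'a::euclidean_space" and l :: real
  assumes l: "l > 0"
begin

definition star :: "'a \<Rightarrow> 'a" where "star y = a + l\<^sup>2 *\<^sub>R inversion (y - a)"

definition rho :: "'a \<Rightarrow> real" where "rho y = l / norm (y - a)"

lemma star_measurable [measurable]: "star \<in> borel_measurable borel"
  unfolding star_def[abs_def] by measurable

lemma rho_measurable [measurable]: "rho \<in> borel_measurable borel"
  unfolding rho_def[abs_def] by measurable

lemma rho_nonneg [simp]: "rho y \<ge> 0" using l by (simp add: rho_def)

lemma rho_pos: "y \<noteq> a \<Longrightarrow> rho y > 0" using l by (simp add: rho_def)

lemma rho_ge_1: "y \<noteq> a \<Longrightarrow> y \<in> ball a l \<Longrightarrow> rho y > 1"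
  using l by (simp add: rho_def dist_norm norm_minus_commute)

lemma star_neq: "y \<noteq> a \<Longrightarrow> star y \<noteq> a" using l by (simp add: star_def)

lemma norm_star: "norm (star y - a) = l\<^sup>2 / norm (y - a)"
  by (simp add: star_def inversion_def dot_square_norm power2_eq_square)

lemma inversion_scaleR: "inversion (c *\<^sub>R x) = (1 / c) *\<^sub>R inversion x"
  by (simp add: inversion_def)

lemma star_star [simp]: "star (star y) = y"
  using l by (simp add: star_def inversion_scaleR)

lemma rho_star: "y \<noteq> a \<Longrightarrow> rho (star y) = 1 / rho y"
  using l by (simp add: rho_def norm_star power2_eq_square)

lemma norm_inversion_diff:
  fixes x y :: 'a
  assumes "x \<noteq> 0" "y \<noteq> 0"
  shows "norm (inversion x - inversion y) = norm (x - y) / (norm x * norm y)"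
proof -
  have "(norm (inversion x - inversion y))\<^sup>2 = (norm (x - y) / (norm x * norm y))\<^sup>2"
  proof -
    have xx: "x \<bullet> x \<noteq> 0" "y \<bullet> y \<noteq> 0" using assms by auto
    have "(norm (inversion x - inversion y))\<^sup>2 = inversion x \<bullet> inversion x - 2 * (inversion x \<bullet> inversion y) + inversion y \<bullet> inversion y"
      by (simp add: power2_norm_eq_inner inner_diff_left inner_diff_right inner_commute)
    also have "\<dots> = 1 / (x \<bullet> x) - 2 * (x \<bullet> y) / ((x \<bullet> x) * (y \<bullet> y)) + 1 / (y \<bullet> y)"
      using xx by (simp add: inversion_def)
    also have "\<dots> = (x \<bullet> x - 2 * (x \<bullet> y) + y \<bullet> y) / ((x \<bullet> x) * (y \<bullet> y))"
      using xx by (simp add: field_simps)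
    also have "x \<bullet> x - 2 * (x \<bullet> y) + y \<bullet> y = (norm (x - y))\<^sup>2"
      by (simp add: power2_norm_eq_inner inner_diff_left inner_diff_right inner_commute)
    finally show ?thesis by (simp add: power_divide power_mult_distrib power2_norm_eq_inner)
  qed
  then show ?thesis by (rule power2_eq_imp_eq) auto
qed

lemma norm_star_diff:
  assumes "y \<noteq> a" "z \<noteq> a" shows "norm (star y - star z) = rho y * rho z * norm (y - z)"
proof -
  have "star y - star z = l\<^sup>2 *\<^sub>R (inversion (y - a) - inversion (z - a))"
    by (simp add: star_def scaleR_diff_right)
  then have "norm (star y - star z) = l\<^sup>2 * (norm ((y - a) - (z - a)) / (norm (y - a) * norm (z - a)))"
    using assms by (simp add: norm_inversion_diff)
  then show ?thesis by (simp add: rho_def power2_eq_square)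
qed

lemma norm_star_left:
  assumes "y \<noteq> a" "z \<noteq> a" shows "norm (star y - z) = rho y / rho z * norm (y - star z)"
  using norm_star_diff[OF assms(1) star_neq[OF assms(2)]] rho_star[OF assms(2)] by simp

lemma reflected_farther:
  assumes y: "y \<in> ball a l" and z: "z \<in> ball a l" "z \<noteq> a"
  shows "rho z * norm (y - z) < norm (y - star z)"
proof -
  define Y Z where "Y = y - a" and "Z = z - a"
  have Z0: "Z \<noteq> 0" using z by (simp add: Z_def)
  have n: "norm Y < l" "norm Z < l" using y z by (auto simp: Y_def Z_def dist_norm norm_minus_commute)
  have ZZ: "Z \<bullet> Z > 0" using Z0 by simp
  have sq: "Y \<bullet> Y < l\<^sup>2" "Z \<bullet> Z < l\<^sup>2"
    using n by (simp_all add: dot_square_norm power_strict_mono)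
  have st: "y - star z = Y - (l\<^sup>2 / (Z \<bullet> Z)) *\<^sub>R Z" by (simp add: star_def inversion_def Y_def Z_def)
  have "(norm (y - star z))\<^sup>2 - (rho z * norm (y - z))\<^sup>2 = (l\<^sup>2 - Y \<bullet> Y) * (l\<^sup>2 - Z \<bullet> Z) / (Z \<bullet> Z)"
  proof -
    have 1: "(norm (y - star z))\<^sup>2 = Y \<bullet> Y - 2 * (l\<^sup>2 / (Z \<bullet> Z)) * (Y \<bullet> Z) + (l\<^sup>2 / (Z \<bullet> Z))\<^sup>2 * (Z \<bullet> Z)"
    proof -
      have "(norm (Y - c *\<^sub>R Z))\<^sup>2 = Y \<bullet> Y - 2 * c * (Y \<bullet> Z) + c\<^sup>2 * (Z \<bullet> Z)" for c
        unfolding power2_norm_eq_inner inner_diff_left inner_diff_right inner_scaleR_left inner_scaleR_right inner_commute[of Z Y]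
        by (simp add: power2_eq_square algebra_simps)
      then show ?thesis unfolding st .
    qed
    have "norm (y - z) = norm (Y - Z)" by (simp add: Y_def Z_def)
    then have 2: "(rho z * norm (y - z))\<^sup>2 = l\<^sup>2 / (Z \<bullet> Z) * (Y \<bullet> Y - 2 * (Y \<bullet> Z) + Z \<bullet> Z)"
      by (simp add: rho_def Z_def[symmetric] power_mult_distrib power_divide power2_norm_eq_inner inner_diff_left inner_diff_right inner_commute)
    show ?thesis unfolding 1 2 using ZZ by (simp add: field_simps power2_eq_square)
  qed
  moreover have "0 < (l\<^sup>2 - Y \<bullet> Y) * (l\<^sup>2 - Z \<bullet> Z) / (Z \<bullet> Z)"
    using sq ZZ by simp
  ultimately have "(rho z * norm (y - z))\<^sup>2 < (norm (y - star z))\<^sup>2" by linarith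
  then show ?thesis by (rule power2_less_imp_less) simp
qed

lemma ball_sets [measurable]: "ball a l \<in> sets borel" by (simp add: borel_open)

lemma nn_integral_star:
  assumes [measurable]: "g \<in> borel_measurable borel"
  shows "(\<integral>\<^sup>+y. g (star y) * ennreal (rho y powr (2 * real DIM('a))) \<partial>lborel) = (\<integral>\<^sup>+y. g y \<partial>lborel)"
proof -
  let ?N = "real DIM('a)"
  have l2: "l\<^sup>2 \<noteq> 0" using l by simp
  define h where "h x = g (a + l\<^sup>2 *\<^sub>R x)" for x
  define k where "k x = h (inversion x) * ennreal (norm x powr (- 2 * ?N))" for x
  have [measurable]: "h \<in> borel_measurable borel" unfolding h_def by measurable
  have [measurable]: "k \<in> borel_measurable borel" unfolding k_def by measurable
  have "(\<integral>\<^sup>+y. g y \<partial>lborel) = ennreal (\<bar>l\<^sup>2\<bar> ^ DIM('a)) * (\<integral>\<^sup>+x. h x \<partial>lborel)"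
    unfolding h_def by (rule nn_integral_affine[OF assms l2])
  also have "(\<integral>\<^sup>+x. h x \<partial>lborel) = (\<integral>\<^sup>+x. k x \<partial>lborel)"
    using nn_integral_inversion[of h] by (simp add: k_def)
  also have "\<dots> = (\<integral>\<^sup>+y. k (- a + y) \<partial>lborel)"
    using nn_integral_translate[of k "- a"] by simp
  also have "ennreal (\<bar>l\<^sup>2\<bar> ^ DIM('a)) * \<dots> = (\<integral>\<^sup>+y. ennreal (\<bar>l\<^sup>2\<bar> ^ DIM('a)) * k (- a + y) \<partial>lborel)"
    by (rule nn_integral_cmult[symmetric]) measurable
  also have "\<dots> = (\<integral>\<^sup>+y. g (star y) * ennreal (rho y powr (2 * ?N)) \<partial>lborel)"
  proof (intro nn_integral_cong)
    fix y :: 'a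
    have "\<bar>l\<^sup>2\<bar> ^ DIM('a) = (l powr 2) powr ?N"
      using l norm_power_dim[of "l\<^sup>2", where 'a = 'a] by simp
    then have "\<bar>l\<^sup>2\<bar> ^ DIM('a) = l powr (2 * ?N)" by (simp only: powr_powr)
    moreover have "l powr (2 * ?N) * norm (y - a) powr (- 2 * ?N) = rho y powr (2 * ?N)"
    proof -
      have "- 2 * ?N = - (2 * ?N)" by simp
      then have "norm (y - a) powr (- 2 * ?N) = inverse (norm (y - a) powr (2 * ?N))" by (simp only: powr_minus)
      moreover have "rho y powr (2 * ?N) = l powr (2 * ?N) / norm (y - a) powr (2 * ?N)"
        unfolding rho_def by (rule powr_divide)
      ultimately show ?thesis by (simp only: divide_inverse)
    qed
    ultimately have "ennreal (\<bar>l\<^sup>2\<bar> ^ DIM('a)) * ennreal (norm (y - a) powr (- 2 * ?N)) = ennreal (rho y powr (2 * ?N))"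
      by (subst ennreal_mult[symmetric]) auto
    moreover have "ennreal (\<bar>l\<^sup>2\<bar> ^ DIM('a)) * k (- a + y) = g (star y) * (ennreal (\<bar>l\<^sup>2\<bar> ^ DIM('a)) * ennreal (norm (y - a) powr (- 2 * ?N)))"
      by (simp add: k_def h_def star_def mult_ac)
    ultimately show "ennreal (\<bar>l\<^sup>2\<bar> ^ DIM('a)) * k (- a + y) = g (star y) * ennreal (rho y powr (2 * ?N))"
      by simp
  qed
  finally show ?thesis ..
qed

lemma AE_not_sphere: "AE y in lborel. norm (y - a) \<noteq> l"
proof -
  have "negligible (sphere a l)" using l by (intro negligible_sphere) 
  then have "sphere a l \<in> null_sets lebesgue" by (simp add: negligible_iff_null_sets)
  then have "sphere a l \<in> null_sets lborel" by (subst (asm) null_sets_completion_iff) (simp_all add: borel_closed)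
  then have "AE y in lborel. y \<notin> sphere a l" by (rule AE_not_in)
  then show ?thesis by (auto elim!: eventually_mono simp: dist_norm norm_minus_commute)
qed

lemma nn_integral_split:
  assumes [measurable]: "f \<in> borel_measurable borel"
  shows "(\<integral>\<^sup>+y. f y \<partial>lborel) = (\<integral>\<^sup>+y. f y * indicator (ball a l) y \<partial>lborel)
    + (\<integral>\<^sup>+y. f (star y) * ennreal (rho y powr (2 * real DIM('a))) * indicator (ball a l) y \<partial>lborel)"
proof -
  let ?N = "real DIM('a)"
  have "(\<integral>\<^sup>+y. f y \<partial>lborel) = (\<integral>\<^sup>+y. f y * indicator (ball a l) y + f y * indicator (- ball a l) y \<partial>lborel)"
    by (intro nn_integral_cong) (simp add: indicator_def)
  also have "\<dots> = (\<integral>\<^sup>+y. f y * indicator (ball a l) y \<partial>lborel) + (\<integral>\<^sup>+y. f y * indicator (- ball a l) y \<partial>lborel)"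
    by (rule nn_integral_add) measurable
  also have "(\<integral>\<^sup>+y. f y * indicator (- ball a l) y \<partial>lborel)
      = (\<integral>\<^sup>+y. f (star y) * indicator (- ball a l) (star y) * ennreal (rho y powr (2 * ?N)) \<partial>lborel)"
    by (rule nn_integral_star[symmetric]) measurable
  also have "\<dots> = (\<integral>\<^sup>+y. f (star y) * ennreal (rho y powr (2 * ?N)) * indicator (ball a l) y \<partial>lborel)"
  proof (rule nn_integral_cong_AE)
    show "AE y in lborel. f (star y) * indicator (- ball a l) (star y) * ennreal (rho y powr (2 * ?N))
      = f (star y) * ennreal (rho y powr (2 * ?N)) * indicator (ball a l) y"
      using AE_not_sphere
    proof eventually_elim
      case (elim y)
      show ?case
      proof (cases "y = a")
        case False
        have "star y \<in> - ball a l \<longleftrightarrow> l \<le> norm (star y - a)" by (simp add: dist_norm norm_minus_commute not_less)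
        also have "\<dots> \<longleftrightarrow> norm (y - a) \<le> l"
          unfolding norm_star using l False by (simp add: field_simps power2_eq_square)
        also have "\<dots> \<longleftrightarrow> y \<in> ball a l" using elim by (auto simp: dist_norm norm_minus_commute)
        finally show ?thesis by (simp add: indicator_def)
      qed (simp add: rho_def)
    qed
  qed
  finally show ?thesis .
qed

definition near :: "real \<Rightarrow> 'a \<Rightarrow> 'a \<Rightarrow> real" where "near b y z = norm (y - z) powr (- b)"
definition far :: "real \<Rightarrow> 'a \<Rightarrow> 'a \<Rightarrow> real" where "far b y z = rho z powr b * norm (y - star z) powr (- b)"

lemma far_less_near:
  assumes b: "b > 0" and y: "y \<in> ball a l" and z: "z \<in> ball a l" "z \<noteq> a" "z \<noteq> y"
  shows "far b y z < near b y z"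
proof -
  have r: "rho z > 0" using z by (intro rho_pos)
  have p: "0 < rho z * norm (y - z)" using r z by simp
  have "norm (y - star z) powr (- b) < (rho z * norm (y - z)) powr (- b)"
    using reflected_farther[OF y z(1,2)] p b by (intro powr_less_mono2_neg) auto
  also have "\<dots> = rho z powr (- b) * near b y z" using r by (simp add: near_def powr_mult)
  finally have "rho z powr b * norm (y - star z) powr (- b) < rho z powr b * (rho z powr (- b) * near b y z)"
    using r by (intro mult_strict_left_mono) auto
  also have "\<dots> = near b y z" using r by (simp add: powr_minus)
  finally show ?thesis by (simp add: far_def)
qed

lemma far_nonneg [simp]: "far b y z \<ge> 0" by (simp add: far_def)
lemma near_nonneg [simp]: "near b y z \<ge> 0" by (simp add: near_def)

lemma near_measurable [measurable]: "near b y \<in> borel_measurable borel" unfolding near_def[abs_def] by measurable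
lemma far_measurable [measurable]: "far b y \<in> borel_measurable borel" unfolding far_def[abs_def] by measurable

text \<open>The part of each potential coming from outside the sphere is pulled back to the ball by the inversion; the contributions then pair up with exchanged kernels.\<close>

lemma kelvin_identity:
  fixes g :: "'a \<Rightarrow> real"
  assumes [measurable]: "g \<in> borel_measurable borel" and g0: "\<And>z. g z \<ge> 0" and b: "b > 0"
    and y: "y \<in> ball a l" "y \<noteq> a"
  defines "gl \<equiv> \<lambda>z. rho z powr (2 * real DIM('a) - b) * g (star z)"
  shows "(\<integral>\<^sup>+z. ennreal (norm (y - z) powr (- b) * g z) \<partial>lborel)
      + (\<integral>\<^sup>+z. ennreal ((near b y z - far b y z) * gl z) * indicator (ball a l) z \<partial>lborel)
    = ennreal (rho y powr b) * (\<integral>\<^sup>+z. ennreal (norm (star y - z) powr (- b) * g z) \<partial>lborel)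
      + (\<integral>\<^sup>+z. ennreal ((near b y z - far b y z) * g z) * indicator (ball a l) z \<partial>lborel)"
proof -
  let ?N = "real DIM('a)"
  have [measurable]: "gl \<in> borel_measurable borel" unfolding gl_def by measurable
  have gl0: "gl z \<ge> 0" for z unfolding gl_def using g0 by simp
  define I where "I k h = (\<integral>\<^sup>+z. ennreal (k z * h z) * indicator (ball a l) z \<partial>lborel)" for k h :: "'a \<Rightarrow> real"
  have ne: "AE z in lborel. z \<noteq> a" "AE z in lborel. z \<noteq> y" by (rule AE_lborel_singleton)+
  have r2: "rho z powr (2 * ?N) = rho z powr b * rho z powr (2 * ?N - b)" for z
    by (simp add: powr_add[symmetric])
  have A: "(\<integral>\<^sup>+z. ennreal (norm (y - z) powr (- b) * g z) \<partial>lborel) = I (near b y) g + I (far b y) gl"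
  proof -
    have "(\<integral>\<^sup>+z. ennreal (norm (y - z) powr (- b) * g z) \<partial>lborel)
      = (\<integral>\<^sup>+z. ennreal (norm (y - z) powr (- b) * g z) * indicator (ball a l) z \<partial>lborel)
       + (\<integral>\<^sup>+z. ennreal (norm (y - star z) powr (- b) * g (star z)) * ennreal (rho z powr (2 * ?N)) * indicator (ball a l) z \<partial>lborel)"
      by (rule nn_integral_split) measurable
    also have "(\<integral>\<^sup>+z. ennreal (norm (y - star z) powr (- b) * g (star z)) * ennreal (rho z powr (2 * ?N)) * indicator (ball a l) z \<partial>lborel) = I (far b y) gl"
      unfolding I_def
    proof (intro nn_integral_cong)
      fix z
      have "ennreal (norm (y - star z) powr (- b) * g (star z)) * ennreal (rho z powr (2 * ?N)) = ennreal (far b y z * gl z)"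
      proof -
        have "ennreal (norm (y - star z) powr (- b) * g (star z)) * ennreal (rho z powr (2 * ?N))
          = ennreal (norm (y - star z) powr (- b) * g (star z) * rho z powr (2 * ?N))"
          by (rule ennreal_mult[symmetric]) (simp_all add: g0)
        also have "norm (y - star z) powr (- b) * g (star z) * rho z powr (2 * ?N) = far b y z * gl z"
          unfolding r2 far_def gl_def by (simp only: mult_ac)
        finally show ?thesis .
      qed
      then show "ennreal (norm (y - star z) powr (- b) * g (star z)) * ennreal (rho z powr (2 * ?N)) * indicator (ball a l) z
        = ennreal (far b y z * gl z) * indicator (ball a l) z" by simp
    qed
    finally show ?thesis by (simp add: I_def near_def)
  qed
  have B: "ennreal (rho y powr b) * (\<integral>\<^sup>+z. ennreal (norm (star y - z) powr (- b) * g z) \<partial>lborel) = I (far b y) g + I (near b y) gl"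
  proof -
    let ?f = "\<lambda>z. ennreal (rho y powr b) * ennreal (norm (star y - z) powr (- b) * g z)"
    have "ennreal (rho y powr b) * (\<integral>\<^sup>+z. ennreal (norm (star y - z) powr (- b) * g z) \<partial>lborel) = (\<integral>\<^sup>+z. ?f z \<partial>lborel)"
      by (rule nn_integral_cmult[symmetric]) measurable
    also have "\<dots> = (\<integral>\<^sup>+z. ?f z * indicator (ball a l) z \<partial>lborel)
       + (\<integral>\<^sup>+z. ?f (star z) * ennreal (rho z powr (2 * ?N)) * indicator (ball a l) z \<partial>lborel)"
      by (rule nn_integral_split) measurable
    also have "(\<integral>\<^sup>+z. ?f z * indicator (ball a l) z \<partial>lborel) = I (far b y) g"
      unfolding I_def
    proof (rule nn_integral_cong_AE)
      show "AE z in lborel. ?f z * indicator (ball a l) z = ennreal (far b y z * g z) * indicator (ball a l) z"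
        using ne(1)
      proof eventually_elim
        case (elim z)
        have ry: "rho y > 0" "rho z > 0" using y elim by (auto intro: rho_pos)
        have "norm (star y - z) powr (- b) = rho y powr (- b) / rho z powr (- b) * norm (y - star z) powr (- b)"
          by (simp only: norm_star_left[OF y(2) elim] powr_mult powr_divide)
        also have "rho y powr (- b) / rho z powr (- b) = rho y powr (- b) * rho z powr b"
          by (simp add: powr_minus divide_inverse)
        finally have "rho y powr b * norm (star y - z) powr (- b) = (rho y powr b * rho y powr (- b)) * far b y z"
          by (simp only: far_def mult_ac)
        also have "rho y powr b * rho y powr (- b) = 1" using ry by (simp add: powr_minus)
        finally have e: "rho y powr b * norm (star y - z) powr (- b) = far b y z" by simp
        have "?f z = ennreal (rho y powr b * (norm (star y - z) powr (- b) * g z))"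
          by (rule ennreal_mult[symmetric]) (simp_all add: g0)
        also have "rho y powr b * (norm (star y - z) powr (- b) * g z) = far b y z * g z"
          by (simp only: e[symmetric] mult.assoc)
        finally have "?f z = ennreal (far b y z * g z)" .
        then show ?case by simp
      qed
    qed
    also have "(\<integral>\<^sup>+z. ?f (star z) * ennreal (rho z powr (2 * ?N)) * indicator (ball a l) z \<partial>lborel) = I (near b y) gl"
      unfolding I_def
    proof (rule nn_integral_cong_AE)
      show "AE z in lborel. ?f (star z) * ennreal (rho z powr (2 * ?N)) * indicator (ball a l) z = ennreal (near b y z * gl z) * indicator (ball a l) z"
        using ne(1)
      proof eventually_elim
        case (elim z)
        have ry: "rho y > 0" "rho z > 0" using y elim by (auto intro: rho_pos)
        have "rho y powr b * norm (star y - star z) powr (- b) * rho z powr (2 * ?N)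
          = rho y powr b * rho y powr (- b) * (rho z powr (- b) * rho z powr b) * (near b y z * rho z powr (2 * ?N - b))"
          using ry unfolding norm_star_diff[OF y(2) elim] r2 near_def by (simp add: powr_mult mult_ac)
        also have "\<dots> = near b y z * rho z powr (2 * ?N - b)" using ry by (simp add: powr_minus)
        finally have k: "rho y powr b * norm (star y - star z) powr (- b) * rho z powr (2 * ?N) = near b y z * rho z powr (2 * ?N - b)" .
        have "?f (star z) * ennreal (rho z powr (2 * ?N)) = ennreal ((rho y powr b * norm (star y - star z) powr (- b) * rho z powr (2 * ?N)) * g (star z))"
          using g0 by (simp add: ennreal_mult[symmetric] mult_ac)
        also have "\<dots> = ennreal (near b y z * gl z)" unfolding k gl_def by (simp add: mult_ac)
        finally show ?case by simp
      qed
    qed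
    finally show ?thesis .
  qed
  have sum: "I (near b y) h = I (far b y) h + (\<integral>\<^sup>+z. ennreal ((near b y z - far b y z) * h z) * indicator (ball a l) z \<partial>lborel)"
    if [measurable]: "h \<in> borel_measurable borel" and h0: "\<And>z. h z \<ge> 0" for h
  proof -
    have "I (near b y) h = (\<integral>\<^sup>+z. ennreal (far b y z * h z) * indicator (ball a l) z + ennreal ((near b y z - far b y z) * h z) * indicator (ball a l) z \<partial>lborel)"
      unfolding I_def
    proof (rule nn_integral_cong_AE)
      show "AE z in lborel. ennreal (near b y z * h z) * indicator (ball a l) z
        = ennreal (far b y z * h z) * indicator (ball a l) z + ennreal ((near b y z - far b y z) * h z) * indicator (ball a l) z"
        using ne
      proof eventually_elim
        case (elim z)
        show ?case
        proof (cases "z \<in> ball a l")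
          case True
          have "far b y z < near b y z" by (rule far_less_near[OF b y(1) True]) (use elim in auto)
          then have "ennreal (far b y z * h z) + ennreal ((near b y z - far b y z) * h z) = ennreal (far b y z * h z + (near b y z - far b y z) * h z)"
            using h0[of z] by (intro ennreal_plus[symmetric] mult_nonneg_nonneg) auto
          also have "far b y z * h z + (near b y z - far b y z) * h z = near b y z * h z" by (simp add: algebra_simps)
          finally show ?thesis using True by simp
        qed simp
      qed
    qed
    also have "\<dots> = I (far b y) h + (\<integral>\<^sup>+z. ennreal ((near b y z - far b y z) * h z) * indicator (ball a l) z \<partial>lborel)"
      unfolding I_def by (rule nn_integral_add) measurable
    finally show ?thesis .
  qed
  show ?thesis
    unfolding A B using sum[of g] sum[of gl] g0 gl0 by (simp add: ac_simps)
qed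

end

section \<open>Comparison with the Kelvin transform\<close>

definition (in choquard) bad :: "'a \<Rightarrow> real \<Rightarrow> 'a set" where
  "bad a l = {z. z \<in> ball a l \<and> z \<noteq> a \<and> kelvin.star a l z \<noteq> 0 \<and>
     kelvin.rho a l z powr (2 * \<theta>) * u (kelvin.star a l z) < u z}"

locale choquard_kelvin = choquard s \<theta> T u \<mu> p q C \<alpha> + kelvin a l
  for s \<theta> :: real and T :: "'a::euclidean_space itself" and u :: "'a \<Rightarrow> real" and \<mu> p q C \<alpha> :: real
    and a :: 'a and l :: real +
  assumes la: "l < norm a"
begin

definition ul :: "'a \<Rightarrow> real" where "ul z = rho z powr (2 * \<theta>) * u (star z)"

definition fl :: "'a \<Rightarrow> real" where "fl z = rho z powr (real DIM('a) + 2 * s) * slap s u (star z)"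

lemma ul_measurable [measurable]: "ul \<in> borel_measurable borel" unfolding ul_def[abs_def] by measurable
lemma fl_measurable [measurable]: "fl \<in> borel_measurable borel" unfolding fl_def[abs_def] by measurable

lemma ul_pos: "z \<noteq> a \<Longrightarrow> ul z > 0" unfolding ul_def using rho_pos[of z] upos by simp

lemma cball_nonzero: "z \<in> cball a l \<Longrightarrow> z \<noteq> 0" using la by auto
lemma ball_nonzero: "z \<in> ball a l \<Longrightarrow> z \<noteq> 0" using cball_nonzero by auto

lemma AE_generic: "AE z in lborel. z \<noteq> a \<and> star z \<noteq> 0 \<and> z \<noteq> y"
proof -
  have "AE z in lborel. z \<noteq> a" "AE z in lborel. z \<noteq> star 0" "AE z in lborel. z \<noteq> y" by (rule AE_lborel_singleton)+
  then show ?thesis by eventually_elim (metis star_star)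
qed

definition K :: "real \<Rightarrow> 'a \<Rightarrow> 'a \<Rightarrow> real" where "K b y z = near b y z - far b y z"

lemma K_measurable [measurable]: "K b y \<in> borel_measurable borel" unfolding K_def[abs_def] by measurable

lemma K_le: "K b y z \<le> near b y z" by (simp add: K_def)

lemma K_pos: "b > 0 \<Longrightarrow> y \<in> ball a l \<Longrightarrow> z \<in> ball a l \<Longrightarrow> z \<noteq> a \<Longrightarrow> z \<noteq> y \<Longrightarrow> K b y z > 0"
  using far_less_near by (simp add: K_def)

definition KI :: "real \<Rightarrow> 'a \<Rightarrow> ('a \<Rightarrow> real) \<Rightarrow> ennreal" where
  "KI b y h = (\<integral>\<^sup>+z. ennreal (K b y z * h z) * indicator (ball a l) z \<partial>lborel)"

lemma KI_mono_AE:
  assumes "b > 0" "y \<in> ball a l" "AE z in lborel. z \<in> ball a l \<longrightarrow> h z \<le> k z"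
  shows "KI b y h \<le> KI b y k"
  unfolding KI_def
proof (rule nn_integral_mono_AE)
  show "AE z in lborel. ennreal (K b y z * h z) * indicator (ball a l) z \<le> ennreal (K b y z * k z) * indicator (ball a l) z"
    using assms(3) AE_generic[of y]
  proof eventually_elim
    case (elim z)
    then show ?case
      using K_pos[OF assms(1,2), of z] by (auto simp: indicator_def intro!: ennreal_leI mult_left_mono)
  qed
qed

lemma KI_add:
  assumes b: "b > 0" "y \<in> ball a l" and [measurable]: "h \<in> borel_measurable borel" "k \<in> borel_measurable borel"
    and nn: "\<And>z. z \<in> ball a l \<Longrightarrow> h z \<ge> 0" "\<And>z. z \<in> ball a l \<Longrightarrow> k z \<ge> 0"
  shows "KI b y (\<lambda>z. h z + k z) = KI b y h + KI b y k"
proof -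
  have "KI b y (\<lambda>z. h z + k z) = (\<integral>\<^sup>+z. ennreal (K b y z * h z) * indicator (ball a l) z + ennreal (K b y z * k z) * indicator (ball a l) z \<partial>lborel)"
    unfolding KI_def
  proof (rule nn_integral_cong_AE)
    show "AE z in lborel. ennreal (K b y z * (h z + k z)) * indicator (ball a l) z
      = ennreal (K b y z * h z) * indicator (ball a l) z + ennreal (K b y z * k z) * indicator (ball a l) z"
      using AE_generic[of y]
    proof eventually_elim
      case (elim z)
      show ?case
      proof (cases "z \<in> ball a l")
        case True
        then have "K b y z \<ge> 0" using K_pos[OF b True] elim by simp
        then show ?thesis using nn[OF True] True by (simp add: distrib_left ennreal_plus)
      qed simp
    qed
  qed
  also have "\<dots> = KI b y h + KI b y k" unfolding KI_def by (rule nn_integral_add) measurable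
  finally show ?thesis .
qed

lemma KI_le_near:
  assumes b: "b > 0" and c: "c \<ge> 0" and E [measurable]: "E \<in> sets borel" "E \<subseteq> ball a l"
  shows "KI b y (\<lambda>z. c * indicator E z) \<le> ennreal c * (\<integral>\<^sup>+z. ennreal (norm (y - z) powr (- b)) * indicator E z \<partial>lborel)"
proof -
  have "KI b y (\<lambda>z. c * indicator E z) \<le> (\<integral>\<^sup>+z. ennreal c * (ennreal (norm (y - z) powr (- b)) * indicator E z) \<partial>lborel)"
    unfolding KI_def
  proof (rule nn_integral_mono)
    fix z
    show "ennreal (K b y z * (c * indicator E z)) * indicator (ball a l) z \<le> ennreal c * (ennreal (norm (y - z) powr (- b)) * indicator E z)"
    proof (cases "z \<in> E")
      case True
      have "K b y z * c \<le> c * norm (y - z) powr (- b)"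
        using mult_right_mono[OF K_le[of b y z] c] by (simp add: near_def mult.commute)
      then show ?thesis using True E(2) c by (auto simp: ennreal_mult[symmetric] intro!: ennreal_leI)
    qed simp
  qed
  also have "\<dots> = ennreal c * (\<integral>\<^sup>+z. ennreal (norm (y - z) powr (- b)) * indicator E z \<partial>lborel)"
    by (rule nn_integral_cmult) measurable
  finally show ?thesis .
qed

lemma near_integrable: assumes b: "0 < b" "b < real DIM('a)"
  shows "integrable lborel (\<lambda>z. near b y z * indicator (ball a l) z)"
proof (rule integrableI_nonneg)
  have fin: "emeasure lborel (ball a l) < \<infinity>" using emeasure_bounded_finite[of "ball a l"] by simp
  obtain D where D: "\<And>y. (\<integral>\<^sup>+z. ennreal (norm (y - z) powr (- b)) * indicator (ball a l) z \<partial>lborel) \<le> ennreal D"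
    by (rule riesz_bounded_sets[OF less_imp_le[OF b(1)] b(2) ball_sets fin], rule that, assumption)
  have "(\<integral>\<^sup>+z. ennreal (near b y z * indicator (ball a l) z) \<partial>lborel) = (\<integral>\<^sup>+z. ennreal (norm (y - z) powr (- b)) * indicator (ball a l) z \<partial>lborel)"
    by (intro nn_integral_cong) (simp add: near_def indicator_def)
  also have "\<dots> < \<infinity>" using D[of y] by (rule order_le_less_trans) simp
  finally show "(\<integral>\<^sup>+z. ennreal (near b y z * indicator (ball a l) z) \<partial>lborel) < \<infinity>" .
  show "(\<lambda>z. near b y z * indicator (ball a l) z) \<in> borel_measurable lborel" by measurable
qed simp

lemma theta_range: "0 < 2 * \<theta>" "2 * \<theta> < real DIM('a)"
  using theta_pos two_theta s0 by auto

text \<open>The identity for the truncations passes to the limit: Fatou handles the reflected term, where the pole sits, and dominated convergence the other one.\<close>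

lemma compare:
  assumes y: "y \<in> ball a l" "y \<noteq> a" "star y \<noteq> 0"
  shows "ennreal (\<kappa> * u y) + KI (2 * \<theta>) y fl \<le> ennreal (\<kappa> * ul y) + KI (2 * \<theta>) y (slap s u)"
    and "KI (2 * \<theta>) y (slap s u) < \<infinity>"
proof -
  let ?b = "2 * \<theta>"
  let ?k = "\<lambda>z. K ?b y z"
  have y0: "y \<noteq> 0" using y(1) by (rule ball_nonzero)
  obtain B where B: "\<And>n x. x \<in> cball a l \<Longrightarrow> slap s (v (real n)) x \<le> B" "\<And>x. x \<in> cball a l \<Longrightarrow> slap s u x \<le> B"
    by (rule slap_v_bound[of "cball a l", OF compact_cball], use la in simp, rule that, assumption+)
  define g where "g n z = slap s (v (real n)) z" for n z
  have gm [measurable]: "g n \<in> borel_measurable borel" for n unfolding g_def[abs_def] by measurable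
  have g0: "g n z \<ge> 0" for n z unfolding g_def by (rule slap_v_nonneg) simp
  have gB: "g n z \<le> B" if "z \<in> ball a l" for n z unfolding g_def using that by (intro B) auto
  have glim: "(\<lambda>n. g n z) \<longlonglongrightarrow> slap s u z" if "z \<noteq> 0" for z unfolding g_def using that by (rule slap_v_tendsto)
  define w where "w z = B * (near ?b y z * indicator (ball a l) z)" for z
  have wi: "integrable lborel w" unfolding w_def[abs_def] by (intro integrable_mult_right near_integrable theta_range)
  have Kb: "AE z in lborel. z \<in> ball a l \<longrightarrow> 0 \<le> ?k z \<and> ?k z \<le> near ?b y z"
    using AE_generic[of y] by eventually_elim (use K_pos[OF theta_range(1) y(1)] K_le in \<open>auto intro: less_imp_le\<close>)
  have dom: "AE z in lborel. norm (indicator (ball a l) z * (?k z * h z)) \<le> w z \<and> 0 \<le> indicator (ball a l) z * (?k z * h z)"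
    if "\<forall>z\<in>ball a l. 0 \<le> h z \<and> h z \<le> B" for h
    using Kb
  proof eventually_elim
    case (elim z)
    show ?case
    proof (cases "z \<in> ball a l")
      case True
      then have k: "0 \<le> ?k z" "?k z \<le> near ?b y z" using elim by auto
      have "?k z * h z \<le> near ?b y z * B" using k that True by (intro mult_mono) auto
      then show ?thesis using k that True by (simp add: w_def mult.commute)
    qed (simp add: w_def)
  qed
  define Y where "Y h = (\<integral>z. indicator (ball a l) z * (?k z * h z) \<partial>lborel)" for h
  have Yi: "KI ?b y h = ennreal (Y h) \<and> Y h \<ge> 0"
    if [measurable]: "h \<in> borel_measurable borel" and h: "\<forall>z\<in>ball a l. 0 \<le> h z \<and> h z \<le> B" for h
  proof -
    note d = dom[of h, OF h]
    have i: "integrable lborel (\<lambda>z. indicator (ball a l) z * (?k z * h z))"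
    proof (rule Bochner_Integration.integrable_bound[OF wi])
      show "AE z in lborel. norm (indicator (ball a l) z * (?k z * h z)) \<le> norm (w z)"
        using d by eventually_elim (metis abs_ge_self order_trans real_norm_def)
    qed measurable
    have nn: "AE z in lborel. 0 \<le> indicator (ball a l) z * (?k z * h z)" using d by eventually_elim blast
    have "KI ?b y h = (\<integral>\<^sup>+z. ennreal (indicator (ball a l) z * (?k z * h z)) \<partial>lborel)"
      unfolding KI_def by (intro nn_integral_cong) (simp add: indicator_def)
    also have "\<dots> = ennreal (Y h)" unfolding Y_def by (rule nn_integral_eq_integral[OF i nn])
    finally show ?thesis unfolding Y_def using integral_nonneg_AE[OF nn] by simp
  qed
  have um: "slap s u \<in> borel_measurable borel" by measurable
  have u0: "\<forall>z\<in>ball a l. 0 \<le> slap s u z \<and> slap s u z \<le> B"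
    using slap_u_nonneg ball_nonzero B(2) by fastforce
  have gb: "\<forall>z\<in>ball a l. 0 \<le> g n z \<and> g n z \<le> B" for n
    using g0 gB by blast
  note Yu = Yi[OF um u0]
  then show "KI ?b y (slap s u) < \<infinity>" by simp
  have Ylim: "(\<lambda>n. Y (g n)) \<longlonglongrightarrow> Y (slap s u)"
    unfolding Y_def
  proof (rule integral_dominated_convergence[OF _ _ wi])
    show "AE z in lborel. norm (indicator (ball a l) z * (?k z * g n z)) \<le> w z" for n
      using dom[of "g n", OF gb[of n]] by eventually_elim blast
    show "AE z in lborel. (\<lambda>n. indicator (ball a l) z * (?k z * g n z)) \<longlonglongrightarrow> indicator (ball a l) z * (?k z * slap s u z)"
      using AE_nonzero by eventually_elim (intro tendsto_intros glim)
  qed measurable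
  define X where "X n = KI ?b y (\<lambda>z. rho z powr (real DIM('a) + 2 * s) * g n (star z))" for n
  have N2: "2 * real DIM('a) - ?b = real DIM('a) + 2 * s" using two_theta by simp
  have ident: "ennreal (\<kappa> * v (real n) y) + X n = ennreal (rho y powr ?b * (\<kappa> * v (real n) (star y)) + Y (g n))" for n
  proof -
    have rep: "(\<integral>\<^sup>+z. ennreal (norm (x - z) powr (- ?b) * g n z) \<partial>lborel) = ennreal (\<kappa> * v (real n) x)" if "x \<noteq> 0" for x
      using v_representation[OF that, of "real n"] by (simp add: riesz_def g_def)
    have "ennreal (\<kappa> * v (real n) y) + X n = ennreal (rho y powr ?b) * ennreal (\<kappa> * v (real n) (star y)) + KI ?b y (g n)"
      using kelvin_identity[OF gm[of n] g0[of n] theta_range(1) y(1,2)] unfolding N2 rep[OF y0] rep[OF y(3)] X_def KI_def K_def .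
    also have "ennreal (rho y powr ?b) * ennreal (\<kappa> * v (real n) (star y)) = ennreal (rho y powr ?b * (\<kappa> * v (real n) (star y)))"
      using kappa_pos v_nonneg[of "real n" "star y"] by (intro ennreal_mult[symmetric]) auto
    also have "\<dots> + KI ?b y (g n) = ennreal (rho y powr ?b * (\<kappa> * v (real n) (star y)) + Y (g n))"
      using Yi[OF gm[of n] gb[of n]] kappa_pos v_nonneg[of "real n" "star y"] by (subst ennreal_plus) auto
    finally show ?thesis .
  qed
  define c d where "c = \<kappa> * u y" and "d = \<kappa> * ul y"
  have cd: "c \<ge> 0" "d \<ge> 0" using kappa_pos upos[of y] ul_pos[OF y(2)] by (auto simp: c_def d_def)
  have ev: "\<forall>\<^sub>F n in sequentially. X n = ennreal (d + Y (g n) - c) \<and> 0 \<le> d + Y (g n) - c"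
  proof -
    have ge: "\<forall>\<^sub>F n in sequentially. t < real n" for t
      by (rule filterlim_at_top_dense[THEN iffD1, OF filterlim_real_sequentially, rule_format])
    show ?thesis
      using ge[of "u y"] ge[of "u (star y)"]
    proof eventually_elim
      case (elim n)
      have "v (real n) y = u y" "v (real n) (star y) = u (star y)"
        using elim y0 y(3) by (auto simp: v_def trunc_id)
      then have e: "ennreal c + X n = ennreal (d + Y (g n))"
        using ident[of n] by (simp add: c_def d_def ul_def mult_ac)
      have "ennreal c + X n < \<infinity>" unfolding e by simp
      then have "X n < \<infinity>" by (simp add: ennreal_add_less_top)
      then obtain x where x: "x \<ge> 0" "X n = ennreal x" by (auto simp: less_top_ennreal)
      have "ennreal (c + x) = ennreal (d + Y (g n))" using e x cd by (simp add: ennreal_plus)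
      then have "c + x = d + Y (g n)" using x cd Yi[OF gm[of n] gb[of n]] by (subst (asm) ennreal_inj) auto
      then have "x = d + Y (g n) - c" by simp
      then show ?case using x by simp
    qed
  qed
  have xl: "(\<lambda>n. d + Y (g n) - c) \<longlonglongrightarrow> d + Y (slap s u) - c" by (intro tendsto_intros Ylim)
  then have "(\<lambda>n. ennreal (d + Y (g n) - c)) \<longlonglongrightarrow> ennreal (d + Y (slap s u) - c)" by (rule tendsto_ennrealI)
  then have Xlim: "X \<longlonglongrightarrow> ennreal (d + Y (slap s u) - c)"
    by (rule Lim_transform_eventually) (use ev in eventually_elim, simp)
  have nnl: "0 \<le> d + Y (slap s u) - c"
    by (rule tendsto_lowerbound[OF xl]) (use ev in \<open>auto elim!: eventually_mono\<close>)
  have "KI ?b y fl \<le> liminf X"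
  proof -
    let ?i = "\<lambda>n z. ennreal (?k z * (rho z powr (real DIM('a) + 2 * s) * g n (star z))) * indicator (ball a l) z"
    have "KI ?b y fl = (\<integral>\<^sup>+z. liminf (\<lambda>n. ?i n z) \<partial>lborel)"
      unfolding KI_def
    proof (rule nn_integral_cong_AE)
      show "AE z in lborel. ennreal (?k z * fl z) * indicator (ball a l) z = liminf (\<lambda>n. ?i n z)"
        using AE_generic[of y]
      proof eventually_elim
        case (elim z)
        have "(\<lambda>n. ennreal (?k z * (rho z powr (real DIM('a) + 2 * s) * g n (star z)))) \<longlonglongrightarrow> ennreal (?k z * fl z)"
          unfolding fl_def using elim by (intro tendsto_ennrealI tendsto_intros glim) auto
        then have "(\<lambda>n. ?i n z) \<longlonglongrightarrow> ennreal (?k z * fl z) * indicator (ball a l) z"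
          by (cases "z \<in> ball a l") auto
        then show ?case by (intro lim_imp_Liminf[symmetric]) auto
      qed
    qed
    also have "\<dots> \<le> liminf (\<lambda>n. \<integral>\<^sup>+z. ?i n z \<partial>lborel)"
      by (rule nn_integral_liminf) measurable
    finally show ?thesis unfolding X_def KI_def .
  qed
  also have "liminf X = ennreal (d + Y (slap s u) - c)" using Xlim by (intro lim_imp_Liminf) auto
  finally have "KI ?b y fl \<le> ennreal (d + Y (slap s u) - c)" .
  then have "ennreal c + KI ?b y fl \<le> ennreal c + ennreal (d + Y (slap s u) - c)" by (rule add_left_mono)
  also have "\<dots> = ennreal (c + (d + Y (slap s u) - c))" using cd nnl by (intro ennreal_plus[symmetric])
  also have "c + (d + Y (slap s u) - c) = d + Y (slap s u)" by simp
  also have "ennreal (d + Y (slap s u)) = ennreal d + KI ?b y (slap s u)" using cd Yu by (simp add: ennreal_plus)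
  finally show "ennreal (\<kappa> * u y) + KI ?b y fl \<le> ennreal (\<kappa> * ul y) + KI ?b y (slap s u)" unfolding c_def d_def .
qed

lemma ennreal_cancel:
  fixes X Y c d g h :: ennreal
  assumes "c + X \<le> d + Y" "Y + g \<le> X + h" "X < \<infinity>" shows "c + g \<le> d + h"
proof -
  have "X + (c + g) = c + X + g" by (simp add: ac_simps)
  also have "\<dots> \<le> d + Y + g" using assms(1) by (rule add_right_mono)
  also have "\<dots> = d + (Y + g)" by (simp add: ac_simps)
  also have "\<dots> \<le> d + (X + h)" using assms(2) by (rule add_left_mono)
  also have "\<dots> = X + (d + h)" by (simp add: ac_simps)
  finally show ?thesis using assms(3) by (auto simp: ennreal_add_left_cancel_le)
qed

lemma compare_perturbed:
  assumes y: "y \<in> ball a l" "y \<noteq> a" "star y \<noteq> 0"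
    and [measurable]: "g \<in> borel_measurable borel" "h \<in> borel_measurable borel"
    and g0: "\<And>z. g z \<ge> 0" and h0: "\<And>z. h z \<ge> 0"
    and le: "\<And>z. z \<in> ball a l \<Longrightarrow> z \<noteq> a \<Longrightarrow> star z \<noteq> 0 \<Longrightarrow> slap s u z + g z \<le> fl z + h z"
  shows "ennreal (\<kappa> * u y) + KI (2 * \<theta>) y g \<le> ennreal (\<kappa> * ul y) + KI (2 * \<theta>) y h"
proof (rule ennreal_cancel[OF compare(1)[OF y]])
  let ?b = "2 * \<theta>"
  define fl' where "fl' z = max 0 (fl z)" for z
  have [measurable]: "fl' \<in> borel_measurable borel" unfolding fl'_def by measurable
  have fl'0: "fl' z \<ge> 0" for z by (simp add: fl'_def)
  have eq: "KI ?b y fl' = KI ?b y fl"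
  proof (rule antisym)
    show "KI ?b y fl' \<le> KI ?b y fl"
    proof (rule KI_mono_AE[OF theta_range(1) y(1)])
      show "AE z in lborel. z \<in> ball a l \<longrightarrow> fl' z \<le> fl z"
        using AE_generic[of y] by eventually_elim (use slap_u_nonneg in \<open>auto simp: fl'_def fl_def\<close>)
    qed
    show "KI ?b y fl \<le> KI ?b y fl'" by (rule KI_mono_AE[OF theta_range(1) y(1)]) (simp add: fl'_def)
  qed
  have "KI ?b y (slap s u) + KI ?b y g = KI ?b y (\<lambda>z. slap s u z + g z)"
    by (rule KI_add[symmetric, OF theta_range(1) y(1)]) (use slap_u_nonneg ball_nonzero g0 in auto)
  also have "\<dots> \<le> KI ?b y (\<lambda>z. fl' z + h z)"
  proof (rule KI_mono_AE[OF theta_range(1) y(1)])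
    show "AE z in lborel. z \<in> ball a l \<longrightarrow> slap s u z + g z \<le> fl' z + h z"
      using AE_generic[of y]
    proof eventually_elim
      case (elim z)
      have "fl z \<le> fl' z" by (simp add: fl'_def)
      then show ?case using le[of z] elim by fastforce
    qed
  qed
  also have "\<dots> = KI ?b y fl' + KI ?b y h"
    by (rule KI_add[OF theta_range(1) y(1)]) (use fl'0 h0 in auto)
  finally show "KI ?b y (slap s u) + KI ?b y g \<le> KI ?b y fl + KI ?b y h" unfolding eq .
  have "ennreal (\<kappa> * u y) + KI ?b y fl < \<infinity>"
    using compare(2)[OF y] by (intro order_le_less_trans[OF compare(1)[OF y]]) (simp add: ennreal_add_less_top)
  then show "KI ?b y fl < \<infinity>" by (simp add: ennreal_add_less_top)
qed

text \<open>The Kelvin transform of the Hartree potential carries the exponent of its own kernel, so the same splitting at the sphere applies to it.\<close>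

definition Hl :: "'a \<Rightarrow> real" where "Hl y = rho y powr \<mu> * H (star y)"

lemma hartree_compare:
  assumes y: "y \<in> ball a l" "y \<noteq> a" "star y \<noteq> 0"
    and M: "\<And>z. z \<in> ball a l \<Longrightarrow> u z \<le> M"
    and [measurable]: "h \<in> borel_measurable borel" and h0: "\<And>z. h z \<ge> 0"
    and le: "\<And>z. z \<in> ball a l \<Longrightarrow> z \<noteq> a \<Longrightarrow> star z \<noteq> 0 \<Longrightarrow> u z powr p \<le> ul z powr p + h z"
  shows "ennreal (H y) \<le> ennreal (Hl y) + KI \<mu> y h"
proof -
  let ?U = "\<lambda>z. u z powr p" and ?V = "\<lambda>z. rho z powr (2 * real DIM('a) - \<mu>) * u (star z) powr p"
  have y0: "y \<noteq> 0" using y(1) by (rule ball_nonzero)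
  have Hn: "(\<integral>\<^sup>+z. ennreal (norm (x - z) powr (- \<mu>) * ?U z) \<partial>lborel) = ennreal (H x)" if "x \<noteq> 0" for x
  proof -
    have "(\<integral>\<^sup>+z. ennreal (norm (x - z) powr (- \<mu>) * ?U z) \<partial>lborel) = (\<integral>\<^sup>+z. ennreal (?U z * norm (x - z) powr (- \<mu>)) \<partial>lborel)"
      by (simp add: mult.commute)
    also have "\<dots> = ennreal (H x)" unfolding H_def by (rule nn_integral_eq_integral[OF Hint[OF that]]) simp
    finally show ?thesis .
  qed
  have Um: "?U \<in> borel_measurable borel" by measurable
  have Un: "?U z \<ge> 0" for z by simp
  have "ennreal (H y) + KI \<mu> y ?V = ennreal (rho y powr \<mu>) * ennreal (H (star y)) + KI \<mu> y ?U"
    using kelvin_identity[OF Um Un \<mu>(1) y(1,2)] unfolding Hn[OF y0] Hn[OF y(3)] KI_def K_def .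
  also have "ennreal (rho y powr \<mu>) * ennreal (H (star y)) = ennreal (Hl y)"
    unfolding Hl_def by (intro ennreal_mult[symmetric]) (auto intro: H_nonneg)
  finally have ident: "ennreal (H y) + KI \<mu> y ?V = ennreal (Hl y) + KI \<mu> y ?U" .
  have V: "ul z powr p \<le> ?V z" if z: "z \<in> ball a l" "z \<noteq> a" for z
  proof -
    have "ul z powr p = rho z powr (2 * \<theta> * p) * u (star z) powr p"
      unfolding ul_def by (simp add: powr_mult powr_powr)
    also have "\<dots> \<le> ?V z"
      using rho_ge_1[OF z(2,1)] psub by (intro mult_right_mono powr_mono) (auto simp: mult.commute)
    finally show ?thesis .
  qed
  have leUV: "KI \<mu> y ?U + 0 \<le> KI \<mu> y ?V + KI \<mu> y h"
  proof -
    have "KI \<mu> y ?U \<le> KI \<mu> y (\<lambda>z. ?V z + h z)"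
    proof (rule KI_mono_AE[OF \<mu>(1) y(1)])
      show "AE z in lborel. z \<in> ball a l \<longrightarrow> u z powr p \<le> ?V z + h z"
        using AE_generic[of y]
      proof eventually_elim
        case (elim z)
        then show ?case using le[of z] V[of z] by fastforce
      qed
    qed
    also have "\<dots> = KI \<mu> y ?V + KI \<mu> y h"
      by (rule KI_add[OF \<mu>(1) y(1)]) (use h0 in auto)
    finally show ?thesis by simp
  qed
  have fin: "KI \<mu> y ?V < \<infinity>"
  proof -
    have "KI \<mu> y ?U \<le> KI \<mu> y (\<lambda>z. \<bar>M\<bar> powr p * indicator (ball a l) z)"
      by (rule KI_mono_AE[OF \<mu>(1) y(1)], rule AE_I2)
        (use M upos p1 in \<open>auto simp: indicator_def intro!: powr_mono2 order_trans[OF M abs_ge_self] intro: less_imp_le\<close>)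
    also have "\<dots> \<le> ennreal (\<bar>M\<bar> powr p) * (\<integral>\<^sup>+z. ennreal (norm (y - z) powr (- \<mu>)) * indicator (ball a l) z \<partial>lborel)"
      by (rule KI_le_near) (use \<mu> in auto)
    also have "\<dots> < \<infinity>"
    proof -
      have f: "emeasure lborel (ball a l) < \<infinity>" using emeasure_bounded_finite[of "ball a l"] by simp
      obtain D where D: "\<And>y. (\<integral>\<^sup>+z. ennreal (norm (y - z) powr (- \<mu>)) * indicator (ball a l) z \<partial>lborel) \<le> ennreal D"
        by (rule riesz_bounded_sets[OF less_imp_le[OF \<mu>(1)] \<mu>(2) ball_sets f], rule that, assumption)
      have "(\<integral>\<^sup>+z. ennreal (norm (y - z) powr (- \<mu>)) * indicator (ball a l) z \<partial>lborel) < \<infinity>"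
        using D[of y] by (rule order_le_less_trans) simp
      then show ?thesis by (simp add: ennreal_mult_less_top)
    qed
    finally have "ennreal (H y) + KI \<mu> y ?V < \<infinity>" unfolding ident by (simp add: ennreal_add_less_top)
    then show ?thesis by (simp add: ennreal_add_less_top)
  qed
  have "ennreal (H y) + 0 \<le> ennreal (Hl y) + KI \<mu> y h"
    by (rule ennreal_cancel[OF _ leUV fin]) (simp add: ident)
  then show ?thesis by simp
qed

lemma fl_ge: assumes z: "z \<in> ball a l" "z \<noteq> a" "star z \<noteq> 0" shows "Hl z * ul z powr q / C \<le> fl z"
proof -
  have e: "ul z powr q = rho z powr (2 * \<theta> * q) * u (star z) powr q"
    unfolding ul_def by (simp add: powr_mult powr_powr)
  have "rho z powr (\<mu> + 2 * \<theta> * q) \<le> rho z powr (real DIM('a) + 2 * s)"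
    using rho_ge_1[OF z(2,1)] qsub by (intro powr_mono) (auto simp: mult.commute)
  then have "rho z powr (\<mu> + 2 * \<theta> * q) * (H (star z) * u (star z) powr q / C) \<le> rho z powr (real DIM('a) + 2 * s) * (H (star z) * u (star z) powr q / C)"
    using H_nonneg C by (intro mult_right_mono) auto
  moreover have "fl z = rho z powr (real DIM('a) + 2 * s) * (H (star z) * u (star z) powr q / C)"
    by (simp add: fl_def slap_u[OF z(3)])
  moreover have "Hl z * ul z powr q / C = rho z powr (\<mu> + 2 * \<theta> * q) * (H (star z) * u (star z) powr q / C)"
    unfolding e Hl_def by (simp add: powr_add)
  ultimately show ?thesis by linarith
qed

end

section \<open>Moving spheres\<close>

lemma powr_diff_le:
  fixes x y p :: real
  assumes "0 < y" "y \<le> x" "p \<ge> 1" shows "x powr p - y powr p \<le> p * x powr (p - 1) * (x - y)"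
proof (cases "y = x")
  case False
  then have yx: "y < x" using assms by simp
  obtain z where z: "y < z" "z < x" "x powr p - y powr p = (x - y) * (p * z powr (p - 1))"
  proof (atomize_elim, rule exE[OF MVT2[OF yx, of "\<lambda>z. z powr p" "\<lambda>z. p * z powr (p - 1)"]])
    show "((\<lambda>z. z powr p) has_real_derivative p * z powr (p - 1)) (at z)" if "y \<le> z" "z \<le> x" for z
      using that assms by (auto intro!: derivative_eq_intros)
  qed blast
  have "z powr (p - 1) \<le> x powr (p - 1)" using z assms by (intro powr_mono2) auto
  then have "(x - y) * (p * z powr (p - 1)) \<le> (x - y) * (p * x powr (p - 1))"
    using yx assms by (intro mult_left_mono) auto
  then show ?thesis using z by (simp add: mult_ac)
qed simp

context choquard_kelvin
begin

lemma bad_eq: "bad a l = {z. z \<in> ball a l \<and> z \<noteq> a \<and> star z \<noteq> 0 \<and> ul z < u z}"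
  by (simp add: bad_def ul_def)

lemma bad_subset: "bad a l \<subseteq> ball a l" by (auto simp: bad_eq)

lemma bad_sets [measurable]: "bad a l \<in> sets borel"
proof -
  have "{z \<in> space borel. z \<in> ball a l \<and> z \<noteq> a \<and> star z \<noteq> 0 \<and> ul z < u z} \<in> sets borel" by measurable
  then show ?thesis by (simp add: bad_eq)
qed

lemma KI_zero: "KI b y (\<lambda>z. 0) = 0" by (simp add: KI_def)

text \<open>Inserting the bound for the excess into the Hartree term and into the power, each bounded on the ball, returns half of it because the potentials of the bad set are small.\<close>

lemma contraction_step:
  assumes M: "\<And>z. z \<in> ball a l \<Longrightarrow> u z \<le> M" and Hm: "\<And>z. z \<in> ball a l \<Longrightarrow> H z \<le> Hm"
    and e: "e \<ge> 0" "\<And>y. (\<integral>\<^sup>+z. ennreal (norm (y - z) powr (- \<mu>)) * indicator (bad a l) z \<partial>lborel) \<le> ennreal e"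
      "\<And>y. (\<integral>\<^sup>+z. ennreal (norm (y - z) powr (- (2 * \<theta>))) * indicator (bad a l) z \<partial>lborel) \<le> ennreal e"
    and D: "D \<ge> 0" "\<And>y. (\<integral>\<^sup>+z. ennreal (norm (y - z) powr (- (2 * \<theta>))) * indicator (ball a l) z \<partial>lborel) \<le> ennreal D"
    and small: "2 * (e * (p * M powr (p - 1) * M powr q * D + Hm * q * M powr (q - 1))) \<le> C * \<kappa>"
    and S: "S \<ge> 0" "\<And>z. z \<in> bad a l \<Longrightarrow> u z - ul z \<le> S"
    and y: "y \<in> bad a l"
  shows "u y - ul y \<le> S / 2"
proof -
  have y': "y \<in> ball a l" "y \<noteq> a" "star y \<noteq> 0" using y by (auto simp: bad_eq)
  have M0: "M > 0" using M[OF y'(1)] upos[of y] by linarith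
  have Hm0: "Hm \<ge> 0" using Hm[OF y'(1)] H_nonneg[of y] by linarith
  define c where "c = p * M powr (p - 1) * S"
  have c0: "c \<ge> 0" using p1 S by (simp add: c_def)
  have pow: "u z powr p \<le> ul z powr p + c * indicator (bad a l) z" if z: "z \<in> ball a l" "z \<noteq> a" "star z \<noteq> 0" for z
  proof (cases "z \<in> bad a l")
    case True
    then have lt: "ul z < u z" by (simp add: bad_eq)
    have "u z powr p - ul z powr p \<le> p * u z powr (p - 1) * (u z - ul z)"
      using ul_pos[OF z(2)] lt p1 by (intro powr_diff_le) auto
    also have "\<dots> \<le> p * M powr (p - 1) * S"
      using M[OF z(1)] upos[of z] p1 S(2)[OF True] lt by (intro mult_mono powr_mono2) (auto intro: less_imp_le)
    finally show ?thesis using True by (simp add: c_def)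
  next
    case False
    then have "u z \<le> ul z" using z by (simp add: bad_eq)
    then have "u z powr p \<le> ul z powr p" using upos[of z] p1 by (intro powr_mono2) (auto intro: less_imp_le)
    then show ?thesis using False by simp
  qed
  have Hc: "H z \<le> Hl z + c * e" if z: "z \<in> ball a l" "z \<noteq> a" "star z \<noteq> 0" for z
  proof -
    have "ennreal (H z) \<le> ennreal (Hl z) + KI \<mu> z (\<lambda>z. c * indicator (bad a l) z)"
      by (rule hartree_compare[OF z M]) (use c0 pow in auto)
    also have "\<dots> \<le> ennreal (Hl z) + ennreal c * ennreal e"
      by (intro add_left_mono order_trans[OF KI_le_near[OF \<mu>(1) c0 bad_sets bad_subset]] mult_left_mono e) simp
    also have "\<dots> = ennreal (Hl z + c * e)"
      using c0 e(1) H_nonneg by (simp add: ennreal_mult[symmetric] ennreal_plus[symmetric] Hl_def del: ennreal_plus)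
    finally show ?thesis using c0 e(1) H_nonneg by (subst (asm) ennreal_le_iff) (auto simp: Hl_def)
  qed
  define A B where "A = c * e * M powr q / C" and "B = Hm * (q * M powr (q - 1) * S) / C"
  have AB: "A \<ge> 0" "B \<ge> 0" using c0 e(1) C Hm0 q1 S(1) by (auto simp: A_def B_def)
  define h where "h z = A * indicator (ball a l) z + B * indicator (bad a l) z" for z
  have [measurable]: "h \<in> borel_measurable borel" unfolding h_def by measurable
  have h0: "h z \<ge> 0" for z using AB by (simp add: h_def)
  have le: "slap s u z + 0 \<le> fl z + h z" if z: "z \<in> ball a l" "z \<noteq> a" "star z \<noteq> 0" for z
  proof -
    have uz: "0 < u z" "u z \<le> M" by (rule upos, rule M[OF z(1)])
    have ulz: "0 < ul z" by (rule ul_pos[OF z(2)])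
    have Hl0: "Hl z \<ge> 0" by (simp add: Hl_def H_nonneg)
    have "H z * u z powr q \<le> Hl z * ul z powr q + c * e * M powr q + Hm * (q * M powr (q - 1) * S) * indicator (bad a l) z"
    proof (cases "z \<in> bad a l")
      case True
      then have lt: "ul z < u z" by (simp add: bad_eq)
      have d: "u z powr q - ul z powr q \<le> q * M powr (q - 1) * S"
      proof -
        have "u z powr q - ul z powr q \<le> q * u z powr (q - 1) * (u z - ul z)"
          using ulz lt q1 by (intro powr_diff_le) auto
        also have "\<dots> \<le> q * M powr (q - 1) * S"
          using uz q1 S(2)[OF True] lt by (intro mult_mono powr_mono2) auto
        finally show ?thesis .
      qed
      have "u z powr q = (u z powr q - ul z powr q) + ul z powr q" by simp
      then have "H z * u z powr q = H z * (u z powr q - ul z powr q) + H z * ul z powr q" by (metis distrib_left)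
      also have "H z * (u z powr q - ul z powr q) \<le> Hm * (q * M powr (q - 1) * S)"
        using d Hm[OF z(1)] H_nonneg Hm0 lt ulz q1 by (intro mult_mono) (auto intro!: powr_mono2)
      also have "H z * ul z powr q \<le> (Hl z + c * e) * ul z powr q" using Hc[OF z] by (intro mult_right_mono) auto
      also have "\<dots> = Hl z * ul z powr q + c * e * ul z powr q" by (simp add: distrib_right)
      also have "c * e * ul z powr q \<le> c * e * M powr q"
        using c0 e(1) ulz lt uz q1 by (intro mult_left_mono powr_mono2) auto
      finally show ?thesis using True by simp
    next
      case False
      then have ge: "u z \<le> ul z" using z by (simp add: bad_eq)
      have "H z * u z powr q \<le> (Hl z + c * e) * u z powr q" using Hc[OF z] by (intro mult_right_mono) auto
      also have "\<dots> = Hl z * u z powr q + c * e * u z powr q" by (simp add: distrib_right)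
      also have "\<dots> \<le> Hl z * ul z powr q + c * e * M powr q"
        using c0 e(1) Hl0 uz ge q1 by (intro add_mono mult_left_mono powr_mono2) auto
      finally show ?thesis using False by simp
    qed
    then have "H z * u z powr q / C \<le> (Hl z * ul z powr q + c * e * M powr q + Hm * (q * M powr (q - 1) * S) * indicator (bad a l) z) / C"
      using C by (intro divide_right_mono) auto
    also have "\<dots> = Hl z * ul z powr q / C + h z" using z by (simp add: h_def A_def B_def add_divide_distrib)
    also have "\<dots> \<le> fl z + h z" using fl_ge[OF z] by simp
    finally show ?thesis using slap_u[of z] ball_nonzero[OF z(1)] by simp
  qed
  have "ennreal (\<kappa> * u y) + KI (2 * \<theta>) y (\<lambda>z. 0) \<le> ennreal (\<kappa> * ul y) + KI (2 * \<theta>) y h"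
    by (rule compare_perturbed[OF y']) (use h0 le in auto)
  also have "KI (2 * \<theta>) y h \<le> ennreal A * ennreal D + ennreal B * ennreal e"
  proof -
    have "KI (2 * \<theta>) y h = KI (2 * \<theta>) y (\<lambda>z. A * indicator (ball a l) z) + KI (2 * \<theta>) y (\<lambda>z. B * indicator (bad a l) z)"
      unfolding h_def by (rule KI_add[OF theta_range(1) y'(1)]) (use AB in auto)
    also have "\<dots> \<le> ennreal A * ennreal D + ennreal B * ennreal e"
      by (intro add_mono order_trans[OF KI_le_near[OF theta_range(1) AB(1) ball_sets subset_refl]]
          order_trans[OF KI_le_near[OF theta_range(1) AB(2) bad_sets bad_subset]] mult_left_mono e D) simp_all
    finally show ?thesis .
  qed
  also have "ennreal (\<kappa> * ul y) + (ennreal A * ennreal D + ennreal B * ennreal e) = ennreal (\<kappa> * ul y + (A * D + B * e))"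
    using AB D(1) e(1) kappa_pos ul_pos[OF y'(2)] by (simp add: ennreal_mult[symmetric] ennreal_plus[symmetric] del: ennreal_plus)
  finally have "ennreal (\<kappa> * u y) \<le> ennreal (\<kappa> * ul y + (A * D + B * e))" by (simp add: KI_zero add_left_mono)
  then have "\<kappa> * u y \<le> \<kappa> * ul y + (A * D + B * e)"
    using AB D(1) e(1) kappa_pos ul_pos[OF y'(2)] by (subst (asm) ennreal_le_iff) (auto intro!: add_nonneg_nonneg)
  moreover have "A * D + B * e = e * (p * M powr (p - 1) * M powr q * D + Hm * q * M powr (q - 1)) * S / C"
    using C by (simp add: A_def B_def c_def field_simps)
  moreover have "e * (p * M powr (p - 1) * M powr q * D + Hm * q * M powr (q - 1)) * S / C \<le> \<kappa> * (S / 2)"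
  proof -
    have "2 * (e * (p * M powr (p - 1) * M powr q * D + Hm * q * M powr (q - 1))) * S \<le> C * \<kappa> * S"
      using small S(1) by (rule mult_right_mono)
    then show ?thesis using C by (simp add: field_simps)
  qed
  ultimately have "\<kappa> * (u y - ul y) \<le> \<kappa> * (S / 2)" unfolding right_diff_distrib by linarith
  then show ?thesis using kappa_pos by simp
qed

text \<open>Iterating the contraction step forces the excess to be at most every term of a geometric sequence tending to zero.\<close>

lemma contraction:
  assumes M: "\<And>z. z \<in> ball a l \<Longrightarrow> u z \<le> M" and Hm: "\<And>z. z \<in> ball a l \<Longrightarrow> H z \<le> Hm"
    and e: "e \<ge> 0" "\<And>y. (\<integral>\<^sup>+z. ennreal (norm (y - z) powr (- \<mu>)) * indicator (bad a l) z \<partial>lborel) \<le> ennreal e"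
      "\<And>y. (\<integral>\<^sup>+z. ennreal (norm (y - z) powr (- (2 * \<theta>))) * indicator (bad a l) z \<partial>lborel) \<le> ennreal e"
    and D: "D \<ge> 0" "\<And>y. (\<integral>\<^sup>+z. ennreal (norm (y - z) powr (- (2 * \<theta>))) * indicator (ball a l) z \<partial>lborel) \<le> ennreal D"
    and small: "2 * (e * (p * M powr (p - 1) * M powr q * D + Hm * q * M powr (q - 1))) \<le> C * \<kappa>"
  shows "bad a l = {}"
proof (rule ccontr)
  assume "bad a l \<noteq> {}"
  then obtain y where y: "y \<in> bad a l" by blast
  have y': "y \<in> ball a l" "ul y < u y" using y by (auto simp: bad_eq)
  have M0: "M \<ge> 0" using M[OF y'(1)] upos[of y] by linarith
  have it: "\<forall>z\<in>bad a l. u z - ul z \<le> M * (1/2) ^ n" for n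
  proof (induction n)
    case 0
    show ?case
    proof
      fix z assume "z \<in> bad a l"
      then have "u z \<le> M" "ul z > 0" using M ul_pos by (auto simp: bad_eq)
      then show "u z - ul z \<le> M * (1/2) ^ 0" by simp
    qed
  next
    case (Suc n)
    show ?case
    proof
      fix z assume "z \<in> bad a l"
      then have "u z - ul z \<le> (M * (1/2) ^ n) / 2"
        using M0 Suc by (intro contraction_step[OF M Hm e D small]) auto
      then show "u z - ul z \<le> M * (1/2) ^ Suc n" by simp
    qed
  qed
  have "(\<lambda>n. M * (1/2) ^ n) \<longlonglongrightarrow> M * 0" by (intro tendsto_intros LIMSEQ_power_zero) simp
  then have "u y - ul y \<le> M * 0" by (rule LIMSEQ_le_const) (use it y in auto)
  then show False using y' by simp
qed

lemma H_pos: assumes "x \<noteq> 0" shows "H x > 0"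
  unfolding H_def
proof (rule integral_pos_open[OF Hint[OF assms]])
  show "AE y in lborel. 0 \<le> u y powr p * norm (x - y) powr - \<mu>" by simp
  show "open (- {x})" by (simp add: open_Compl)
  have "0 \<in> - {x}" using assms by simp
  then show "- {x} \<noteq> {}" by blast
  show "0 < u y powr p * norm (x - y) powr - \<mu>" if "y \<in> - {x}" for y using that upos[of y] by simp
qed

lemma star_0_ball: "star 0 \<in> ball a l" "star 0 \<noteq> a"
proof -
  have a0: "norm a > 0" using la l by linarith
  have "l * l < l * norm a" using la l by simp
  then have "l\<^sup>2 / norm a < l" using a0 by (simp add: power2_eq_square field_simps)
  then show "star 0 \<in> ball a l" using norm_star[of 0] by (simp add: dist_norm norm_minus_commute)
  show "star 0 \<noteq> a" using a0 by (intro star_neq) auto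
qed

lemma isCont_star: assumes "z \<noteq> a" shows "isCont star z"
  unfolding star_def[abs_def] inversion_def using assms by (intro continuous_intros) auto

text \<open>The transform has a pole at the image of the origin while the solution is bounded there, so the right-hand sides differ on an open set and the kernel is positive.\<close>

lemma strict:
  assumes good: "bad a l = {}" and y: "y \<in> ball a l" "y \<noteq> a" "star y \<noteq> 0"
  shows "u y < ul y"
proof -
  have le: "u z \<le> ul z" if "z \<in> ball a l" "z \<noteq> a" "star z \<noteq> 0" for z
  proof (rule ccontr)
    assume "\<not> u z \<le> ul z"
    then have "z \<in> bad a l" using that by (simp add: bad_eq)
    then show False using good by simp
  qed
  obtain M where M: "\<And>z. z \<in> ball a l \<Longrightarrow> u z \<le> M"
  proof -
    have "\<exists>x\<in>cball a l. \<forall>z\<in>cball a l. u z \<le> u x"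
      by (rule continuous_attains_sup[OF compact_cball _ continuous_on_subset[OF ucont]]) (use l la in auto)
    then show ?thesis using that by (meson ball_subset_cball subsetD)
  qed
  have HH: "H z \<le> Hl z" if z: "z \<in> ball a l" "z \<noteq> a" "star z \<noteq> 0" for z
  proof -
    have "ennreal (H z) \<le> ennreal (Hl z) + KI \<mu> z (\<lambda>z. 0)"
      by (rule hartree_compare[OF z M]) (use le upos p1 in \<open>auto intro!: powr_mono2 intro: less_imp_le\<close>)
    then show ?thesis using H_nonneg by (simp add: KI_zero Hl_def)
  qed
  have fle: "H z * ul z powr q / C \<le> fl z" if z: "z \<in> ball a l" "z \<noteq> a" "star z \<noteq> 0" for z
  proof -
    have "H z * ul z powr q / C \<le> Hl z * ul z powr q / C"
      using HH[OF z] C by (intro divide_right_mono mult_right_mono) auto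
    then show ?thesis using fl_ge[OF z] by linarith
  qed
  have ff: "slap s u z \<le> fl z" if z: "z \<in> ball a l" "z \<noteq> a" "star z \<noteq> 0" for z
  proof -
    have "H z * u z powr q / C \<le> H z * ul z powr q / C"
      using le[OF z] upos[of z] q1 C H_nonneg by (intro divide_right_mono mult_left_mono powr_mono2) (auto intro: less_imp_le)
    then show ?thesis using fle[OF z] slap_u[of z] ball_nonzero[OF z(1)] by simp
  qed
  define z0 where "z0 = star 0"
  have z0: "z0 \<in> ball a l" "z0 \<noteq> a" "star z0 = 0" using star_0_ball by (auto simp: z0_def)
  obtain r where r: "r > 0" "\<And>z. z \<noteq> z0 \<Longrightarrow> dist z z0 < r \<Longrightarrow> z \<in> ball a l \<and> z \<noteq> a \<and> star z \<noteq> 0 \<and> u z < ul z"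
  proof -
    have cu: "isCont u z0" using ucont ball_nonzero[OF z0(1)] by (simp add: continuous_on_eq_continuous_at open_Compl)
    have e1: "\<forall>\<^sub>F z in at z0. z \<in> ball a l \<and> z \<noteq> a"
      using z0 by (intro eventually_conj eventually_at_in_open' t1_space_nhds[THEN filter_leD[OF at_within_le_nhds]]) auto
    have "(u \<longlongrightarrow> u z0) (at z0)" using cu by (simp add: isCont_def)
    then have e2: "\<forall>\<^sub>F z in at z0. u z < u z0 + 1" by (rule order_tendstoD) simp
    have e3: "\<forall>\<^sub>F z in at z0. star z \<noteq> 0"
    proof -
      have "\<forall>\<^sub>F z in at z0. z \<noteq> z0" by (rule eventually_neq_at_within)
      then show ?thesis by eventually_elim (metis star_star z0_def)
    qed
    have "(star \<longlongrightarrow> 0) (at z0)" using isCont_star[OF z0(2)] z0(3) by (simp add: isCont_def)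
    then have "filterlim star (at 0) (at z0)" using e3 by (rule filterlim_atI)
    then have "filterlim (\<lambda>z. u (star z)) at_top (at z0)" by (rule filterlim_compose[OF ulim])
    then have e4: "\<forall>\<^sub>F z in at z0. u z0 + 1 \<le> u (star z)" by (simp add: filterlim_at_top)
    have "\<forall>\<^sub>F z in at z0. z \<in> ball a l \<and> z \<noteq> a \<and> star z \<noteq> 0 \<and> u z < ul z"
      using e1 e2 e3 e4
    proof eventually_elim
      case (elim z)
      have "1 powr (2 * \<theta>) \<le> rho z powr (2 * \<theta>)"
        using rho_ge_1[of z] elim theta_range by (intro powr_mono2) auto
      then have "1 * u (star z) \<le> ul z" unfolding ul_def using upos[of "star z"] by (intro mult_right_mono) (auto intro: less_imp_le)
      then show ?case using elim by auto
    qed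
    then show ?thesis using that unfolding eventually_at by blast
  qed
  define g where "g z = max 0 (fl z - slap s u z)" for z
  have [measurable]: "g \<in> borel_measurable borel" unfolding g_def by measurable
  have cmp: "ennreal (\<kappa> * u y) + KI (2 * \<theta>) y g \<le> ennreal (\<kappa> * ul y) + KI (2 * \<theta>) y (\<lambda>z. 0)"
    by (rule compare_perturbed[OF y]) (use ff in \<open>auto simp: g_def\<close>)
  have "KI (2 * \<theta>) y g \<noteq> 0"
  proof
    assume "KI (2 * \<theta>) y g = 0"
    then have "AE z in lborel. ennreal (K (2 * \<theta>) y z * g z) * indicator (ball a l) z = 0"
      unfolding KI_def by (subst (asm) nn_integral_0_iff_AE) auto
    then have "AE z in lborel. ennreal (K (2 * \<theta>) y z * g z) * indicator (ball a l) z = 0 \<and> z \<noteq> y \<and> z \<noteq> z0"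
      using AE_lborel_singleton[of y] AE_lborel_singleton[of z0] by eventually_elim auto
    then obtain z where z: "z \<in> ball z0 r" "ennreal (K (2 * \<theta>) y z * g z) * indicator (ball a l) z = 0 \<and> z \<noteq> y \<and> z \<noteq> z0"
      by (rule AE_lborel_open_witness[OF _ open_ball]) (use r in auto)
    have zz: "z \<in> ball a l" "z \<noteq> a" "star z \<noteq> 0" "u z < ul z" using r(2)[of z] z by (auto simp: dist_commute)
    have "K (2 * \<theta>) y z > 0" using z zz by (intro K_pos theta_range y) auto
    moreover have "g z > 0"
    proof -
      have zn: "z \<noteq> 0" by (rule ball_nonzero[OF zz(1)])
      have "H z * u z powr q / C < H z * ul z powr q / C"
        using zz(4) upos[of z] q1 C H_pos[OF zn] by (intro divide_strict_right_mono mult_strict_left_mono powr_less_mono2) (auto intro: less_imp_le)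
      then show ?thesis using fle[OF zz(1-3)] slap_u[OF zn] by (simp add: g_def)
    qed
    ultimately have "0 < K (2 * \<theta>) y z * g z" by simp
    then show False using z zz by (simp add: ennreal_eq_0_iff)
  qed
  then have pos: "KI (2 * \<theta>) y g > 0" by (simp add: zero_less_iff_neq_zero)
  have "ennreal (\<kappa> * u y) + 0 < ennreal (\<kappa> * u y) + KI (2 * \<theta>) y g"
    using pos by (subst ennreal_add_left_cancel_less) auto
  also note cmp
  finally have "ennreal (\<kappa> * u y) < ennreal (\<kappa> * ul y)" by (simp add: KI_zero)
  then have "\<kappa> * u y < \<kappa> * ul y" using kappa_pos upos[of y] by (subst (asm) ennreal_less_iff) (auto intro: less_imp_le)
  then show ?thesis using kappa_pos by simp
qed

end

context choquard
begin

text \<open>All constants in the contraction can be taken uniform in the radius, because every ball involved lies in one closed ball that avoids the origin.\<close>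

lemma small_bad_empty:
  assumes r: "0 < r1" "r1 < norm a"
  shows "\<exists>d>0. \<forall>l. 0 < l \<and> l \<le> r1 \<and> emeasure lborel (bad a l) \<le> ennreal d \<longrightarrow> bad a l = {}"
proof -
  let ?K = "cball a r1"
  have K: "compact ?K" "0 \<notin> ?K" "?K \<noteq> {}" using r by auto
  have uc: "continuous_on ?K u" by (rule continuous_on_subset[OF ucont]) (use K in auto)
  obtain x1 where x1: "\<forall>z\<in>?K. u z \<le> u x1" using continuous_attains_sup[OF K(1,3) uc] by blast
  obtain x0 where x0: "\<forall>z\<in>?K. u x0 \<le> u z" using continuous_attains_inf[OF K(1,3) uc] by blast
  obtain B where B: "\<And>n x. x \<in> ?K \<Longrightarrow> slap s (v (real n)) x \<le> B" "\<And>x. x \<in> ?K \<Longrightarrow> slap s u x \<le> B"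
    by (rule slap_v_bound[OF K(1,2)], rule that, assumption+)
  define M Hm where "M = u x1" and "Hm = C * \<bar>B\<bar> / u x0 powr q"
  have Hm: "H z \<le> Hm" if z: "z \<in> ?K" for z
  proof -
    have z0: "z \<noteq> 0" using z K by auto
    have "H z * u x0 powr q \<le> H z * u z powr q"
      using x0 z upos[of x0] q1 by (intro mult_left_mono powr_mono2 H_nonneg) (auto intro: less_imp_le)
    also have "\<dots> = C * slap s u z" using slap_u[OF z0] C by simp
    also have "\<dots> \<le> C * \<bar>B\<bar>" using B(2)[OF z] C by (intro mult_left_mono) auto
    finally show ?thesis unfolding Hm_def using upos[of x0] by (subst pos_le_divide_eq) auto
  qed
  have fin: "emeasure lborel (ball a r1) < \<infinity>" using emeasure_bounded_finite[of "ball a r1"] by simp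
  have \<theta>r: "0 \<le> 2 * \<theta>" "2 * \<theta> < real DIM('a)" using theta_pos two_theta s0 by auto
  obtain D where D: "D \<ge> 0" "\<And>y. (\<integral>\<^sup>+z. ennreal (norm (y - z) powr (- (2 * \<theta>))) * indicator (ball a r1) z \<partial>lborel) \<le> ennreal D"
    by (rule riesz_bounded_sets[OF \<theta>r borel_open[OF open_ball] fin], rule that, assumption+)
  define X where "X = p * M powr (p - 1) * M powr q * D + Hm * q * M powr (q - 1)"
  have X: "X \<ge> 0" using p1 q1 D(1) C by (auto simp: X_def Hm_def)
  define e where "e = C * \<kappa> / (2 * (X + 1))"
  have e: "e > 0" using C kappa_pos X by (simp add: e_def)
  have small: "2 * (e * X) \<le> C * \<kappa>"
  proof -
    have "2 * (e * X) \<le> 2 * (e * (X + 1))" using e by simp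
    also have "\<dots> = C * \<kappa>" unfolding e_def using X by (simp add: field_simps)
    finally show ?thesis .
  qed
  obtain d1 where d1: "d1 > 0" "\<And>E (y::'a). E \<in> sets borel \<Longrightarrow> emeasure lborel E \<le> ennreal d1 \<Longrightarrow>
       (\<integral>\<^sup>+z. ennreal (norm (y - z) powr (- \<mu>)) * indicator E z \<partial>lborel) \<le> ennreal e"
    by (rule riesz_small_sets[OF less_imp_le[OF \<mu>(1)] \<mu>(2) e], rule that, assumption+)
  obtain d2 where d2: "d2 > 0" "\<And>E (y::'a). E \<in> sets borel \<Longrightarrow> emeasure lborel E \<le> ennreal d2 \<Longrightarrow>
       (\<integral>\<^sup>+z. ennreal (norm (y - z) powr (- (2 * \<theta>))) * indicator E z \<partial>lborel) \<le> ennreal e"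
    by (rule riesz_small_sets[OF \<theta>r e], rule that, assumption+)
  have "bad a l = {}" if l: "0 < l" "l \<le> r1" and em: "emeasure lborel (bad a l) \<le> ennreal (min d1 d2)" for l
  proof -
    interpret k: choquard_kelvin s \<theta> T u \<mu> p q C \<alpha> a l by unfold_locales (use l r in auto)
    have sub: "z \<in> ?K" if "z \<in> ball a l" for z using that l by auto
    have em12: "emeasure lborel (bad a l) \<le> ennreal d1" "emeasure lborel (bad a l) \<le> ennreal d2"
      by (rule order_trans[OF em], rule ennreal_leI, simp)+
    show ?thesis
    proof (rule k.contraction[where M = M and Hm = Hm and e = e and D = D])
      show "u z \<le> M" if "z \<in> ball a l" for z using x1 sub[OF that] by (simp add: M_def)
      show "H z \<le> Hm" if "z \<in> ball a l" for z using Hm sub[OF that] by simp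
      show "(\<integral>\<^sup>+z. ennreal (norm (y - z) powr (- \<mu>)) * indicator (bad a l) z \<partial>lborel) \<le> ennreal e" for y
        by (rule d1(2)[OF k.bad_sets em12(1)])
      show "(\<integral>\<^sup>+z. ennreal (norm (y - z) powr (- (2 * \<theta>))) * indicator (bad a l) z \<partial>lborel) \<le> ennreal e" for y
        by (rule d2(2)[OF k.bad_sets em12(2)])
      show "(\<integral>\<^sup>+z. ennreal (norm (y - z) powr (- (2 * \<theta>))) * indicator (ball a l) z \<partial>lborel) \<le> ennreal D" for y
        by (rule order_trans[OF nn_integral_mono D(2)[of y]]) (use l in \<open>auto simp: indicator_def\<close>)
    qed (use e D(1) small in \<open>auto simp: X_def\<close>)
  qed
  then show ?thesis using d1(1) d2(1) by (intro exI[of _ "min d1 d2"]) auto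
qed

lemma tendsto_kelvin_radius:
  assumes z: "z \<noteq> a" and l: "l > 0" and st: "kelvin.star a l z \<noteq> 0"
    and x: "(x \<longlongrightarrow> l) F" "\<forall>\<^sub>F n in F. x n > 0"
  shows "((\<lambda>n. kelvin.star a (x n) z) \<longlongrightarrow> kelvin.star a l z) F"
    and "((\<lambda>n. kelvin.rho a (x n) z powr (2 * \<theta>) * u (kelvin.star a (x n) z)) \<longlongrightarrow> kelvin.rho a l z powr (2 * \<theta>) * u (kelvin.star a l z)) F"
proof -
  have st_eq: "kelvin.star a t z = a + t\<^sup>2 *\<^sub>R inversion (z - a)" if "t > 0" for t
    by (rule kelvin.star_def[OF kelvin.intro[OF that]])
  have rho_eq: "kelvin.rho a t z = t / norm (z - a)" if "t > 0" for t
    by (rule kelvin.rho_def[OF kelvin.intro[OF that]])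
  have "((\<lambda>n. a + (x n)\<^sup>2 *\<^sub>R inversion (z - a)) \<longlongrightarrow> a + l\<^sup>2 *\<^sub>R inversion (z - a)) F"
    by (intro tendsto_intros x)
  then have "((\<lambda>n. a + (x n)\<^sup>2 *\<^sub>R inversion (z - a)) \<longlongrightarrow> kelvin.star a l z) F" by (simp add: st_eq l)
  then show S: "((\<lambda>n. kelvin.star a (x n) z) \<longlongrightarrow> kelvin.star a l z) F"
    by (rule Lim_transform_eventually) (use x(2) in eventually_elim, simp add: st_eq)
  have "((\<lambda>n. x n / norm (z - a)) \<longlongrightarrow> l / norm (z - a)) F" using z by (intro tendsto_intros x) auto
  then have "((\<lambda>n. x n / norm (z - a)) \<longlongrightarrow> kelvin.rho a l z) F" by (simp add: rho_eq l)
  then have R: "((\<lambda>n. kelvin.rho a (x n) z) \<longlongrightarrow> kelvin.rho a l z) F"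
    by (rule Lim_transform_eventually) (use x(2) in eventually_elim, simp add: rho_eq)
  have "isCont u (kelvin.star a l z)" using ucont st by (simp add: continuous_on_eq_continuous_at open_Compl)
  then have U: "((\<lambda>n. u (kelvin.star a (x n) z)) \<longlongrightarrow> u (kelvin.star a l z)) F" by (rule isCont_tendsto_compose[OF _ S])
  have "kelvin.rho a l z \<noteq> 0" using z l by (simp add: rho_eq)
  then show "((\<lambda>n. kelvin.rho a (x n) z powr (2 * \<theta>) * u (kelvin.star a (x n) z)) \<longlongrightarrow> kelvin.rho a l z powr (2 * \<theta>) * u (kelvin.star a l z)) F"
    by (intro tendsto_mult tendsto_powr R U tendsto_const)
qed

lemma bad_in_ball: "z \<in> bad a l \<Longrightarrow> norm (z - a) < l"
  by (simp add: bad_def dist_norm norm_minus_commute)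

text \<open>Dominated convergence makes the measure of the bad sets small, which forces them to be empty.\<close>

lemma no_vanishing_bad_sets:
  assumes l: "0 < l" "l < norm a"
    and x: "\<And>n. 0 < x n" "\<And>n. x n \<le> l" "\<And>n. bad a (x n) \<noteq> {}"
    and ae: "AE z in lborel. \<forall>\<^sub>F n in sequentially. z \<notin> bad a (x n)"
  shows False
proof -
  obtain d where d: "d > 0" "\<forall>t. 0 < t \<and> t \<le> l \<and> emeasure lborel (bad a t) \<le> ennreal d \<longrightarrow> bad a t = {}"
    using small_bad_empty[OF l] by (elim exE conjE) (rule that)
  have m: "bad a (x n) \<in> sets borel" for n
  proof -
    interpret k: choquard_kelvin s \<theta> T u \<mu> p q C \<alpha> a "x n" by unfold_locales (use x(1,2)[of n] l in auto)
    show ?thesis by (rule k.bad_sets)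
  qed
  note [measurable] = m
  have sub: "bad a (x n) \<subseteq> ball a l" for n
    using bad_in_ball[of _ a "x n"] x(2)[of n] by (force simp: dist_norm norm_minus_commute)
  have wi: "integrable lborel (indicator (ball a l) :: 'a \<Rightarrow> real)"
    using emeasure_bounded_finite[of "ball a l"] by (intro integrable_real_indicator) auto
  have "(\<lambda>n. \<integral>z. indicator (bad a (x n)) z \<partial>lborel) \<longlonglongrightarrow> (\<integral>z. (0::real) \<partial>(lborel::'a measure))"
  proof (rule integral_dominated_convergence[OF _ _ wi])
    show "AE z in lborel. (\<lambda>n. indicator (bad a (x n)) z :: real) \<longlonglongrightarrow> 0"
      using ae
    proof eventually_elim
      case (elim z)
      then show ?case by (intro tendsto_eventually) (auto elim!: eventually_mono)
    qed
    show "AE z in lborel. norm (indicator (bad a (x n)) z :: real) \<le> indicator (ball a l) z" for n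
      using sub[of n] by (intro AE_I2) (auto simp: indicator_def)
  qed measurable
  then have "(\<lambda>n. measure lborel (bad a (x n))) \<longlonglongrightarrow> 0" by simp
  then have "\<forall>\<^sub>F n in sequentially. measure lborel (bad a (x n)) < d" by (rule order_tendstoD) (rule d(1))
  then obtain n where n: "measure lborel (bad a (x n)) < d" by (auto simp: eventually_sequentially)
  have "emeasure lborel (bad a (x n)) \<le> emeasure lborel (ball a l)" by (rule emeasure_mono[OF sub]) simp
  also have "\<dots> < \<infinity>" using emeasure_bounded_finite[of "ball a l"] by simp
  finally have "emeasure lborel (bad a (x n)) = ennreal (measure lborel (bad a (x n)))"
    by (intro emeasure_eq_ennreal_measure) (auto simp: top_unique)
  then have "emeasure lborel (bad a (x n)) \<le> ennreal d" using n by (simp add: ennreal_leI)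
  then have "bad a (x n) = {}" using d(2) x(1,2) by blast
  then show False using x(3) by blast
qed

text \<open>At the infimum of the radii with a nonempty bad set the comparison still holds and is strict, so nearby bad sets vanish almost everywhere.\<close>

lemma moving_spheres: assumes l: "0 < l" "l < norm a" shows "bad a l = {}"
proof (rule ccontr)
  assume ne: "bad a l \<noteq> {}"
  define B where "B = {t. 0 < t \<and> t \<le> l \<and> bad a t \<noteq> {}}"
  define m where "m = Inf B"
  have lB: "l \<in> B" using l ne by (simp add: B_def)
  have bdd: "bdd_below B" by (rule bdd_belowI[of _ 0]) (simp add: B_def)
  have m: "0 \<le> m" "m \<le> l" unfolding m_def
    using lB bdd by (auto intro!: cInf_greatest cInf_lower simp: B_def)
  have "m \<in> closure B" unfolding m_def using lB bdd by (intro closure_contains_Inf) auto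
  then obtain x where x: "\<And>n. x n \<in> B" "x \<longlonglongrightarrow> m" unfolding closure_sequential by blast
  have xB: "0 < x n" "x n \<le> l" "bad a (x n) \<noteq> {}" for n using x(1)[of n] by (auto simp: B_def)
  have outside: "\<forall>\<^sub>F n in sequentially. z \<notin> bad a (x n)" if "m < norm (z - a)" for z
  proof -
    have "\<forall>\<^sub>F n in sequentially. x n < norm (z - a)" using x(2) that by (rule order_tendstoD)
    then show ?thesis by eventually_elim (use bad_in_ball in force)
  qed
  have "AE z in lborel. \<forall>\<^sub>F n in sequentially. z \<notin> bad a (x n)"
  proof (cases "m = 0")
    case True
    show ?thesis using AE_lborel_singleton[of a] by eventually_elim (use True outside in auto)
  next
    case False
    then have m0: "m > 0" using m by simp
    interpret k: choquard_kelvin s \<theta> T u \<mu> p q C \<alpha> a m by unfold_locales (use m0 m l in auto)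
    have good: "bad a m = {}"
    proof (rule ccontr)
      assume "bad a m \<noteq> {}"
      then obtain z where z: "z \<in> ball a m" "z \<noteq> a" "k.star z \<noteq> 0" "k.ul z < u z" by (auto simp: k.bad_eq)
      have t0: "\<forall>\<^sub>F t in at_left m. 0 < t \<and> norm (z - a) < t \<and> t < m"
      proof -
        have zm: "norm (z - a) < m" using z(1) by (simp add: dist_norm norm_minus_commute)
        have "\<forall>\<^sub>F t in at_left m. t \<in> {norm (z - a)<..<m}" by (rule eventually_at_left_real[OF zm])
        then show ?thesis by eventually_elim (auto intro: le_less_trans[OF norm_ge_zero[of "z - a"]])
      qed
      have tp: "\<forall>\<^sub>F t in at_left m. 0 < t" using t0 by eventually_elim simp
      note T = tendsto_kelvin_radius[OF z(2) m0 z(3) tendsto_ident_at tp]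
      have e1: "\<forall>\<^sub>F t in at_left m. kelvin.star a t z \<noteq> 0" by (rule tendsto_imp_eventually_ne[OF T(1) z(3)])
      have e2: "\<forall>\<^sub>F t in at_left m. kelvin.rho a t z powr (2 * \<theta>) * u (kelvin.star a t z) < u z"
        by (rule order_tendstoD(2)[OF T(2)]) (use z(4) in \<open>simp add: k.ul_def\<close>)
      have "\<forall>\<^sub>F t in at_left m. t \<in> B \<and> t < m"
        using t0 e1 e2
      proof eventually_elim
        case (elim t)
        then have "z \<in> bad a t" using z(2) by (simp add: bad_def dist_norm norm_minus_commute)
        then show ?case using elim m by (auto simp: B_def)
      qed
      then have "\<exists>t. t \<in> B \<and> t < m" by (rule eventually_happens'[rotated]) simp
      then obtain t where t: "t \<in> B" "t < m" by (elim exE conjE) (rule that)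
      have "m \<le> t" unfolding m_def by (rule cInf_lower[OF t(1) bdd])
      then show False using t(2) by simp
    qed
    show ?thesis
      using k.AE_not_sphere k.AE_generic[of 0]
    proof eventually_elim
      case (elim z)
      show ?case
      proof (cases "m < norm (z - a)")
        case False
        then have zb: "z \<in> ball a m" using elim by (simp add: dist_norm norm_minus_commute)
        have z: "z \<noteq> a" "k.star z \<noteq> 0" using elim by auto
        have "\<forall>\<^sub>F n in sequentially. u z < kelvin.rho a (x n) z powr (2 * \<theta>) * u (kelvin.star a (x n) z)"
          by (rule order_tendstoD(1)[OF tendsto_kelvin_radius(2)[OF z(1) m0 z(2) x(2)]])
            (use k.strict[OF good zb z] xB(1) in \<open>auto simp: k.ul_def\<close>)
        then show ?thesis by eventually_elim (simp add: bad_def)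
      qed (rule outside)
    qed
  qed
  then show False by (rule no_vanishing_bad_sets[OF l xB])
qed

text \<open>The sphere is chosen to exchange the two points; its centre tends to infinity as the parameter tends to zero.\<close>

lemma radial_le_scaled:
  assumes b: "b \<noteq> 0" "norm b < norm a" and t: "t > 0"
  shows "u a \<le> sqrt (1 + t) powr (2 * \<theta>) * u b"
proof -
  define n where "n = a - b"
  have n0: "n \<noteq> 0" using b by (auto simp: n_def)
  define c l where "c = a + (1 / t) *\<^sub>R n" and "l = norm n * sqrt (1 + t) / t"
  have l0: "l > 0" using n0 t by (simp add: l_def)
  have ac: "a - c = - (1 / t) *\<^sub>R n" by (simp add: c_def)
  have nac: "norm (a - c) = norm n / t" unfolding ac using t by simp
  have l2: "l\<^sup>2 = (norm n)\<^sup>2 * (1 + t) / t\<^sup>2" using t by (simp add: l_def power_mult_distrib power_divide)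
  have c2: "(norm c)\<^sup>2 = (norm a)\<^sup>2 + 2 / t * (a \<bullet> n) + (norm n)\<^sup>2 / t\<^sup>2"
    unfolding c_def power2_norm_eq_inner using t by (simp add: inner_simps inner_commute power2_eq_square field_simps)
  have an: "2 * (a \<bullet> n) = (norm a)\<^sup>2 - (norm b)\<^sup>2 + (norm n)\<^sup>2"
    unfolding n_def power2_norm_eq_inner by (simp add: inner_simps inner_commute)
  have "l\<^sup>2 < (norm c)\<^sup>2"
  proof -
    have "(norm c)\<^sup>2 = l\<^sup>2 + (norm a)\<^sup>2 + ((norm a)\<^sup>2 - (norm b)\<^sup>2) / t"
    proof -
      have e1: "2 / t * (a \<bullet> n) = ((norm a)\<^sup>2 - (norm b)\<^sup>2 + (norm n)\<^sup>2) / t" using an by simp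
      have e2: "(X + Y) / t + Y / t\<^sup>2 = Y * (1 + t) / t\<^sup>2 + X / t" for X Y :: real
        using t by (simp add: field_simps power2_eq_square)
      have "2 / t * (a \<bullet> n) + (norm n)\<^sup>2 / t\<^sup>2 = (norm n)\<^sup>2 * (1 + t) / t\<^sup>2 + ((norm a)\<^sup>2 - (norm b)\<^sup>2) / t"
        unfolding e1 by (rule e2)
      then show ?thesis unfolding c2 l2 by linarith
    qed
    moreover have "((norm a)\<^sup>2 - (norm b)\<^sup>2) / t > 0" using b t by (simp add: power_strict_mono)
    moreover have "(norm a)\<^sup>2 \<ge> 0" by simp
    ultimately show ?thesis by linarith
  qed
  then have lc: "l < norm c" by (rule power2_less_imp_less) simp
  interpret k: choquard_kelvin s \<theta> T u \<mu> p q C \<alpha> c l by unfold_locales (use l0 lc in auto)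
  have rho: "k.rho a = sqrt (1 + t)" unfolding k.rho_def nac using n0 t by (simp add: l_def)
  have star: "k.star a = b"
  proof -
    have ii: "(a - c) \<bullet> (a - c) = (norm n)\<^sup>2 / t\<^sup>2" unfolding power2_norm_eq_inner[symmetric] nac by (simp add: power_divide)
    have "k.star a = c + (l\<^sup>2 / ((norm n)\<^sup>2 / t\<^sup>2)) *\<^sub>R (a - c)" unfolding k.star_def inversion_def ii by simp
    also have "l\<^sup>2 / ((norm n)\<^sup>2 / t\<^sup>2) = 1 + t" unfolding l2 using n0 t by simp
    also have "c + (1 + t) *\<^sub>R (a - c) = a + ((1 / t) - (1 + t) / t) *\<^sub>R n" unfolding ac unfolding c_def by (simp add: scaleR_diff_left)
    also have "(1 / t) - (1 + t) / t = -1" using t by (simp add: field_simps)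
    finally show ?thesis by (simp add: n_def)
  qed
  have "1 < sqrt (1 + t)" using t by simp
  then have ab: "a \<in> ball c l" unfolding mem_ball dist_norm using n0 t nac by (simp add: l_def norm_minus_commute field_simps)
  have "a \<noteq> c" using nac n0 t by auto
  then have "u a \<le> k.ul a" using moving_spheres[OF l0 lc] ab star b unfolding k.bad_eq by (metis (mono_tags, lifting) empty_Collect_eq not_less)
  then show ?thesis by (simp add: k.ul_def rho star)
qed

text \<open>The Kelvin factor tends to one as the centre of the sphere recedes to infinity.\<close>

lemma radial_le: assumes b: "b \<noteq> 0" "norm b < norm a" shows "u a \<le> u b"
proof -
  have "((\<lambda>t. sqrt (1 + t) powr (2 * \<theta>) * u b) \<longlongrightarrow> sqrt (1 + 0) powr (2 * \<theta>) * u b) (at_right 0)"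
    by (intro tendsto_intros) auto
  then have "u a \<le> sqrt (1 + 0) powr (2 * \<theta>) * u b"
  proof (rule tendsto_lowerbound)
    have "\<forall>\<^sub>F t in at_right (0::real). 0 < t" by (rule eventually_at_right_less)
    then show "\<forall>\<^sub>F t in at_right 0. u a \<le> sqrt (1 + t) powr (2 * \<theta>) * u b"
      by eventually_elim (rule radial_le_scaled[OF b])
  qed simp
  then show ?thesis by simp
qed

lemma isCont_u: "x \<noteq> 0 \<Longrightarrow> isCont u x"
  using ucont by (simp add: continuous_on_eq_continuous_at open_Compl)

lemma radial: assumes "norm x = norm y" "x \<noteq> 0" shows "u x \<le> u y"
proof -
  have y: "y \<noteq> 0" using assms by auto
  have "((\<lambda>c. c *\<^sub>R y) \<longlongrightarrow> 1 *\<^sub>R y) (at_left 1)" by (intro tendsto_intros)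
  then have "((\<lambda>c. u (c *\<^sub>R y)) \<longlongrightarrow> u (1 *\<^sub>R y)) (at_left 1)" by (intro isCont_tendsto_compose[OF isCont_u]) (use y in auto)
  then have "u x \<le> u (1 *\<^sub>R y)"
  proof (rule tendsto_lowerbound)
    have "\<forall>\<^sub>F c in at_left (1::real). c \<in> {0<..<1}" by (rule eventually_at_left_real) simp
    then show "\<forall>\<^sub>F c in at_left 1. u x \<le> u (c *\<^sub>R y)"
      by eventually_elim (use assms y in \<open>auto intro!: radial_le\<close>)
  qed simp
  then show ?thesis by simp
qed

end

section \<open>Strict monotonicity\<close>

lemma integral_affine_refl:
  fixes f :: "'a::euclidean_space \<Rightarrow> real"
  assumes [measurable]: "f \<in> borel_measurable borel"
  shows "integrable lborel (\<lambda>z. f (t + refl n z)) \<longleftrightarrow> integrable lborel f"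
    and "(\<integral>z. f (t + refl n z) \<partial>lborel) = integral\<^sup>L lborel f"
  using integrable_refl_iff[of "\<lambda>z. f (t + z)" n] integral_refl[of "\<lambda>z. f (t + z)" n]
    integrable_translate_iff[of f t] integral_translate[of f t] by simp_all

text \<open>Folding an integral against an antisymmetric weight along the mirror hyperplane.\<close>

lemma integral_antisymmetric:
  fixes f D :: "'a::euclidean_space \<Rightarrow> real"
  assumes [measurable]: "f \<in> borel_measurable borel" "D \<in> borel_measurable borel"
    and i: "integrable lborel (\<lambda>z. f z * D z)" and anti: "\<And>z. D (t + refl n z) = - D z"
  shows "integrable lborel (\<lambda>z. (f z - f (t + refl n z)) * D z)"
    and "(\<integral>z. (f z - f (t + refl n z)) * D z \<partial>lborel) = 2 * (\<integral>z. f z * D z \<partial>lborel)"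
proof -
  have m: "(\<lambda>z. f z * D z) \<in> borel_measurable borel" by measurable
  have j: "integrable lborel (\<lambda>z. - (f (t + refl n z) * D z))" "(\<integral>z. - (f (t + refl n z) * D z) \<partial>lborel) = (\<integral>z. f z * D z \<partial>lborel)"
    using integral_affine_refl[OF m, of t n] i by (simp_all add: anti)
  have e: "(f z - f (t + refl n z)) * D z = f z * D z + - (f (t + refl n z) * D z)" for z by (simp add: algebra_simps)
  show "integrable lborel (\<lambda>z. (f z - f (t + refl n z)) * D z)" unfolding e by (rule Bochner_Integration.integrable_add[OF i j(1)])
  show "(\<integral>z. (f z - f (t + refl n z)) * D z \<partial>lborel) = 2 * (\<integral>z. f z * D z \<partial>lborel)"
    unfolding e Bochner_Integration.integral_add[OF i j(1)] j(2) by simp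
qed

lemma weighted_const_minus:
  fixes u :: "'a::euclidean_space \<Rightarrow> real"
  assumes s: "s > 0" and u: "weighted s u" shows "weighted s (\<lambda>x. m - u x)"
proof -
  note [measurable] = weighted_measurable[OF u]
  have "weighted s (\<lambda>x::'a. m)" by (rule weighted_bounded[OF s, of _ "\<bar>m\<bar>"]) auto
  then have c: "integrable lborel (\<lambda>x::'a. \<bar>m\<bar> / (1 + norm x powr (real DIM('a) + 2 * s)))" by (simp add: weighted_def)
  have d: "integrable lborel (\<lambda>x. \<bar>u x\<bar> / (1 + norm x powr (real DIM('a) + 2 * s)))" using u by (simp add: weighted_def)
  have "integrable lborel (\<lambda>x. \<bar>m - u x\<bar> / (1 + norm x powr (real DIM('a) + 2 * s)))"
  proof (rule Bochner_Integration.integrable_bound[OF Bochner_Integration.integrable_add[OF c d]])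
    show "AE x in lborel. norm (\<bar>m - u x\<bar> / (1 + norm x powr (real DIM('a) + 2 * s)))
      \<le> norm (\<bar>m\<bar> / (1 + norm x powr (real DIM('a) + 2 * s)) + \<bar>u x\<bar> / (1 + norm x powr (real DIM('a) + 2 * s)))"
      by (intro AE_I2) (auto simp: add_divide_distrib[symmetric] intro!: divide_right_mono abs_triangle_ineq4 add_nonneg_nonneg)
  qed measurable
  then show ?thesis by (simp add: weighted_def)
qed

context choquard
begin

text \<open>At a point around which the function is constant no cancellation is needed and the fractional Laplacian is an ordinary integral.\<close>

lemma slap_on_plateau:
  assumes \<delta>: "\<delta> > 0" and flat: "\<And>w. norm w < \<delta> \<Longrightarrow> u (c + w) = m"
  shows "integrable lborel (\<lambda>z. (m - u z) * kern s (z - c))" (is ?I)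
    and "slap s u c = (\<integral>z. (m - u z) * kern s (z - c) \<partial>lborel)" (is ?E)
proof -
  define g where "g z = m - u z" for z
  have gw: "weighted s g" unfolding g_def[abs_def] by (rule weighted_const_minus[OF s0 uw])
  note [measurable] = weighted_measurable[OF gw]
  have far: "integrable lborel (\<lambda>w. \<bar>g (c + w)\<bar> * kern s w * indicator (- ball 0 \<delta>) w)"
    by (rule weighted_far(1)[OF gw s0 \<delta> order_refl])
  have "(\<lambda>w. \<bar>g (c + w)\<bar> * kern s w * indicator (- ball 0 \<delta>) w) = (\<lambda>w. norm (g (c + w) * kern s w))"
    by (rule ext) (auto simp: indicator_def g_def flat abs_mult)
  then have i: "integrable lborel (\<lambda>w. g (c + w) * kern s w)"
    using far by (intro integrable_norm_cancel[of _ "\<lambda>w. g (c + w) * kern s w"]) auto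
  have m1: "(\<lambda>w. g (c + w) * kern s w) \<in> borel_measurable borel" by measurable
  have fl: "integrable lborel (\<lambda>w. g (c - w) * kern s w)" "(\<integral>w. g (c - w) * kern s w \<partial>lborel) = (\<integral>w. g (c + w) * kern s w \<partial>lborel)"
    using integrable_flip_iff[OF m1, of 0] integral_flip[OF m1, of 0] i by simp_all
  have m2: "(\<lambda>z. g z * kern s (z - c)) \<in> borel_measurable borel" by measurable
  have tr: "integrable lborel (\<lambda>z. g z * kern s (z - c))" "(\<integral>z. g z * kern s (z - c) \<partial>lborel) = (\<integral>w. g (c + w) * kern s w \<partial>lborel)"
    using integrable_translate_iff[OF m2, of c] integral_translate[OF m2, of c] i by simp_all
  then show ?I by (simp add: g_def)
  have "u c = m" using flat[of 0] \<delta> by simp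
  then have "sdiff u w c * kern s w = g (c + w) * kern s w + g (c - w) * kern s w" for w
    by (simp add: sdiff_def g_def algebra_simps)
  then have "slap s u c = (\<integral>w. g (c + w) * kern s w \<partial>lborel)"
    unfolding slap_def using Bochner_Integration.integral_add[OF i fl(1)] fl(2) by simp
  then show ?E using tr(2) by (simp add: g_def)
qed

text \<open>On an annulus of constancy two points on a ray are exchanged by a reflection. Folding along its hyperplane orders the Hartree potentials one way and, because of the pole, the fractional Laplacians strictly the other way.\<close>

lemma radial_strict:
  assumes r: "0 < r1" "r1 < r2" and e: "norm e = 1"
  shows "u (r2 *\<^sub>R e) < u (r1 *\<^sub>R e)"
proof (rule ccontr)
  assume "\<not> u (r2 *\<^sub>R e) < u (r1 *\<^sub>R e)"
  moreover have e0: "e \<noteq> 0" using e by auto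
  moreover have "u (r2 *\<^sub>R e) \<le> u (r1 *\<^sub>R e)" using r e e0 by (intro radial_le) auto
  ultimately have eq: "u (r2 *\<^sub>R e) = u (r1 *\<^sub>R e)" by simp
  define m where "m = u (r1 *\<^sub>R e)"
  have flat: "u z = m" if "r1 < norm z" "norm z < r2" for z
  proof -
    have "z \<noteq> 0" using that r by auto
    then have "u z \<le> u (r1 *\<^sub>R e)" "u (r2 *\<^sub>R e) \<le> u z" using that r e e0 by (auto intro!: radial_le)
    then show ?thesis using eq by (simp add: m_def)
  qed
  define \<delta> where "\<delta> = (r2 - r1) / 6"
  have \<delta>: "\<delta> > 0" "r2 = r1 + 6 * \<delta>" using r unfolding \<delta>_def by (auto simp: field_simps)
  define x y c where "x = r1 + 4 * \<delta>" and "y = r1 + 2 * \<delta>" and "c = r1 + 3 * \<delta>"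
  have xy: "r1 < y" "y < x" "x < r2" "x + y = 2 * c" "c > 0" using r \<delta> by (auto simp: x_def y_def c_def)
  define a b where "a = x *\<^sub>R e" and "b = y *\<^sub>R e"
  define t where "t = (2 * c) *\<^sub>R e"
  define J where "J z = t + refl e z" for z
  have ee: "e \<bullet> e = 1" using e by (simp add: dot_square_norm)
  have re: "refl e z = z - (2 * (z \<bullet> e)) *\<^sub>R e" for z by (simp add: refl_def ee)
  have dbl: "(w * 2) *\<^sub>R e = w *\<^sub>R e + w *\<^sub>R e" "(w * 4) *\<^sub>R e = (w * 2) *\<^sub>R e + (w * 2) *\<^sub>R e" for w
    by (simp_all add: scaleR_left_distrib[symmetric])
  have Tb: "norm (J z - a) = norm (z - b)" for z
  proof -
    have "J z - a = refl e (z - b)" unfolding J_def re t_def a_def b_def xy(4)[symmetric]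
      by (simp add: inner_simps ee algebra_simps dbl)
    then show ?thesis by (simp add: norm_refl)
  qed
  have TT: "J (J z) = z" for z unfolding J_def re t_def by (simp add: inner_simps ee algebra_simps dbl)
  have Ta: "norm (J z - b) = norm (z - a)" for z using Tb[of "J z"] by (simp add: TT)
  have Te: "J z \<bullet> e = 2 * c - z \<bullet> e" for z unfolding J_def re t_def by (simp add: inner_simps ee)
  have dist2: "(norm (z - b))\<^sup>2 - (norm (z - a))\<^sup>2 = 2 * (x - y) * (z \<bullet> e - c)" for z
  proof -
    have "(norm (z - b))\<^sup>2 - (norm (z - a))\<^sup>2 = 2 * (x - y) * (z \<bullet> e) - (x - y) * (x + y)"
      unfolding power2_norm_eq_inner a_def b_def by (simp add: inner_simps ee inner_commute algebra_simps)
    then show ?thesis unfolding xy(4) by (simp add: algebra_simps)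
  qed
  have norm2: "(norm z)\<^sup>2 - (norm (J z))\<^sup>2 = 4 * c * (z \<bullet> e - c)" for z
    unfolding J_def re t_def power2_norm_eq_inner by (simp add: inner_simps ee inner_commute algebra_simps)
  define D where "D k z = norm (z - a) powr (- k) - norm (z - b) powr (- k)" for k z
  have [measurable]: "D k \<in> borel_measurable borel" for k unfolding D_def[abs_def] by measurable
  have DT: "D k (t + refl e z) = - D k z" for k z using Ta[of z] Tb[of z] by (simp add: D_def J_def)
  have Dpos: "D k z > 0" if "k > 0" "z \<bullet> e > c" "z \<noteq> a" for k z
  proof -
    have "0 < 2 * (x - y) * (z \<bullet> e - c)" using xy that by (intro mult_pos_pos) auto
    then have "(norm (z - a))\<^sup>2 < (norm (z - b))\<^sup>2" using dist2[of z] by linarith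
    then have "norm (z - a) < norm (z - b)" by (rule power2_less_imp_less) simp
    then show ?thesis unfolding D_def using that by (simp add: powr_less_mono2_neg)
  qed
  have uT: "u z \<le> u (J z)" if "z \<bullet> e > c" "J z \<noteq> 0" for z
  proof -
    have "0 < 4 * c * (z \<bullet> e - c)" using xy that by (intro mult_pos_pos) auto
    then have "(norm (J z))\<^sup>2 < (norm z)\<^sup>2" using norm2[of z] by linarith
    then have "norm (J z) < norm z" by (rule power2_less_imp_less) simp
    then show ?thesis by (rule radial_le[OF that(2)])
  qed
  have sign: "0 \<le> (f (u (J z)) - f (u z)) * D k z"
    if k: "k > 0" and f: "\<And>v w. 0 < v \<Longrightarrow> v \<le> w \<Longrightarrow> f v \<le> f w" and z: "z \<noteq> 0" "J z \<noteq> 0" "z \<noteq> a" "z \<noteq> b"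
    for f :: "real \<Rightarrow> real" and k z
  proof -
    consider "z \<bullet> e > c" | "z \<bullet> e < c" | "z \<bullet> e = c" by linarith
    then show ?thesis
    proof cases
      case 1
      then show ?thesis using Dpos[OF k 1 z(3)] f[OF upos uT[OF 1 z(2)]] by simp
    next
      case 2
      then have T1: "J z \<bullet> e > c" by (simp add: Te)
      have "J z \<noteq> a" using Tb[of z] z(4) by auto
      then have "D k (J z) > 0" by (rule Dpos[OF k T1])
      then have "D k z < 0" using DT[of k z] by (simp add: J_def)
      moreover have "f (u (J z)) \<le> f (u z)" using f[OF upos uT[OF T1]] z(1) by (simp add: TT)
      ultimately show ?thesis by (simp add: mult_nonpos_nonpos)
    next
      case 3
      then have "(norm (z - b))\<^sup>2 = (norm (z - a))\<^sup>2" using dist2[of z] by simp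
      then have "norm (z - b) = norm (z - a)" by simp
      then show ?thesis by (simp add: D_def)
    qed
  qed
  have AEz: "AE z in lborel. z \<noteq> 0 \<and> J z \<noteq> 0 \<and> z \<noteq> a \<and> z \<noteq> b"
  proof -
    have "AE z in lborel. z \<noteq> 0" "AE z in lborel. z \<noteq> J 0" "AE z in lborel. z \<noteq> a" "AE z in lborel. z \<noteq> b" by (rule AE_lborel_singleton)+
    then show ?thesis by eventually_elim (metis TT)
  qed
  have na: "norm a = x" "norm b = y" using xy r e by (auto simp: a_def b_def)
  have ab0: "a \<noteq> 0" "b \<noteq> 0" using na xy r by auto
  have Hle: "H a \<le> H b"
  proof -
    have i: "integrable lborel (\<lambda>z. u z powr p * norm (z - a) powr (- \<mu>))" "integrable lborel (\<lambda>z. u z powr p * norm (z - b) powr (- \<mu>))"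
      using Hint[OF ab0(1)] Hint[OF ab0(2)] by (simp_all add: norm_minus_commute)
    have HH: "H a = (\<integral>z. u z powr p * norm (z - a) powr (- \<mu>) \<partial>lborel)" "H b = (\<integral>z. u z powr p * norm (z - b) powr (- \<mu>) \<partial>lborel)"
      by (simp_all add: H_def norm_minus_commute)
    have e: "(- (u z powr p)) * D \<mu> z = - (u z powr p * norm (z - a) powr (- \<mu>)) + u z powr p * norm (z - b) powr (- \<mu>)" for z
      by (simp add: D_def algebra_simps)
    have j: "integrable lborel (\<lambda>z. (- (u z powr p)) * D \<mu> z)" unfolding e using i by (intro Bochner_Integration.integrable_add integrable_minus)
    have "(\<integral>z. (- (u z powr p)) * D \<mu> z \<partial>lborel) = H b - H a"
      unfolding e HH using i by (subst Bochner_Integration.integral_add) auto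
    moreover have "(\<integral>z. (- (u z powr p) - (- (u (t + refl e z) powr p))) * D \<mu> z \<partial>lborel) = 2 * (\<integral>z. (- (u z powr p)) * D \<mu> z \<partial>lborel)"
      by (rule integral_antisymmetric(2)[OF _ _ j DT]) measurable
    moreover have "0 \<le> (\<integral>z. (- (u z powr p) - (- (u (t + refl e z) powr p))) * D \<mu> z \<partial>lborel)"
    proof (rule integral_nonneg_AE)
      show "AE z in lborel. 0 \<le> (- (u z powr p) - (- (u (t + refl e z) powr p))) * D \<mu> z"
        using AEz
      proof eventually_elim
        case (elim z)
        then show ?case using sign[OF \<mu>(1), of "\<lambda>v. v powr p" z] p1 powr_mono2 by (auto simp: J_def)
      qed
    qed
    ultimately show ?thesis by linarith
  qed
  have fa: "u (a + w) = m" if "norm w < \<delta>" for w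
    using that r \<delta> norm_triangle_ineq[of a w] norm_triangle_ineq2[of a "- w"] na norm_ge_zero[of w] unfolding x_def y_def norm_minus_cancel diff_minus_eq_add by (intro flat) linarith+
  have fb: "u (b + w) = m" if "norm w < \<delta>" for w
    using that r \<delta> norm_triangle_ineq[of b w] norm_triangle_ineq2[of b "- w"] na norm_ge_zero[of w] unfolding x_def y_def norm_minus_cancel diff_minus_eq_add by (intro flat) linarith+
  note pa = slap_on_plateau[OF \<delta>(1) fa] and pb = slap_on_plateau[OF \<delta>(1) fb]
  let ?k = "real DIM('a) + 2 * s"
  have k0: "?k > 0" using s0 by simp
  have e': "(m - u z) * D ?k z = (m - u z) * kern s (z - a) - (m - u z) * kern s (z - b)" for z
    by (simp add: D_def kern_def algebra_simps)
  have j: "integrable lborel (\<lambda>z. (m - u z) * D ?k z)" unfolding e' by (rule Bochner_Integration.integrable_diff[OF pa(1) pb(1)])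
  have s: "(\<integral>z. (m - u z) * D ?k z \<partial>lborel) = slap s u a - slap s u b"
    using Bochner_Integration.integral_diff[OF pa(1) pb(1)] pa(2) pb(2) by (simp add: e')
  have mm: "(\<lambda>z. m - u z) \<in> borel_measurable borel" by measurable
  note A = integral_antisymmetric[OF mm _ j DT]
  have "0 < (\<integral>z. ((m - u z) - (m - u (t + refl e z))) * D ?k z \<partial>lborel)"
  proof -
    obtain d where d: "d > 0" "\<And>z. z \<noteq> 0 \<Longrightarrow> norm z < d \<Longrightarrow> m + 1 \<le> u z"
    proof -
      have "\<forall>\<^sub>F z in at 0. m + 1 \<le> u z" using ulim by (simp add: filterlim_at_top)
      then show ?thesis using that unfolding eventually_at by auto
    qed
    define R where "R = min d r1"
    have R: "R > 0" "R \<le> d" "R \<le> r1" using d r by (auto simp: R_def)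
    show ?thesis
    proof (rule integral_pos_open[OF A(1)])
      show "AE z in lborel. 0 \<le> (m - u z - (m - u (t + refl e z))) * D ?k z"
        using AEz
      proof eventually_elim
        case (elim z)
        then show ?case using sign[OF k0, of "\<lambda>v. v" z] by (auto simp: J_def)
      qed
      show "open (ball t R - {t})" by (intro open_delete) simp
      have "t + (R / 2) *\<^sub>R e \<in> ball t R - {t}" using R e e0 by (simp add: dist_norm)
      then show "ball t R - {t} \<noteq> {}" by blast
      fix z assume z: "z \<in> ball t R - {t}"
      have nt: "norm (z - t) < R" using z by (simp add: dist_norm norm_minus_commute)
      have "J z = refl e (z - t)" unfolding J_def re t_def by (simp add: inner_simps ee algebra_simps dbl)
      then have nT: "norm (J z) = norm (z - t)" by (simp add: norm_refl)
      have "J z \<noteq> 0" using nT z by auto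
      then have u1: "m + 1 \<le> u (J z)" using d(2) nT nt R by auto
      have ntt: "norm t = r1 + r2" using e r \<delta> by (simp add: t_def c_def)
      have nz: "r2 < norm z" using norm_triangle_ineq2[of t "t - z"] nt ntt R by (simp add: norm_minus_commute)
      have u2: "u z \<le> m" unfolding m_def eq[symmetric] using nz r e e0 by (intro radial_le) auto
      have "- ((z - t) \<bullet> e) \<le> norm (z - t)" using Cauchy_Schwarz_ineq2[of "z - t" e] e by simp
      also note nt
      also note R(3)
      finally have "- ((z - t) \<bullet> e) < r1" .
      moreover have "(z - t) \<bullet> e = z \<bullet> e - 2 * c" by (simp add: t_def inner_simps ee)
      moreover have "c + r1 < 2 * c" using r \<delta> by (simp add: c_def)
      ultimately have "z \<bullet> e > c" by linarith
      moreover have "z \<noteq> a" using nz na xy by auto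
      ultimately have "D ?k z > 0" by (rule Dpos[OF k0])
      moreover have "0 < m - u z - (m - u (t + refl e z))" using u1 u2 by (simp add: J_def)
      ultimately show "0 < (m - u z - (m - u (t + refl e z))) * D ?k z" by simp
    qed measurable
  qed
  also have "\<dots> = 2 * (slap s u a - slap s u b)" unfolding s[symmetric] by (rule A(2)) measurable
  finally have "slap s u b < slap s u a" by simp
  moreover have "u a = m" "u b = m" using fa[of 0] fb[of 0] \<delta> by auto
  then have "slap s u a \<le> slap s u b"
    unfolding slap_u[OF ab0(1)] slap_u[OF ab0(2)] using Hle C by (simp add: divide_right_mono mult_right_mono)
  ultimately show False by simp
qed

lemma radially_decreasing:
  "\<exists>U :: real \<Rightarrow> real. (\<forall>r>0. U r > 0) \<and> (\<forall>x. x \<noteq> 0 \<longrightarrow> u x = U (norm x)) \<and> strict_antimono_on {0<..} U"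
proof -
  obtain e :: 'a where "e \<in> Basis" using nonempty_Basis by blast
  then have e: "norm e = 1" by simp
  have "u x = u (norm x *\<^sub>R e)" if "x \<noteq> 0" for x
    by (rule antisym; rule radial) (use that e in auto)
  moreover have "strict_antimono_on {0<..} (\<lambda>r. u (r *\<^sub>R e))"
    by (rule monotone_onI) (use radial_strict e in auto)
  ultimately show ?thesis using upos by (intro exI[of _ "\<lambda>r. u (r *\<^sub>R e)"]) auto
qed

end

section \<open>Regularity on the punctured space\<close>

lemma locally_Hoelder_on_isCont:
  fixes f :: "'a::euclidean_space \<Rightarrow> real"
  assumes H: "locally_Hoelder_on \<tau> S f" and \<tau>: "\<tau> > 0" and S: "open S" "x \<in> S"
  shows "isCont f x"
proof -
  obtain r where r: "r > 0" "cball x r \<subseteq> S" using S open_contains_cball by blast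
  obtain M where M: "\<forall>y\<in>cball x r. \<forall>z\<in>cball x r. \<bar>f y - f z\<bar> \<le> M * norm (y - z) powr \<tau>"
    using H r compact_cball[of x r] unfolding locally_Hoelder_on_def by blast
  have "((\<lambda>y. f y - f x) \<longlongrightarrow> 0) (at x)"
  proof (rule Lim_null_comparison)
    have "\<forall>\<^sub>F y in at x. y \<in> ball x r" by (rule eventually_at_in_open') (use r in auto)
    then show "\<forall>\<^sub>F y in at x. norm (f y - f x) \<le> M * norm (y - x) powr \<tau>"
      by eventually_elim (use M r in auto)
    have "((\<lambda>y. M * norm (y - x) powr \<tau>) \<longlongrightarrow> M * 0 powr \<tau>) (at x)"
      by (intro tendsto_mult tendsto_const tendsto_powr' tendsto_norm_zero LIM_zero tendsto_ident_at) (use \<tau> in simp)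
    then show "((\<lambda>y. M * norm (y - x) powr \<tau>) \<longlongrightarrow> 0) (at x)" by simp
  qed
  then show ?thesis unfolding isCont_def by (rule LIM_zero_cancel)
qed

lemma continuous_bounded_on_compact:
  fixes f :: "'i \<Rightarrow> 'a::euclidean_space \<Rightarrow> real"
  assumes K: "compact K" and I: "finite I" and c: "\<And>i. i \<in> I \<Longrightarrow> continuous_on K (f i)"
  obtains B where "B \<ge> 0" "\<And>i x. i \<in> I \<Longrightarrow> x \<in> K \<Longrightarrow> \<bar>f i x\<bar> \<le> B"
proof -
  have "\<forall>i\<in>I. \<exists>B. \<forall>x\<in>K. \<bar>f i x\<bar> \<le> B"
  proof
    fix i assume "i \<in> I"
    then have "bounded (f i ` K)" by (intro compact_imp_bounded compact_continuous_image[OF c K])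
    then show "\<exists>B. \<forall>x\<in>K. \<bar>f i x\<bar> \<le> B" by (simp add: bounded_iff)
  qed
  from bchoice[OF this] obtain B where B: "\<forall>i\<in>I. \<forall>x\<in>K. \<bar>f i x\<bar> \<le> B i" by (elim exE) (rule that)
  show ?thesis
  proof (rule that[of "\<Sum>i\<in>I. \<bar>B i\<bar>"])
    fix i x assume i: "i \<in> I" and x: "x \<in> K"
    have "\<bar>f i x\<bar> \<le> \<bar>B i\<bar>" by (rule order_trans[OF B[rule_format, OF i x] abs_ge_self])
    also have "\<dots> \<le> (\<Sum>i\<in>I. \<bar>B i\<bar>)" by (rule member_le_sum[where f = "\<lambda>i. \<bar>B i\<bar>", OF i _ I]) simp
    finally show "\<bar>f i x\<bar> \<le> (\<Sum>i\<in>I. \<bar>B i\<bar>)" .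
  qed (rule sum_nonneg, simp)
qed

lemma lipschitz_of_partials:
  fixes f :: "'a::euclidean_space \<Rightarrow> real"
  assumes d: "\<And>y. y \<in> cball x r \<Longrightarrow> f differentiable (at y)"
    and B: "\<And>b y. b \<in> Basis \<Longrightarrow> y \<in> cball x r \<Longrightarrow> \<bar>iter_pderiv [b] f y\<bar> \<le> B"
    and z: "norm z \<le> r"
  shows "\<bar>f (x + z) - f x\<bar> \<le> real DIM('a) * B * norm z"
proof -
  have "norm (f (x + z) - f x) \<le> (real DIM('a) * B) * norm (x + z - x)"
  proof (rule differentiable_bound[where S = "cball x r" and f = f and f' = "\<lambda>y. frechet_derivative f (at y)"
        and B = "real DIM('a) * B" and x = "x + z" and y = x])
    show "(f has_derivative frechet_derivative f (at y)) (at y within cball x r)" if "y \<in> cball x r" for y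
      by (rule has_derivative_at_withinI[OF d[OF that, unfolded frechet_derivative_works]])
    show "onorm (frechet_derivative f (at y)) \<le> real DIM('a) * B" if y: "y \<in> cball x r" for y
    proof (rule onorm_le)
      fix h
      have "\<bar>frechet_derivative f (at y) h\<bar> \<le> (\<Sum>b\<in>Basis. \<bar>(h \<bullet> b) * iter_pderiv [b] f y\<bar>)"
        unfolding frechet_derivative_eq_sum[OF d[OF y]] by (rule sum_abs)
      also have "\<dots> \<le> (\<Sum>b\<in>(Basis::'a set). norm h * B)"
      proof (rule sum_mono)
        fix b :: 'a assume b: "b \<in> Basis"
        show "\<bar>(h \<bullet> b) * iter_pderiv [b] f y\<bar> \<le> norm h * B"
          unfolding abs_mult by (rule mult_mono[OF Basis_le_norm[OF b] B[OF b y]]) auto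
      qed
      finally show "norm (frechet_derivative f (at y) h) \<le> real DIM('a) * B * norm h" by (simp add: mult_ac)
    qed
    show "convex (cball x r)" by (rule convex_cball)
    show "x + z \<in> cball x r" "x \<in> cball x r" using z order_trans[OF norm_ge_zero z] by (auto simp: dist_norm)
  qed
  then show ?thesis by simp
qed

lemma square_le_powr:
  fixes t L w \<alpha> :: real
  assumes "\<bar>t\<bar> \<le> L * w" "0 \<le> w" "w \<le> 1" "\<alpha> \<le> 2" shows "t\<^sup>2 \<le> L\<^sup>2 * w powr \<alpha>"
proof (cases "w = 0")
  case False
  have "t\<^sup>2 = \<bar>t\<bar>\<^sup>2" by simp
  also have "\<dots> \<le> (L * w)\<^sup>2" using assms by (intro power_mono) auto
  also have "\<dots> = L\<^sup>2 * w powr 2" using False assms by (simp add: power_mult_distrib)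
  also have "\<dots> \<le> L\<^sup>2 * w powr \<alpha>" using False assms by (intro mult_left_mono powr_mono') auto
  finally show ?thesis .
qed (use assms in simp)

text \<open>Three cases according to the integer part of the exponent: Hoelder functions, functions with Hoelder first derivatives, and functions with bounded second derivatives.\<close>

lemma C_loc_second_differences:
  fixes u :: "'a::euclidean_space \<Rightarrow> real"
  assumes s: "0 < s" "s < 1" and \<gamma>: "2 * s < \<gamma>" "\<gamma> \<notin> \<nat>" and u: "C_loc \<gamma> (- {0}) u"
  shows "continuous_on (- {0}) u"
    and "\<exists>\<alpha>>2 * s. \<forall>K. compact K \<longrightarrow> 0 \<notin> K \<longrightarrow> (\<exists>M\<ge>0. \<exists>\<delta>>0. \<forall>x\<in>K. \<forall>z. norm z \<le> \<delta> \<longrightarrow>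
       x + z \<noteq> 0 \<and> \<bar>sdiff u z x\<bar> \<le> M * norm z powr \<alpha> \<and> (u (x + z) - u x)\<^sup>2 \<le> M * norm z powr \<alpha>)"
proof -
  let ?S = "- {0::'a}"
  define k \<tau> where "k = nat \<lfloor>\<gamma>\<rfloor>" and "\<tau> = frac \<gamma>"
  have k: "real k = \<lfloor>\<gamma>\<rfloor>" using s \<gamma> by (simp add: k_def)
  have k\<tau>: "\<gamma> = real k + \<tau>" unfolding k \<tau>_def by (simp add: frac_def)
  have \<tau>: "0 < \<tau>" "\<tau> < 1"
  proof -
    have "\<tau> \<noteq> 0" using k\<tau> \<gamma>(2) by (metis add.right_neutral of_nat_in_Nats)
    then show "0 < \<tau>" using frac_ge_0[of \<gamma>] by (simp add: \<tau>_def)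
    show "\<tau> < 1" by (simp add: \<tau>_def frac_lt_1)
  qed
  have diff: "iter_pderiv bs u differentiable (at x)" if "set bs \<subseteq> Basis" "length bs < k" "x \<noteq> 0" for bs x
    using u that unfolding C_loc_def k_def[symmetric] by auto
  have hoel: "locally_Hoelder_on \<tau> ?S (iter_pderiv bs u)" if "set bs \<subseteq> Basis" "length bs = k" for bs
    using u that unfolding C_loc_def k_def[symmetric] \<tau>_def by blast
  have cont: "continuous_on ?S (iter_pderiv bs u)" if "set bs \<subseteq> Basis" "length bs \<le> k" for bs
  proof (rule continuous_at_imp_continuous_on, rule ballI)
    fix x :: 'a assume x: "x \<in> ?S"
    show "isCont (iter_pderiv bs u) x"
    proof (cases "length bs = k")
      case True
      show ?thesis by (rule locally_Hoelder_on_isCont[OF hoel[OF that(1) True] \<tau>(1) _ x]) (simp add: open_Compl)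
    next
      case False
      then show ?thesis using diff[OF that(1), of x] that x by (intro differentiable_imp_continuous_within) auto
    qed
  qed
  show "continuous_on ?S u" using cont[of "[]"] by simp
  have enlarge: "\<exists>d K'. 0 < d \<and> d \<le> 1 \<and> compact K' \<and> K' \<subseteq> ?S \<and> (\<forall>x\<in>K. cball x d \<subseteq> K')"
    if K: "compact K" "0 \<notin> K" for K :: "'a set"
  proof -
    obtain e where e: "e > 0" "\<And>x. x \<in> K \<Longrightarrow> e \<le> norm x"
      using separate_point_closed[OF compact_imp_closed[OF K(1)] K(2)] by (auto simp: dist_norm)
    define d where "d = min 1 (e / 2)"
    have d: "0 < d" "d \<le> 1" "d < e" using e by (auto simp: d_def)
    define K' where "K' = {x + y |x y. x \<in> K \<and> y \<in> cball 0 d}"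
    have "compact K'" unfolding K'_def by (rule compact_sums[OF K(1) compact_cball])
    moreover have "K' \<subseteq> ?S"
    proof
      fix w assume "w \<in> K'"
      then obtain x y where w: "w = x + y" "x \<in> K" "norm y \<le> d" by (auto simp: K'_def)
      have "norm y < norm x" using w(3) e(2)[OF w(2)] d by linarith
      then show "w \<in> ?S" using w(1) by (auto simp: add_eq_0_iff)
    qed
    moreover have "cball x d \<subseteq> K'" if "x \<in> K" for x
    proof
      fix y assume "y \<in> cball x d"
      then have "y - x \<in> cball 0 d" by (simp add: dist_norm norm_minus_commute)
      then show "y \<in> K'" unfolding K'_def using that by (intro CollectI exI[of _ x] exI[of _ "y - x"]) auto
    qed
    ultimately show ?thesis using d by (intro exI[of _ d] exI[of _ K']) auto
  qed
  define \<alpha> where "\<alpha> = min 2 \<gamma>"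
  have \<alpha>: "2 * s < \<alpha>" "\<alpha> \<le> 2" using s \<gamma> by (auto simp: \<alpha>_def)
  have "\<exists>M\<ge>0. \<exists>\<delta>>0. \<forall>x\<in>K. \<forall>z. norm z \<le> \<delta> \<longrightarrow>
       x + z \<noteq> 0 \<and> \<bar>sdiff u z x\<bar> \<le> M * norm z powr \<alpha> \<and> (u (x + z) - u x)\<^sup>2 \<le> M * norm z powr \<alpha>"
    if K: "compact K" "0 \<notin> K" for K
  proof -
    obtain d K' where d: "0 < d" "d \<le> 1" and K': "compact K'" "K' \<subseteq> ?S" "\<And>x. x \<in> K \<Longrightarrow> cball x d \<subseteq> K'"
      using enlarge[OF K] by blast
    have inK: "x \<in> K'" "x + z \<in> K'" "x - z \<in> K'" "x + z \<noteq> 0" if "x \<in> K" "norm z \<le> d" for x z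
    proof -
      have "x \<in> cball x d" "x + z \<in> cball x d" "x - z \<in> cball x d" using that d by (auto simp: dist_norm)
      then show "x \<in> K'" "x + z \<in> K'" "x - z \<in> K'" using K'(3)[OF that(1)] by auto
      then show "x + z \<noteq> 0" using K'(2) by auto
    qed
    have sub: "y \<noteq> 0" "y \<in> K'" if "x \<in> K" "y \<in> cball x r" "r \<le> d" for x y r
    proof -
      have "y \<in> cball x d" using that by auto
      then show "y \<in> K'" using K'(3)[OF that(1)] by auto
      then show "y \<noteq> 0" using K'(2) by auto
    qed
    have suff: ?thesis
      if "A \<ge> 0" "\<And>x z. x \<in> K \<Longrightarrow> norm z \<le> d \<Longrightarrow> \<bar>sdiff u z x\<bar> \<le> A * norm z powr \<alpha>"
        "\<And>x z. x \<in> K \<Longrightarrow> norm z \<le> d \<Longrightarrow> (u (x + z) - u x)\<^sup>2 \<le> L\<^sup>2 * norm z powr \<alpha>" for A L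
    proof (rule exI[of _ "A + L\<^sup>2"], rule conjI, use that in simp, rule exI[of _ d], rule conjI[OF d(1)], intro ballI allI impI conjI)
      fix x z :: 'a assume x: "x \<in> K" and z: "norm z \<le> d"
      show "x + z \<noteq> 0" by (rule inK(4)[OF x z])
      have "A * norm z powr \<alpha> \<le> (A + L\<^sup>2) * norm z powr \<alpha>" "L\<^sup>2 * norm z powr \<alpha> \<le> (A + L\<^sup>2) * norm z powr \<alpha>"
        using that(1) by (auto intro!: mult_right_mono)
      then show "\<bar>sdiff u z x\<bar> \<le> (A + L\<^sup>2) * norm z powr \<alpha>" "(u (x + z) - u x)\<^sup>2 \<le> (A + L\<^sup>2) * norm z powr \<alpha>"
        using that(2,3)[OF x z] by linarith+
    qed
    have cK: "continuous_on K' (iter_pderiv bs u)" if "set bs \<subseteq> Basis" "length bs \<le> k" for bs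
      by (rule continuous_on_subset[OF cont[OF that] K'(2)])
    consider "k = 0" | "k = 1" | "k \<ge> 2" by linarith
    then show ?thesis
    proof cases
      case 1
      have \<gamma>\<tau>: "\<alpha> = \<tau>" using k\<tau> 1 \<tau> by (simp add: \<alpha>_def)
      obtain M where M: "\<forall>x\<in>K'. \<forall>y\<in>K'. \<bar>u x - u y\<bar> \<le> M * norm (x - y) powr \<tau>"
        using hoel[of "[]"] 1 K'(1,2) unfolding locally_Hoelder_on_def by auto
      have b: "\<bar>u (x + z) - u x\<bar> \<le> \<bar>M\<bar> * norm z powr \<tau>" if "x \<in> K" "norm z \<le> d" for x z
      proof -
        have "\<bar>u (x + z) - u x\<bar> \<le> M * norm (x + z - x) powr \<tau>" using M inK[OF that] by blast
        also have "\<dots> \<le> \<bar>M\<bar> * norm z powr \<tau>" by (simp add: mult_right_mono)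
        finally show ?thesis .
      qed
      show ?thesis
      proof (rule suff[of "2 * \<bar>M\<bar>" "\<bar>M\<bar>"])
        fix x z :: 'a assume x: "x \<in> K" and z: "norm z \<le> d"
        have z': "norm (- z) \<le> d" using z by simp
        show "\<bar>sdiff u z x\<bar> \<le> 2 * \<bar>M\<bar> * norm z powr \<alpha>"
          using b[OF x z] b[OF x z'] unfolding sdiff_def \<gamma>\<tau> by (simp add: abs_le_iff)
        have "norm z powr \<tau> \<le> 1" using z d \<tau> powr_mono2[of \<tau> "norm z" 1] by simp
        have "(u (x + z) - u x)\<^sup>2 \<le> \<bar>M\<bar>\<^sup>2 * (norm z powr \<tau>) powr 1"
          by (rule square_le_powr[OF b[OF x z]]) (use \<open>norm z powr \<tau> \<le> 1\<close> in auto)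
        then show "(u (x + z) - u x)\<^sup>2 \<le> \<bar>M\<bar>\<^sup>2 * norm z powr \<alpha>" by (simp add: \<gamma>\<tau>)
      qed simp
    next
      case 2
      have \<gamma>\<tau>: "\<alpha> = 1 + \<tau>" using k\<tau> 2 \<tau> by (simp add: \<alpha>_def)
      have ud: "u differentiable (at y)" if "y \<noteq> 0" for y using diff[of "[]" y] 2 that by simp
      obtain B where B: "B \<ge> 0" "\<And>b y. b \<in> Basis \<Longrightarrow> y \<in> K' \<Longrightarrow> \<bar>iter_pderiv [b] u y\<bar> \<le> B"
        by (rule continuous_bounded_on_compact[OF K'(1) finite_Basis, of "\<lambda>b. iter_pderiv [b] u"])
          (rule cK, use 2 in simp, use 2 in simp, rule that, assumption+)
      have "\<forall>b\<in>Basis. \<exists>M. \<forall>x\<in>K'. \<forall>y\<in>K'. \<bar>iter_pderiv [b] u x - iter_pderiv [b] u y\<bar> \<le> M * norm (x - y) powr \<tau>"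
      proof
        fix b :: 'a assume b: "b \<in> Basis"
        have "locally_Hoelder_on \<tau> ?S (iter_pderiv [b] u)" by (rule hoel) (use b 2 in auto)
        then show "\<exists>M. \<forall>x\<in>K'. \<forall>y\<in>K'. \<bar>iter_pderiv [b] u x - iter_pderiv [b] u y\<bar> \<le> M * norm (x - y) powr \<tau>"
          unfolding locally_Hoelder_on_def using K'(1,2) by (elim allE[of _ K'] impE) (rule conjI)
      qed
      from bchoice[OF this] obtain m where m: "\<forall>b\<in>Basis. \<forall>x\<in>K'. \<forall>y\<in>K'. \<bar>iter_pderiv [b] u x - iter_pderiv [b] u y\<bar> \<le> m b * norm (x - y) powr \<tau>"
        by (elim exE) (rule that)
      define M where "M = (\<Sum>b\<in>(Basis::'a set). \<bar>m b\<bar>)"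
      show ?thesis
      proof (rule suff[of "2 * M" "real DIM('a) * B"])
        show "0 \<le> 2 * M" by (simp add: M_def sum_nonneg)
        fix x z :: 'a assume x: "x \<in> K" and z: "norm z \<le> d"
        have "\<bar>sdiff u z x\<bar> \<le> 2 * M * norm z powr (1 + \<tau>)"
        proof (rule sdiff_bound_of_derivative(2))
          fix y assume y: "y \<in> cball x (norm z)"
          note yK = sub[OF x y z]
          show "(u has_derivative frechet_derivative u (at y)) (at y)" using ud[OF yK(1)] by (simp add: frechet_derivative_works)
          fix h
          have xK: "x \<in> K'" "x \<noteq> 0" using sub[OF x _ z, of x] by auto
          have "frechet_derivative u (at y) h - frechet_derivative u (at x) h
            = (\<Sum>b\<in>Basis. (h \<bullet> b) * (iter_pderiv [b] u y - iter_pderiv [b] u x))"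
            unfolding frechet_derivative_eq_sum[OF ud[OF yK(1)]] frechet_derivative_eq_sum[OF ud[OF xK(2)]]
            by (simp add: sum_subtractf right_diff_distrib)
          also have "\<bar>\<dots>\<bar> \<le> (\<Sum>b\<in>Basis. \<bar>(h \<bullet> b) * (iter_pderiv [b] u y - iter_pderiv [b] u x)\<bar>)" by (rule sum_abs)
          also have "\<dots> \<le> (\<Sum>b\<in>(Basis::'a set). norm h * (\<bar>m b\<bar> * norm (y - x) powr \<tau>))"
          proof (rule sum_mono)
            fix b :: 'a assume b: "b \<in> Basis"
            have "\<bar>iter_pderiv [b] u y - iter_pderiv [b] u x\<bar> \<le> m b * norm (y - x) powr \<tau>" using m b yK(2) xK(1) by blast
            also have "\<dots> \<le> \<bar>m b\<bar> * norm (y - x) powr \<tau>" by (intro mult_right_mono) auto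
            finally show "\<bar>(h \<bullet> b) * (iter_pderiv [b] u y - iter_pderiv [b] u x)\<bar> \<le> norm h * (\<bar>m b\<bar> * norm (y - x) powr \<tau>)"
              unfolding abs_mult by (rule mult_mono[OF Basis_le_norm[OF b]]) auto
          qed
          also have "\<dots> = M * norm (y - x) powr \<tau> * norm h"
            unfolding M_def by (simp add: sum_distrib_left sum_distrib_right mult_ac)
          finally show "\<bar>frechet_derivative u (at y) h - frechet_derivative u (at x) h\<bar> \<le> M * norm (y - x) powr \<tau> * norm h" .
        qed (use \<tau> in simp)
        then show "\<bar>sdiff u z x\<bar> \<le> 2 * M * norm z powr \<alpha>" by (simp add: \<gamma>\<tau>)
        have "\<bar>u (x + z) - u x\<bar> \<le> real DIM('a) * B * norm z"
          by (rule lipschitz_of_partials[OF _ _ z]) (use sub[OF x _ order_refl] ud B(2) in blast)+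
        then show "(u (x + z) - u x)\<^sup>2 \<le> (real DIM('a) * B)\<^sup>2 * norm z powr \<alpha>"
          by (rule square_le_powr) (use z d \<alpha> in auto)
      qed
    next
      case 3
      have "\<gamma> \<ge> 2" using k\<tau> 3 \<tau> by linarith
      then have \<alpha>2: "\<alpha> = 2" by (simp add: \<alpha>_def)
      have ud: "u differentiable (at y)" if "y \<noteq> 0" for y using diff[of "[]" y] 3 that by simp
      have ud2: "iter_pderiv [b] u differentiable (at y)" if "y \<noteq> 0" "b \<in> Basis" for y b using diff[of "[b]" y] 3 that by simp
      obtain B where B: "B \<ge> 0" "\<And>b y. b \<in> Basis \<Longrightarrow> y \<in> K' \<Longrightarrow> \<bar>iter_pderiv [b] u y\<bar> \<le> B"
        by (rule continuous_bounded_on_compact[OF K'(1) finite_Basis, of "\<lambda>b. iter_pderiv [b] u"])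
          (rule cK, use 3 in simp, use 3 in simp, rule that, assumption+)
      obtain A where A: "A \<ge> 0" "\<And>i y. i \<in> Basis \<times> Basis \<Longrightarrow> y \<in> K' \<Longrightarrow> \<bar>iter_pderiv [fst i, snd i] u y\<bar> \<le> A"
        by (rule continuous_bounded_on_compact[OF K'(1) finite_cartesian_product[OF finite_Basis finite_Basis], of "\<lambda>i. iter_pderiv [fst i, snd i] u"])
          (rule cK, use 3 in force, use 3 in simp, rule that, assumption+)
      show ?thesis
      proof (rule suff[of "2 * (real DIM('a) ^ 2 * A)" "real DIM('a) * B"])
        show "0 \<le> 2 * (real DIM('a) ^ 2 * A)" using A(1) by simp
        fix x z :: 'a assume x: "x \<in> K" and z: "norm z \<le> d"
        have "\<bar>sdiff u z x\<bar> \<le> 2 * (real DIM('a) ^ 2 * A) * norm z powr 2"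
        proof (rule sdiff_bound_C2[OF _ _ _ z])
          fix y assume y: "y \<in> cball x d"
          note yK = sub[OF x y order_refl]
          show "u differentiable (at y)" by (rule ud[OF yK(1)])
          show "iter_pderiv [b] u differentiable (at y)" if "b \<in> Basis" for b by (rule ud2[OF yK(1) that])
          show "\<bar>iter_pderiv [c, b] u y\<bar> \<le> A" if "b \<in> Basis" "c \<in> Basis" for b c
            using A(2)[of "(c, b)" y] yK(2) that by simp
        qed
        then show "\<bar>sdiff u z x\<bar> \<le> 2 * (real DIM('a) ^ 2 * A) * norm z powr \<alpha>" by (simp add: \<alpha>2)
        have "\<bar>u (x + z) - u x\<bar> \<le> real DIM('a) * B * norm z"
          by (rule lipschitz_of_partials[OF _ _ z]) (use sub[OF x _ order_refl] ud B(2) in blast)+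
        then show "(u (x + z) - u x)\<^sup>2 \<le> (real DIM('a) * B)\<^sup>2 * norm z powr \<alpha>"
          by (rule square_le_powr) (use z d \<alpha> in auto)
      qed
    qed
  qed
  then show "\<exists>\<alpha>>2 * s. \<forall>K. compact K \<longrightarrow> 0 \<notin> K \<longrightarrow> (\<exists>M\<ge>0. \<exists>\<delta>>0. \<forall>x\<in>K. \<forall>z. norm z \<le> \<delta> \<longrightarrow>
       x + z \<noteq> 0 \<and> \<bar>sdiff u z x\<bar> \<le> M * norm z powr \<alpha> \<and> (u (x + z) - u x)\<^sup>2 \<le> M * norm z powr \<alpha>)"
    using \<alpha>(1) by (intro exI[of _ \<alpha>]) blast
qed

section \<open>Radial symmetry\<close>

lemma borel_punctured:
  fixes u :: "'a::euclidean_space \<Rightarrow> real"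
  assumes "continuous_on (- {0}) u" shows "u(0 := c) \<in> borel_measurable borel"
proof -
  have [measurable]: "(\<lambda>x. indicator (- {0}) x *\<^sub>R u x) \<in> borel_measurable borel"
    by (rule borel_measurable_continuous_on_indicator[OF _ assms]) simp
  have "u(0 := c) = (\<lambda>x. indicator (- {0}) x *\<^sub>R u x + c * indicator {0} x)"
    by (rule ext) (simp add: indicator_def)
  also have "\<dots> \<in> borel_measurable borel" by measurable
  finally show ?thesis .
qed

lemma AE_punctured: "AE x in lborel. (u(0 := c)) x = u x" for u :: "'a::euclidean_space \<Rightarrow> real"
  using AE_lborel_singleton[of 0] by eventually_elim simp

theorem theorem1p2:
  fixes s \<mu> p q :: real and u F :: "'a::euclidean_space \<Rightarrow> real"
  assumes "0 < s" "s < 1" "real DIM('a) > 2 * s"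
    and "0 < \<mu>" "\<mu> < real DIM('a)"
    and "p \<ge> 1" "q \<ge> 1"
    and "p \<le> (2 * real DIM('a) - \<mu>) / (real DIM('a) - 2 * s)"
    and "q \<le> (real DIM('a) + 2 * s - \<mu>) / (real DIM('a) - 2 * s)"
    and "positive_punctured_solution s \<mu> p q u"
    and "\<And>x. x \<noteq> 0 \<Longrightarrow> F x = hartree p \<mu> u x * u x powr q"
    and "integrable lebesgue (\<lambda>y. F y / (1 + norm y powr (real DIM('a) - 2 * s)))"
    and "Limsup (at 0) (\<lambda>x. ereal (norm x powr (real DIM('a) - 2 * s) * u x)) < \<infinity>"
    and "filterlim u at_top (at 0)"
  shows "\<exists>U :: real \<Rightarrow> real.
      (\<forall>r>0. U r > 0) \<and>
      (\<forall>x. x \<noteq> 0 \<longrightarrow> u x = U (norm x)) \<and>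
      strict_antimono_on {0<..} U"
proof -
  note s = assms(1,2)
  have L: "u \<in> L_space s" and pos: "\<And>x. x \<noteq> 0 \<Longrightarrow> u x > 0"
    and fin: "\<And>x. x \<noteq> 0 \<Longrightarrow> hartree_finite p \<mu> u x"
    and sol: "\<And>x. x \<noteq> 0 \<Longrightarrow> frac_laplacian s u x = hartree p \<mu> u x * u x powr q"
    using assms(10) unfolding positive_punctured_solution_def by blast+
  obtain \<beta> where \<beta>: "\<beta> > 0" "2 * s + \<beta> \<notin> \<nat>" "C_loc (2 * s + \<beta>) (- {0}) u"
    using assms(10) unfolding positive_punctured_solution_def by blast
  have \<gamma>: "2 * s < 2 * s + \<beta>" using \<beta> by simp
  note reg = C_loc_second_differences[OF s \<gamma> \<beta>(2,3)]
  obtain \<alpha> where \<alpha>: "\<alpha> > 2 * s" and loc: "\<And>K. compact K \<Longrightarrow> 0 \<notin> K \<Longrightarrow> \<exists>M\<ge>0. \<exists>\<delta>>0. \<forall>x\<in>K. \<forall>z. norm z \<le> \<delta> \<longrightarrow>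
       x + z \<noteq> 0 \<and> \<bar>sdiff u z x\<bar> \<le> M * norm z powr \<alpha> \<and> (u (x + z) - u x)\<^sup>2 \<le> M * norm z powr \<alpha>"
    using reg(2) by blast
  define w where "w = u(0 := 1)"
  have um [measurable]: "u \<in> borel_measurable borel" using borel_punctured[OF reg(1), of "u 0"] by simp
  have wm [measurable]: "w \<in> borel_measurable borel" unfolding w_def by (rule borel_punctured[OF reg(1)])
  have w: "w x = u x" if "x \<noteq> 0" for x using that by (simp add: w_def)
  have uw: "weighted s u"
  proof -
    have "integrable lebesgue (\<lambda>x. \<bar>u x\<bar> / (1 + norm x powr (real DIM('a) + 2 * s)))" using L by (simp add: L_space_def)
    then have "integrable lborel (\<lambda>x. \<bar>u x\<bar> / (1 + norm x powr (real DIM('a) + 2 * s)))" by (subst (asm) integrable_completion) measurable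
    then show ?thesis by (simp add: weighted_def)
  qed
  have ww: "weighted s w"
  proof -
    have "integrable lborel (\<lambda>x. \<bar>w x\<bar> / (1 + norm x powr (real DIM('a) + 2 * s))) \<longleftrightarrow> integrable lborel (\<lambda>x. \<bar>u x\<bar> / (1 + norm x powr (real DIM('a) + 2 * s)))"
      by (rule integrable_cong_AE) (measurable, measurable, use AE_punctured[of u 1] in \<open>eventually_elim, simp add: w_def\<close>)
    then show ?thesis using uw by (simp add: weighted_def)
  qed
  have sd: "sdiff w z x = sdiff u z x" if "x \<noteq> 0" "x + z \<noteq> 0" "x + - z \<noteq> 0" for x z
    using that by (simp add: sdiff_def w)
  have slap: "pv_integral s u x = slap s w x" if x: "x \<noteq> 0" for x
  proof -
    have "compact {x}" "0 \<notin> {x}" using x by auto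
    from loc[OF this] obtain M \<delta> where M: "M \<ge> 0" "\<delta> > 0" "\<forall>y\<in>{x}. \<forall>z. norm z \<le> \<delta> \<longrightarrow>
       y + z \<noteq> 0 \<and> \<bar>sdiff u z y\<bar> \<le> M * norm z powr \<alpha> \<and> (u (y + z) - u y)\<^sup>2 \<le> M * norm z powr \<alpha>"
      by (elim exE conjE) (rule that)
    have "pv_integral s u x = slap s u x"
      by (rule pv_integral_eq_slap[OF uw s(1) sdiff_kern_integrable[OF uw s(1) \<alpha> M(2), of _ M]]) (use M(3) in auto)
    also have "\<dots> = slap s w x"
      unfolding slap_def
    proof (intro arg_cong[of _ _ "\<lambda>t. t / 2"] integral_cong_AE)
      have "AE z in lborel. z \<noteq> x" "AE z in lborel. z \<noteq> - x" by (rule AE_lborel_singleton)+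
      then show "AE z in lborel. sdiff u z x * kern s z = sdiff w z x * kern s z"
        by eventually_elim (use sd[OF x] in \<open>auto simp: add_eq_0_iff\<close>)
    qed measurable
    finally show ?thesis .
  qed
  define h where "h x y = w y powr p * norm (x - y) powr (- \<mu>)" for x y
  have hm [measurable]: "h x \<in> borel_measurable borel" for x unfolding h_def[abs_def] by measurable
  have hart: "integrable lborel (h x) \<and> hartree p \<mu> u x = (\<integral>y. h x y \<partial>lborel)" if x: "x \<noteq> 0" for x
  proof -
    define k where "k y = indicator (- {0}) y *\<^sub>R (u y powr p / norm (x - y) powr \<mu>)" for y
    have [measurable]: "k \<in> borel_measurable borel" unfolding k_def by measurable
    have ae: "AE y in lborel. k y = h x y"
      using AE_lborel_singleton[of 0] by eventually_elim (simp add: k_def h_def w powr_minus divide_inverse)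
    have "integrable lebesgue k" using fin[OF x] by (simp add: hartree_finite_def set_integrable_def k_def[abs_def])
    then have "integrable lborel k" by (subst (asm) integrable_completion) measurable
    then have "integrable lborel (h x)" by (subst (asm) integrable_cong_AE[OF _ _ ae]) measurable
    moreover have "hartree p \<mu> u x = (\<integral>y. k y \<partial>lebesgue)" by (simp add: hartree_def set_lebesgue_integral_def k_def)
    moreover have "(\<integral>y. k y \<partial>lebesgue) = (\<integral>y. k y \<partial>lborel)" by (rule integral_completion) measurable
    moreover have "(\<integral>y. k y \<partial>lborel) = (\<integral>y. h x y \<partial>lborel)" by (rule integral_cong_AE[OF _ _ ae]) measurable
    ultimately show ?thesis by simp
  qed
  define C where "C = frac_laplacian_const TYPE('a) s"
  have d0: "real DIM('a) - 2 * s > 0" using assms(3) by simp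
  have d2: "2 * ((real DIM('a) - 2 * s) / 2) = real DIM('a) - 2 * s" by simp
  interpret choquard s "(real DIM('a) - 2 * s) / 2" "TYPE('a)" w \<mu> p q C \<alpha>
  proof
    show "0 < s" "s < 1" "2 * s < real DIM('a)" "0 < \<mu>" "\<mu> < real DIM('a)" "1 \<le> p" "1 \<le> q" by (rule assms)+
    show "weighted s w" by (rule ww)
    show "w x > 0" for x using pos[of x] by (cases "x = 0") (simp_all add: w_def)
    show "continuous_on (- {0}) w" using reg(1) by (rule continuous_on_eq) (simp add: w)
    show "2 * s < \<alpha>" by (rule \<alpha>)
    show "p * (2 * ((real DIM('a) - 2 * s) / 2)) \<le> 2 * real DIM('a) - \<mu>"
      unfolding d2 using assms(8) d0 by (simp add: pos_le_divide_eq)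
    show "q * (2 * ((real DIM('a) - 2 * s) / 2)) \<le> real DIM('a) + 2 * s - \<mu>"
      unfolding d2 using assms(9) d0 by (simp add: pos_le_divide_eq)
    show "integrable lborel (\<lambda>y. w y powr p * norm (x - y) powr - \<mu>)" if "x \<noteq> 0" for x
      using hart[OF that] by (simp add: h_def[abs_def])
    show "C > 0" unfolding C_def by (rule frac_laplacian_const_pos[OF s])
    show "C * slap s w x = (\<integral>y. w y powr p * norm (x - y) powr - \<mu> \<partial>lborel) * w x powr q" if "x \<noteq> 0" for x
      using sol[OF that] hart[OF that] slap[OF that] by (simp add: h_def C_def frac_laplacian_def w that)
    have ev: "\<forall>\<^sub>F x in at 0. u x = w x" using eventually_neq_at_within[of 0] by eventually_elim (simp add: w)
    show "filterlim w at_top (at 0)" by (rule filterlim_cong[OF refl refl ev, THEN iffD1, OF assms(14)])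
    show "\<exists>M\<ge>0. \<exists>\<delta>>0. \<forall>x\<in>K. \<forall>z. norm z \<le> \<delta> \<longrightarrow>
       \<bar>sdiff w z x\<bar> \<le> M * norm z powr \<alpha> \<and> (w (x + z) - w x)\<^sup>2 \<le> M * norm z powr \<alpha>" if K: "compact K" "0 \<notin> K" for K
    proof -
      obtain M \<delta> where M: "M \<ge> 0" "\<delta> > 0" "\<forall>x\<in>K. \<forall>z. norm z \<le> \<delta> \<longrightarrow>
         x + z \<noteq> 0 \<and> \<bar>sdiff u z x\<bar> \<le> M * norm z powr \<alpha> \<and> (u (x + z) - u x)\<^sup>2 \<le> M * norm z powr \<alpha>"
        using loc[OF K] by (elim exE conjE) (rule that)
      show ?thesis
      proof (rule exI[of _ M], rule conjI[OF M(1)], rule exI[of _ \<delta>], rule conjI[OF M(2)], intro ballI allI impI conjI)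
        fix x z :: 'a assume x: "x \<in> K" and z: "norm z \<le> \<delta>"
        have z': "norm (- z) \<le> \<delta>" using z by simp
        have x0: "x \<noteq> 0" using x K by auto
        note b = M(3)[rule_format, OF x z] and b' = M(3)[rule_format, OF x z']
        show "\<bar>sdiff w z x\<bar> \<le> M * norm z powr \<alpha>" using b sd[OF x0 conjunct1[OF b] conjunct1[OF b']] by simp
        show "(w (x + z) - w x)\<^sup>2 \<le> M * norm z powr \<alpha>" using b x0 by (simp add: w)
      qed
    qed
  qed simp
  obtain U :: "real \<Rightarrow> real" where U: "\<forall>r>0. U r > 0" "\<forall>x. x \<noteq> 0 \<longrightarrow> w x = U (norm x)" "strict_antimono_on {0<..} U"
    using radially_decreasing by (elim exE conjE) (rule that)
  have "\<forall>x. x \<noteq> 0 \<longrightarrow> u x = U (norm x)" using U(2) w by simp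
  with U(1,3) show ?thesis by (intro exI[of _ U] conjI)
qed

end
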